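(* Let $\Gamma$ be an infinite finitely generated group, let $\Gamma\rhd\Gamma_1\rhd\Gamma_2\rhd\cdots$ be a nested sequence of finite index normal subgroups of $\Gamma$ with $\bigcap_{n}\Gamma_n=\{1\}$, let $S$ be a finite symmetric generating set of $\Gamma$, and let $\mathcal{G}=\{G_n\}$ be the graph sequence where $G_n$ is the Cayley graph of $\Gamma/\Gamma_n$ with respect to (the image of) $S$. Then $$c(\mathcal{G})-1\le \mathrm{rk\,grad}\{\Gamma,\{\Gamma_n\}\}.$$ If moreover $\Gamma$ is finitely presented, then for every prime $p$, $$\beta_{\mathbb{Q}}(\mathcal{G})=\beta^1_{(2)}(\Gamma)\le \text{mod-}p\text{-homology grad}\{\Gamma,\{\Gamma_n\}\}=\beta_{\mathbb{F}_p}(\mathcal{G})\le c(\mathcal{G})-1,$$ where $\beta^1_{(2)}(\Gamma)$ is the first $L^2$-Betti number of $\Gamma$.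
   Context: A graph sequence is a sequence $\mathcal{G}=\{G_n\}$ of finite simple graphs with uniformly bounded vertex degrees and $|V(G_n)|\to\infty$. For graph sequences with $V(H_n)=V(G_n)$, $\mathcal{H}\prec\mathcal{G}$ means there is an integer $L>0$ with $d_{G_n}(x,y)\le L\,d_{H_n}(x,y)$ for all $n,x,y$ (shortest path metrics), and $\mathcal{G}\simeq\mathcal{H}$ means $\mathcal{H}\prec\mathcal{G}$ and $\mathcal{G}\prec\mathcal{H}$. $e(\mathcal{G})=\liminf_n |E(G_n)|/|V(G_n)|$, $c(\mathcal{G})=\inf_{\mathcal{H}\simeq\mathcal{G}}e(\mathcal{H})$. For a field $K$ and a finite graph $G$, let $\varepsilon_K(G)$ be the $K$-vector space spanned by the oriented edges with the convention $(x,y)=-(y,x)$; a cycle $(x_1,\dots,x_m,x_1)$ gives the vector $\sum_{i=1}^{m-1}(x_i,x_{i+1})+(x_m,x_1)$, and $C^q_K(G)$ is the subspace spanned by the vectors of cycles of length at most $q$. Set $s^q_K(\mathcal{G})=\liminf_n \frac{|E(G_n)|-\dim_K C^q_K(G_n)}{|V(G_n)|}-1$ and $\beta_K(\mathcal{G})=\inf_q s^q_K(\mathcal{G})$. The Cayley graph of $\Gamma/\Gamma_n$ w.r.t. $S$ has vertex set $\Gamma/\Gamma_n$, with $x\ne y$ adjacent iff $y=sx$ for some $s\in S$. $d(H)$ denotes the minimal number of generators of a group $H$; $\mathrm{rk\,grad}\{\Gamma,\{\Gamma_n\}\}=\lim_{n\to\infty} d(\Gamma_n)/|\Gamma:\Gamma_n|$.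 With $d_p(\Gamma_n)=\dim_{\mathbb{F}_p}H_1(\Gamma_n,\mathbb{F}_p)$, $\text{mod-}p\text{-homology grad}\{\Gamma,\{\Gamma_n\}\}=\liminf_{n\to\infty} d_p(\Gamma_n)/|\Gamma:\Gamma_n|$. *)

theory Defs
  imports "HOL-Analysis.Analysis" "HOL-Algebra.Algebra" "HOL-Library.Function_Algebras"
begin

type_synonym 'v graph = "'v set \<times> 'v set set"

definition verts :: "'v graph \<Rightarrow> 'v set" where "verts G = fst G"
definition edges :: "'v graph \<Rightarrow> 'v set set" where "edges G = snd G"

definition simple_graph :: "'v graph \<Rightarrow> bool" where
  "simple_graph G \<longleftrightarrow> finite (verts G) \<and> (\<forall>e\<in>edges G. e \<subseteq> verts G \<and> card e = 2)"

definition adj :: "'v graph \<Rightarrow> 'v \<Rightarrow> 'v \<Rightarrow> bool" where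
  "adj G x y \<longleftrightarrow> {x, y} \<in> edges G"

definition degree :: "'v graph \<Rightarrow> 'v \<Rightarrow> nat" where
  "degree G v = card {e\<in>edges G. v \<in> e}"

definition graph_seq :: "(nat \<Rightarrow> 'v graph) \<Rightarrow> bool" where
  "graph_seq Gs \<longleftrightarrow> (\<forall>n. simple_graph (Gs n))
     \<and> (\<exists>D::nat. \<forall>n. \<forall>v\<in>verts (Gs n). degree (Gs n) v \<le> D)
     \<and> filterlim (\<lambda>n. card (verts (Gs n))) at_top sequentially"

definition walk :: "'v graph \<Rightarrow> 'v list \<Rightarrow> bool" where
  "walk G p \<longleftrightarrow> p \<noteq> [] \<and> set p \<subseteq> verts G \<and> (\<forall>i. Suc i < length p \<longrightarrow> adj G (p!i) (p!Suc i))"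

text \<open>Shortest path metric (infinite if there is no path).\<close>
definition gdist :: "'v graph \<Rightarrow> 'v \<Rightarrow> 'v \<Rightarrow> enat" where
  "gdist G x y = (INF p \<in> {p. walk G p \<and> hd p = x \<and> last p = y}. enat (length p - 1))"

definition graph_prec :: "(nat \<Rightarrow> 'v graph) \<Rightarrow> (nat \<Rightarrow> 'v graph) \<Rightarrow> bool" where
  "graph_prec Hs Gs \<longleftrightarrow> (\<exists>L::nat. L > 0 \<and> (\<forall>n. \<forall>x\<in>verts (Gs n). \<forall>y\<in>verts (Gs n).
       gdist (Gs n) x y \<le> enat L * gdist (Hs n) x y))"

definition graph_equiv :: "(nat \<Rightarrow> 'v graph) \<Rightarrow> (nat \<Rightarrow> 'v graph) \<Rightarrow> bool" where
  "graph_equiv Gs Hs \<longleftrightarrow> graph_prec Hs Gs \<and> graph_prec Gs Hs"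

definition edge_density :: "(nat \<Rightarrow> 'v graph) \<Rightarrow> ereal" where
  "edge_density Gs = liminf (\<lambda>n. ereal (real (card (edges (Gs n))) / real (card (verts (Gs n)))))"

definition cost :: "(nat \<Rightarrow> 'v graph) \<Rightarrow> ereal" where
  "cost Gs = (INF Hs \<in> {Hs. graph_seq Hs \<and> (\<forall>n. verts (Hs n) = verts (Gs n)) \<and> graph_equiv Gs Hs}.
                edge_density Hs)"

text \<open>The space \<epsilon>_K(G) of oriented edges with (x,y) = -(y,x) is realised as functions
  on ordered pairs; the oriented edge (x,y) is the vector chi_(x,y) - chi_(y,x).\<close>
definition oriented_edge :: "'v \<Rightarrow> 'v \<Rightarrow> ('v \<times> 'v \<Rightarrow> 'k::field)" where
  "oriented_edge x y = (\<lambda>a. (if a = (x, y) then 1 else 0) - (if a = (y, x) then 1 else 0))"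

definition cycle_vec :: "'v list \<Rightarrow> ('v \<times> 'v \<Rightarrow> 'k::field)" where
  "cycle_vec xs = (\<Sum>i<length xs. oriented_edge (xs!i) (xs!((Suc i) mod length xs)))"

definition is_cycle :: "'v graph \<Rightarrow> 'v list \<Rightarrow> bool" where
  "is_cycle G xs \<longleftrightarrow> length xs \<ge> 3 \<and> distinct xs \<and> set xs \<subseteq> verts G
     \<and> (\<forall>i<length xs. adj G (xs!i) (xs!((Suc i) mod length xs)))"

definition fscale :: "'k::field \<Rightarrow> ('v \<times> 'v \<Rightarrow> 'k) \<Rightarrow> ('v \<times> 'v \<Rightarrow> 'k)" where
  "fscale c f = (\<lambda>a. c * f a)"

definition dim_cycle_space :: "'k::field itself \<Rightarrow> nat \<Rightarrow> 'v graph \<Rightarrow> nat" where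
  "dim_cycle_space K q G = vector_space.dim (fscale :: 'k \<Rightarrow> _)
      {(cycle_vec xs :: 'v \<times> 'v \<Rightarrow> 'k) | xs. is_cycle G xs \<and> length xs \<le> q}"

definition s_q :: "'k::field itself \<Rightarrow> nat \<Rightarrow> (nat \<Rightarrow> 'v graph) \<Rightarrow> ereal" where
  "s_q K q Gs = liminf (\<lambda>n. ereal ((real (card (edges (Gs n))) - real (dim_cycle_space K q (Gs n)))
                                    / real (card (verts (Gs n))))) - 1"

definition beta :: "'k::field itself \<Rightarrow> (nat \<Rightarrow> 'v graph) \<Rightarrow> ereal" where
  "beta K Gs = (INF q. s_q K q Gs)"

definition cayley_quot :: "('a, 'b) monoid_scheme \<Rightarrow> 'a set \<Rightarrow> 'a set \<Rightarrow> 'a set graph" where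
  "cayley_quot G N S = (rcosets\<^bsub>G\<^esub> N,
     {{x, y} | x y. x \<in> rcosets\<^bsub>G\<^esub> N \<and> y \<in> rcosets\<^bsub>G\<^esub> N \<and> x \<noteq> y \<and>
        (\<exists>s\<in>S. y = (N #>\<^bsub>G\<^esub> s) <#>\<^bsub>G\<^esub> x)})"

definition group_index :: "('a, 'b) monoid_scheme \<Rightarrow> 'a set \<Rightarrow> nat" where
  "group_index G N = card (rcosets\<^bsub>G\<^esub> N)"

definition fin_gen :: "('a, 'b) monoid_scheme \<Rightarrow> bool" where
  "fin_gen G \<longleftrightarrow> (\<exists>A. finite A \<and> A \<subseteq> carrier G \<and> generate G A = carrier G)"

definition min_gens :: "('a, 'b) monoid_scheme \<Rightarrow> 'a set \<Rightarrow> nat" where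
  "min_gens G H = (LEAST n. \<exists>A. finite A \<and> A \<subseteq> H \<and> card A = n \<and> generate G A = H)"

definition rk_grad :: "('a, 'b) monoid_scheme \<Rightarrow> (nat \<Rightarrow> 'a set) \<Rightarrow> real" where
  "rk_grad G Ns = lim (\<lambda>n. real (min_gens G (Ns n)) / real (group_index G (Ns n)))"

text \<open>d_p(H) = dim_{F_p} H_1(H, F_p), where H_1(H,F_p) = H / [H,H] H^p.\<close>
definition modp_frattini :: "('a, 'b) monoid_scheme \<Rightarrow> 'a set \<Rightarrow> nat \<Rightarrow> 'a set" where
  "modp_frattini G H p = generate G
     ({x \<otimes>\<^bsub>G\<^esub> y \<otimes>\<^bsub>G\<^esub> inv\<^bsub>G\<^esub> x \<otimes>\<^bsub>G\<^esub> inv\<^bsub>G\<^esub> y | x y. x \<in> H \<and> y \<in> H}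
      \<union> {x [^]\<^bsub>G\<^esub> p | x. x \<in> H})"

definition d_p :: "('a, 'b) monoid_scheme \<Rightarrow> nat \<Rightarrow> 'a set \<Rightarrow> nat" where
  "d_p G p H = (THE d. card ((\<lambda>x. modp_frattini G H p #>\<^bsub>G\<^esub> x) ` H) = p ^ d)"

definition modp_grad :: "('a, 'b) monoid_scheme \<Rightarrow> (nat \<Rightarrow> 'a set) \<Rightarrow> nat \<Rightarrow> ereal" where
  "modp_grad G Ns p = liminf (\<lambda>n. ereal (real (d_p G p (Ns n)) / real (group_index G (Ns n))))"

definition eval_word :: "('a, 'b) monoid_scheme \<Rightarrow> 'a list \<Rightarrow> 'a" where
  "eval_word G w = foldr (\<lambda>x y. x \<otimes>\<^bsub>G\<^esub> y) w \<one>\<^bsub>G\<^esub>"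

definition pres_rels :: "('a, 'b) monoid_scheme \<Rightarrow> 'a set \<Rightarrow> 'a list set \<Rightarrow> 'a list set" where
  "pres_rels G T R = R \<union> {[t, inv\<^bsub>G\<^esub> t] | t. t \<in> T}"

definition rel_move :: "'a list set \<Rightarrow> 'a list \<Rightarrow> 'a list \<Rightarrow> bool" where
  "rel_move R w w' \<longleftrightarrow> (\<exists>u v r. r \<in> R \<and> ((w = u @ v \<and> w' = u @ r @ v) \<or> (w = u @ r @ v \<and> w' = u @ v)))"

definition is_fin_pres :: "('a, 'b) monoid_scheme \<Rightarrow> 'a set \<Rightarrow> 'a list set \<Rightarrow> bool" where
  "is_fin_pres G T R \<longleftrightarrow> finite T \<and> T \<subseteq> carrier G \<and> (\<forall>t\<in>T. inv\<^bsub>G\<^esub> t \<in> T)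
     \<and> generate G T = carrier G \<and> finite R
     \<and> (\<forall>r\<in>R. set r \<subseteq> T \<and> eval_word G r = \<one>\<^bsub>G\<^esub>)
     \<and> (\<forall>w. set w \<subseteq> T \<and> eval_word G w = \<one>\<^bsub>G\<^esub> \<longrightarrow> (rel_move (pres_rels G T R))\<^sup>*\<^sup>* w [])"

definition finitely_presented :: "('a, 'b) monoid_scheme \<Rightarrow> bool" where
  "finitely_presented G \<longleftrightarrow> (\<exists>T R. is_fin_pres G T R)"

text \<open>Universal cover X of the presentation complex of (T,R): vertices G, edges (g,t) from
  g to g t, 2-cells (g,r). The space of L2-harmonic 1-chains (closed subspace of
  l2(G \<times> T)): divergence free and orthogonal to all boundaries of 2-cells.\<close>
definition l2_harmonic :: "('a, 'b) monoid_scheme \<Rightarrow> 'a set \<Rightarrow> 'a list set \<Rightarrow> ('a \<times> 'a \<Rightarrow> real) set" where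
  "l2_harmonic G T R = {f. (\<forall>a. f a \<noteq> 0 \<longrightarrow> a \<in> carrier G \<times> T)
      \<and> (\<lambda>a. (f a)\<^sup>2) summable_on UNIV
      \<and> (\<forall>v\<in>carrier G. (\<Sum>t\<in>T. f (v, t)) - (\<Sum>t\<in>T. f (v \<otimes>\<^bsub>G\<^esub> inv\<^bsub>G\<^esub> t, t)) = 0)
      \<and> (\<forall>g\<in>carrier G. \<forall>r\<in>pres_rels G T R.
            (\<Sum>i<length r. f (g \<otimes>\<^bsub>G\<^esub> eval_word G (take i r), r!i)) = 0)}"

definition l2_norm :: "('a \<times> 'a \<Rightarrow> real) \<Rightarrow> real" where
  "l2_norm f = sqrt (infsum (\<lambda>a. (f a)\<^sup>2) UNIV)"

text \<open>von Neumann dimension of the harmonic space: sum over t \<in> T of <P e_(1,t), e_(1,t)>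
  = |P e_(1,t)|^2, where P is the orthogonal projection and |P e| = sup of <e,h> over
  harmonic h with |h| \<le> 1.\<close>
definition l2_betti1_pres :: "('a, 'b) monoid_scheme \<Rightarrow> 'a set \<Rightarrow> 'a list set \<Rightarrow> real" where
  "l2_betti1_pres G T R = (\<Sum>t\<in>T. (SUP h \<in> {h\<in>l2_harmonic G T R. l2_norm h \<le> 1}. h (\<one>\<^bsub>G\<^esub>, t))\<^sup>2)"

definition l2_betti1 :: "('a, 'b) monoid_scheme \<Rightarrow> real" where
  "l2_betti1 G = (let P = (SOME P. is_fin_pres G (fst P) (snd P)) in l2_betti1_pres G (fst P) (snd P))"

end

theory Submission
  imports Defs "Jordan_Normal_Form.Schur_Decomposition"
begin

text \<open>The annihilator of the cycles of length at most \<open>q\<close> of \<open>G\<^sub>n\<close> consists of the edge functions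
  that sum to zero around them. For a finitely presented \<open>\<Gamma>\<close>, large \<open>q\<close> and then large \<open>n\<close>, these are
  exactly the differences of functions \<open>u\<close> on \<open>\<Gamma>\<close> with \<open>u (\<gamma> x) = u \<gamma> + u x\<close> for \<open>\<gamma> \<in> \<Gamma>\<^sub>n\<close>. Such a \<open>u\<close>
  amounts to a homomorphism on \<open>\<Gamma>\<^sub>n\<close> together with arbitrary values on the nontrivial cosets. Over the
  prime field the homomorphisms are counted by \<open>d\<^sub>p\<close>. Over the reals they form the first cohomology of
  the quotient by \<open>\<Gamma>\<^sub>n\<close> of the universal cover of the presentation complex, whose normalised dimension
  tends to the first \<open>L\<^sup>2\<close>-Betti number by Lueck's argument: moments of the spectral measures
  converge, and integrality of the characteristic polynomials keeps eigenvalues from accumulating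
  at 0. Passing from the rationals to a field of characteristic \<open>p\<close> can only lower the rank of the
  integral cycle vectors.

  An edge function of \<open>G\<^sub>n\<close> that vanishes on short cycles is determined by its sums along short paths
  joining the endpoints of the edges of a Lipschitz equivalent graph \<open>H\<^sub>n\<close>, so such functions form a
  space of dimension at most \<open>|E(H\<^sub>n)|\<close>. In the other direction, a Cayley graph of \<open>\<Gamma>\<^sub>m / \<Gamma>\<^sub>n\<close> for a
  minimal generating set of \<open>\<Gamma>\<^sub>m\<close>, with each remaining vertex of \<open>\<Gamma> / \<Gamma>\<^sub>n\<close> attached by one edge, is
  equivalent to \<open>G\<^sub>n\<close> and has edge density at most \<open>1 + (d(\<Gamma>\<^sub>m) - 1) / |\<Gamma> : \<Gamma>\<^sub>m|\<close>.\<close>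

text \<open>The edge count minus the rank of the short cycles is the dimension of their annihilator.
  The free coset values contribute the index minus one to it, which cancels the -1 in
  \<open>s_q\<close> up to 1/index, and that vanishes because \<Gamma> is infinite. For large q the
  limit inferior no longer depends on q, so the infimum is one value. The obstacle on the analytic
  side is the projection onto the harmonic chains of an infinite group. It is never formed as an
  operator. The even iterates of \<open>Aop\<close> on a point mass stay finitely supported and
  converge pointwise to its projection, whose norm is the supremum in \<open>l2_betti1_pres\<close>.
  Once \<open>\<Gamma>\<^sub>n\<close> avoids the finite support of one iterate, the quotient has
  exactly the same diagonal entry as \<Gamma>, so traces agree and are not merely close. Uniformity
  in n then rests on the constant \<open>K\<close>, which depends on the matrix alone, and on the
  integrality bound. Orthogonality is used over the reals, so \<rat> is exchanged for \<real>, which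
  preserves ranks of integral vectors. Since the cycle side does not mention a presentation, the one
  picked inside \<open>l2_betti1\<close> may be arbitrary.\<close>

unbundle no vec_syntax

subsection \<open>Integral positive semidefinite matrices\<close>

text \<open>Rows are indexed by an arbitrary set because the matrices that occur later are indexed
  by pairs of a coset and a generator. Sums run over \<open>I\<close>; entries with an index outside
  \<open>I\<close> carry no meaning.\<close>

primrec kernel_pow :: "'i set \<Rightarrow> ('i \<Rightarrow> 'i \<Rightarrow> real) \<Rightarrow> nat \<Rightarrow> 'i \<Rightarrow> 'i \<Rightarrow> real" where
  "kernel_pow I B 0 = (\<lambda>i j. if i = j then 1 else 0)"
| "kernel_pow I B (Suc k) = (\<lambda>i j. \<Sum>l\<in>I. B i l * kernel_pow I B k l j)"

definition mat_trace :: "'a::comm_ring_1 mat \<Rightarrow> 'a" where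
  "mat_trace A = (\<Sum>i<dim_row A. A $$ (i, i))"

lemma mat_mult_index:
  assumes "A \<in> carrier_mat n m" "B \<in> carrier_mat m l" "i < n" "j < l"
  shows "(A * B) $$ (i, j) = (\<Sum>k<m. A $$ (i, k) * B $$ (k, j))"
  using assms by (auto simp: scalar_prod_def lessThan_atLeast0 intro!: sum.cong)

lemma mat_trace_comm:
  fixes A B :: "'a::comm_ring_1 mat"
  assumes "A \<in> carrier_mat n m" "B \<in> carrier_mat m n"
  shows "mat_trace (A * B) = mat_trace (B * A)"
proof -
  have "mat_trace (A * B) = (\<Sum>i<n. \<Sum>k<m. A $$ (i, k) * B $$ (k, i))"
    unfolding mat_trace_def using assms by (auto simp: mat_mult_index[OF assms] simp del: index_mult_mat(1) intro!: sum.cong)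
  also have "\<dots> = (\<Sum>k<m. \<Sum>i<n. B $$ (k, i) * A $$ (i, k))"
    by (subst sum.swap) (simp add: mult.commute)
  also have "\<dots> = mat_trace (B * A)"
    unfolding mat_trace_def using assms by (auto simp: mat_mult_index[OF assms(2,1)] simp del: index_mult_mat(1) intro!: sum.cong)
  finally show ?thesis .
qed

lemma upper_triangular_mult:
  fixes A B :: "'a::comm_ring_1 mat"
  assumes A: "A \<in> carrier_mat n n" and B: "B \<in> carrier_mat n n"
    and uA: "upper_triangular A" and uB: "upper_triangular B"
  shows "upper_triangular (A * B)" "\<And>i. i < n \<Longrightarrow> (A * B) $$ (i, i) = A $$ (i, i) * B $$ (i, i)"
proof -
  have zA: "A $$ (i, j) = 0" if "j < i" "i < n" for i j using uA A that by auto
  have zB: "B $$ (i, j) = 0" if "j < i" "i < n" for i j using uB B that by auto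
  show "upper_triangular (A * B)"
  proof (rule upper_triangularI)
    fix i j assume ij: "j < i" "i < dim_row (A * B)"
    then have i: "i < n" using A by simp
    have "(A * B) $$ (i, j) = (\<Sum>k<n. A $$ (i, k) * B $$ (k, j))"
      using mat_mult_index[OF A B i] ij i by simp
    also have "\<dots> = 0"
    proof (rule sum.neutral, intro ballI)
      fix k assume k: "k \<in> {..<n}"
      show "A $$ (i, k) * B $$ (k, j) = 0"
        using zA[of k i] zB[of j k] ij i k by (cases "k < i") auto
    qed
    finally show "(A * B) $$ (i, j) = 0" .
  qed
  fix i assume i: "i < n"
  have "(A * B) $$ (i, i) = (\<Sum>k<n. A $$ (i, k) * B $$ (k, i))"
    using mat_mult_index[OF A B i i] .
  also have "\<dots> = (\<Sum>k\<in>{i}. A $$ (i, k) * B $$ (k, i))"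
  proof (rule sum.mono_neutral_right)
    show "\<forall>k\<in>{..<n} - {i}. A $$ (i, k) * B $$ (k, i) = 0"
    proof
      fix k assume "k \<in> {..<n} - {i}"
      then show "A $$ (i, k) * B $$ (k, i) = 0"
        using zA[of k i] zB[of i k] i by (cases "k < i") auto
    qed
  qed (use i in auto)
  finally show "(A * B) $$ (i, i) = A $$ (i, i) * B $$ (i, i)" by simp
qed

lemma upper_triangular_pow:
  fixes A :: "'a::comm_ring_1 mat"
  assumes A: "A \<in> carrier_mat n n" and uA: "upper_triangular A"
  shows "upper_triangular (A ^\<^sub>m k) \<and> (\<forall>i<n. (A ^\<^sub>m k) $$ (i, i) = (A $$ (i, i)) ^ k)"
proof (induction k)
  case 0
  then show ?case using A by auto
next
  case (Suc k)
  have P: "A ^\<^sub>m k \<in> carrier_mat n n" using A by simp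
  show ?case using upper_triangular_mult[OF P A _ uA] Suc A by auto
qed

lemma kernel_pow_mat:
  fixes B :: "nat \<Rightarrow> nat \<Rightarrow> real"
  assumes "i < N" "j < N"
  shows "(mat N N (\<lambda>(i, j). complex_of_real (B i j)) ^\<^sub>m k) $$ (i, j) = complex_of_real (kernel_pow {..<N} B k i j)"
  using assms
proof (induction k arbitrary: i j)
  case 0
  then show ?case by auto
next
  case (Suc k)
  let ?M = "mat N N (\<lambda>(i, j). complex_of_real (B i j))"
  have M: "?M \<in> carrier_mat N N" by simp
  have P: "?M ^\<^sub>m k \<in> carrier_mat N N" by (rule pow_carrier_mat[OF M])
  \<comment> \<open>\<open>^\<^sub>m\<close> puts the new factor on the right,
    \<open>kernel_pow\<close> puts it on the left.\<close>
  have comm: "?M ^\<^sub>m k * ?M = ?M * ?M ^\<^sub>m k"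
  proof (induction k)
    case (Suc k)
    have P: "?M ^\<^sub>m k \<in> carrier_mat N N" by (rule pow_carrier_mat[OF M])
    have "?M ^\<^sub>m Suc k * ?M = (?M * ?M ^\<^sub>m k) * ?M" using Suc by simp
    also have "\<dots> = ?M * (?M ^\<^sub>m k * ?M)" by (rule assoc_mult_mat[OF M P M])
    finally show ?case by simp
  qed simp
  have "(?M ^\<^sub>m Suc k) $$ (i, j) = (\<Sum>l<N. ?M $$ (i, l) * (?M ^\<^sub>m k) $$ (l, j))"
    using mat_mult_index[OF M P Suc.prems] comm by simp
  also have "\<dots> = complex_of_real (\<Sum>l<N. B i l * kernel_pow {..<N} B k l j)"
    using Suc by (auto intro!: sum.cong)
  finally show ?case by simp
qed

text \<open>The list holds the roots of the characteristic polynomial with multiplicity. Symmetry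
  makes them real and the two form bounds put them into [0, K]; a Schur triangular form gives the
  traces of powers without diagonalisation. The product of the nonzero roots is, up to sign, the
  lowest nonzero coefficient of an integral polynomial, hence at least 1 in absolute value.\<close>

lemma int_psd_spectrum_nat:
  fixes m :: "nat \<Rightarrow> nat \<Rightarrow> int" and K :: real
  assumes K: "K > 0"
    and sym: "\<And>i j. i < N \<Longrightarrow> j < N \<Longrightarrow> m i j = m j i"
    and psd: "\<And>x :: nat \<Rightarrow> real. 0 \<le> (\<Sum>i<N. \<Sum>j<N. x i * m i j * x j)"
    and bnd: "\<And>x :: nat \<Rightarrow> real. (\<Sum>i<N. \<Sum>j<N. x i * m i j * x j) \<le> K * (\<Sum>i<N. (x i)\<^sup>2)"
  defines "B \<equiv> \<lambda>i j. (if i = j then 1 else 0) - real_of_int (m i j) / K"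
  shows "\<exists>es :: real list. length es = N \<and> (\<forall>e\<in>set es. 0 \<le> e \<and> e \<le> K)
    \<and> (\<forall>k. (\<Sum>i<N. kernel_pow {..<N} B k i i) = (\<Sum>e\<leftarrow>es. (1 - e / K) ^ k))
    \<and> 1 \<le> prod_list (filter (\<lambda>e. e \<noteq> 0) es)"
proof -
  define Mi where "Mi = mat N N (\<lambda>(i, j). m i j)"
  define M where "M = mat N N (\<lambda>(i, j). complex_of_int (m i j))"
  have M: "M \<in> carrier_mat N N" unfolding M_def by simp
  have Mi: "Mi \<in> carrier_mat N N" unfolding Mi_def by simp
  have MMi: "M = map_mat of_int Mi" unfolding M_def Mi_def by (intro eq_matI) auto
  obtain cs where cs: "char_poly M = (\<Prod>a\<leftarrow>cs. [:- a, 1:])" "length cs = N"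
    using char_poly_factorized[OF M] by blast
  have real_ev: "\<exists>r. c = complex_of_real r \<and> 0 \<le> r \<and> r \<le> K" if c: "c \<in> set cs" for c
  proof -
    have "poly (char_poly M) c = 0" unfolding cs(1) using c by (auto simp: poly_prod_list prod_list_zero_iff)
    then have "eigenvalue M c" using eigenvalue_root_char_poly[OF M] by simp
    then obtain v where v: "v \<in> carrier_vec N" "v \<noteq> 0\<^sub>v N" "M *\<^sub>v v = c \<cdot>\<^sub>v v"
      unfolding eigenvalue_def eigenvector_def using M by auto
    define x where "x i = Re (v $ i)" for i
    define y where "y i = Im (v $ i)" for i
    have vi: "v $ i = Complex (x i) (y i)" for i by (simp add: x_def y_def)
    have row: "(\<Sum>j<N. of_int (m i j) * v $ j) = c * v $ i" if i: "i < N" for i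
    proof -
      have "(M *\<^sub>v v) $ i = (\<Sum>j<N. of_int (m i j) * v $ j)"
        using i v(1) unfolding M_def by (auto simp: scalar_prod_def lessThan_atLeast0 intro!: sum.cong)
      then show ?thesis using v i by simp
    qed
    have rowR: "(\<Sum>j<N. m i j * x j) = Re c * x i - Im c * y i"
      and rowI: "(\<Sum>j<N. m i j * y j) = Re c * y i + Im c * x i" if i: "i < N" for i
      using arg_cong[OF row[OF i], of Re] arg_cong[OF row[OF i], of Im]
      by (auto simp: vi Re_sum Im_sum algebra_simps)
    have e1: "(\<Sum>i<N. \<Sum>j<N. x i * m i j * x j) = Re c * (\<Sum>i<N. (x i)\<^sup>2) - Im c * (\<Sum>i<N. x i * y i)"
    proof -
      have "(\<Sum>i<N. \<Sum>j<N. x i * m i j * x j) = (\<Sum>i<N. x i * (\<Sum>j<N. m i j * x j))"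
        by (simp add: sum_distrib_left mult.assoc)
      also have "\<dots> = (\<Sum>i<N. x i * (Re c * x i - Im c * y i))" using rowR by (intro sum.cong) auto
      finally show ?thesis by (simp add: algebra_simps sum_subtractf sum_distrib_left power2_eq_square)
    qed
    have e2: "(\<Sum>i<N. \<Sum>j<N. y i * m i j * y j) = Re c * (\<Sum>i<N. (y i)\<^sup>2) + Im c * (\<Sum>i<N. x i * y i)"
    proof -
      have "(\<Sum>i<N. \<Sum>j<N. y i * m i j * y j) = (\<Sum>i<N. y i * (\<Sum>j<N. m i j * y j))"
        by (simp add: sum_distrib_left mult.assoc)
      also have "\<dots> = (\<Sum>i<N. y i * (Re c * y i + Im c * x i))" using rowI by (intro sum.cong) auto
      finally show ?thesis by (simp add: algebra_simps sum.distrib sum_distrib_left power2_eq_square)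
    qed
    have e3: "(\<Sum>i<N. \<Sum>j<N. y i * m i j * x j) = Re c * (\<Sum>i<N. x i * y i) - Im c * (\<Sum>i<N. (y i)\<^sup>2)"
    proof -
      have "(\<Sum>i<N. \<Sum>j<N. y i * m i j * x j) = (\<Sum>i<N. y i * (\<Sum>j<N. m i j * x j))"
        by (simp add: sum_distrib_left mult.assoc)
      also have "\<dots> = (\<Sum>i<N. y i * (Re c * x i - Im c * y i))" using rowR by (intro sum.cong) auto
      finally show ?thesis by (simp add: algebra_simps sum_subtractf sum_distrib_left power2_eq_square)
    qed
    have e4: "(\<Sum>i<N. \<Sum>j<N. x i * m i j * y j) = Re c * (\<Sum>i<N. x i * y i) + Im c * (\<Sum>i<N. (x i)\<^sup>2)"
    proof -
      have "(\<Sum>i<N. \<Sum>j<N. x i * m i j * y j) = (\<Sum>i<N. x i * (\<Sum>j<N. m i j * y j))"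
        by (simp add: sum_distrib_left mult.assoc)
      also have "\<dots> = (\<Sum>i<N. x i * (Re c * y i + Im c * x i))" using rowI by (intro sum.cong) auto
      finally show ?thesis by (simp add: algebra_simps sum.distrib sum_distrib_left power2_eq_square)
    qed
    \<comment> \<open>For the eigenvector v = x + iy, symmetry of \<open>m\<close> equates the mixed
      forms \<open>e3\<close> and \<open>e4\<close>. Their difference is Im c times the squared norm
      of v, so c is real.\<close>
    have "(\<Sum>i<N. \<Sum>j<N. y i * m i j * x j) = (\<Sum>j<N. \<Sum>i<N. y i * m i j * x j)" by (rule sum.swap)
    also have "\<dots> = (\<Sum>i<N. \<Sum>j<N. x i * m i j * y j)"
      using sym by (intro sum.cong) (auto simp: mult_ac)
    finally have "Im c * ((\<Sum>i<N. (x i)\<^sup>2) + (\<Sum>i<N. (y i)\<^sup>2)) = 0"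
      unfolding e3 e4 by (simp add: algebra_simps)
    moreover have pos: "(\<Sum>i<N. (x i)\<^sup>2) + (\<Sum>i<N. (y i)\<^sup>2) > 0"
    proof -
      obtain i where i: "i < N" "v $ i \<noteq> 0" using v(1,2) by (metis carrier_vecD eq_vecI index_zero_vec(1) index_zero_vec(2))
      have "0 < (x i)\<^sup>2 + (y i)\<^sup>2" using i(2) unfolding vi by (simp add: complex_eq_iff sum_power2_gt_zero_iff)
      also have "\<dots> \<le> (\<Sum>i<N. (x i)\<^sup>2 + (y i)\<^sup>2)" using i(1) by (intro member_le_sum) auto
      finally show ?thesis by (simp add: sum.distrib)
    qed
    ultimately have im: "Im c = 0" by simp
    have q: "(\<Sum>i<N. \<Sum>j<N. x i * m i j * x j) + (\<Sum>i<N. \<Sum>j<N. y i * m i j * y j)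
        = Re c * ((\<Sum>i<N. (x i)\<^sup>2) + (\<Sum>i<N. (y i)\<^sup>2))"
      unfolding e1 e2 by (simp add: algebra_simps)
    have "0 \<le> Re c * ((\<Sum>i<N. (x i)\<^sup>2) + (\<Sum>i<N. (y i)\<^sup>2))"
      unfolding q[symmetric] using psd[of x] psd[of y] by simp
    moreover have "Re c * ((\<Sum>i<N. (x i)\<^sup>2) + (\<Sum>i<N. (y i)\<^sup>2)) \<le> K * ((\<Sum>i<N. (x i)\<^sup>2) + (\<Sum>i<N. (y i)\<^sup>2))"
      unfolding q[symmetric] using bnd[of x] bnd[of y] by (simp add: algebra_simps)
    ultimately have "0 \<le> Re c" "Re c \<le> K" using pos by (auto simp: zero_le_mult_iff)
    then show ?thesis using im by (intro exI[of _ "Re c"]) (auto simp: complex_eq_iff)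
  qed
  define es where "es = map Re cs"
  have ces: "cs = map complex_of_real es"
    unfolding es_def map_map by (rule map_idI[symmetric]) (use real_ev in fastforce)
  have es_rng: "\<forall>e\<in>set es. 0 \<le> e \<and> e \<le> K" unfolding es_def using real_ev by fastforce
  have len: "length es = N" using cs(2) by (simp add: es_def)
  obtain T P Q where TPQ: "schur_decomposition M cs = (T, P, Q)" by (cases "schur_decomposition M cs") auto
  have wit: "similar_mat_wit M T P Q" and uT: "upper_triangular T" and dT: "diag_mat T = cs"
    using schur_decomposition[OF M cs(1) TPQ] by auto
  have T: "T \<in> carrier_mat N N" and P: "P \<in> carrier_mat N N" and Q: "Q \<in> carrier_mat N N"
    and PQ: "P * Q = 1\<^sub>m N" and QP: "Q * P = 1\<^sub>m N" and MPT: "M = P * T * Q"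
    using wit M unfolding similar_mat_wit_def Let_def by auto
  have Tii: "T $$ (i, i) = complex_of_real (es ! i)" if "i < N" for i
  proof -
    have "diag_mat T ! i = T $$ (i, i)" using T that by (simp add: diag_mat_def)
    then show ?thesis using dT that len by (simp add: ces)
  qed
  \<comment> \<open>The same \<open>P\<close> and \<open>Q\<close> that triangularise
    \<open>M\<close> triangularise 1 - M/K, with diagonal entries 1 - e/K.\<close>
  define T' where "T' = 1\<^sub>m N + (- 1 / complex_of_real K) \<cdot>\<^sub>m T"
  have T': "T' \<in> carrier_mat N N" unfolding T'_def using T by simp
  have uT': "upper_triangular T'" using uT T unfolding T'_def by (intro upper_triangularI) (auto simp: upper_triangular_def)
  have T'ii: "T' $$ (i, i) = complex_of_real (1 - es ! i / K)" if "i < N" for i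
    using that T Tii[OF that] unfolding T'_def by simp
  define Bc where "Bc = mat N N (\<lambda>(i, j). complex_of_real (B i j))"
  have Bc: "Bc \<in> carrier_mat N N" unfolding Bc_def by simp
  have BcM: "Bc = 1\<^sub>m N + (- 1 / complex_of_real K) \<cdot>\<^sub>m M"
    unfolding Bc_def M_def B_def by (intro eq_matI) auto
  have "P * T' * Q = Bc"
  proof -
    have "P * T' = P + (- 1 / complex_of_real K) \<cdot>\<^sub>m (P * T)"
      unfolding T'_def using P T by (simp add: mult_add_distrib_mat[OF P one_carrier_mat] mult_smult_distrib[OF P T])
    then have "P * T' * Q = P * Q + ((- 1 / complex_of_real K) \<cdot>\<^sub>m (P * T)) * Q"
      using P T Q by (simp add: add_mult_distrib_mat[of _ N N _ _ N])
    also have "\<dots> = 1\<^sub>m N + (- 1 / complex_of_real K) \<cdot>\<^sub>m M"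
      using P T Q PQ by (simp add: mult_smult_assoc_mat[of _ N N _ N] MPT)
    finally show ?thesis using BcM by simp
  qed
  then have witB: "similar_mat_wit Bc T' P Q"
    unfolding similar_mat_wit_def Let_def using Bc T' P Q PQ QP by auto
  have tr: "(\<Sum>i<N. kernel_pow {..<N} B k i i) = (\<Sum>e\<leftarrow>es. (1 - e / K) ^ k)" for k
  proof -
    have Tk: "T' ^\<^sub>m k \<in> carrier_mat N N" using T' by simp
    have "Bc ^\<^sub>m k = P * T' ^\<^sub>m k * Q" by (rule similar_mat_wit_pow_id[OF witB])
    then have "mat_trace (Bc ^\<^sub>m k) = mat_trace (P * (T' ^\<^sub>m k * Q))"
      using P Tk Q by simp
    also have "\<dots> = mat_trace ((T' ^\<^sub>m k * Q) * P)" using P Tk Q by (intro mat_trace_comm[of _ N N]) auto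
    also have "(T' ^\<^sub>m k * Q) * P = T' ^\<^sub>m k" using QP by (simp add: assoc_mult_mat[OF Tk Q P] right_mult_one_mat[OF Tk])
    also have "mat_trace (T' ^\<^sub>m k) = (\<Sum>i<N. complex_of_real ((1 - es ! i / K) ^ k))"
      unfolding mat_trace_def using Tk T' upper_triangular_pow[OF T' uT', of k] T'ii by (auto intro!: sum.cong)
    also have "mat_trace (Bc ^\<^sub>m k) = (\<Sum>i<N. complex_of_real (kernel_pow {..<N} B k i i))"
      unfolding mat_trace_def using Bc kernel_pow_mat[of _ N _ B k] by (auto simp: Bc_def intro!: sum.cong)
    finally have "complex_of_real (\<Sum>i<N. kernel_pow {..<N} B k i i) = complex_of_real (\<Sum>i<N. (1 - es ! i / K) ^ k)"
      by simp
    then have "(\<Sum>i<N. kernel_pow {..<N} B k i i) = (\<Sum>i<N. (1 - es ! i / K) ^ k)"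
      using of_real_eq_iff by blast
    then show ?thesis using len by (simp add: sum_list_sum_nth lessThan_atLeast0)
  qed
  have prod1: "1 \<le> prod_list (filter (\<lambda>e. e \<noteq> 0) es)"
  proof -
    \<comment> \<open>The multiplicity of the root 0. The factor X^k only shifts coefficients, so
      the coefficient at \<open>k\<close> is the constant term of the product over the nonzero
      roots.\<close>
    define k where "k = length (filter (\<lambda>e. e = 0) es)"
    have split: "(\<Prod>a\<leftarrow>map complex_of_real xs. [:- a, 1:])
      = Polynomial.monom 1 (length (filter (\<lambda>e. e = 0) xs)) * (\<Prod>a\<leftarrow>map complex_of_real (filter (\<lambda>e. e \<noteq> 0) xs). [:- a, 1:])" for xs
    proof (induction xs)
      case (Cons a xs)
      show ?case
      proof (cases "a = 0")
        case True
        have "[:0, 1:] * Polynomial.monom (1::complex) l = Polynomial.monom 1 (Suc l)" for l by (simp add: monom_Suc)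
        then show ?thesis using True Cons by (simp flip: mult.assoc)
      qed (use Cons in \<open>simp add: mult.left_commute del: mult_pCons_left mult_pCons_right\<close>)
    qed simp
    have "char_poly M = map_poly of_int (char_poly Mi)"
      unfolding MMi using of_int_hom.char_poly_hom[OF Mi] .
    then have ci: "Polynomial.coeff (char_poly M) k = of_int (Polynomial.coeff (char_poly Mi) k)" by simp
    have "Polynomial.coeff (char_poly M) k = Polynomial.coeff (\<Prod>a\<leftarrow>map complex_of_real (filter (\<lambda>e. e \<noteq> 0) es). [:- a, 1:]) 0"
      unfolding cs(1) ces using split[of es] by (simp add: coeff_monom_mult k_def[symmetric])
    also have "\<dots> = (\<Prod>a\<leftarrow>map complex_of_real (filter (\<lambda>e. e \<noteq> 0) es). - a)"
      by (simp add: poly_0_coeff_0[symmetric] poly_prod_list comp_def)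
    finally have eq: "of_int (Polynomial.coeff (char_poly Mi) k) = (\<Prod>a\<leftarrow>map complex_of_real (filter (\<lambda>e. e \<noteq> 0) es). - a)"
      using ci by simp
    have nm: "norm (\<Prod>a\<leftarrow>map complex_of_real xs. - a) = prod_list xs" if "\<forall>e\<in>set xs. 0 \<le> e" for xs
      using that by (induction xs) (auto simp: norm_mult)
    have "norm (complex_of_int (Polynomial.coeff (char_poly Mi) k)) = prod_list (filter (\<lambda>e. e \<noteq> 0) es)"
      unfolding eq using es_rng by (intro nm) auto
    moreover have "prod_list (filter (\<lambda>e. e \<noteq> 0) es) \<noteq> 0" by (simp add: prod_list_zero_iff)
    ultimately have "real_of_int \<bar>Polynomial.coeff (char_poly Mi) k\<bar> = prod_list (filter (\<lambda>e. e \<noteq> 0) es)" "Polynomial.coeff (char_poly Mi) k \<noteq> 0"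
      by auto
    then show ?thesis by (metis of_int_1_le_iff zero_less_abs_iff zless_imp_add1_zle add_0)
  qed
  show ?thesis using len es_rng tr prod1 by (intro exI[of _ es]) auto
qed

lemma kernel_pow_reindex:
  assumes h: "bij_betw h J I" and ij: "i \<in> J" "j \<in> J"
  shows "kernel_pow I B k (h i) (h j) = kernel_pow J (\<lambda>i j. B (h i) (h j)) k i j"
  using ij
proof (induction k arbitrary: i j)
  case 0
  then show ?case using h by (auto simp: bij_betw_def inj_on_def)
next
  case (Suc k)
  then show ?case by (simp add: sum.reindex_bij_betw[OF h, symmetric])
qed

text \<open>An enumeration of \<open>I\<close> reduces this to an initial segment of the naturals.
  \<open>B\<close> is prescribed on \<open>I\<close> only, since no other entries enter the
  traces.\<close>

lemma int_psd_spectrum: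
  fixes m :: "'i \<Rightarrow> 'i \<Rightarrow> int" and K :: real
  assumes I: "finite I" and K: "K > 0"
    and sym: "\<And>i j. i \<in> I \<Longrightarrow> j \<in> I \<Longrightarrow> m i j = m j i"
    and psd: "\<And>x :: 'i \<Rightarrow> real. 0 \<le> (\<Sum>i\<in>I. \<Sum>j\<in>I. x i * m i j * x j)"
    and bnd: "\<And>x :: 'i \<Rightarrow> real. (\<Sum>i\<in>I. \<Sum>j\<in>I. x i * m i j * x j) \<le> K * (\<Sum>i\<in>I. (x i)\<^sup>2)"
    and B: "\<And>i j. i \<in> I \<Longrightarrow> j \<in> I \<Longrightarrow> B i j = (if i = j then 1 else 0) - real_of_int (m i j) / K"
  shows "\<exists>es :: real list. length es = card I \<and> (\<forall>e\<in>set es. 0 \<le> e \<and> e \<le> K)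
    \<and> (\<forall>k. (\<Sum>i\<in>I. kernel_pow I B k i i) = (\<Sum>e\<leftarrow>es. (1 - e / K) ^ k))
    \<and> 1 \<le> prod_list (filter (\<lambda>e. e \<noteq> 0) es)"
proof -
  let ?N = "card I"
  obtain h where h: "bij_betw h {..<?N} I" using I by (metis bij_betw_from_nat_into_finite)
  have hI: "h i \<in> I" if "i < ?N" for i using h that by (auto simp: bij_betw_def)
  have quad: "(\<Sum>i<?N. \<Sum>j<?N. x i * m (h i) (h j) * x j)
      = (\<Sum>i\<in>I. \<Sum>j\<in>I. x (inv_into {..<?N} h i) * m i j * x (inv_into {..<?N} h j))" for x :: "nat \<Rightarrow> real"
    unfolding sum.reindex_bij_betw[OF h, symmetric]
    using h by (intro sum.cong) (auto simp: bij_betw_def)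
  have sq: "(\<Sum>i<?N. (x i)\<^sup>2) = (\<Sum>i\<in>I. (x (inv_into {..<?N} h i))\<^sup>2)" for x :: "nat \<Rightarrow> real"
    unfolding sum.reindex_bij_betw[OF h, symmetric]
    using h by (intro sum.cong) (auto simp: bij_betw_def)
  define B' where "B' = (\<lambda>i j. (if i = j then 1 else 0) - real_of_int (m (h i) (h j)) / K)"
  have ker: "kernel_pow I B k (h i) (h i) = kernel_pow {..<?N} B' k i i" if "i < ?N" for k i
  proof -
    have cong: "kernel_pow {..<?N} (\<lambda>i j. B (h i) (h j)) k i j = kernel_pow {..<?N} B' k i j" if "i < ?N" "j < ?N" for i j
      using that
    proof (induction k arbitrary: i j)
      case (Suc k)
      have "B (h i) (h l) = B' i l" if "l < ?N" for l
        using B[OF hI hI] that Suc.prems h unfolding B'_def by (auto simp: bij_betw_def inj_on_def)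
      then show ?case using Suc by auto
    qed simp
    show ?thesis using kernel_pow_reindex[OF h, of i i B k] cong that by auto
  qed
  have "\<exists>es :: real list. length es = ?N \<and> (\<forall>e\<in>set es. 0 \<le> e \<and> e \<le> K)
    \<and> (\<forall>k. (\<Sum>i<?N. kernel_pow {..<?N} B' k i i) = (\<Sum>e\<leftarrow>es. (1 - e / K) ^ k))
    \<and> 1 \<le> prod_list (filter (\<lambda>e. e \<noteq> 0) es)"
    unfolding B'_def
  proof (rule int_psd_spectrum_nat[OF K])
    show "m (h i) (h j) = m (h j) (h i)" if "i < ?N" "j < ?N" for i j using sym hI that by auto
    show "0 \<le> (\<Sum>i<?N. \<Sum>j<?N. x i * m (h i) (h j) * x j)" for x :: "nat \<Rightarrow> real"
      unfolding quad by (rule psd)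
    show "(\<Sum>i<?N. \<Sum>j<?N. x i * m (h i) (h j) * x j) \<le> K * (\<Sum>i<?N. (x i)\<^sup>2)" for x :: "nat \<Rightarrow> real"
      unfolding quad sq by (rule bnd)
  qed
  moreover have "(\<Sum>i<?N. kernel_pow {..<?N} B' k i i) = (\<Sum>i\<in>I. kernel_pow I B k i i)" for k
    unfolding sum.reindex_bij_betw[OF h, symmetric] using ker by (intro sum.cong) auto
  ultimately show ?thesis by simp
qed

text \<open>The product of the nonzero eigenvalues is at least 1, so few of them can be small.\<close>

lemma few_small_eigenvalues:
  fixes es :: "real list"
  assumes es: "\<forall>e\<in>set es. 0 \<le> e \<and> e \<le> K" and pr: "1 \<le> prod_list (filter (\<lambda>e. e \<noteq> 0) es)"
    and K: "1 \<le> K" and eps: "0 < \<epsilon>" "\<epsilon> < 1"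
  shows "(\<Sum>e\<leftarrow>es. (1 - e / K) ^ (2 * j)) \<le> real (length (filter (\<lambda>e. e = 0) es))
     + real (length es) * (ln K / ln (1 / \<epsilon>)) + real (length es) * (1 - \<epsilon> / K) ^ (2 * j)"
proof -
  define c where "c = length (filter (\<lambda>e. e \<noteq> 0 \<and> e < \<epsilon>) es)"
  \<comment> \<open>A nonzero factor contributes at most ln K to the logarithm, and at most ln K -
    ln(1/\<epsilon>) if it lies below \<epsilon>. As the total is nonnegative, the number of small
    factors is at most the length times ln K / ln(1/\<epsilon>).\<close>
  have lnprod: "ln (prod_list (filter (\<lambda>e. e \<noteq> 0) xs)) \<le> real (length xs) * ln K
      - real (length (filter (\<lambda>e. e \<noteq> 0 \<and> e < \<epsilon>) xs)) * ln (1 / \<epsilon>)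
    \<and> 0 < prod_list (filter (\<lambda>e. e \<noteq> 0) xs)" if "\<forall>e\<in>set xs. 0 \<le> e \<and> e \<le> K" for xs
    using that
  proof (induction xs)
    case (Cons a xs)
    then have IH: "ln (prod_list (filter (\<lambda>e. e \<noteq> 0) xs)) \<le> real (length xs) * ln K
      - real (length (filter (\<lambda>e. e \<noteq> 0 \<and> e < \<epsilon>) xs)) * ln (1 / \<epsilon>)"
      "0 < prod_list (filter (\<lambda>e. e \<noteq> 0) xs)" by auto
    have lK: "0 \<le> ln K" using K by simp
    show ?case
    proof (cases "a = 0")
      case True
      then show ?thesis using IH lK by (simp add: algebra_simps)
    next
      case False
      then have a: "0 < a" "a \<le> K" using Cons.prems by (auto simp: less_le)
      have l: "ln (a * prod_list (filter (\<lambda>e. e \<noteq> 0) xs)) = ln a + ln (prod_list (filter (\<lambda>e. e \<noteq> 0) xs))"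
        using a IH(2) by (simp add: ln_mult)
      have "ln a \<le> ln K" using a K by simp
      moreover have "ln a \<le> - ln (1 / \<epsilon>)" if "a < \<epsilon>" using a eps that by (simp add: ln_div)
      ultimately have "ln a \<le> ln K - (if a < \<epsilon> then 1 else 0) * ln (1 / \<epsilon>)" using lK by auto
      moreover have "0 < a * prod_list (filter (\<lambda>e. e \<noteq> 0) xs)" using a IH(2) by simp
      ultimately show ?thesis using IH(1) False l by (cases "a < \<epsilon>"; simp add: distrib_right; linarith)
    qed
  qed simp
  have lp: "0 < ln (1 / \<epsilon>)" using eps by (simp add: ln_div)
  have "0 \<le> ln (prod_list (filter (\<lambda>e. e \<noteq> 0) es))" using pr by simp
  then have "real c * ln (1 / \<epsilon>) \<le> real (length es) * ln K"
    using lnprod[OF es] unfolding c_def by linarith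
  then have c: "real c \<le> real (length es) * (ln K / ln (1 / \<epsilon>))" using lp by (simp add: field_simps)
  \<comment> \<open>Zero entries contribute 1 each, small nonzero ones at most 1, and the rest at
    most the power taken at \<epsilon>.\<close>
  have "(\<Sum>e\<leftarrow>xs. (1 - e / K) ^ (2 * j)) \<le> real (length (filter (\<lambda>e. e = 0) xs))
     + real (length (filter (\<lambda>e. e \<noteq> 0 \<and> e < \<epsilon>) xs)) + real (length xs) * (1 - \<epsilon> / K) ^ (2 * j)"
    if "\<forall>e\<in>set xs. 0 \<le> e \<and> e \<le> K" for xs
    using that
  proof (induction xs)
    case (Cons a xs)
    then have a: "0 \<le> a" "a \<le> K" by auto
    have pos: "0 \<le> (1 - \<epsilon> / K) ^ (2 * j)" by (simp add: power_mult)
    have le1: "(1 - a / K) ^ (2 * j) \<le> 1" using a K by (intro power_le_one) (auto simp: field_simps)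
    have le2: "(1 - a / K) ^ (2 * j) \<le> (1 - \<epsilon> / K) ^ (2 * j)" if "\<not> a < \<epsilon>"
      using a K that by (intro power_mono) (auto simp: field_simps)
    show ?case using Cons le1 le2 pos by (auto simp: algebra_simps)
  qed simp
  from this[OF es] c show ?thesis unfolding c_def by linarith
qed

text \<open>The even exponent makes the terms of the nonzero entries nonnegative for every
  list.\<close>

lemma zero_eigenvalues_le:
  fixes es :: "real list"
  shows "real (length (filter (\<lambda>e. e = 0) es)) \<le> (\<Sum>e\<leftarrow>es. (1 - e / K) ^ (2 * j))"
proof (induction es)
  case (Cons a es)
  have "0 \<le> (1 - a / K) ^ (2 * j)" by (simp add: power_mult)
  then show ?case using Cons by (cases "a = 0"; simp; linarith)
qed simp

lemma zero_eigenvalues_limit: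
  fixes es :: "real list"
  assumes "\<forall>e\<in>set es. 0 \<le> e \<and> e \<le> K" "0 < K"
  shows "(\<lambda>j. \<Sum>e\<leftarrow>es. (1 - e / K) ^ (2 * j)) \<longlonglongrightarrow> real (length (filter (\<lambda>e. e = 0) es))"
  using assms
proof (induction es)
  case (Cons a es)
  have "(\<lambda>j. (1 - a / K) ^ (2 * j)) \<longlonglongrightarrow> (if a = 0 then 1 else 0)"
  proof (cases "a = 0")
    case False
    then have "\<bar>1 - a / K\<bar> < 1" using Cons.prems by (simp add: abs_less_iff field_simps)
    then have "\<bar>(1 - a / K)\<^sup>2\<bar> < 1" by (simp add: abs_square_less_1)
    then have "(\<lambda>j. ((1 - a / K)\<^sup>2) ^ j) \<longlonglongrightarrow> 0" by (intro LIMSEQ_abs_realpow_zero2)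
    then show ?thesis using False by (simp add: power_mult)
  qed simp
  from tendsto_add[OF this Cons.IH] show ?case using Cons.prems by auto
qed simp

subsection \<open>Spaces of functions over a field\<close>

text \<open>\<open>fscale\<close> lives on functions of pairs; functions on group elements and on
  vertices are scaled as well.\<close>

definition fun_scale :: "'k::field \<Rightarrow> ('i \<Rightarrow> 'k) \<Rightarrow> ('i \<Rightarrow> 'k)" where
  "fun_scale c f = (\<lambda>a. c * f a)"

lemma fun_scale_apply [simp]: "fun_scale c f a = c * f a"
  by (simp add: fun_scale_def)

lemma fscale_eq_fun_scale: "fscale = fun_scale"
  by (intro ext) (simp add: fscale_def)

interpretation fv: vector_space "fun_scale :: 'k::field \<Rightarrow> ('i \<Rightarrow> 'k) \<Rightarrow> ('i \<Rightarrow> 'k)"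
  by unfold_locales (auto simp: fun_eq_iff algebra_simps)

lemma fun_pair: "vector_space_pair (fun_scale :: 'k::field \<Rightarrow> ('i \<Rightarrow> 'k) \<Rightarrow> ('i \<Rightarrow> 'k))
  (fun_scale :: 'k \<Rightarrow> ('j \<Rightarrow> 'k) \<Rightarrow> ('j \<Rightarrow> 'k))" ..

lemma sum_fun_apply: "sum f A x = (\<Sum>i\<in>A. f i x)"
  by (induction A rule: infinite_finite_induct) auto

lemma linear_funI:
  assumes "\<And>f g. \<phi> (f + g) = \<phi> f + \<phi> g" "\<And>c f. \<phi> (fun_scale c f) = fun_scale c (\<phi> f)"
  shows "Vector_Spaces.linear fun_scale fun_scale \<phi>"
  by unfold_locales (use assms in auto)

text \<open>The dimension of a set is that of its span, so injectivity is asked on the span.\<close>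

lemma dim_inj_image:
  fixes \<phi> :: "('i \<Rightarrow> 'k::field) \<Rightarrow> ('j \<Rightarrow> 'k)"
  assumes lin: "Vector_Spaces.linear fun_scale fun_scale \<phi>" and inj: "inj_on \<phi> (fv.span W)"
  shows "fv.dim (\<phi> ` W) = fv.dim W"
proof -
  obtain B where B: "B \<subseteq> W" "fv.independent B" "W \<subseteq> fv.span B" "card B = fv.dim W"
    by (rule fv.basis_exists)
  have sp: "fv.span B \<subseteq> fv.span W" using B(1) by (rule fv.span_mono)
  show ?thesis
  proof (rule fv.dim_unique)
    show "\<phi> ` B \<subseteq> \<phi> ` W" using B by auto
    have "\<phi> ` fv.span B = fv.span (\<phi> ` B)" by (rule vector_space_pair.linear_span_image[OF fun_pair lin, symmetric])
    then show "\<phi> ` W \<subseteq> fv.span (\<phi> ` B)" using B(3) by auto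
    show "fv.independent (\<phi> ` B)"
      by (rule vector_space_pair.linear_independent_injective_image[OF fun_pair lin B(2) inj_on_subset[OF inj sp]])
    have "inj_on \<phi> B" by (rule inj_on_subset[OF inj subset_trans[OF fv.span_superset sp]])
    then show "card (\<phi> ` B) = fv.dim W" using B(4) by (simp add: card_image)
  qed
qed

definition supported :: "'i set \<Rightarrow> ('i \<Rightarrow> 'k::comm_ring_1) set" where
  "supported I = {f. \<forall>i. i \<notin> I \<longrightarrow> f i = 0}"

definition delta :: "'i \<Rightarrow> 'i \<Rightarrow> 'k::comm_ring_1" where
  "delta x = (\<lambda>i. if i = x then 1 else 0)"

lemma subspace_supported: "fv.subspace (supported I)"
  by (auto simp: fv.subspace_def supported_def)

lemma supported_expand:
  assumes "finite I" "f \<in> supported I"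
  shows "f = (\<Sum>x\<in>I. fun_scale (f x) (delta x))"
proof
  fix i
  have "(\<Sum>x\<in>I. fun_scale (f x) (delta x)) i = (\<Sum>x\<in>I. if i = x then f x else 0)"
    by (simp add: sum_fun_apply delta_def if_distrib cong: if_cong)
  also have "\<dots> = f i" using assms by (auto simp: supported_def)
  finally show "f i = (\<Sum>x\<in>I. fun_scale (f x) (delta x)) i" by simp
qed

lemma delta_basis:
  assumes I: "finite I"
  shows "fv.independent (delta ` I :: ('i \<Rightarrow> 'k::field) set)" "fv.span (delta ` I) = (supported I :: ('i \<Rightarrow> 'k) set)"
    "card (delta ` I :: ('i \<Rightarrow> 'k) set) = card I"
proof -
  have inj: "inj_on (delta :: 'i \<Rightarrow> 'i \<Rightarrow> 'k) I"
    by (auto simp: inj_on_def delta_def fun_eq_iff split: if_splits)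
  then show "card (delta ` I :: ('i \<Rightarrow> 'k) set) = card I" by (rule card_image)
  show "fv.independent (delta ` I :: ('i \<Rightarrow> 'k) set)"
  proof (rule fv.independent_if_scalars_zero)
    fix f :: "('i \<Rightarrow> 'k) \<Rightarrow> 'k" and v :: "'i \<Rightarrow> 'k" assume s: "(\<Sum>x\<in>delta ` I. fun_scale (f x) x) = 0" and v: "v \<in> delta ` I"
    then obtain x where x: "x \<in> I" "v = delta x" by auto
    have "(\<Sum>y\<in>I. f (delta y) * delta y x) = 0"
      using fun_cong[OF s, of x] by (simp add: sum_fun_apply sum.reindex[OF inj])
    then show "f v = 0" using I x by (simp add: delta_def if_distrib cong: if_cong)
  qed (use I in auto)
  show "fv.span (delta ` I) = (supported I :: ('i \<Rightarrow> 'k) set)"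
  proof
    show "fv.span (delta ` I) \<subseteq> (supported I :: ('i \<Rightarrow> 'k) set)"
      by (rule fv.span_minimal[OF _ subspace_supported]) (auto simp: supported_def delta_def)
    show "supported I \<subseteq> fv.span (delta ` I :: ('i \<Rightarrow> 'k) set)"
    proof
      fix f :: "'i \<Rightarrow> 'k" assume f: "f \<in> supported I"
      show "f \<in> fv.span (delta ` I)"
        by (subst supported_expand[OF I f]) (rule fv.span_sum, rule fv.span_scale, rule fv.span_base, simp)
    qed
  qed
qed

lemma dim_supported: "finite I \<Longrightarrow> fv.dim (supported I :: ('i \<Rightarrow> 'k::field) set) = card I"
  using fv.dim_eq_card_independent[OF delta_basis(1)[of I, where 'k='k]] delta_basis(2,3)[of I, where 'k='k] fv.dim_span by metis

lemma independent_supported_finite: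
  assumes I: "finite I" and B: "B \<subseteq> supported I" "fv.independent (B :: ('i \<Rightarrow> 'k::field) set)"
  shows "finite B" "card B \<le> card I"
proof -
  have "B \<subseteq> fv.span (delta ` I)" using B(1) delta_basis(2)[OF I, where 'k='k] by simp
  then have "finite B \<and> card B \<le> card (delta ` I :: ('i \<Rightarrow> 'k) set)"
    using fv.independent_span_bound[OF _ B(2)] I by blast
  then show "finite B" "card B \<le> card I" using delta_basis(3)[OF I, where 'k='k] by auto
qed

text \<open>Independent sets can be extended to bases in any space, but cardinalities compare only
  when the bases are finite. The finite support set \<open>I\<close> guarantees this.\<close>

lemma independent_card_le_dim:
  assumes I: "finite I" and V: "V \<subseteq> supported I" and B: "B \<subseteq> V" "fv.independent (B :: ('i \<Rightarrow> 'k::field) set)"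
  shows "card B \<le> fv.dim V"
proof -
  obtain E where E: "B \<subseteq> E" "E \<subseteq> V" "fv.independent E" "V \<subseteq> fv.span E"
    by (rule fv.maximal_independent_subset_extend[OF B])
  have "finite E" using independent_supported_finite[OF I _ E(3)] E V by blast
  then show ?thesis using E fv.dim_unique[OF E(2,4,3) refl] card_mono[OF _ E(1)] by simp
qed

lemma dim_mono_supported:
  assumes I: "finite I" and W: "W \<subseteq> supported I" and VW: "V \<subseteq> W"
  shows "fv.dim V \<le> fv.dim (W :: ('i \<Rightarrow> 'k::field) set)"
proof -
  obtain B where B: "B \<subseteq> V" "fv.independent B" "V \<subseteq> fv.span B" "card B = fv.dim V"
    by (rule fv.basis_exists)
  show ?thesis using independent_card_le_dim[OF I W _ B(2)] B VW by auto
qed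

definition annihilator :: "'i set \<Rightarrow> ('i \<Rightarrow> 'k::field) set \<Rightarrow> ('i \<Rightarrow> 'k) set" where
  "annihilator I B = {f \<in> supported I. \<forall>b\<in>B. (\<Sum>x\<in>I. f x * b x) = 0}"

text \<open>A basis C of the span of \<open>B\<close> extends to a basis E of all functions on
  \<open>I\<close>. The coordinate functionals of the elements of E - C, turned into functions by
  the pairing, form a basis of the annihilator.\<close>

lemma dim_annihilator:
  fixes B :: "('i \<Rightarrow> 'k::field) set"
  assumes I: "finite I" and B: "B \<subseteq> supported I"
  shows "fv.dim (annihilator I B) + fv.dim B = card I"
proof -
  obtain C where C: "C \<subseteq> B" "fv.independent C" "B \<subseteq> fv.span C" "card C = fv.dim B"
    by (rule fv.basis_exists)
  obtain E where E: "C \<subseteq> E" "E \<subseteq> supported I" "fv.independent E" "supported I \<subseteq> fv.span E"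
    by (rule fv.maximal_independent_subset_extend[OF subset_trans[OF C(1) B] C(2)])
  have finE: "finite E" using independent_supported_finite[OF I E(2,3)] by simp
  have cardE: "card E = card I"
    using fv.dim_unique[OF E(2,4,3) refl] dim_supported[OF I, where 'k='k] by simp
  define r where "r v k = fv.representation E v k" for v k
  define \<phi> where "\<phi> k = (\<lambda>x. if x \<in> I then r (delta x) k else 0)" for k
  have dsp: "delta x \<in> fv.span E" if "x \<in> I" for x
    using E(4) that by (auto simp: supported_def delta_def)
  have pair: "(\<Sum>x\<in>I. \<phi> k x * w x) = r w k" if w: "w \<in> supported I" for w k
  proof -
    have "r w k = r (\<Sum>x\<in>I. fun_scale (w x) (delta x)) k" using supported_expand[OF I w] by simp
    also have "\<dots> = (\<Sum>x\<in>I. r (fun_scale (w x) (delta x)) k)"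
      unfolding r_def using E(3) dsp by (subst fv.representation_sum) (auto intro: fv.span_scale simp: sum_fun_apply)
    also have "\<dots> = (\<Sum>x\<in>I. w x * r (delta x) k)"
      unfolding r_def using E(3) dsp by (intro sum.cong) (auto simp: fv.representation_scale)
    finally show ?thesis unfolding \<phi>_def by (simp add: mult.commute)
  qed
  have rb: "r e k = (if k = e then 1 else 0)" if "e \<in> E" for e k
    unfolding r_def using fv.representation_basis[OF E(3) that] by auto
  have inj: "inj_on \<phi> (E - C)"
  proof (rule inj_onI)
    fix k l assume kl: "k \<in> E - C" "l \<in> E - C" "\<phi> k = \<phi> l"
    have "r l k = r l l" using pair[of l k] pair[of l l] kl E(2) by auto
    then show "k = l" using rb kl by (auto split: if_splits)
  qed
  have "fv.dim (annihilator I B) = card (E - C)"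
  proof (rule fv.dim_unique)
    show "\<phi> ` (E - C) \<subseteq> annihilator I B"
    proof
      fix f assume "f \<in> \<phi> ` (E - C)"
      then obtain k where k: "k \<in> E" "k \<notin> C" "f = \<phi> k" by auto
      have "(\<Sum>x\<in>I. \<phi> k x * b x) = 0" if b: "b \<in> B" for b
      proof -
        have "r b k = fv.representation C b k"
          unfolding r_def using fv.representation_extend[OF E(3) _ E(1)] C b by (metis subsetD)
        also have "\<dots> = 0" using k(2) fv.representation_ne_zero by blast
        finally show ?thesis using pair b B by auto
      qed
      then show "f \<in> annihilator I B" unfolding annihilator_def k(3) by (auto simp: supported_def \<phi>_def)
    qed
    show "annihilator I B \<subseteq> fv.span (\<phi> ` (E - C))"
    proof
      fix f assume f: "f \<in> annihilator I B"
      \<comment> \<open>As a functional, \<open>f\<close> is determined by its values on E. Those on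
        C vanish, and the values \<open>l k\<close> for k in E - C are the coefficients of
        \<open>f\<close> with respect to the functions \<open>\<phi> k\<close>.\<close>
      define l where "l w = (\<Sum>y\<in>I. f y * w y)" for w
      have "f = (\<Sum>k\<in>E - C. fun_scale (l k) (\<phi> k))"
      proof
        fix x
        show "f x = (\<Sum>k\<in>E - C. fun_scale (l k) (\<phi> k)) x"
        proof (cases "x \<in> I")
          case False
          then show ?thesis using f by (auto simp: annihilator_def supported_def sum_fun_apply \<phi>_def)
        next
          case True
          have "f x = l (delta x)" unfolding l_def delta_def using I True by (simp add: if_distrib cong: if_cong)
          also have "delta x = (\<Sum>k\<in>E. fun_scale (r (delta x) k) k)"
            unfolding r_def using fv.sum_representation_eq[OF E(3) dsp[OF True] finE] by simp
          also have "l \<dots> = (\<Sum>k\<in>E. r (delta x) k * l k)"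
            unfolding l_def by (simp add: sum_fun_apply sum_distrib_left mult_ac) (subst sum.swap, rule refl)
          also have "\<dots> = (\<Sum>k\<in>E - C. r (delta x) k * l k)"
            using finE f C(1) by (intro sum.mono_neutral_right) (auto simp: annihilator_def l_def)
          also have "\<dots> = (\<Sum>k\<in>E - C. fun_scale (l k) (\<phi> k)) x"
            using True by (simp add: sum_fun_apply \<phi>_def mult.commute)
          finally show ?thesis .
        qed
      qed
      then show "f \<in> fv.span (\<phi> ` (E - C))"
        by (metis (no_types, lifting) fv.span_sum fv.span_scale fv.span_base imageI)
    qed
    show "fv.independent (\<phi> ` (E - C))"
    proof (rule fv.independent_if_scalars_zero)
      fix g v assume s: "(\<Sum>x\<in>\<phi> ` (E - C). fun_scale (g x) x) = 0" and v: "v \<in> \<phi> ` (E - C)"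
      then obtain e where e: "e \<in> E - C" "v = \<phi> e" by auto
      have z: "(\<Sum>k\<in>E - C. g (\<phi> k) * \<phi> k x) = 0" for x
        using fun_cong[OF s, of x] by (simp add: sum_fun_apply sum.reindex[OF inj])
      have "0 = (\<Sum>x\<in>I. (\<Sum>k\<in>E - C. g (\<phi> k) * \<phi> k x) * e x)" using z by simp
      also have "\<dots> = (\<Sum>k\<in>E - C. g (\<phi> k) * (\<Sum>x\<in>I. \<phi> k x * e x))"
        by (simp add: sum_distrib_right sum_distrib_left mult.assoc) (subst sum.swap, rule refl)
      also have "\<dots> = (\<Sum>k\<in>E - C. g (\<phi> k) * (if k = e then 1 else 0))"
        using pair rb e E(2) by (intro sum.cong) auto
      also have "\<dots> = g v" using e finE by (simp add: if_distrib cong: if_cong)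
      finally show "g v = 0" by simp
    qed (use finE in auto)
    show "card (\<phi> ` (E - C)) = card (E - C)" using inj by (rule card_image)
  qed
  moreover have "card (E - C) = card I - fv.dim B"
    using finE E(1) C(4) cardE by (simp add: card_Diff_subset finite_subset)
  moreover have "fv.dim B \<le> card I" using card_mono[OF finE E(1)] C(4) cardE by simp
  ultimately show ?thesis by simp
qed

lemma card_span_finite_field:
  fixes B :: "('i \<Rightarrow> 'k::{field,finite}) set"
  assumes B: "finite B" "fv.independent B"
  shows "card (fv.span B) = CARD('k) ^ card B" "finite (fv.span B)"
proof -
  let ?s = "\<lambda>u. \<Sum>v\<in>B. fun_scale (u v) v"
  have im: "fv.span B = ?s ` (B \<rightarrow>\<^sub>E UNIV)"
  proof -
    have "?s u \<in> ?s ` (B \<rightarrow>\<^sub>E UNIV)" for u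
    proof
      show "?s u = ?s (restrict u B)" by (rule sum.cong) auto
    qed auto
    then show ?thesis unfolding fv.span_finite[OF B(1)] by blast
  qed
  have inj: "inj_on ?s (B \<rightarrow>\<^sub>E UNIV)"
  proof (rule inj_onI)
    fix u w assume uw: "u \<in> B \<rightarrow>\<^sub>E UNIV" "w \<in> B \<rightarrow>\<^sub>E UNIV" "?s u = ?s w"
    have "(\<Sum>v\<in>B. fun_scale (u v - w v) v) = ?s u - ?s w"
      by (simp add: fv.scale_left_diff_distrib sum_subtractf)
    then have z: "(\<Sum>v\<in>B. fun_scale (u v - w v) v) = 0" using uw by simp
    have "u v = w v" if "v \<in> B" for v
      using fv.independentD[OF B(2) B(1) order_refl z that] by simp
    then show "u = w" using uw by (intro PiE_ext) auto
  qed
  show "card (fv.span B) = CARD('k) ^ card B"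
    unfolding im card_image[OF inj] using B(1) by (simp add: card_PiE)
  show "finite (fv.span B)" unfolding im using B(1) by (simp add: finite_PiE)
qed

lemma card_subspace_finite_field:
  fixes W :: "('i \<Rightarrow> 'k::{field,finite}) set"
  assumes W: "fv.subspace W" and fin: "finite W"
  shows "card W = CARD('k) ^ fv.dim W"
proof -
  obtain B where B: "B \<subseteq> W" "fv.independent B" "W \<subseteq> fv.span B" "card B = fv.dim W"
    by (rule fv.basis_exists)
  have "W = fv.span B" using B W fv.span_minimal by blast
  then show ?thesis using card_span_finite_field[OF _ B(2)] B fin finite_subset by metis
qed

text \<open>A basis over the field is lifted to integral vectors. A nontrivial rational relation
  among the lifts can be made integral and primitive. Reduced to the field it is trivial, so the
  characteristic divides every coefficient, against primitivity. In characteristic 0 this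
  divisibility says that the coefficients are 0.\<close>

lemma rank_field_le_rank_rat:
  fixes W :: "('i \<Rightarrow> int) set"
  assumes I: "finite I" and W: "W \<subseteq> supported I"
  shows "fv.dim ((\<lambda>w i. of_int (w i) :: 'k::field) ` W) \<le> fv.dim ((\<lambda>w i. of_int (w i) :: rat) ` W)"
proof -
  let ?h = "\<lambda>w i. of_int (w i) :: 'k" and ?q = "\<lambda>(w::'i\<Rightarrow>int) i. of_int (w i) :: rat"
  obtain B where B: "B \<subseteq> ?h ` W" "fv.independent B" "?h ` W \<subseteq> fv.span B" "card B = fv.dim (?h ` W)"
    by (rule fv.basis_exists)
  obtain Y where Y: "Y \<subseteq> W" "inj_on ?h Y" "B = ?h ` Y" using B(1) by (meson subset_image_inj)
  have suppK: "?h ` W \<subseteq> supported I" using W by (auto simp: supported_def)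
  have suppQ: "?q ` W \<subseteq> supported I" using W by (auto simp: supported_def)
  have finB: "finite B" using independent_supported_finite[OF I _ B(2)] B(1) suppK by auto
  then have finY: "finite Y" using Y finite_imageD by blast
  have injq: "inj_on ?q Y" by (auto simp: inj_on_def fun_eq_iff)
  have indQ: "fv.independent (?q ` Y)"
  proof (rule fv.independent_if_scalars_zero)
    show "finite (?q ` Y)" using finY by simp
    fix g v assume s: "(\<Sum>x\<in>?q ` Y. fun_scale (g x) x) = 0" and v: "v \<in> ?q ` Y"
    define c where "c y = g (?q y)" for y
    have z: "(\<Sum>y\<in>Y. c y * of_int (y i)) = 0" for i
      using fun_cong[OF s, of i] by (simp add: sum_fun_apply sum.reindex[OF injq] c_def)
    \<comment> \<open>A common denominator of all coefficients.\<close>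
    define D where "D = (\<Prod>y\<in>Y. snd (quotient_of (c y)))"
    have Dpos: "D > 0" unfolding D_def by (intro prod_pos) (simp add: quotient_of_denom_pos')
    have "\<exists>z. of_int z = of_int D * c y" if y: "y \<in> Y" for y
    proof -
      obtain a b where ab: "quotient_of (c y) = (a, b)" by (cases "quotient_of (c y)") auto
      have b: "b > 0" using quotient_of_denom_pos[OF ab] .
      have "D = b * (\<Prod>x\<in>Y - {y}. snd (quotient_of (c x)))"
        unfolding D_def using finY y ab by (simp add: prod.remove)
      then have "of_int D * c y = of_int (a * (\<Prod>x\<in>Y - {y}. snd (quotient_of (c x))))"
        using quotient_of_div[OF ab] b by simp
      then show ?thesis by metis
    qed
    then obtain z' where z': "\<And>y. y \<in> Y \<Longrightarrow> of_int (z' y) = of_int D * c y" by metis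
    show "g v = 0"
    proof (rule ccontr)
      assume nz: "g v \<noteq> 0"
      obtain y0 where y0: "y0 \<in> Y" "v = ?q y0" using v by auto
      have "z' y0 \<noteq> 0"
      proof
        assume "z' y0 = 0"
        then have "of_int D * c y0 = 0" using z'[OF y0(1)] by simp
        then show False using nz Dpos y0 unfolding c_def by simp
      qed
      \<comment> \<open>Dividing by the gcd makes the integral relation primitive; \<open>d\<close>
        is nonzero because the coefficient at \<open>y0\<close> is.\<close>
      define d where "d = Gcd (z' ` Y)"
      have dn: "d \<noteq> 0" unfolding d_def using y0 \<open>z' y0 \<noteq> 0\<close> by auto
      have zsum: "(\<Sum>y\<in>Y. z' y * y i) = 0" for i
      proof -
        have "rat_of_int (\<Sum>y\<in>Y. z' y * y i) = of_int D * (\<Sum>y\<in>Y. c y * of_int (y i))"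
          using z' by (simp add: sum_distrib_left mult.assoc)
        then have "rat_of_int (\<Sum>y\<in>Y. z' y * y i) = 0" unfolding z by simp
        then show ?thesis by (simp only: of_int_eq_0_iff)
      qed
      define zz where "zz y = z' y div d" for y
      have zd: "z' y = zz y * d" if "y \<in> Y" for y unfolding zz_def d_def using that by (simp add: Gcd_dvd)
      have zzsum: "(\<Sum>y\<in>Y. zz y * y i) = 0" for i
      proof -
        have "(\<Sum>y\<in>Y. zz y * y i) * d = (\<Sum>y\<in>Y. z' y * y i)"
          using zd by (simp add: sum_distrib_left mult_ac)
        then show ?thesis using zsum dn by simp
      qed
      have "of_int (zz y) = (0::'k)" if y: "y \<in> Y" for y
      proof -
        define u where "u b = (of_int (zz (inv_into Y ?h b)) :: 'k)" for b
        have ii: "inv_into Y ?h (?h y) = y" if "y \<in> Y" for y by (rule inv_into_f_f[OF Y(2) that])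
        have "(\<Sum>b\<in>B. fun_scale (u b) b) = 0"
        proof
          fix i
          have "(\<Sum>b\<in>B. fun_scale (u b) b) i = (\<Sum>y\<in>Y. of_int (zz y) * of_int (y i))"
            unfolding Y(3) sum_fun_apply by (subst sum.reindex[OF Y(2)]) (auto simp: u_def ii intro!: sum.cong)
          also have "\<dots> = of_int (\<Sum>y\<in>Y. zz y * y i)" by simp
          finally show "(\<Sum>b\<in>B. fun_scale (u b) b) i = 0 i" using zzsum by simp
        qed
        then have "u (?h y) = 0" using fv.independentD[OF B(2) finB order_refl] Y(3) y by blast
        then show ?thesis unfolding u_def using ii[OF y] by simp
      qed
      then have "int CHAR('k) dvd zz y" if "y \<in> Y" for y using that by (simp add: of_int_eq_0_iff_char_dvd)
      then have "int CHAR('k) * d dvd z' y" if "y \<in> Y" for y using that zd by simp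
      then have "int CHAR('k) * d dvd Gcd (z' ` Y)" by (intro Gcd_greatest) auto
      then have "int CHAR('k) * d dvd d" unfolding d_def .
      then have "int CHAR('k) dvd 1" using dn by (metis dvd_times_right_cancel_iff mult_1)
      then show False by simp
    qed
  qed
  have "card B = card (?q ` Y)" using Y injq by (simp add: card_image)
  also have "\<dots> \<le> fv.dim (?q ` W)" using independent_card_le_dim[OF I suppQ _ indQ] Y by auto
  finally show ?thesis using B(4) by simp
qed

text \<open>One inequality is the preceding comparison. For the other, a nontrivial real relation
  between integral vectors is pushed to a rational one by a \<rat>-linear functional on \<real> that
  does not kill one of its coefficients.\<close>

lemma rank_rat_eq_rank_real:
  fixes W :: "('i \<Rightarrow> int) set"
  assumes I: "finite I" and W: "W \<subseteq> supported I"
  shows "fv.dim ((\<lambda>w i. of_int (w i) :: rat) ` W) = fv.dim ((\<lambda>w i. of_int (w i) :: real) ` W)"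
proof (rule antisym)
  show "fv.dim ((\<lambda>w i. of_int (w i) :: real) ` W) \<le> fv.dim ((\<lambda>w i. of_int (w i) :: rat) ` W)"
    by (rule rank_field_le_rank_rat[OF I W])
  let ?h = "\<lambda>(w::'i\<Rightarrow>int) i. of_int (w i) :: real" and ?q = "\<lambda>(w::'i\<Rightarrow>int) i. of_int (w i) :: rat"
  obtain B where B: "B \<subseteq> ?q ` W" "fv.independent B" "?q ` W \<subseteq> fv.span B" "card B = fv.dim (?q ` W)"
    by (rule fv.basis_exists)
  obtain Y where Y: "Y \<subseteq> W" "inj_on ?q Y" "B = ?q ` Y" using B(1) by (meson subset_image_inj)
  have suppK: "?h ` W \<subseteq> supported I" using W by (auto simp: supported_def)
  have suppQ: "?q ` W \<subseteq> supported I" using W by (auto simp: supported_def)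
  have finB: "finite B" using independent_supported_finite[OF I _ B(2)] B(1) suppQ by auto
  then have finY: "finite Y" using Y finite_imageD by blast
  have injh: "inj_on ?h Y" by (auto simp: inj_on_def fun_eq_iff)
  interpret RQ: vector_space_pair "\<lambda>q r. real_of_rat q * r" "(*) :: rat \<Rightarrow> rat \<Rightarrow> rat"
    by unfold_locales (auto simp: algebra_simps of_rat_add of_rat_mult)
  have indR: "fv.independent (?h ` Y)"
  proof (rule fv.independent_if_scalars_zero)
    show "finite (?h ` Y)" using finY by simp
    fix g v assume s: "(\<Sum>x\<in>?h ` Y. fun_scale (g x) x) = 0" and v: "v \<in> ?h ` Y"
    obtain y0 where y0: "y0 \<in> Y" "v = ?h y0" using v by auto
    show "g v = 0"
    proof (rule ccontr)
      assume nz: "g v \<noteq> 0"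
      \<comment> \<open>A nonzero real number is independent over \<rat>, so some \<rat>-linear
        functional maps it to 1.\<close>
      have "RQ.vs1.independent {g v}" using nz by simp
      from RQ.linear_independent_extend[OF this, of "\<lambda>_. 1"] obtain \<phi>
        where \<phi>: "Vector_Spaces.linear (\<lambda>q r. real_of_rat q * r) (*) \<phi>" "\<phi> (g v) = 1" by auto
      have z: "(\<Sum>y\<in>Y. of_rat (of_int (y i)) * g (?h y)) = 0" for i
        using fun_cong[OF s, of i] by (simp add: sum_fun_apply sum.reindex[OF injh] mult.commute)
      have "(\<Sum>y\<in>Y. of_int (y i) * \<phi> (g (?h y))) = 0" for i
      proof -
        have "\<phi> (\<Sum>y\<in>Y. of_rat (of_int (y i)) * g (?h y)) = (\<Sum>y\<in>Y. of_int (y i) * \<phi> (g (?h y)))"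
          by (simp add: RQ.linear_sum[OF \<phi>(1)] RQ.linear_scale[OF \<phi>(1)] del: of_rat_of_int_eq)
        then show ?thesis using z RQ.linear_0[OF \<phi>(1)] by simp
      qed
      note z2 = this
      define u where "u b = \<phi> (g (?h (inv_into Y ?q b)))" for b
      have ii: "inv_into Y ?q (?q y) = y" if "y \<in> Y" for y by (rule inv_into_f_f[OF Y(2) that])
      have "(\<Sum>b\<in>B. fun_scale (u b) b) = 0"
      proof
        fix i
        have "(\<Sum>b\<in>B. fun_scale (u b) b) i = (\<Sum>y\<in>Y. \<phi> (g (?h y)) * of_int (y i))"
          unfolding Y(3) sum_fun_apply by (subst sum.reindex[OF Y(2)]) (auto simp: u_def ii intro!: sum.cong)
        then show "(\<Sum>b\<in>B. fun_scale (u b) b) i = 0 i" using z2[of i] by (simp add: mult.commute)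
      qed
      then have "u (?q y0) = 0" using fv.independentD[OF B(2) finB order_refl] Y(3) y0 by blast
      then show False unfolding u_def using ii[OF y0(1)] y0 \<phi>(2) by simp
    qed
  qed
  have "card B = card (?h ` Y)" using Y injh by (simp add: card_image)
  also have "\<dots> \<le> fv.dim (?h ` W)" using independent_card_le_dim[OF I suppK _ indR] Y by auto
  finally show "fv.dim (?q ` W) \<le> fv.dim (?h ` W)" using B(4) by simp
qed

section \<open>Orthonormal bases and orthogonal complements\<close>

definition ortho_on :: "'i set \<Rightarrow> ('i \<Rightarrow> real) set \<Rightarrow> bool" where
  "ortho_on I B \<longleftrightarrow> (\<forall>b\<in>B. \<forall>c\<in>B. (\<Sum>i\<in>I. b i * c i) = (if b = c then 1 else 0))"

lemma ortho_on_independent: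
  assumes B: "finite B" "ortho_on I B"
  shows "fv.independent B"
proof (rule fv.independent_if_scalars_zero[OF B(1)])
  fix f and v :: "'a \<Rightarrow> real" assume s: "(\<Sum>x\<in>B. fun_scale (f x) x) = 0" and v: "v \<in> B"
  have "0 = (\<Sum>i\<in>I. (\<Sum>x\<in>B. fun_scale (f x) x) i * v i)" unfolding s by simp
  also have "\<dots> = (\<Sum>x\<in>B. f x * (\<Sum>i\<in>I. x i * v i))"
    by (simp add: sum_fun_apply sum_distrib_left sum_distrib_right mult.assoc) (subst sum.swap, rule refl)
  also have "\<dots> = (\<Sum>x\<in>B. f x * (if x = v then 1 else 0))" using B(2) v by (simp add: ortho_on_def)
  also have "\<dots> = f v" using v B(1) by (simp add: if_distrib cong: if_cong)
  finally show "f v = 0" by simp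
qed

text \<open>Orthonormal sets have at most card \<open>I\<close> elements, so one of maximal size
  exists in \<open>W\<close>. A vector of \<open>W\<close> outside its span would leave a nonzero
  Gram-Schmidt remainder, whose normalisation enlarges the set.\<close>

lemma ortho_basis_exists:
  fixes W :: "('i \<Rightarrow> real) set"
  assumes I: "finite I" and W: "W \<subseteq> supported I" "fv.subspace W"
  shows "\<exists>B. finite B \<and> B \<subseteq> W \<and> ortho_on I B \<and> fv.span B = W \<and> card B = fv.dim W"
proof -
  let ?P = "\<lambda>B. finite B \<and> B \<subseteq> W \<and> ortho_on I B"
  have bd: "card B \<le> card I" if "?P B" for B
    using independent_supported_finite(2)[OF I _ ortho_on_independent] that W(1) by blast
  have "\<exists>B. ?P B \<and> (\<forall>C. ?P C \<longrightarrow> card C \<le> card B)"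
  proof (rule ex_has_greatest_nat)
    show "?P {}" by (simp add: ortho_on_def)
    show "\<forall>B. ?P B \<longrightarrow> card B < Suc (card I)" using bd by (simp add: less_Suc_eq_le)
  qed
  then obtain B where B: "finite B" "B \<subseteq> W" "ortho_on I B" and mx: "\<And>C. ?P C \<Longrightarrow> card C \<le> card B" by blast
  have sub: "fv.span B \<subseteq> W" using B(2) W(2) by (rule fv.span_minimal)
  have "W \<subseteq> fv.span B"
  proof (rule ccontr)
    assume "\<not> W \<subseteq> fv.span B"
    then obtain w where w: "w \<in> W" "w \<notin> fv.span B" by auto
    define p where "p = (\<Sum>b\<in>B. fun_scale (\<Sum>i\<in>I. w i * b i) b)"
    have pB: "p \<in> fv.span B" unfolding p_def by (rule fv.span_sum, rule fv.span_scale, rule fv.span_base)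
    define v where "v = w - p"
    have vW: "v \<in> W" unfolding v_def using w(1) pB sub W(2) fv.subspace_diff by blast
    have vn: "v \<noteq> 0" using w(2) pB unfolding v_def by auto
    have perp: "(\<Sum>i\<in>I. v i * b i) = 0" if b: "b \<in> B" for b
    proof -
      have "(\<Sum>i\<in>I. p i * b i) = (\<Sum>c\<in>B. (\<Sum>i\<in>I. w i * c i) * (\<Sum>i\<in>I. c i * b i))"
        unfolding p_def
        by (simp add: sum_fun_apply sum_distrib_right sum_distrib_left mult.assoc) (subst sum.swap, rule refl)
      also have "\<dots> = (\<Sum>c\<in>B. (\<Sum>i\<in>I. w i * c i) * (if c = b then 1 else 0))"
        using B(3) b by (simp add: ortho_on_def)
      also have "\<dots> = (\<Sum>i\<in>I. w i * b i)" using b B(1) by (simp add: if_distrib cong: if_cong)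
      finally show ?thesis unfolding v_def by (simp add: algebra_simps sum_subtractf)
    qed
    define n where "n = (\<Sum>i\<in>I. (v i)\<^sup>2)"
    have npos: "n > 0"
    proof -
      obtain i where "v i \<noteq> 0" using vn by (auto simp: fun_eq_iff)
      moreover from this have "i \<in> I" using vW W(1) by (auto simp: supported_def)
      ultimately show ?thesis unfolding n_def using I by (intro sum_pos2[of _ i]) auto
    qed
    define e where "e = fun_scale (1 / sqrt n) v"
    have eW: "e \<in> W" unfolding e_def using vW W(2) fv.subspace_scale by blast
    have ee: "(\<Sum>i\<in>I. e i * e i) = 1"
    proof -
      have "(\<Sum>i\<in>I. e i * e i) = (\<Sum>i\<in>I. (v i)\<^sup>2 / n)"
        unfolding e_def using npos by (intro sum.cong) (auto simp: power2_eq_square)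
      also have "\<dots> = (\<Sum>i\<in>I. (v i)\<^sup>2) / n" by (simp add: sum_divide_distrib)
      finally show ?thesis using npos unfolding n_def[symmetric] by simp
    qed
    have eb: "(\<Sum>i\<in>I. e i * b i) = 0" if "b \<in> B" for b
      using perp[OF that] unfolding e_def by (simp add: mult.assoc flip: sum_divide_distrib)
    have eb': "(\<Sum>i\<in>I. b i * e i) = 0" if "b \<in> B" for b using eb[OF that] by (simp add: mult.commute)
    have enB: "e \<notin> B" using eb[of e] ee by auto
    have "?P (insert e B)" using B eW ee eb eb' enB by (auto simp: ortho_on_def)
    from mx[OF this] show False using enB B(1) by simp
  qed
  then have "fv.span B = W" using sub by auto
  moreover have "card B = fv.dim W"
    using fv.dim_eq_card[of B W] calculation ortho_on_independent[OF B(1,3)] fv.span_eq_iff[of W] W(2) by metis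
  ultimately show ?thesis using B by blast
qed

text \<open>Orthonormal bases of \<open>C\<close> and of its complement in \<open>Z\<close> are
  disjoint, and their union is an orthonormal basis of \<open>Z\<close>.\<close>

lemma ortho_complement_dim:
  fixes Z C :: "('i \<Rightarrow> real) set"
  assumes I: "finite I" and Z: "Z \<subseteq> supported I" "fv.subspace Z" and C: "C \<subseteq> Z" "fv.subspace C"
  shows "fv.dim {z \<in> Z. \<forall>c\<in>C. (\<Sum>i\<in>I. z i * c i) = 0} + fv.dim C = fv.dim Z"
proof -
  let ?H = "{z \<in> Z. \<forall>c\<in>C. (\<Sum>i\<in>I. z i * c i) = 0}"
  have H: "fv.subspace ?H"
    using Z(2) by (auto simp: fv.subspace_def algebra_simps sum.distrib simp flip: sum_distrib_left)
  obtain B where B: "finite B" "B \<subseteq> C" "ortho_on I B" "fv.span B = C" "card B = fv.dim C"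
    using ortho_basis_exists[OF I _ C(2)] C(1) Z(1) by blast
  obtain E where E: "finite E" "E \<subseteq> ?H" "ortho_on I E" "fv.span E = ?H" "card E = fv.dim ?H"
    using ortho_basis_exists[OF I _ H] Z(1) by blast
  have EB: "(\<Sum>i\<in>I. e i * b i) = 0" if "e \<in> E" "b \<in> B" for e b using that E(2) B(2) by auto
  have BE: "(\<Sum>i\<in>I. b i * e i) = 0" if "e \<in> E" "b \<in> B" for e b using EB[OF that] by (simp add: mult.commute)
  have disj: "E \<inter> B = {}"
  proof (rule ccontr)
    assume "E \<inter> B \<noteq> {}"
    then obtain e where e: "e \<in> E" "e \<in> B" by auto
    then show False using EB[OF e] E(3) by (auto simp: ortho_on_def)
  qed
  have o: "ortho_on I (E \<union> B)" using E(3) B(3) EB BE disj by (auto simp: ortho_on_def)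
  have "fv.dim Z = card (E \<union> B)"
  proof (rule fv.dim_unique[OF _ _ _ refl])
    show "E \<union> B \<subseteq> Z" using E(2) B(2) C(1) by auto
    show "fv.independent (E \<union> B)" using ortho_on_independent[OF _ o] E(1) B(1) by simp
    show "Z \<subseteq> fv.span (E \<union> B)"
    proof
      fix z assume z: "z \<in> Z"
      define p where "p = (\<Sum>b\<in>B. fun_scale (\<Sum>i\<in>I. z i * b i) b)"
      have pB: "p \<in> fv.span B" unfolding p_def by (rule fv.span_sum, rule fv.span_scale, rule fv.span_base)
      have pb: "(\<Sum>i\<in>I. (z - p) i * b i) = 0" if b: "b \<in> B" for b
      proof -
        have "(\<Sum>i\<in>I. p i * b i) = (\<Sum>c\<in>B. (\<Sum>i\<in>I. z i * c i) * (\<Sum>i\<in>I. c i * b i))"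
          unfolding p_def
          by (simp add: sum_fun_apply sum_distrib_right sum_distrib_left mult.assoc) (subst sum.swap, rule refl)
        also have "\<dots> = (\<Sum>c\<in>B. (\<Sum>i\<in>I. z i * c i) * (if c = b then 1 else 0))"
          using B(3) b by (simp add: ortho_on_def)
        also have "\<dots> = (\<Sum>i\<in>I. z i * b i)" using b B(1) by (simp add: if_distrib cong: if_cong)
        finally show ?thesis by (simp add: algebra_simps sum_subtractf)
      qed
      have sub: "fv.subspace {c. (\<Sum>i\<in>I. (z - p) i * c i) = 0}"
        by (auto simp: fv.subspace_def algebra_simps sum.distrib sum_subtractf simp flip: sum_distrib_left)
      have "fv.span B \<subseteq> {c. (\<Sum>i\<in>I. (z - p) i * c i) = 0}"
        by (rule fv.span_minimal[OF _ sub]) (use pb in auto)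
      moreover have "z - p \<in> Z" using z pB B(4) C(1) Z(2) fv.subspace_diff by blast
      ultimately have "z - p \<in> ?H" using B(4) by auto
      then have "z - p \<in> fv.span (E \<union> B)" using E(4) fv.span_mono[of E "E \<union> B"] by auto
      moreover have "p \<in> fv.span (E \<union> B)" using pB fv.span_mono[of B "E \<union> B"] by auto
      ultimately have "(z - p) + p \<in> fv.span (E \<union> B)" by (rule fv.span_add)
      then show "z \<in> fv.span (E \<union> B)" by simp
    qed
  qed
  then show ?thesis using card_Un_disjoint[OF E(1) B(1) disj] E(5) B(5) by simp
qed

subsection \<open>Lueck approximation\<close>

lemma summable_finite_support:
  fixes f :: "'v \<Rightarrow> real"
  assumes "finite {v \<in> V. f v \<noteq> 0}"
  shows "f summable_on V"
proof -
  have "f summable_on {v \<in> V. f v \<noteq> 0} \<longleftrightarrow> f summable_on V" by (rule summable_on_cong_neutral) auto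
  then show ?thesis using assms summable_on_finite by blast
qed

lemma infsum_finite_support:
  fixes f :: "'v \<Rightarrow> real"
  assumes "finite F" "F \<subseteq> V" "\<And>v. v \<in> V \<Longrightarrow> v \<notin> F \<Longrightarrow> f v = 0"
  shows "infsum f V = sum f F"
proof -
  have "infsum f V = infsum f F" by (rule infsum_cong_neutral) (use assms in auto)
  then show ?thesis using assms by simp
qed

lemma infsum_sum_commute:
  fixes f :: "'j \<Rightarrow> 'v \<Rightarrow> real"
  assumes "finite J" "\<And>j. j \<in> J \<Longrightarrow> f j summable_on V"
  shows "(\<lambda>v. \<Sum>j\<in>J. f j v) summable_on V" "infsum (\<lambda>v. \<Sum>j\<in>J. f j v) V = (\<Sum>j\<in>J. infsum (f j) V)"
proof -
  have "(\<lambda>v. \<Sum>j\<in>J. f j v) summable_on V \<and> infsum (\<lambda>v. \<Sum>j\<in>J. f j v) V = (\<Sum>j\<in>J. infsum (f j) V)"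
    using assms by (induction J rule: finite_induct) (auto simp: infsum_add intro!: summable_on_add)
  then show "(\<lambda>v. \<Sum>j\<in>J. f j v) summable_on V" "infsum (\<lambda>v. \<Sum>j\<in>J. f j v) V = (\<Sum>j\<in>J. infsum (f j) V)"
    by auto
qed

section \<open>Group ring matrices as operators on square-summable functions\<close>

locale right_action = group G for G (structure) +
  fixes V :: "'v set" and act :: "'v \<Rightarrow> 'a \<Rightarrow> 'v"
  assumes act_closed: "v \<in> V \<Longrightarrow> g \<in> carrier G \<Longrightarrow> act v g \<in> V"
    and act_one: "v \<in> V \<Longrightarrow> act v \<one> = v"
    and act_mult: "v \<in> V \<Longrightarrow> g \<in> carrier G \<Longrightarrow> h \<in> carrier G \<Longrightarrow> act (act v g) h = act v (g \<otimes> h)"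
begin

lemma act_inv1: "v \<in> V \<Longrightarrow> g \<in> carrier G \<Longrightarrow> act (act v g) (inv g) = v"
  by (simp add: act_mult act_one)

lemma act_inv2: "v \<in> V \<Longrightarrow> g \<in> carrier G \<Longrightarrow> act (act v (inv g)) g = v"
  by (simp add: act_mult act_one)

lemma act_bij: "g \<in> carrier G \<Longrightarrow> bij_betw (\<lambda>v. act v g) V V"
  by (rule bij_betwI[where g = "\<lambda>v. act v (inv g)"]) (auto simp: act_closed act_inv1 act_inv2)

end

text \<open>A matrix over the integral group ring with rows indexed by \<open>T\<close>, columns by \<open>Q\<close> and
  coefficients \<open>m t q a\<close> (for \<open>a\<close> in a finite set \<open>A\<close>) acts on functions on
  \<open>V \<times> T\<close> for every right \<open>G\<close>-set \<open>V\<close>.\<close>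

locale group_ring_matrix = right_action G V act for G (structure) and V :: "'v set" and act +
  fixes T :: "'t set" and Q :: "'q set" and A :: "'a set" and m :: "'t \<Rightarrow> 'q \<Rightarrow> 'a \<Rightarrow> int"
  assumes finT: "finite T" and finQ: "finite Q" and finA: "finite A" and A_sub: "A \<subseteq> carrier G"
begin

definition D :: "('v \<times> 't \<Rightarrow> real) \<Rightarrow> 'v \<times> 'q \<Rightarrow> real" where
  "D f = (\<lambda>(v, q). if v \<in> V \<and> q \<in> Q then \<Sum>t\<in>T. \<Sum>a\<in>A. real_of_int (m t q a) * f (act v a, t) else 0)"

text \<open>The formal adjoint: each translation by a group element is replaced by the translation
  by its inverse.\<close>

definition Dadj :: "('v \<times> 'q \<Rightarrow> real) \<Rightarrow> 'v \<times> 't \<Rightarrow> real" where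
  "Dadj x = (\<lambda>(v, t). if v \<in> V \<and> t \<in> T then \<Sum>q\<in>Q. \<Sum>a\<in>A. real_of_int (m t q a) * x (act v (inv a), q) else 0)"

text \<open>The inner product of l2(V \<times> Y), summed over \<open>V\<close> first. Since
  \<open>infsum\<close> returns 0 on families without a sum, additivity is stated only with finitely
  supported arguments.\<close>

definition ip :: "'y set \<Rightarrow> ('v \<times> 'y \<Rightarrow> real) \<Rightarrow> ('v \<times> 'y \<Rightarrow> real) \<Rightarrow> real" where
  "ip Y f g = (\<Sum>y\<in>Y. infsum (\<lambda>v. f (v, y) * g (v, y)) V)"

definition fs :: "'y set \<Rightarrow> ('v \<times> 'y \<Rightarrow> real) set" where
  "fs Y = {f \<in> supported (V \<times> Y). finite {i. f i \<noteq> 0}}"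

lemma fs_fst_finite: "f \<in> fs Y \<Longrightarrow> finite {v \<in> V. f (v, y) \<noteq> 0}"
  by (rule finite_subset[of _ "fst ` {i. f i \<noteq> 0}"]) (auto simp: fs_def image_iff)

lemma fs_act_finite:
  assumes f: "f \<in> fs Y" and a: "a \<in> carrier G"
  shows "finite {v \<in> V. f (act v a, y) \<noteq> 0}"
proof (rule finite_imageD)
  show "inj_on (\<lambda>v. act v a) {v \<in> V. f (act v a, y) \<noteq> 0}"
    using act_bij[OF a] by (auto simp: bij_betw_def inj_on_def)
  show "finite ((\<lambda>v. act v a) ` {v \<in> V. f (act v a, y) \<noteq> 0})"
    by (rule finite_subset[OF _ fs_fst_finite[OF f, of y]]) (use a act_closed in auto)
qed

lemma fs_summable: "f \<in> fs Y \<Longrightarrow> (\<lambda>v. f (v, y) * g (v, y)) summable_on V"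
  by (rule summable_finite_support, rule finite_subset[OF _ fs_fst_finite[of f Y y]]) auto

lemma ip_commute: "ip Y f g = ip Y g f"
  by (simp add: ip_def mult.commute)

lemma ip_add_left: "f \<in> fs Y \<Longrightarrow> f' \<in> fs Y \<Longrightarrow> ip Y (\<lambda>i. f i + f' i) g = ip Y f g + ip Y f' g"
  by (simp add: ip_def distrib_right infsum_add fs_summable sum.distrib)

lemma ip_scale_left: "ip Y (\<lambda>i. c * f i) g = c * ip Y f g"
  by (simp add: ip_def sum_distrib_left mult.assoc infsum_cmult_right')

lemma ip_scale_right: "ip Y g (\<lambda>i. c * f i) = c * ip Y g f"
  using ip_scale_left[of Y c f g] by (simp add: ip_commute[of Y g])

lemma ip_add_right: "f \<in> fs Y \<Longrightarrow> ip Y f (\<lambda>i. g i + g' i) = ip Y f g + ip Y f g'"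
  by (simp add: ip_def distrib_left infsum_add fs_summable sum.distrib)

lemma ip_diff_left:
  assumes "f \<in> fs Y" "f' \<in> fs Y"
  shows "ip Y (\<lambda>i. f i - c * f' i) g = ip Y f g - c * ip Y f' g"
proof -
  have "(\<lambda>i. -c * f' i) \<in> fs Y" using assms(2) by (auto simp: fs_def supported_def elim!: rev_finite_subset)
  from ip_add_left[OF assms(1) this] show ?thesis using ip_scale_left[of Y "-c"] by simp
qed

lemma ip_diff_right: "f \<in> fs Y \<Longrightarrow> ip Y f (\<lambda>i. g i - c * g' i) = ip Y f g - c * ip Y f g'"
  using ip_add_right[of f Y g "\<lambda>i. -c * g' i"] ip_scale_right[of Y f "-c" g'] by simp

lemma ip_nonneg: "0 \<le> ip Y f f"
  unfolding ip_def by (intro sum_nonneg infsum_nonneg) auto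

lemma ip_finite:
  assumes Y: "finite Y" and f: "f \<in> supported F" and F: "finite F" "F \<subseteq> V \<times> Y"
  shows "ip Y f g = (\<Sum>i\<in>F. f i * g i)"
proof -
  have "ip Y f g = (\<Sum>y\<in>Y. \<Sum>v\<in>fst ` F. f (v, y) * g (v, y))"
    unfolding ip_def
  proof (rule sum.cong[OF refl], rule infsum_finite_support)
    fix y v assume "y \<in> Y" "v \<in> V" "v \<notin> fst ` F"
    then have "(v, y) \<notin> F" by (auto simp: image_iff)
    then show "f (v, y) * g (v, y) = 0" using f by (auto simp: supported_def)
  qed (use F in auto)
  also have "\<dots> = (\<Sum>i\<in>fst ` F \<times> Y. f i * g i)"
    by (subst sum.swap) (simp add: sum.cartesian_product split_def)
  also have "\<dots> = (\<Sum>i\<in>F. f i * g i)"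
  proof (rule sum.mono_neutral_right)
    show "F \<subseteq> fst ` F \<times> Y" using F by (force simp: image_iff)
  qed (use F Y f in \<open>auto simp: supported_def\<close>)
  finally show ?thesis .
qed

lemma delta_fs: "i \<in> V \<times> Y \<Longrightarrow> delta i \<in> fs Y"
  by (auto simp: fs_def supported_def delta_def)

lemma ip_delta:
  assumes "finite Y" "i \<in> V \<times> Y"
  shows "ip Y (delta i) g = g i"
proof -
  have "ip Y (delta i) g = (\<Sum>j\<in>{i}. delta i j * g j)"
    by (rule ip_finite) (use assms in \<open>auto simp: supported_def delta_def\<close>)
  then show ?thesis by (simp add: delta_def)
qed

lemma D_fs:
  assumes f: "f \<in> fs T"
  shows "D f \<in> fs Q"
proof -
  have "{i. D f i \<noteq> 0} \<subseteq> (\<Union>a\<in>A. (\<lambda>(w, q). (act w (inv a), q)) ` (fst ` {i. f i \<noteq> 0} \<times> Q))"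
  proof
    fix i assume "i \<in> {i. D f i \<noteq> 0}"
    then have nz: "D f i \<noteq> 0" by simp
    obtain v q where vq: "i = (v, q)" by (cases i)
    have i: "i = (v, q)" "v \<in> V" "q \<in> Q" "(\<Sum>t\<in>T. \<Sum>a\<in>A. real_of_int (m t q a) * f (act v a, t)) \<noteq> 0"
      using nz unfolding vq D_def by (simp_all split: if_splits)
    from i(4) obtain t where t: "t \<in> T" "(\<Sum>a\<in>A. real_of_int (m t q a) * f (act v a, t)) \<noteq> 0" by (rule sum.not_neutral_contains_not_neutral)
    from t(2) obtain a where a: "a \<in> A" "real_of_int (m t q a) * f (act v a, t) \<noteq> 0" by (rule sum.not_neutral_contains_not_neutral)
    have "i = (\<lambda>(w, q). (act w (inv a), q)) (act v a, q)" using i a A_sub by (auto simp: act_inv1)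
    moreover have "act v a \<in> fst ` {i. f i \<noteq> 0}" using a(2) by (force simp: image_iff)
    ultimately show "i \<in> (\<Union>a\<in>A. (\<lambda>(w, q). (act w (inv a), q)) ` (fst ` {i. f i \<noteq> 0} \<times> Q))" using a(1) i(3) by blast
  qed
  moreover have "finite \<dots>" using f finA finQ by (auto simp: fs_def)
  ultimately have "finite {i. D f i \<noteq> 0}" by (rule finite_subset)
  then show ?thesis by (auto simp: fs_def supported_def D_def)
qed

lemma Dadj_fs:
  assumes x: "x \<in> fs Q"
  shows "Dadj x \<in> fs T"
proof -
  have "{i. Dadj x i \<noteq> 0} \<subseteq> (\<Union>a\<in>A. (\<lambda>(w, t). (act w a, t)) ` (fst ` {i. x i \<noteq> 0} \<times> T))"
  proof
    fix i assume "i \<in> {i. Dadj x i \<noteq> 0}"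
    then have nz: "Dadj x i \<noteq> 0" by simp
    obtain v t where vt: "i = (v, t)" by (cases i)
    have i: "i = (v, t)" "v \<in> V" "t \<in> T" "(\<Sum>q\<in>Q. \<Sum>a\<in>A. real_of_int (m t q a) * x (act v (inv a), q)) \<noteq> 0"
      using nz unfolding vt Dadj_def by (simp_all split: if_splits)
    from i(4) obtain q where t: "q \<in> Q" "(\<Sum>a\<in>A. real_of_int (m t q a) * x (act v (inv a), q)) \<noteq> 0" by (rule sum.not_neutral_contains_not_neutral)
    from t(2) obtain a where a: "a \<in> A" "real_of_int (m t q a) * x (act v (inv a), q) \<noteq> 0" by (rule sum.not_neutral_contains_not_neutral)
    have "i = (\<lambda>(w, q). (act w a, q)) (act v (inv a), t)" using i a A_sub by (auto simp: act_inv2)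
    moreover have "act v (inv a) \<in> fst ` {i. x i \<noteq> 0}" using a(2) by (force simp: image_iff)
    ultimately show "i \<in> (\<Union>a\<in>A. (\<lambda>(w, t). (act w a, t)) ` (fst ` {i. x i \<noteq> 0} \<times> T))" using a(1) i(3) by blast
  qed
  moreover have "finite \<dots>" using x finA finT by (auto simp: fs_def)
  ultimately have "finite {i. Dadj x i \<noteq> 0}" by (rule finite_subset)
  then show ?thesis by (auto simp: fs_def supported_def Dadj_def)
qed

text \<open>Each translate is moved to the other side by the substitution w = v a. Finite support of
  one argument is enough, so a harmonic function spread over the whole group may be the
  other.\<close>

lemma D_adjoint:
  assumes fx: "f \<in> fs T \<or> x \<in> fs Q"
  shows "ip Q (D f) x = ip T f (Dadj x)"
proof -
  define J where "J t q a = infsum (\<lambda>v. f (act v a, t) * x (v, q)) V" for t q a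
  have s1: "(\<lambda>v. f (act v a, t) * x (v, q)) summable_on V" if "a \<in> A" for t q a
  proof (rule summable_finite_support)
    show "finite {v \<in> V. f (act v a, t) * x (v, q) \<noteq> 0}"
      using fx
    proof
      assume "f \<in> fs T"
      then show ?thesis using fs_act_finite[of f T a t] that A_sub by (auto elim!: rev_finite_subset)
    next
      assume "x \<in> fs Q"
      then show ?thesis using fs_fst_finite[of x Q q] by (auto elim!: rev_finite_subset)
    qed
  qed
  have J2: "infsum (\<lambda>w. f (w, t) * x (act w (inv a), q)) V = J t q a"
    and s2: "(\<lambda>w. f (w, t) * x (act w (inv a), q)) summable_on V" if "a \<in> A" for t q a
  proof -
    have a: "a \<in> carrier G" using that A_sub by auto
    have c: "f (act v a, t) * x (v, q) = f (act v a, t) * x (act (act v a) (inv a), q)" if "v \<in> V" for v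
      using act_inv1[OF that a] by simp
    have "J t q a = infsum (\<lambda>v. f (act v a, t) * x (act (act v a) (inv a), q)) V"
      unfolding J_def by (rule infsum_cong) (use c in auto)
    also have "\<dots> = infsum (\<lambda>w. f (w, t) * x (act w (inv a), q)) V"
      by (rule infsum_reindex_bij_betw[OF act_bij[OF a]])
    finally show "infsum (\<lambda>w. f (w, t) * x (act w (inv a), q)) V = J t q a" by simp
    have "(\<lambda>v. f (act v a, t) * x (act (act v a) (inv a), q)) summable_on V"
      using s1[OF that, of t q] by (subst summable_on_cong[OF c[symmetric]]) auto
    then show "(\<lambda>w. f (w, t) * x (act w (inv a), q)) summable_on V"
      using summable_on_reindex_bij_betw[OF act_bij[OF a], of "\<lambda>w. f (w, t) * x (act w (inv a), q)"] by simp
  qed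
  have "ip Q (D f) x = (\<Sum>q\<in>Q. infsum (\<lambda>v. \<Sum>t\<in>T. \<Sum>a\<in>A. real_of_int (m t q a) * (f (act v a, t) * x (v, q))) V)"
    unfolding ip_def D_def by (intro sum.cong infsum_cong) (auto simp: sum_distrib_right mult.assoc)
  also have "\<dots> = (\<Sum>q\<in>Q. \<Sum>t\<in>T. \<Sum>a\<in>A. real_of_int (m t q a) * J t q a)"
    unfolding J_def using s1 finA finT
    by (intro sum.cong refl) (simp add: infsum_sum_commute summable_on_cmult_right infsum_cmult_right')
  also have "\<dots> = (\<Sum>t\<in>T. \<Sum>q\<in>Q. \<Sum>a\<in>A. real_of_int (m t q a) * J t q a)" by (rule sum.swap)
  also have "\<dots> = (\<Sum>t\<in>T. infsum (\<lambda>w. \<Sum>q\<in>Q. \<Sum>a\<in>A. real_of_int (m t q a) * (f (w, t) * x (act w (inv a), q))) V)"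
    using s2 J2 finA finQ
    by (intro sum.cong refl) (simp add: infsum_sum_commute summable_on_cmult_right infsum_cmult_right')
  also have "\<dots> = ip T f (Dadj x)"
    unfolding ip_def Dadj_def by (intro sum.cong infsum_cong) (auto simp: sum_distrib_left mult_ac)
  finally show ?thesis .
qed

text \<open>The squared operator norm bound that Cauchy-Schwarz gives over the terms indexed by
  \<open>T\<close> and \<open>A\<close>, plus 1 so that division by \<open>K\<close> is safe and ln
  K is nonnegative. Neither \<open>V\<close> nor the action enters, so one constant serves \<Gamma>
  and all its quotients.\<close>

definition K :: real where
  "K = 1 + real (card T) * real (card A) * (\<Sum>q\<in>Q. \<Sum>t\<in>T. \<Sum>a\<in>A. (real_of_int (m t q a))\<^sup>2)"

lemma K_ge_1: "K \<ge> 1"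
  unfolding K_def by (simp add: sum_nonneg)

text \<open>Pointwise, Cauchy-Schwarz bounds the square of the sum by the number of terms times the
  sum of the squares; translating by a group element does not change the norm of
  \<open>f\<close>.\<close>

lemma D_bound:
  assumes f: "f \<in> fs T"
  shows "ip Q (D f) (D f) \<le> K * ip T f f"
proof -
  define n where "n t = infsum (\<lambda>v. (f (v, t))\<^sup>2) V" for t
  have nn: "0 \<le> n t" for t unfolding n_def by (rule infsum_nonneg) auto
  have ipn: "ip T f f = (\<Sum>t\<in>T. n t)" by (simp add: ip_def n_def power2_eq_square)
  have s: "(\<lambda>v. (f (act v a, t))\<^sup>2) summable_on V" and na: "infsum (\<lambda>v. (f (act v a, t))\<^sup>2) V = n t" if "a \<in> A" for a t
  proof -
    have a: "a \<in> carrier G" using that A_sub by auto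
    show "(\<lambda>v. (f (act v a, t))\<^sup>2) summable_on V"
      by (rule summable_finite_support) (use fs_act_finite[OF f a, of t] in auto)
    show "infsum (\<lambda>v. (f (act v a, t))\<^sup>2) V = n t"
      unfolding n_def by (rule infsum_reindex_bij_betw[OF act_bij[OF a]])
  qed
  let ?c = "real (card T) * real (card A)"
  have pt: "(D f (v, q))\<^sup>2 \<le> ?c * (\<Sum>t\<in>T. \<Sum>a\<in>A. (real_of_int (m t q a))\<^sup>2 * (f (act v a, t))\<^sup>2)" if "v \<in> V" "q \<in> Q" for v q
  proof -
    have "(D f (v, q))\<^sup>2 = (\<Sum>(t, a)\<in>T \<times> A. real_of_int (m t q a) * f (act v a, t))\<^sup>2"
      using that by (simp add: D_def sum.cartesian_product)
    also have "\<dots> \<le> (\<Sum>(t, a)\<in>T \<times> A. (real_of_int (m t q a) * f (act v a, t))\<^sup>2) * (\<Sum>(t, a)\<in>T \<times> A. 1\<^sup>2)"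
      using Cauchy_Schwarz_ineq_sum[of "\<lambda>(t, a). real_of_int (m t q a) * f (act v a, t)" "\<lambda>_. 1" "T \<times> A"]
      by (simp add: split_def)
    also have "\<dots> = ?c * (\<Sum>t\<in>T. \<Sum>a\<in>A. (real_of_int (m t q a))\<^sup>2 * (f (act v a, t))\<^sup>2)"
      by (simp add: sum.cartesian_product power_mult_distrib card_cartesian_product)
    finally show ?thesis .
  qed
  have "ip Q (D f) (D f) = (\<Sum>q\<in>Q. infsum (\<lambda>v. (D f (v, q))\<^sup>2) V)" by (simp add: ip_def power2_eq_square)
  also have "\<dots> \<le> (\<Sum>q\<in>Q. infsum (\<lambda>v. ?c * (\<Sum>t\<in>T. \<Sum>a\<in>A. (real_of_int (m t q a))\<^sup>2 * (f (act v a, t))\<^sup>2)) V)"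
  proof (rule sum_mono)
    fix q assume q: "q \<in> Q"
    show "infsum (\<lambda>v. (D f (v, q))\<^sup>2) V \<le> infsum (\<lambda>v. ?c * (\<Sum>t\<in>T. \<Sum>a\<in>A. (real_of_int (m t q a))\<^sup>2 * (f (act v a, t))\<^sup>2)) V"
    proof (rule infsum_mono)
      show "(\<lambda>v. (D f (v, q))\<^sup>2) summable_on V"
        using fs_summable[OF D_fs[OF f], of q "D f"] by (simp add: power2_eq_square)
      show "(\<lambda>v. ?c * (\<Sum>t\<in>T. \<Sum>a\<in>A. (real_of_int (m t q a))\<^sup>2 * (f (act v a, t))\<^sup>2)) summable_on V"
        using s finA finT by (intro summable_on_cmult_right infsum_sum_commute(1)) auto
    qed (use pt q in auto)
  qed
  also have "\<dots> = ?c * (\<Sum>q\<in>Q. \<Sum>t\<in>T. \<Sum>a\<in>A. (real_of_int (m t q a))\<^sup>2 * n t)"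
    using s na finA finT
    by (simp add: infsum_sum_commute summable_on_cmult_right infsum_cmult_right' sum_distrib_left)
  also have "\<dots> \<le> ?c * (\<Sum>q\<in>Q. \<Sum>t\<in>T. \<Sum>a\<in>A. (real_of_int (m t q a))\<^sup>2 * ip T f f)"
  proof -
    have "n t \<le> ip T f f" if "t \<in> T" for t unfolding ipn using nn finT that by (intro member_le_sum) auto
    then show ?thesis by (intro mult_left_mono sum_mono) auto
  qed
  also have "\<dots> = (K - 1) * ip T f f" unfolding K_def by (simp add: sum_distrib_right mult.assoc)
  also have "\<dots> \<le> K * ip T f f" using ip_nonneg by (intro mult_right_mono) auto
  finally show ?thesis .
qed

text \<open>A self-adjoint contraction that fixes every function killed by \<open>D\<close>.
  Diagonal entries of its powers are moments of the spectral measure of \<open>Dadj\<close> composed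
  with \<open>D\<close>, after rescaling the spectrum to [0, 1] and reversing it.\<close>

definition Aop :: "('v \<times> 't \<Rightarrow> real) \<Rightarrow> 'v \<times> 't \<Rightarrow> real" where
  "Aop f = (\<lambda>i. f i - (1 / K) * Dadj (D f) i)"

lemma Aop_fs: "f \<in> fs T \<Longrightarrow> Aop f \<in> fs T"
proof -
  assume f: "f \<in> fs T"
  have g: "Dadj (D f) \<in> fs T" using f D_fs Dadj_fs by auto
  have "{i. Aop f i \<noteq> 0} \<subseteq> {i. f i \<noteq> 0} \<union> {i. Dadj (D f) i \<noteq> 0}" by (auto simp: Aop_def)
  then have "finite {i. Aop f i \<noteq> 0}" using f g by (auto simp: fs_def intro: finite_subset)
  then show ?thesis using f g by (auto simp: fs_def supported_def Aop_def)
qed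

lemma Aop_pow_fs: "f \<in> fs T \<Longrightarrow> (Aop ^^ k) f \<in> fs T"
  by (induction k) (auto simp: Aop_fs)

lemma Aop_sym: "f \<in> fs T \<Longrightarrow> ip T (Aop f) g = ip T f (Aop g)"
proof -
  assume f: "f \<in> fs T"
  have "ip T (Aop f) g = ip T f g - (1 / K) * ip T (Dadj (D f)) g"
    unfolding Aop_def using f D_fs Dadj_fs by (intro ip_diff_left) auto
  also have "ip T (Dadj (D f)) g = ip Q (D g) (D f)"
    using D_adjoint[of g "D f"] D_fs[OF f] ip_commute by metis
  also have "\<dots> = ip T f (Dadj (D g))"
    using D_adjoint[of f "D g"] f ip_commute by metis
  also have "ip T f g - (1 / K) * ip T f (Dadj (D g)) = ip T f (Aop g)"
    unfolding Aop_def using f by (intro ip_diff_right[symmetric])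
  finally show ?thesis .
qed

lemma Aop_pow_sym: "f \<in> fs T \<Longrightarrow> ip T ((Aop ^^ k) f) g = ip T f ((Aop ^^ k) g)"
proof (induction k arbitrary: g)
  case (Suc k)
  have "ip T ((Aop ^^ Suc k) f) g = ip T ((Aop ^^ k) f) (Aop g)"
    using Aop_sym[OF Aop_pow_fs[OF Suc.prems]] by simp
  also have "\<dots> = ip T f ((Aop ^^ k) (Aop g))" using Suc by auto
  finally show ?case by (simp add: funpow_swap1)
qed simp

text \<open>From \<open>\<parallel>D* y\<parallel>\<^sup>2 \<le> K \<parallel>y\<parallel>\<^sup>2\<close> the operator \<open>Aop = 1 - D* D / K\<close>
  is a contraction whose defect controls \<open>D f\<close>.\<close>

lemma Aop_contract:
  assumes f: "f \<in> fs T"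
  shows "ip T (Aop f) (Aop f) \<le> ip T f f - (1 / K) * ip Q (D f) (D f)"
proof -
  let ?g = "Dadj (D f)"
  have g: "?g \<in> fs T" and Df: "D f \<in> fs Q" using f D_fs Dadj_fs by auto
  define x where "x = ip Q (D f) (D f)"
  define y where "y = ip T ?g ?g"
  have K: "K > 0" using K_ge_1 by simp
  have fg: "ip T f ?g = x" using D_adjoint[of f "D f"] f by (simp add: x_def)
  have yx: "y = ip Q (D ?g) (D f)" using D_adjoint[of ?g "D f"] g by (simp add: y_def)
  have y0: "0 \<le> y" and x0: "0 \<le> x" unfolding y_def x_def by (rule ip_nonneg)+
  \<comment> \<open>Only \<open>D\<close> has been bounded so far. Expanding this square and
    inserting \<open>D_bound\<close> for \<open>?g\<close> yields the bound
    \<parallel>\<open>Dadj\<close> (D f)\<parallel>^2 \<le> K \<parallel>D f\<parallel>^2 for the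
    adjoint.\<close>
  have "0 \<le> ip Q (\<lambda>i. D ?g i - K * D f i) (\<lambda>i. D ?g i - K * D f i)" by (rule ip_nonneg)
  also have "\<dots> = ip Q (D ?g) (\<lambda>i. D ?g i - K * D f i) - K * ip Q (D f) (\<lambda>i. D ?g i - K * D f i)"
    using D_fs[OF g] Df by (intro ip_diff_left)
  also have "\<dots> = ip Q (D ?g) (D ?g) - K * y - K * (y - K * x)"
    using ip_diff_right[OF D_fs[OF g]] ip_diff_right[OF Df] yx ip_commute[of Q "D f" "D ?g"] by (simp add: x_def)
  also have "ip Q (D ?g) (D ?g) \<le> K * y" using D_bound[OF g] by (simp add: y_def)
  finally have "K * y \<le> K * (K * x)" by (simp add: algebra_simps)
  then have yKx: "y \<le> K * x" using K by simp
  have "ip T (Aop f) (Aop f) = ip T f (Aop f) - (1 / K) * ip T ?g (Aop f)"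
    unfolding Aop_def[of f] using f g by (intro ip_diff_left)
  also have "ip T f (Aop f) = ip T f f - (1 / K) * x"
    unfolding Aop_def using ip_diff_right[OF f, of f "1 / K" ?g] fg by simp
  also have "ip T ?g (Aop f) = x - (1 / K) * y"
    unfolding Aop_def using ip_diff_right[OF g, of f "1 / K" ?g] fg ip_commute[of T f ?g] by (simp add: y_def)
  finally have "ip T (Aop f) (Aop f) = ip T f f - (1 / K) * x - (1 / K) * (x - (1 / K) * y)" .
  moreover have "(1 / K) * (x - (1 / K) * y) \<ge> 0"
    using yKx K by (simp add: field_simps)
  ultimately show ?thesis unfolding x_def by linarith
qed

lemma sum_sq_le_ip:
  assumes f: "f \<in> fs Y" and Y: "finite Y" and F: "finite F"
  shows "(\<Sum>i\<in>F. (f i)\<^sup>2) \<le> ip Y f f"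
proof -
  let ?S = "{i. f i \<noteq> 0}"
  have S: "finite ?S" "?S \<subseteq> V \<times> Y" "f \<in> supported ?S" using f by (auto simp: fs_def supported_def)
  have "(\<Sum>i\<in>F. (f i)\<^sup>2) \<le> (\<Sum>i\<in>F \<union> ?S. (f i)\<^sup>2)" using F S by (intro sum_mono2) auto
  also have "\<dots> = (\<Sum>i\<in>?S. (f i)\<^sup>2)" using F S by (intro sum.mono_neutral_right) auto
  also have "\<dots> = ip Y f f" using ip_finite[OF Y S(3,1,2), of f] by (simp add: power2_eq_square)
  finally show ?thesis .
qed

text \<open>The numbers \<open>a j\<close>, the squared norms of the iterates of
  \<open>delta i\<close>, decrease and so converge. This makes the even iterates pointwise Cauchy.
  Their limit is the projection of \<open>delta i\<close> to the harmonic functions: the drop from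
  \<open>a j\<close> to its successor bounds the norm of \<open>D (x j)\<close>, so \<open>D\<close>
  kills the limit, and \<open>f i\<close> is the limit of the \<open>a j\<close>.\<close>

lemma Aop_limit:
  assumes i: "i \<in> V \<times> T"
  shows "\<exists>f \<in> supported (V \<times> T). (\<forall>y. (\<lambda>n. (Aop ^^ (2 * n)) (delta i) y) \<longlonglongrightarrow> f y)
    \<and> D f = (\<lambda>_. 0) \<and> (\<forall>F. finite F \<longrightarrow> (\<Sum>y\<in>F. (f y)\<^sup>2) \<le> f i)"
proof -
  define x where "x j = (Aop ^^ j) (delta i)" for j
  define a where "a j = ip T (x j) (x j)" for j
  have xfs: "x j \<in> fs T" for j unfolding x_def using delta_fs[OF i] by (rule Aop_pow_fs)
  have xx: "ip T (x j) (x k) = x (j + k) i" for j k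
  proof -
    have "ip T (x j) (x k) = ip T (delta i) ((Aop ^^ j) (x k))"
      unfolding x_def[of j] using delta_fs[OF i] by (rule Aop_pow_sym)
    also have "\<dots> = x (j + k) i" using ip_delta[OF finT i] by (simp add: x_def funpow_add)
    finally show ?thesis .
  qed
  have a2: "a j = x (2 * j) i" for j unfolding a_def xx by (simp add: mult_2)
  have step: "a (Suc j) \<le> a j - (1 / K) * ip Q (D (x j)) (D (x j))" for j
    using Aop_contract[OF xfs[of j]] by (simp add: a_def x_def)
  have K: "K > 0" using K_ge_1 by simp
  have "a (Suc j) \<le> a j" for j
    using step[of j] ip_nonneg[of Q "D (x j)"] K by (smt (verit) divide_nonneg_pos mult_nonneg_nonneg zero_le_one)
  then have dec: "decseq a" by (rule decseq_SucI)
  have a0: "0 \<le> a j" for j unfolding a_def by (rule ip_nonneg)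
  obtain \<alpha> where \<alpha>: "a \<longlonglongrightarrow> \<alpha>"
    using decseq_convergent[OF dec, of 0] a0 by metis
  \<comment> \<open>Even indices make the cross term equal to \<open>a (k + l)\<close>, so all three
    terms on the right tend to the same limit.\<close>
  have diff: "(x (2 * k) y - x (2 * l) y)\<^sup>2 \<le> a (2 * k) + a (2 * l) - 2 * a (k + l)" for k l y
  proof -
    let ?d = "\<lambda>i. x (2 * k) i - 1 * x (2 * l) i"
    have dfs: "?d \<in> fs T"
    proof -
      have "{i. ?d i \<noteq> 0} \<subseteq> {i. x (2 * k) i \<noteq> 0} \<union> {i. x (2 * l) i \<noteq> 0}" by auto
      then have "finite {i. ?d i \<noteq> 0}" using xfs[of "2 * k"] xfs[of "2 * l"] by (auto simp: fs_def intro: finite_subset)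
      then show ?thesis using xfs[of "2 * k"] xfs[of "2 * l"] by (auto simp: fs_def supported_def)
    qed
    have "(x (2 * k) y - x (2 * l) y)\<^sup>2 \<le> ip T ?d ?d" using sum_sq_le_ip[OF dfs finT, of "{y}"] by simp
    also have "\<dots> = ip T (x (2 * k)) ?d - 1 * ip T (x (2 * l)) ?d" by (rule ip_diff_left[OF xfs xfs])
    also have "\<dots> = (a (2 * k) - x (2 * k + 2 * l) i) - (x (2 * l + 2 * k) i - a (2 * l))"
      using ip_diff_right[OF xfs, of "2 * k" "x (2 * k)" 1 "x (2 * l)"] ip_diff_right[OF xfs, of "2 * l" "x (2 * k)" 1 "x (2 * l)"]
      by (simp add: a_def xx)
    finally show ?thesis unfolding a2[of "k + l"] by (simp add: algebra_simps)
  qed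
  have conv: "convergent (\<lambda>n. x (2 * n) y)" for y
  proof (rule Cauchy_convergent, rule metric_CauchyI)
    fix e :: real assume e: "e > 0"
    then have e2: "e\<^sup>2 / 4 > 0" by simp
    obtain M where M: "\<And>n. n \<ge> M \<Longrightarrow> \<bar>a n - \<alpha>\<bar> < e\<^sup>2 / 4"
      using LIMSEQ_D[OF \<alpha> e2] by auto
    show "\<exists>M. \<forall>k\<ge>M. \<forall>l\<ge>M. dist (x (2 * k) y) (x (2 * l) y) < e"
    proof (intro exI allI impI)
      fix k l assume kl: "k \<ge> M" "l \<ge> M"
      have "\<bar>a (2 * k) - \<alpha>\<bar> < e\<^sup>2 / 4" "\<bar>a (2 * l) - \<alpha>\<bar> < e\<^sup>2 / 4" "\<bar>a (k + l) - \<alpha>\<bar> < e\<^sup>2 / 4"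
        using M[of "2 * k"] M[of "2 * l"] M[of "k + l"] kl by linarith+
      then have "(x (2 * k) y - x (2 * l) y)\<^sup>2 < e\<^sup>2"
        using diff[of k y l] unfolding abs_less_iff by linarith
      then have "\<bar>x (2 * k) y - x (2 * l) y\<bar>\<^sup>2 < e\<^sup>2" by simp
      then show "dist (x (2 * k) y) (x (2 * l) y) < e"
        unfolding dist_real_def by (rule power2_less_imp_less) (use e in simp)
    qed
  qed
  define f where "f y = lim (\<lambda>n. x (2 * n) y)" for y
  have lim: "(\<lambda>n. x (2 * n) y) \<longlonglongrightarrow> f y" for y
    unfolding f_def using conv by (simp add: convergent_LIMSEQ_iff)
  have fi: "f i = \<alpha>" using LIMSEQ_unique[OF lim[of i]] \<alpha> unfolding a2[abs_def] by blast
  have fsup: "f \<in> supported (V \<times> T)"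
  proof -
    have "f y = 0" if "y \<notin> V \<times> T" for y
    proof -
      have "x (2 * n) y = 0" for n using xfs[of "2 * n"] that unfolding fs_def supported_def by blast
      then have "(\<lambda>n. x (2 * n) y) \<longlonglongrightarrow> 0" by simp
      then show ?thesis using lim[of y] LIMSEQ_unique by blast
    qed
    then show ?thesis by (simp add: supported_def)
  qed
  have Df: "D f (v, q) = 0" for v q
  proof (cases "v \<in> V \<and> q \<in> Q")
    case True
    have l1: "(\<lambda>n. D (x (2 * n)) (v, q)) \<longlonglongrightarrow> D f (v, q)"
      using True lim unfolding D_def by (auto intro!: tendsto_intros)
    have "(\<lambda>n. K * (a (2 * n) - a (Suc (2 * n)))) \<longlonglongrightarrow> K * (\<alpha> - \<alpha>)"
    proof (intro tendsto_intros)
      have "strict_mono (\<lambda>n::nat. 2 * n)" "strict_mono (\<lambda>n::nat. Suc (2 * n))" by (auto simp: strict_mono_def)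
      then show "(\<lambda>n. a (2 * n)) \<longlonglongrightarrow> \<alpha>" "(\<lambda>n. a (Suc (2 * n))) \<longlonglongrightarrow> \<alpha>"
        using LIMSEQ_subseq_LIMSEQ[OF \<alpha>] by (auto simp: comp_def)
    qed
    then have u: "(\<lambda>n. K * (a (2 * n) - a (Suc (2 * n)))) \<longlonglongrightarrow> 0" by simp
    have "(\<lambda>n. (D (x (2 * n)) (v, q))\<^sup>2) \<longlonglongrightarrow> 0"
    proof (rule tendsto_sandwich[OF _ _ tendsto_const u])
      show "\<forall>\<^sub>F n in sequentially. (D (x (2 * n)) (v, q))\<^sup>2 \<le> K * (a (2 * n) - a (Suc (2 * n)))"
      proof (rule always_eventually, rule allI)
        fix n
        have "(D (x (2 * n)) (v, q))\<^sup>2 \<le> ip Q (D (x (2 * n))) (D (x (2 * n)))"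
          using sum_sq_le_ip[OF D_fs[OF xfs] finQ, of "{(v, q)}"] by simp
        also have "\<dots> \<le> K * (a (2 * n) - a (Suc (2 * n)))"
          using step[of "2 * n"] K by (simp add: field_simps)
        finally show "(D (x (2 * n)) (v, q))\<^sup>2 \<le> K * (a (2 * n) - a (Suc (2 * n)))" .
      qed
    qed simp
    moreover have "(\<lambda>n. (D (x (2 * n)) (v, q))\<^sup>2) \<longlonglongrightarrow> (D f (v, q))\<^sup>2" using l1 by (intro tendsto_intros)
    ultimately have "(D f (v, q))\<^sup>2 = 0" using LIMSEQ_unique by blast
    then show ?thesis by simp
  qed (auto simp: D_def)
  have sq: "(\<Sum>y\<in>F. (f y)\<^sup>2) \<le> f i" if F: "finite F" for F
  proof (rule LIMSEQ_le)
    show "(\<lambda>n. \<Sum>y\<in>F. (x (2 * n) y)\<^sup>2) \<longlonglongrightarrow> (\<Sum>y\<in>F. (f y)\<^sup>2)" using lim by (intro tendsto_intros)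
    have "strict_mono (\<lambda>n::nat. 2 * n)" by (auto simp: strict_mono_def)
    then show "(\<lambda>n. a (2 * n)) \<longlonglongrightarrow> f i" using LIMSEQ_subseq_LIMSEQ[OF \<alpha>] fi by (auto simp: comp_def)
    show "\<exists>N. \<forall>n\<ge>N. (\<Sum>y\<in>F. (x (2 * n) y)\<^sup>2) \<le> a (2 * n)"
      using sum_sq_le_ip[OF xfs finT F] by (auto simp: a_def)
  qed
  show ?thesis
    using fsup lim Df sq unfolding x_def by (intro bexI[of _ f]) auto
qed

lemma Aop_pow_harmonic:
  assumes "D h = (\<lambda>_. 0)"
  shows "(Aop ^^ k) h = h"
proof (induction k)
  case (Suc k)
  have "Dadj (\<lambda>_. 0) = (\<lambda>_. 0)" by (auto simp: Dadj_def)
  then have "Aop h = h" by (simp add: Aop_def assms)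
  then show ?case using Suc by simp
qed simp

text \<open>Moving the symmetric operator onto \<open>h\<close>, which it fixes, leaves evaluation
  at \<open>i\<close>. This is how an infinitely supported \<open>h\<close> is tested against
  finitely supported iterates.\<close>

lemma harmonic_eval:
  assumes "D h = (\<lambda>_. 0)" "i \<in> V \<times> T"
  shows "ip T ((Aop ^^ k) (delta i)) h = h i"
  using Aop_pow_sym[OF delta_fs[OF assms(2)], of k h] Aop_pow_harmonic[OF assms(1)] ip_delta[OF finT assms(2)] by simp

definition l2harm :: "('v \<times> 't \<Rightarrow> real) set" where
  "l2harm = {h \<in> supported (V \<times> T). (\<lambda>i. (h i)\<^sup>2) summable_on UNIV \<and> D h = (\<lambda>_. 0)}"

text \<open>The supremum of h(i) over the unit ball of harmonic functions is the norm of the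
  projection of \<open>delta i\<close>. With \<alpha> the limit of the diagonal entries,
  Cauchy-Schwarz against the iterates bounds h(i) by the square root of \<alpha>, and the limit
  function of \<open>Aop_limit\<close>, normalised, attains this value.\<close>

lemma l2harm_sup_limit:
  assumes i: "i \<in> V \<times> T"
  shows "(\<lambda>n. (Aop ^^ (2 * n)) (delta i) i)
    \<longlonglongrightarrow> (SUP h \<in> {h \<in> l2harm. sqrt (infsum (\<lambda>a. (h a)\<^sup>2) UNIV) \<le> 1}. h i)\<^sup>2"
proof -
  obtain f where f: "f \<in> supported (V \<times> T)" "\<And>y. (\<lambda>n. (Aop ^^ (2 * n)) (delta i) y) \<longlonglongrightarrow> f y"
    "D f = (\<lambda>_. 0)" "\<And>F. finite F \<Longrightarrow> (\<Sum>y\<in>F. (f y)\<^sup>2) \<le> f i"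
    using Aop_limit[OF i] by blast
  let ?H = "{h \<in> l2harm. sqrt (infsum (\<lambda>a. (h a)\<^sup>2) UNIV) \<le> 1}"
  define \<alpha> where "\<alpha> = f i"
  have \<alpha>0: "0 \<le> \<alpha>" using f(4)[of "{}"] by (simp add: \<alpha>_def)
  have up: "h i \<le> sqrt \<alpha>" if h: "h \<in> ?H" for h
  proof -
    have hs: "(\<lambda>i. (h i)\<^sup>2) summable_on UNIV" "D h = (\<lambda>_. 0)" "h \<in> supported (V \<times> T)" using h by (auto simp: l2harm_def)
    have h1: "(\<Sum>y\<in>F. (h y)\<^sup>2) \<le> 1" if "finite F" for F
    proof -
      have "(\<Sum>y\<in>F. (h y)\<^sup>2) \<le> infsum (\<lambda>a. (h a)\<^sup>2) UNIV"
        using finite_sum_le_infsum[OF hs(1) that] by simp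
      also have "\<dots> \<le> 1" using h by simp
      finally show ?thesis .
    qed
    \<comment> \<open>Evaluation at \<open>i\<close> is pairing with the n-th iterate, whose squared
      norm is the diagonal entry of the power 2n.\<close>
    have fin: "(h i)\<^sup>2 \<le> (Aop ^^ (2 * n)) (delta i) i" for n
    proof -
      let ?x = "(Aop ^^ n) (delta i)"
      let ?S = "{y. ?x y \<noteq> 0}"
      have xfs: "?x \<in> fs T" using delta_fs[OF i] by (rule Aop_pow_fs)
      have S: "finite ?S" "?S \<subseteq> V \<times> T" "?x \<in> supported ?S" using xfs by (auto simp: fs_def supported_def)
      have "(h i)\<^sup>2 = (\<Sum>y\<in>?S. ?x y * h y)\<^sup>2"
        using harmonic_eval[OF hs(2) i, of n] ip_finite[OF finT S(3,1,2), of h] by simp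
      also have "\<dots> \<le> (\<Sum>y\<in>?S. (?x y)\<^sup>2) * (\<Sum>y\<in>?S. (h y)\<^sup>2)" by (rule Cauchy_Schwarz_ineq_sum)
      also have "\<dots> \<le> (\<Sum>y\<in>?S. (?x y)\<^sup>2) * 1" using h1[OF S(1)] by (intro mult_left_mono sum_nonneg) auto
      also have "(\<Sum>y\<in>?S. (?x y)\<^sup>2) = ip T ?x ?x"
        using ip_finite[OF finT S(3,1,2), of ?x] by (simp add: power2_eq_square)
      also have "\<dots> = ip T (delta i) ((Aop ^^ n) ?x)" using delta_fs[OF i] by (rule Aop_pow_sym)
      also have "\<dots> = (Aop ^^ (2 * n)) (delta i) i" using ip_delta[OF finT i] by (simp add: mult_2 funpow_add)
      finally show ?thesis by simp
    qed
    have "(h i)\<^sup>2 \<le> \<alpha>" unfolding \<alpha>_def using LIMSEQ_le_const[OF f(2)[of i]] fin by blast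
    then show ?thesis by (rule real_le_rsqrt)
  qed
  have zero: "(\<lambda>_. 0) \<in> ?H" by (auto simp: l2harm_def supported_def D_def)
  have "(SUP h\<in>?H. h i) = sqrt \<alpha>"
  proof (rule antisym)
    show "(SUP h\<in>?H. h i) \<le> sqrt \<alpha>" using up zero by (intro cSUP_least) auto
    have bdd: "bdd_above ((\<lambda>h. h i) ` ?H)" using up by (auto simp: bdd_above_def)
    show "sqrt \<alpha> \<le> (SUP h\<in>?H. h i)"
    proof (cases "\<alpha> = 0")
      case True
      then show ?thesis using cSUP_upper[OF zero bdd] by simp
    next
      case False
      then have \<alpha>p: "\<alpha> > 0" using \<alpha>0 by simp
      define h where "h = (\<lambda>y. f y / sqrt \<alpha>)"
      have hF: "(\<Sum>y\<in>F. (h y)\<^sup>2) \<le> 1" if "finite F" for F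
      proof -
        have "(\<Sum>y\<in>F. (h y)\<^sup>2) = (\<Sum>y\<in>F. (f y)\<^sup>2) / \<alpha>"
          using \<alpha>p by (simp add: h_def power_divide sum_divide_distrib)
        then show ?thesis using f(4)[OF that] \<alpha>p by (simp add: \<alpha>_def)
      qed
      have sm: "(\<lambda>y. (h y)\<^sup>2) summable_on UNIV"
        by (rule nonneg_bdd_above_summable_on) (use hF in \<open>auto simp: bdd_above_def\<close>)
      have "infsum (\<lambda>y. (h y)\<^sup>2) UNIV \<le> 1"
        by (rule infsum_le_finite_sums[OF sm]) (use hF in auto)
      moreover have "D h = (\<lambda>_. 0)"
      proof
        fix vq
        have "D h vq = D f vq / sqrt \<alpha>"
          unfolding D_def h_def by (auto simp: sum_divide_distrib split: prod.split)
        then show "D h vq = 0" using f(3) by simp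
      qed
      ultimately have "h \<in> ?H" using sm f(1) by (auto simp: l2harm_def supported_def h_def)
      from cSUP_upper[OF this bdd] have "h i \<le> (SUP h\<in>?H. h i)" .
      moreover have "h i = sqrt \<alpha>" using \<alpha>p by (simp add: h_def \<alpha>_def real_div_sqrt)
      ultimately show ?thesis by simp
    qed
  qed
  then have "(SUP h\<in>?H. h i)\<^sup>2 = f i" using \<alpha>0 by (simp add: \<alpha>_def)
  then show ?thesis using f(2)[of i] by simp
qed

section \<open>Finite quotients: traces and kernel dimensions\<close>

definition Ker :: "('v \<times> 't \<Rightarrow> real) set" where
  "Ker = {h \<in> supported (V \<times> T). D h = (\<lambda>_. 0)}"

lemma D_add: "D (f + g) = D f + D g"
  by (auto simp: D_def fun_eq_iff algebra_simps sum.distrib)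

lemma D_scale: "D (fun_scale c f) = fun_scale c (D f)"
  by (auto simp: D_def fun_eq_iff sum_distrib_left mult_ac intro!: sum.cong)

lemma subspace_Ker: "fv.subspace Ker"
proof -
  have "D 0 = (\<lambda>_. 0)" by (auto simp: D_def)
  then show ?thesis
    unfolding fv.subspace_def Ker_def by (auto simp: D_add D_scale supported_def)
qed

text \<open>Each diagonal entry tends to that of the orthogonal projection onto \<open>Ker\<close>,
  the sum of b(i)^2 over an orthonormal basis; summing over i counts the basis.\<close>

lemma trace_limit:
  assumes finV: "finite V"
  shows "(\<lambda>n. \<Sum>i\<in>V \<times> T. (Aop ^^ (2 * n)) (delta i) i) \<longlonglongrightarrow> real (fv.dim Ker)"
proof -
  let ?I = "V \<times> T"
  have I: "finite ?I" using finV finT by simp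
  have KI: "Ker \<subseteq> supported ?I" by (auto simp: Ker_def)
  obtain B where B: "finite B" "B \<subseteq> Ker" "ortho_on ?I B" "fv.span B = Ker" "card B = fv.dim Ker"
    using ortho_basis_exists[OF I KI subspace_Ker] by blast
  have lim: "(\<lambda>n. (Aop ^^ (2 * n)) (delta i) i) \<longlonglongrightarrow> (\<Sum>b\<in>B. (b i)\<^sup>2)" if i: "i \<in> ?I" for i
  proof -
    obtain f where f: "f \<in> supported ?I" "\<And>y. (\<lambda>n. (Aop ^^ (2 * n)) (delta i) y) \<longlonglongrightarrow> f y" "D f = (\<lambda>_. 0)"
      using Aop_limit[OF i] by blast
    have fb: "(\<Sum>y\<in>?I. f y * b y) = b i" if b: "b \<in> B" for b
    proof -
      have "(\<Sum>y\<in>?I. (Aop ^^ (2 * n)) (delta i) y * b y) = b i" for n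
      proof -
        have "(Aop ^^ (2 * n)) (delta i) \<in> supported ?I"
          using Aop_pow_fs[OF delta_fs[OF i]] by (auto simp: fs_def)
        from ip_finite[OF finT this I order_refl, of b] show ?thesis
          using harmonic_eval[OF _ i, of b "2 * n"] b B(2) by (auto simp: Ker_def)
      qed
      moreover have "(\<lambda>n. \<Sum>y\<in>?I. (Aop ^^ (2 * n)) (delta i) y * b y) \<longlonglongrightarrow> (\<Sum>y\<in>?I. f y * b y)"
        using f(2) by (intro tendsto_intros)
      ultimately show ?thesis using LIMSEQ_unique[OF _ tendsto_const] by simp
    qed
    have "f \<in> fv.span B" using f B(4) by (simp add: Ker_def)
    then obtain c where c: "f = (\<Sum>b\<in>B. fun_scale (c b) b)" unfolding fv.span_finite[OF B(1)] by auto
    have cb: "c b = b i" if b: "b \<in> B" for b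
    proof -
      have "(\<Sum>y\<in>?I. f y * b y) = (\<Sum>d\<in>B. c d * (\<Sum>y\<in>?I. d y * b y))"
        unfolding c by (simp add: sum_fun_apply sum_distrib_right sum_distrib_left mult.assoc del: sum.cartesian_product)
          (subst sum.swap, rule refl)
      also have "\<dots> = (\<Sum>d\<in>B. c d * (if d = b then 1 else 0))" using B(3) b by (simp add: ortho_on_def)
      also have "\<dots> = c b" using B(1) b by (simp add: if_distrib cong: if_cong)
      finally show ?thesis using fb[OF b] by simp
    qed
    have "f i = (\<Sum>b\<in>B. c b * b i)" unfolding c by (simp add: sum_fun_apply)
    also have "\<dots> = (\<Sum>b\<in>B. (b i)\<^sup>2)" using cb by (simp add: power2_eq_square)
    finally show ?thesis using f(2)[of i] by simp
  qed
  have "(\<lambda>n. \<Sum>i\<in>?I. (Aop ^^ (2 * n)) (delta i) i) \<longlonglongrightarrow> (\<Sum>i\<in>?I. \<Sum>b\<in>B. (b i)\<^sup>2)"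
    using lim by (intro tendsto_sum) auto
  also have "(\<Sum>i\<in>?I. \<Sum>b\<in>B. (b i)\<^sup>2) = (\<Sum>b\<in>B. \<Sum>i\<in>?I. b i * b i)"
    by (subst sum.swap) (simp add: power2_eq_square)
  also have "\<dots> = (\<Sum>b\<in>B. 1)" using B(3) by (intro sum.cong) (auto simp: ortho_on_def)
  also have "\<dots> = real (fv.dim Ker)" using B(5) by simp
  finally show ?thesis .
qed

text \<open>The matrix of \<open>D\<close> in the point masses. Several elements of \<open>A\<close>
  may carry one coset to the same coset, hence the sum.\<close>

definition dint :: "'v \<times> 't \<Rightarrow> 'v \<times> 'q \<Rightarrow> int" where
  "dint i k = (\<Sum>a\<in>A. if act (fst k) a = fst i then m (snd i) (snd k) a else 0)"

definition gram :: "'v \<times> 't \<Rightarrow> 'v \<times> 't \<Rightarrow> int" where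
  "gram i j = (\<Sum>k\<in>V \<times> Q. dint i k * dint j k)"

lemma D_delta:
  assumes i: "i \<in> V \<times> T" and k: "k \<in> V \<times> Q"
  shows "D (delta i) k = real_of_int (dint i k)"
proof -
  obtain w t where wt: "i = (w, t)" "t \<in> T" using i by auto
  obtain v q where vq: "k = (v, q)" "v \<in> V" "q \<in> Q" using k by auto
  have "D (delta i) k = (\<Sum>t'\<in>T. if t' = t then \<Sum>a\<in>A. (if act v a = w then real_of_int (m t' q a) else 0) else 0)"
    unfolding D_def vq delta_def wt using vq by (auto intro!: sum.cong)
  also have "\<dots> = real_of_int (dint i k)"
    unfolding dint_def wt vq using finT wt(2) by (simp add: if_distrib cong: if_cong)
  finally show ?thesis .
qed

lemma DD_delta:
  assumes finV: "finite V" and i: "i \<in> V \<times> T" and j: "j \<in> V \<times> T"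
  shows "Dadj (D (delta j)) i = real_of_int (gram i j)"
proof -
  have VQ: "finite (V \<times> Q)" using finV finQ by simp
  have "Dadj (D (delta j)) i = ip T (delta i) (Dadj (D (delta j)))" using ip_delta[OF finT i] by simp
  also have "\<dots> = ip Q (D (delta i)) (D (delta j))" using D_adjoint delta_fs[OF i] by metis
  also have "\<dots> = (\<Sum>k\<in>V \<times> Q. D (delta i) k * D (delta j) k)"
    using D_fs[OF delta_fs[OF i]] VQ by (intro ip_finite[OF finQ]) (auto simp: fs_def)
  also have "\<dots> = real_of_int (gram i j)" unfolding gram_def using D_delta i j by simp
  finally show ?thesis .
qed

lemma gram_sym: "gram i j = gram j i"
  by (simp add: gram_def mult.commute)

lemma DD_expand:
  assumes finV: "finite V" and i: "i \<in> V \<times> T" and f: "f \<in> supported (V \<times> T)"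
  shows "Dadj (D f) i = (\<Sum>j\<in>V \<times> T. real_of_int (gram i j) * f j)"
proof -
  have I: "finite (V \<times> T)" using finV finT by simp
  have ffs: "f \<in> fs T" using f I by (auto simp: fs_def supported_def intro!: finite_subset[OF _ I])
  have "Dadj (D f) i = ip T (delta i) (Dadj (D f))" using ip_delta[OF finT i] by simp
  also have "\<dots> = ip Q (D (delta i)) (D f)" using D_adjoint delta_fs[OF i] by metis
  also have "\<dots> = ip T f (Dadj (D (delta i)))" using D_adjoint ffs ip_commute by metis
  also have "\<dots> = (\<Sum>j\<in>V \<times> T. f j * Dadj (D (delta i)) j)" using ip_finite[OF finT f I order_refl] .
  also have "\<dots> = (\<Sum>j\<in>V \<times> T. real_of_int (gram i j) * f j)"
    using DD_delta[OF finV _ i] gram_sym by (intro sum.cong) (auto simp: mult.commute)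
  finally show ?thesis .
qed

text \<open>\<open>gram\<close> is an integral positive semidefinite matrix bounded by
  \<open>K\<close>, so the spectral estimates apply to it. Both errors are proportional to card
  \<open>V\<close>, as is needed after dividing by the index.\<close>

lemma kernel_dim_bounds:
  assumes finV: "finite V" and eps: "0 < \<epsilon>" "\<epsilon> < 1"
  shows "real (fv.dim Ker) \<le> (\<Sum>i\<in>V \<times> T. (Aop ^^ (2 * n)) (delta i) i)"
    and "(\<Sum>i\<in>V \<times> T. (Aop ^^ (2 * n)) (delta i) i) \<le> real (fv.dim Ker)
      + real (card V * card T) * (ln K / ln (1 / \<epsilon>)) + real (card V * card T) * (1 - \<epsilon> / K) ^ (2 * n)"
proof -
  let ?I = "V \<times> T"
  have I: "finite ?I" using finV finT by simp
  have K: "K > 0" using K_ge_1 by simp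
  define B where "B i j = (if i = j then 1 else 0) - real_of_int (gram i j) / K" for i j
  have quad: "(\<Sum>i\<in>?I. \<Sum>j\<in>?I. x i * real_of_int (gram i j) * x j) = ip Q (D f) (D f) \<and> f \<in> fs T \<and> ip T f f = (\<Sum>i\<in>?I. (x i)\<^sup>2)"
    if f_def: "f = (\<lambda>i. if i \<in> ?I then x i else 0)" for x f
  proof -
    have fI: "f \<in> supported ?I" by (auto simp: f_def supported_def)
    have ffs: "f \<in> fs T" using fI I by (auto simp: fs_def supported_def intro!: finite_subset[OF _ I])
    have "(\<Sum>i\<in>?I. \<Sum>j\<in>?I. x i * real_of_int (gram i j) * x j) = (\<Sum>i\<in>?I. f i * (\<Sum>j\<in>?I. real_of_int (gram i j) * f j))"
      by (simp add: f_def sum_distrib_left mult.assoc del: sum.cartesian_product)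
    also have "\<dots> = (\<Sum>i\<in>?I. f i * Dadj (D f) i)"
      using DD_expand[OF finV _ fI] by simp
    also have "\<dots> = ip T f (Dadj (D f))" using ip_finite[OF finT fI I order_refl] by simp
    also have "\<dots> = ip Q (D f) (D f)" using D_adjoint ffs by metis
    finally show ?thesis
      using ffs ip_finite[OF finT fI I order_refl, of f] by (auto simp: f_def power2_eq_square)
  qed
  have "\<exists>es :: real list. length es = card ?I \<and> (\<forall>e\<in>set es. 0 \<le> e \<and> e \<le> K)
    \<and> (\<forall>k. (\<Sum>i\<in>?I. kernel_pow ?I B k i i) = (\<Sum>e\<leftarrow>es. (1 - e / K) ^ k))
    \<and> 1 \<le> prod_list (filter (\<lambda>e. e \<noteq> 0) es)"
  proof (rule int_psd_spectrum[OF I K])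
    show "gram i j = gram j i" for i j by (rule gram_sym)
    fix x :: "'v \<times> 't \<Rightarrow> real"
    let ?f = "\<lambda>i. if i \<in> ?I then x i else 0"
    have q1: "(\<Sum>i\<in>?I. \<Sum>j\<in>?I. x i * real_of_int (gram i j) * x j) = ip Q (D ?f) (D ?f)"
      and q2: "?f \<in> fs T" and q3: "(\<Sum>i\<in>?I. (x i)\<^sup>2) = ip T ?f ?f"
      using quad[OF refl, of x] by (simp_all only:)
    show "0 \<le> (\<Sum>i\<in>?I. \<Sum>j\<in>?I. x i * real_of_int (gram i j) * x j)" unfolding q1 by (rule ip_nonneg)
    show "(\<Sum>i\<in>?I. \<Sum>j\<in>?I. x i * real_of_int (gram i j) * x j) \<le> K * (\<Sum>i\<in>?I. (x i)\<^sup>2)"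
      unfolding q1 q3 by (rule D_bound[OF q2])
  qed (simp add: B_def)
  then obtain es where es: "length es = card ?I" "\<forall>e\<in>set es. 0 \<le> e \<and> e \<le> K"
    "\<And>k. (\<Sum>i\<in>?I. kernel_pow ?I B k i i) = (\<Sum>e\<leftarrow>es. (1 - e / K) ^ k)"
    "1 \<le> prod_list (filter (\<lambda>e. e \<noteq> 0) es)" by blast
  have pow: "(Aop ^^ k) (delta j) i = kernel_pow ?I B k i j" if "i \<in> ?I" "j \<in> ?I" for k i j
    using that
  proof (induction k arbitrary: i)
    case 0
    then show ?case by (auto simp: delta_def)
  next
    case (Suc k)
    have sup: "(Aop ^^ k) (delta j) \<in> supported ?I"
      using Aop_pow_fs[OF delta_fs[OF Suc.prems(2)]] by (auto simp: fs_def)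
    have "(Aop ^^ Suc k) (delta j) i = (Aop ^^ k) (delta j) i - (1 / K) * (\<Sum>l\<in>?I. real_of_int (gram i l) * (Aop ^^ k) (delta j) l)"
      using DD_expand[OF finV Suc.prems(1) sup] by (simp add: Aop_def)
    also have "(Aop ^^ k) (delta j) i = (\<Sum>l\<in>?I. (if i = l then 1 else 0) * (Aop ^^ k) (delta j) l)"
      using I Suc.prems(1) by (simp add: if_distrib[of "\<lambda>c. c * _"] cong: if_cong)
    also have "\<dots> - (1 / K) * (\<Sum>l\<in>?I. real_of_int (gram i l) * (Aop ^^ k) (delta j) l)
        = (\<Sum>l\<in>?I. B i l * (Aop ^^ k) (delta j) l)"
      by (simp add: B_def sum_distrib_left left_diff_distrib sum_subtractf)
    also have "\<dots> = (\<Sum>l\<in>?I. B i l * kernel_pow ?I B k l j)" using Suc by (intro sum.cong) auto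
    finally show ?case by simp
  qed
  have tr: "(\<Sum>i\<in>?I. (Aop ^^ k) (delta i) i) = (\<Sum>e\<leftarrow>es. (1 - e / K) ^ k)" for k
    using pow es(3)[of k] by simp
  have "(\<lambda>n. \<Sum>i\<in>?I. (Aop ^^ (2 * n)) (delta i) i) \<longlonglongrightarrow> real (length (filter (\<lambda>e. e = 0) es))"
    unfolding tr by (rule zero_eigenvalues_limit[OF es(2) K])
  \<comment> \<open>The traces of the even powers tend both to the number of zero roots and to dim
    \<open>Ker\<close>. Comparing the limits identifies the multiplicity of 0 with the kernel
    dimension.\<close>
  then have z: "real (fv.dim Ker) = real (length (filter (\<lambda>e. e = 0) es))"
    using trace_limit[OF finV] LIMSEQ_unique by blast
  show "real (fv.dim Ker) \<le> (\<Sum>i\<in>?I. (Aop ^^ (2 * n)) (delta i) i)"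
    unfolding z tr by (rule zero_eigenvalues_le)
  show "(\<Sum>i\<in>?I. (Aop ^^ (2 * n)) (delta i) i) \<le> real (fv.dim Ker)
      + real (card V * card T) * (ln K / ln (1 / \<epsilon>)) + real (card V * card T) * (1 - \<epsilon> / K) ^ (2 * n)"
    unfolding z tr using few_small_eigenvalues[OF es(2,4) K_ge_1 eps] es(1) by (simp add: card_cartesian_product)
qed

end

text \<open>Pulling functions back along an equivariant map intertwines the two operators, because
  their constants \<open>K\<close> coincide. The diagonal entry downstairs is therefore the sum of
  the entries over the fibre of \<open>\<pi> v0\<close> upstairs, and \<open>sep\<close> leaves only
  the one at \<open>v0\<close>.\<close>

lemma Aop_equivariant:
  fixes T :: "'t set" and Q :: "'q set" and V :: "'v set" and V' :: "'w set"
  assumes gm: "group_ring_matrix G V act T Q A" and gm': "group_ring_matrix G V' act' T Q A"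
    and \<pi>V: "\<And>v. v \<in> V \<Longrightarrow> \<pi> v \<in> V'"
    and \<pi>eq: "\<And>v g. v \<in> V \<Longrightarrow> g \<in> carrier G \<Longrightarrow> \<pi> (act v g) = act' (\<pi> v) g"
    and v0: "v0 \<in> V" and t0: "t0 \<in> T"
    and sep: "\<And>v. v \<in> V \<Longrightarrow> \<pi> v = \<pi> v0 \<Longrightarrow>
       (group_ring_matrix.Aop G V act T Q A m ^^ k) (delta (v0, t0)) (v, t0) \<noteq> 0 \<Longrightarrow> v = v0"
  shows "(group_ring_matrix.Aop G V' act' T Q A m ^^ k) (delta (\<pi> v0, t0)) (\<pi> v0, t0)
       = (group_ring_matrix.Aop G V act T Q A m ^^ k) (delta (v0, t0)) (v0, t0)"
proof -
  interpret P: group_ring_matrix G V act T Q A m by (rule gm)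
  interpret P': group_ring_matrix G V' act' T Q A m by (rule gm')
  define pb where "pb \<phi> = (\<lambda>(v, y). if v \<in> V then \<phi> (\<pi> v, y) else 0 :: real)" for \<phi> :: "_ \<times> 't \<Rightarrow> real"
  define pq where "pq \<phi> = (\<lambda>(v, y). if v \<in> V then \<phi> (\<pi> v, y) else 0 :: real)" for \<phi> :: "_ \<times> 'q \<Rightarrow> real"
  have Ac: "a \<in> carrier G" if "a \<in> A" for a using that P.A_sub by auto
  have D: "P.D (pb \<phi>) = pq (P'.D \<phi>)" for \<phi>
    unfolding P.D_def P'.D_def pb_def pq_def using \<pi>V \<pi>eq P.act_closed Ac
    by (auto simp: fun_eq_iff intro!: sum.cong)
  have Ds: "P.Dadj (pq x) = pb (P'.Dadj x)" for x
    unfolding P.Dadj_def P'.Dadj_def pb_def pq_def using \<pi>V \<pi>eq P.act_closed Ac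
    by (auto simp: fun_eq_iff intro!: sum.cong)
  have "P.K = P'.K" unfolding P.K_def P'.K_def ..
  then have Aop: "P.Aop (pb \<phi>) = pb (P'.Aop \<phi>)" for \<phi>
    unfolding P.Aop_def P'.Aop_def D Ds by (auto simp: pb_def fun_eq_iff)
  have pow: "(P.Aop ^^ k) (pb \<phi>) = pb ((P'.Aop ^^ k) \<phi>)" for \<phi>
    by (induction k) (auto simp: Aop)
  have i: "(v0, t0) \<in> V \<times> T" using v0 t0 by simp
  let ?x = "(P.Aop ^^ k) (delta (v0, t0))" and ?e = "pb (delta (\<pi> v0, t0))"
  have xfs: "?x \<in> P.fs T" using P.delta_fs[OF i] by (rule P.Aop_pow_fs)
  let ?S = "{y. ?x y \<noteq> 0}"
  have S: "finite ?S" "?S \<subseteq> V \<times> T" "?x \<in> supported ?S" using xfs by (auto simp: P.fs_def supported_def)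
  have "(P'.Aop ^^ k) (delta (\<pi> v0, t0)) (\<pi> v0, t0) = (P.Aop ^^ k) ?e (v0, t0)"
    unfolding pow using v0 by (simp add: pb_def)
  also have "\<dots> = P.ip T (delta (v0, t0)) ((P.Aop ^^ k) ?e)" using P.ip_delta[OF P.finT i] by simp
  also have "\<dots> = P.ip T ?x ?e" using P.Aop_pow_sym[OF P.delta_fs[OF i]] by simp
  also have "\<dots> = (\<Sum>y\<in>?S. ?x y * ?e y)" by (rule P.ip_finite[OF P.finT S(3,1,2)])
  also have "\<dots> = (\<Sum>y\<in>?S. if y = (v0, t0) then ?x y else 0)"
  proof (rule sum.cong[OF refl])
    fix y assume y: "y \<in> ?S"
    obtain v t where vt: "y = (v, t)" by (cases y)
    have v: "v \<in> V" using y S(2) vt by auto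
    show "?x y * ?e y = (if y = (v0, t0) then ?x y else 0)"
      using sep[OF v] y v0 v unfolding vt by (auto simp: pb_def delta_def)
  qed
  also have "\<dots> = ?x (v0, t0)" using S(1) by auto
  finally show ?thesis .
qed

section \<open>Residual chains and convergence of normalised kernel dimensions\<close>

locale residual_chain = group G for G (structure) +
  fixes Ns :: "nat \<Rightarrow> 'a set"
  assumes normal: "Ns n \<lhd> G"
    and finidx: "finite (rcosets (Ns n))"
    and nested: "Ns (Suc n) \<subseteq> Ns n"
    and inter: "(\<Inter>n. Ns n) = {\<one>}"
begin

lemma Ns_subgroup: "subgroup (Ns n) G"
  using normal normal_imp_subgroup by blast

lemma Ns_carrier: "Ns n \<subseteq> carrier G"
  using Ns_subgroup subgroup.subset by blast

lemma Ns_antimono: "n \<le> k \<Longrightarrow> Ns k \<subseteq> Ns n"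
  using nested by (rule lift_Suc_antimono_le)

text \<open>Each nontrivial element leaves the nested chain at some stage for good, and finitely
  many stages have a maximum.\<close>

lemma eventually_separates:
  assumes F: "finite F"
  shows "\<forall>\<^sub>F n in sequentially. Ns n \<inter> F \<subseteq> {\<one>}"
proof -
  have "\<forall>\<^sub>F n in sequentially. x \<in> Ns n \<longrightarrow> x = \<one>" for x
  proof (cases "x = \<one>")
    case False
    then obtain k where "x \<notin> Ns k" using inter by blast
    then have "\<forall>n\<ge>k. x \<notin> Ns n" using Ns_antimono by blast
    then show ?thesis unfolding eventually_sequentially by blast
  qed simp
  then have "\<forall>\<^sub>F n in sequentially. \<forall>x\<in>F. x \<in> Ns n \<longrightarrow> x = \<one>"
    using F by (simp add: eventually_ball_finite)
  then show ?thesis by (rule eventually_mono) blast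
qed

lemma Ns_nonempty: "rcosets (Ns n) \<noteq> {}"
  using subgroup.one_closed[OF Ns_subgroup] by (auto simp: RCOSETS_def)

lemma index_pos: "card (rcosets (Ns n)) > 0"
  using finidx Ns_nonempty by (simp add: card_gt_0_iff)

lemma coset_action: "right_action G (rcosets (Ns n)) (\<lambda>x g. x #> g)"
proof
  fix v g h assume v: "v \<in> rcosets (Ns n)" and g: "g \<in> carrier G" and h: "h \<in> carrier G"
  obtain k where k: "k \<in> carrier G" "v = Ns n #> k" using v by (auto simp: RCOSETS_def)
  show "v #> g \<in> rcosets (Ns n)"
    using k g coset_mult_assoc[OF Ns_carrier] by (auto simp: RCOSETS_def)
  show "(v #> g) #> h = v #> (g \<otimes> h)"
    using k g h by (simp add: coset_mult_assoc[OF Ns_carrier] m_assoc)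
next
  fix v assume v: "v \<in> rcosets (Ns n)"
  obtain k where k: "k \<in> carrier G" "v = Ns n #> k" using v by (auto simp: RCOSETS_def)
  then show "v #> \<one> = v" by (simp add: coset_mult_assoc[OF Ns_carrier])
qed

lemma self_action: "right_action G (carrier G) (\<otimes>)"
  by unfold_locales (auto simp: m_assoc)

lemma coset_eq_imp_mem:
  assumes g: "g \<in> carrier G" and h: "h \<in> carrier G" and eq: "Ns n #> (g \<otimes> h) = Ns n #> g"
  shows "h \<in> Ns n"
proof -
  have "g \<otimes> h \<in> Ns n #> g" using eq rcos_self[OF _ Ns_subgroup, of "g \<otimes> h" n] g h by simp
  then obtain x where x: "x \<in> Ns n" "g \<otimes> h = x \<otimes> g" by (auto simp: r_coset_def)
  have xc: "x \<in> carrier G" using x Ns_carrier by auto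
  have "h = inv g \<otimes> (g \<otimes> h)" using g h by (simp flip: m_assoc)
  also have "\<dots> = inv g \<otimes> x \<otimes> g" using x(2) g xc by (simp add: m_assoc)
  also have "\<dots> \<in> Ns n" using normal.inv_op_closed1[OF normal g x(1)] .
  finally show ?thesis .
qed

text \<open>For fixed j and all large n the trace at stage n is the index times the moment
  \<open>\<tau> j\<close> of the infinite group. Dividing \<open>kernel_dim_bounds\<close> by the
  index puts \<open>\<tau> j\<close> between the kernel density and this density plus two errors
  independent of n. The order of choice is \<epsilon>, then j, then n.\<close>

theorem lueck_approximation:
  fixes T :: "'t set" and Q :: "'q set" and m :: "'t \<Rightarrow> 'q \<Rightarrow> 'a \<Rightarrow> int"
  assumes fin: "finite T" "finite Q" "finite A" and A: "A \<subseteq> carrier G"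
  shows "(\<lambda>n. real (fv.dim (group_ring_matrix.Ker (rcosets (Ns n)) (\<lambda>x g. x #> g) T Q A m)) / real (card (rcosets (Ns n))))
    \<longlonglongrightarrow> (\<Sum>t\<in>T. (SUP h \<in> {h \<in> group_ring_matrix.l2harm (carrier G) (\<otimes>) T Q A m.
          sqrt (infsum (\<lambda>a. (h a)\<^sup>2) UNIV) \<le> 1}. h (\<one>, t))\<^sup>2)"
    (is "(\<lambda>n. real (?d n) / real (?c n)) \<longlonglongrightarrow> ?\<beta>")
proof -
  interpret P: group_ring_matrix G "carrier G" "(\<otimes>)" T Q A m
    by (intro group_ring_matrix.intro self_action group_ring_matrix_axioms.intro fin A)
  have gm: "group_ring_matrix G (rcosets (Ns n)) (\<lambda>x g. x #> g) T Q A" for n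
    by (intro group_ring_matrix.intro coset_action group_ring_matrix_axioms.intro fin A)
  define \<tau> where "\<tau> j = (\<Sum>t\<in>T. (P.Aop ^^ (2 * j)) (delta (\<one>, t)) (\<one>, t))" for j
  define tr where "tr j n = (\<Sum>i\<in>(rcosets (Ns n)) \<times> T.
      (group_ring_matrix.Aop G (rcosets (Ns n)) (\<lambda>x g. x #> g) T Q A m ^^ (2 * j)) (delta i) i)" for j n
  have \<tau>lim: "\<tau> \<longlonglongrightarrow> ?\<beta>"
    unfolding \<tau>_def by (intro tendsto_sum P.l2harm_sup_limit) auto
  have tr: "\<forall>\<^sub>F n in sequentially. tr j n = real (?c n) * \<tau> j" for j
  proof -
    define F where "F = (\<Union>t\<in>T. fst ` {y. (P.Aop ^^ (2 * j)) (delta (\<one>, t)) y \<noteq> 0})"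
    have "(P.Aop ^^ (2 * j)) (delta (\<one>, t)) \<in> P.fs T" if "t \<in> T" for t
      using that by (intro P.Aop_pow_fs P.delta_fs) auto
    then have "finite F" unfolding F_def using fin(1) by (auto simp: P.fs_def)
    from eventually_separates[OF this] show ?thesis
    proof (rule eventually_mono)
      fix n assume sep: "Ns n \<inter> F \<subseteq> {\<one>}"
      let ?V = "rcosets (Ns n)"
      have one: "(group_ring_matrix.Aop G ?V (\<lambda>x g. x #> g) T Q A m ^^ (2 * j)) (delta (x, t)) (x, t)
          = (P.Aop ^^ (2 * j)) (delta (\<one>, t)) (\<one>, t)" if x: "x \<in> ?V" and t: "t \<in> T" for x t
      proof -
        obtain g where g: "g \<in> carrier G" "x = Ns n #> g" using x by (auto simp: RCOSETS_def)
        \<comment> \<open>An equivariant map from the group to the cosets that sends the identity to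
          the given coset \<open>x\<close>; so every coset has the same diagonal entry.\<close>
        define \<pi> where "\<pi> h = Ns n #> (g \<otimes> h)" for h
        have \<pi>1: "\<pi> \<one> = x" using g by (simp add: \<pi>_def)
        have "(group_ring_matrix.Aop G ?V (\<lambda>x g. x #> g) T Q A m ^^ (2 * j)) (delta (\<pi> \<one>, t)) (\<pi> \<one>, t)
          = (P.Aop ^^ (2 * j)) (delta (\<one>, t)) (\<one>, t)"
        proof (rule Aop_equivariant[OF P.group_ring_matrix_axioms gm])
          show "\<pi> v \<in> ?V" if "v \<in> carrier G" for v using that g by (auto simp: \<pi>_def RCOSETS_def)
          show "\<pi> (v \<otimes> h) = \<pi> v #> h" if "v \<in> carrier G" "h \<in> carrier G" for v h
            using that g by (simp add: \<pi>_def coset_mult_assoc[OF Ns_carrier] m_assoc)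
          fix v assume v: "v \<in> carrier G" "\<pi> v = \<pi> \<one>" "(P.Aop ^^ (2 * j)) (delta (\<one>, t)) (v, t) \<noteq> 0"
          have "v \<in> Ns n" using coset_eq_imp_mem[OF g(1) v(1)] v(2) g by (simp add: \<pi>_def)
          moreover have "v \<in> F" unfolding F_def using v(3) t by (force simp: image_iff)
          ultimately show "v = \<one>" using sep by auto
        qed (use t in auto)
        then show ?thesis using \<pi>1 by simp
      qed
      have "tr j n = (\<Sum>x\<in>?V. \<Sum>t\<in>T. (P.Aop ^^ (2 * j)) (delta (\<one>, t)) (\<one>, t))"
        unfolding tr_def sum.cartesian_product using one by (intro sum.cong) auto
      then show "tr j n = real (?c n) * \<tau> j" by (simp add: \<tau>_def)
    qed
  qed
  have K1: "P.K \<ge> 1" by (rule P.K_ge_1)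
  have up: "\<forall>\<^sub>F n in sequentially. real (?d n) / real (?c n) \<le> \<tau> j" for j
    using tr[of j]
  proof (rule eventually_mono)
    fix n assume n: "tr j n = real (?c n) * \<tau> j"
    interpret Q: group_ring_matrix G "rcosets (Ns n)" "\<lambda>x g. x #> g" T Q A m by (rule gm)
    have "real (?d n) \<le> tr j n" unfolding tr_def using Q.kernel_dim_bounds(1)[OF finidx, of "1/2"] by simp
    then show "real (?d n) / real (?c n) \<le> \<tau> j" using n index_pos[of n] by (simp add: field_simps)
  qed
  have lo: "\<forall>\<^sub>F n in sequentially. \<tau> j \<le> real (?d n) / real (?c n) + real (card T) * (ln P.K / ln (1 / \<epsilon>))
      + real (card T) * (1 - \<epsilon> / P.K) ^ (2 * j)" if eps: "0 < \<epsilon>" "\<epsilon> < 1" for j \<epsilon>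
    using tr[of j]
  proof (rule eventually_mono)
    fix n assume n: "tr j n = real (?c n) * \<tau> j"
    interpret Q: group_ring_matrix G "rcosets (Ns n)" "\<lambda>x g. x #> g" T Q A m by (rule gm)
    have "tr j n \<le> real (?d n) + real (?c n * card T) * (ln P.K / ln (1 / \<epsilon>))
        + real (?c n * card T) * (1 - \<epsilon> / P.K) ^ (2 * j)"
      unfolding tr_def using Q.kernel_dim_bounds(2)[OF finidx eps, of j] by simp
    then have "real (?c n) * \<tau> j \<le> real (?c n) * (real (?d n) / real (?c n) + real (card T) * (ln P.K / ln (1 / \<epsilon>))
      + real (card T) * (1 - \<epsilon> / P.K) ^ (2 * j))"
      unfolding n using index_pos[of n] by (simp add: algebra_simps)
    then show "\<tau> j \<le> real (?d n) / real (?c n) + real (card T) * (ln P.K / ln (1 / \<epsilon>))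
      + real (card T) * (1 - \<epsilon> / P.K) ^ (2 * j)" using index_pos[of n] by simp
  qed
  show ?thesis
  proof (rule tendstoI)
    fix \<eta> :: real assume \<eta>: "\<eta> > 0"
    define c where "c = real (card T) * ln P.K"
    have c0: "c \<ge> 0" unfolding c_def using K1 by simp
    \<comment> \<open>Chosen so that the first error equals c / (3c/\<eta> + 1), which is below
      \<eta>/3. The summand 1 keeps \<epsilon> below 1 even when c is 0.\<close>
    define \<epsilon> where "\<epsilon> = exp (- (3 * c / \<eta> + 1))"
    have l\<epsilon>: "ln (1 / \<epsilon>) = 3 * c / \<eta> + 1" by (simp add: \<epsilon>_def ln_div)
    have pos: "3 * c / \<eta> + 1 > 0" using c0 \<eta> by (intro add_nonneg_pos) auto
    have "c / (3 * c / \<eta> + 1) < \<eta> / 3"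
      using \<eta> by (subst divide_less_eq) (use pos in \<open>auto simp: field_simps\<close>)
    then have \<epsilon>: "real (card T) * (ln P.K / ln (1 / \<epsilon>)) < \<eta> / 3" "0 < \<epsilon>" "\<epsilon> < 1"
      unfolding l\<epsilon> using pos by (auto simp: c_def \<epsilon>_def)
    have "\<bar>(1 - \<epsilon> / P.K)\<^sup>2\<bar> < 1"
    proof -
      have "\<bar>1 - \<epsilon> / P.K\<bar> < 1" using \<epsilon> K1 by (simp add: abs_less_iff field_simps)
      then show ?thesis by (simp add: abs_square_less_1)
    qed
    then have "(\<lambda>j. real (card T) * ((1 - \<epsilon> / P.K)\<^sup>2) ^ j) \<longlonglongrightarrow> real (card T) * 0"
      by (intro tendsto_intros LIMSEQ_abs_realpow_zero2)
    then have l1: "\<forall>\<^sub>F j in sequentially. real (card T) * (1 - \<epsilon> / P.K) ^ (2 * j) < \<eta> / 3"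
      using \<eta> by (intro order_tendstoD(2)) (auto simp: power_mult)
    have l2: "\<forall>\<^sub>F j in sequentially. dist (\<tau> j) ?\<beta> < \<eta> / 3" using \<tau>lim \<eta> by (intro tendstoD) auto
    from eventually_conj[OF l1 l2] obtain j where
      j: "real (card T) * (1 - \<epsilon> / P.K) ^ (2 * j) < \<eta> / 3" "dist (\<tau> j) ?\<beta> < \<eta> / 3"
      using eventually_happens[of _ sequentially] by auto
    show "\<forall>\<^sub>F n in sequentially. dist (real (?d n) / real (?c n)) ?\<beta> < \<eta>"
      using up[of j] lo[OF \<epsilon>(2,3), of j]
      by eventually_elim (use j \<epsilon>(1) in \<open>unfold dist_real_def abs_less_iff, linarith\<close>)
  qed
qed

end

subsection \<open>Words and potentials\<close>

text \<open>\<open>F g t\<close> is the value of a 1-cochain on the edge from g to g t; the sum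
  follows the path that starts at \<open>g\<close> and spells the word.\<close>

primrec path_sum :: "('a, 'b) monoid_scheme \<Rightarrow> ('a \<Rightarrow> 'a \<Rightarrow> 'k::ab_group_add) \<Rightarrow> 'a \<Rightarrow> 'a list \<Rightarrow> 'k" where
  "path_sum G F g [] = 0"
| "path_sum G F g (t # w) = F g t + path_sum G F (g \<otimes>\<^bsub>G\<^esub> t) w"

lemma eval_word_simps [simp]:
  "eval_word G [] = \<one>\<^bsub>G\<^esub>" "eval_word G (t # w) = t \<otimes>\<^bsub>G\<^esub> eval_word G w"
  by (simp_all add: eval_word_def)

context group
begin

lemma eval_word_closed [simp]: "set w \<subseteq> carrier G \<Longrightarrow> eval_word G w \<in> carrier G"
  by (induction w) auto

lemma eval_word_append:
  "set v \<subseteq> carrier G \<Longrightarrow> set w \<subseteq> carrier G \<Longrightarrow> eval_word G (v @ w) = eval_word G v \<otimes> eval_word G w"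
  by (induction v) (auto simp: m_assoc)

lemma path_sum_append:
  assumes "g \<in> carrier G" "set v \<subseteq> carrier G"
  shows "path_sum G F g (v @ w) = path_sum G F g v + path_sum G F (g \<otimes> eval_word G v) w"
  using assms by (induction v arbitrary: g) (auto simp: m_assoc add.assoc)

lemma path_sum_eq_sum:
  assumes "g \<in> carrier G" "set w \<subseteq> carrier G"
  shows "path_sum G F g w = (\<Sum>i<length w. F (g \<otimes> eval_word G (take i w)) (w ! i))"
  using assms
proof (induction w arbitrary: g)
  case (Cons t w)
  have tw: "set (take i w) \<subseteq> carrier G" for i using Cons.prems(2) by (auto dest: in_set_takeD)
  have "path_sum G F g (t # w) = F g t + (\<Sum>i<length w. F (g \<otimes> t \<otimes> eval_word G (take i w)) (w ! i))"
    using Cons by simp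
  also have "\<dots> = (\<Sum>i<Suc (length w). F (g \<otimes> eval_word G (take i (t # w))) ((t # w) ! i))"
    unfolding sum.lessThan_Suc_shift using Cons.prems tw by (simp add: m_assoc)
  finally show ?case by simp
qed simp

lemma path_sum_diff:
  assumes "g \<in> carrier G" "set w \<subseteq> carrier G" "\<And>h t. h \<in> carrier G \<Longrightarrow> t \<in> set w \<Longrightarrow> F h t = u (h \<otimes> t) - u h"
  shows "path_sum G F g w = u (g \<otimes> eval_word G w) - u g"
  using assms by (induction w arbitrary: g) (auto simp: m_assoc)

lemma generate_word:
  assumes S: "S \<subseteq> carrier G" and sym: "\<And>s. s \<in> S \<Longrightarrow> inv s \<in> S" and g: "g \<in> generate G S"
  shows "\<exists>w. set w \<subseteq> S \<and> eval_word G w = g"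
  using g
proof (induction rule: generate.induct)
  case one
  then show ?case by (intro exI[of _ "[]"]) auto
next
  case (incl h)
  then show ?case using S by (intro exI[of _ "[h]"]) auto
next
  case (inv h)
  then show ?case using S sym by (intro exI[of _ "[inv h]"]) auto
next
  case (eng h1 h2)
  then obtain w1 w2 where "set w1 \<subseteq> S" "eval_word G w1 = h1" "set w2 \<subseteq> S" "eval_word G w2 = h2" by blast
  then show ?case using S by (intro exI[of _ "w1 @ w2"]) (auto simp: eval_word_append)
qed

lemma invariant_constant:
  assumes S: "S \<subseteq> carrier G" and sym: "\<And>s. s \<in> S \<Longrightarrow> inv s \<in> S" and gen: "generate G S = carrier G"
    and u: "\<And>g s. g \<in> carrier G \<Longrightarrow> s \<in> S \<Longrightarrow> u (g \<otimes> s) = u g" and g: "g \<in> carrier G"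
  shows "u g = u \<one>"
proof -
  obtain w where w: "set w \<subseteq> S" "eval_word G w = g" using generate_word[OF S sym] gen g by blast
  have "u (h \<otimes> eval_word G w) = u h" if "h \<in> carrier G" "set w \<subseteq> S" for h w
    using that
  proof (induction w arbitrary: h)
    case (Cons t w)
    have wc: "set w \<subseteq> carrier G" "t \<in> carrier G" using Cons.prems S by auto
    have "u (h \<otimes> eval_word G (t # w)) = u ((h \<otimes> t) \<otimes> eval_word G w)" using Cons.prems wc by (simp add: m_assoc)
    also have "\<dots> = u (h \<otimes> t)" using Cons wc by auto
    also have "\<dots> = u h" using u Cons.prems by auto
    finally show ?case .
  qed simp
  from this[of \<one> w] w g show ?thesis by simp
qed

text \<open>Integrate \<open>F\<close> along a chosen word for each element. Two words for the same
  element have equal sums, since one and the same word closes both.\<close>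

lemma potential_exists:
  fixes F :: "'a \<Rightarrow> 'a \<Rightarrow> 'k::ab_group_add"
  assumes S: "S \<subseteq> carrier G" and sym: "\<And>s. s \<in> S \<Longrightarrow> inv s \<in> S" and gen: "generate G S = carrier G"
    and closed: "\<And>w. set w \<subseteq> S \<Longrightarrow> eval_word G w = \<one> \<Longrightarrow> path_sum G F \<one> w = 0"
  shows "\<exists>u. u \<one> = 0 \<and> (\<forall>x. x \<notin> carrier G \<longrightarrow> u x = 0) \<and> (\<forall>g\<in>carrier G. \<forall>s\<in>S. u (g \<otimes> s) - u g = F g s)"
proof -
  have "\<forall>g\<in>carrier G. \<exists>w. set w \<subseteq> S \<and> eval_word G w = g" using generate_word[OF S sym] gen by auto
  then obtain wd where wd: "\<And>g. g \<in> carrier G \<Longrightarrow> set (wd g) \<subseteq> S \<and> eval_word G (wd g) = g" by metis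
  have Sc: "set w \<subseteq> carrier G" if "set w \<subseteq> S" for w using that S by auto
  have same: "path_sum G F \<one> v = path_sum G F \<one> w" if v: "set v \<subseteq> S" and w: "set w \<subseteq> S" and eq: "eval_word G v = eval_word G w" for v w
  proof -
    let ?z = "wd (inv (eval_word G w))"
    have z: "set ?z \<subseteq> S" "eval_word G ?z = inv (eval_word G w)" using wd Sc[OF w] by auto
    have "path_sum G F \<one> (v @ ?z) = 0" "path_sum G F \<one> (w @ ?z) = 0"
      using v w z eq Sc by (auto intro!: closed simp: eval_word_append)
    then have "path_sum G F \<one> v + path_sum G F (eval_word G w) ?z = path_sum G F \<one> w + path_sum G F (eval_word G w) ?z"
      using Sc[OF v] Sc[OF w] eq by (simp add: path_sum_append)
    then show ?thesis by (simp only: add_right_cancel)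
  qed
  define u where "u g = (if g \<in> carrier G then path_sum G F \<one> (wd g) else 0)" for g
  have "u \<one> = 0" using same[of "wd \<one>" "[]"] wd[of \<one>] by (simp add: u_def)
  moreover have "u (g \<otimes> s) - u g = F g s" if g: "g \<in> carrier G" and s: "s \<in> S" for g s
  proof -
    have sc: "s \<in> carrier G" using s S by auto
    have "path_sum G F \<one> (wd (g \<otimes> s)) = path_sum G F \<one> (wd g @ [s])"
      using wd[OF g] wd[of "g \<otimes> s"] g s sc Sc by (intro same) (auto simp: eval_word_append)
    then show ?thesis using wd[OF g] g sc Sc by (simp add: u_def path_sum_append)
  qed
  ultimately show ?thesis by (intro exI[of _ u]) (auto simp: u_def)
qed

lemma pres_rels_props:
  assumes pres: "is_fin_pres G T R" and r: "r \<in> pres_rels G T R"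
  shows "set r \<subseteq> T" "eval_word G r = \<one>"
proof -
  have T: "T \<subseteq> carrier G" "\<forall>t\<in>T. inv t \<in> T" and R: "\<forall>r\<in>R. set r \<subseteq> T \<and> eval_word G r = \<one>"
    using pres unfolding is_fin_pres_def by blast+
  consider "r \<in> R" | t where "t \<in> T" "r = [t, inv t]" using r unfolding pres_rels_def by blast
  then have "set r \<subseteq> T \<and> eval_word G r = \<one>"
  proof cases
    case 2
    then have "t \<in> carrier G" using T by auto
    then show ?thesis using 2 T by simp
  qed (use R in blast)
  then show "set r \<subseteq> T" "eval_word G r = \<one>" by auto
qed

text \<open>Inserting or deleting a relator leaves the sum unchanged: the relator contributes 0 and
  returns to the point where it started. A presentation reduces every trivial word to the empty one
  by such moves.\<close>

lemma relators_imp_closed: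
  assumes pres: "is_fin_pres G T R"
    and rel: "\<And>g r. g \<in> carrier G \<Longrightarrow> r \<in> pres_rels G T R \<Longrightarrow> path_sum G F g r = 0"
    and w: "set w \<subseteq> T" "eval_word G w = \<one>" and g: "g \<in> carrier G"
  shows "path_sum G F g w = 0"
proof -
  have T: "T \<subseteq> carrier G" "\<And>t. t \<in> T \<Longrightarrow> inv t \<in> T" using pres by (auto simp: is_fin_pres_def)
  have R: "set r \<subseteq> carrier G \<and> eval_word G r = \<one>" if "r \<in> pres_rels G T R" for r
    using pres_rels_props[OF pres that] T(1) by auto
  have ins: "path_sum G F g (u @ r @ v) = path_sum G F g (u @ v)"
    if r: "r \<in> pres_rels G T R" and u: "set u \<subseteq> carrier G" for u v r
  proof -
    have rc: "set r \<subseteq> carrier G" "eval_word G r = \<one>" using R[OF r] by auto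
    have "path_sum G F (g \<otimes> eval_word G u) (r @ v) = path_sum G F (g \<otimes> eval_word G u) v"
      using rc u g rel[OF _ r] by (simp add: path_sum_append)
    then show ?thesis using u g by (simp add: path_sum_append)
  qed
  have "(rel_move (pres_rels G T R))\<^sup>*\<^sup>* w []" using pres w unfolding is_fin_pres_def by blast
  then have "set [] \<subseteq> carrier G \<and> path_sum G F g w = path_sum G F g []"
  proof (induction rule: rtranclp_induct)
    case base
    then show ?case using w(1) T by auto
  next
    case (step y z)
    from step.hyps(2) obtain u v r where r: "r \<in> pres_rels G T R"
      and yz: "(y = u @ v \<and> z = u @ r @ v) \<or> (y = u @ r @ v \<and> z = u @ v)"
      unfolding rel_move_def by blast
    have uv: "set u \<subseteq> carrier G" "set v \<subseteq> carrier G" using yz step.IH by auto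
    from yz show ?case using ins[OF r uv(1), of v] R[OF r] uv step.IH by auto
  qed
  then show ?thesis by simp
qed

end

text \<open>The condition says that left translation by an element of \<open>N\<close> changes
  \<open>u\<close> by a constant, so the differences u(g s) - u(g) descend to the cosets, and that u
  vanishes at the identity. Zero values off the carrier make \<open>u\<close> unique as a function
  on the type.\<close>

definition quasi_hom :: "('a, 'b) monoid_scheme \<Rightarrow> 'a set \<Rightarrow> ('a \<Rightarrow> 'k::field) set" where
  "quasi_hom G N = {u. (\<forall>x. x \<notin> carrier G \<longrightarrow> u x = 0) \<and>
     (\<forall>\<gamma>\<in>N. \<forall>h\<in>carrier G. u (\<gamma> \<otimes>\<^bsub>G\<^esub> h) = u \<gamma> + u h)}"

lemma subspace_quasi_hom: "fv.subspace (quasi_hom G N)"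
  by (auto simp: fv.subspace_def quasi_hom_def algebra_simps)

lemma (in group) quasi_hom_one:
  assumes "subgroup N G" "u \<in> quasi_hom G N"
  shows "u \<one> = 0"
proof -
  have "u (\<one> \<otimes> \<one>) = u \<one> + u \<one>" using assms subgroup.one_closed[OF assms(1)] unfolding quasi_hom_def by blast
  then have "u \<one> = u \<one> + u \<one>" by simp
  then show ?thesis by (simp only: add_cancel_right_right)
qed

lemma (in group) quasi_hom_potential:
  fixes F :: "'a \<Rightarrow> 'a \<Rightarrow> 'k::field"
  assumes S: "S \<subseteq> carrier G" and sym: "\<And>s. s \<in> S \<Longrightarrow> inv s \<in> S" and gen: "generate G S = carrier G"
    and N: "N \<subseteq> carrier G"
    and closed: "\<And>w. set w \<subseteq> S \<Longrightarrow> eval_word G w = \<one> \<Longrightarrow> path_sum G F \<one> w = 0"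
    and invar: "\<And>\<gamma> g s. \<gamma> \<in> N \<Longrightarrow> g \<in> carrier G \<Longrightarrow> s \<in> S \<Longrightarrow> F (\<gamma> \<otimes> g) s = F g s"
  shows "\<exists>u \<in> quasi_hom G N. \<forall>g\<in>carrier G. \<forall>s\<in>S. u (g \<otimes> s) - u g = F g s"
proof -
  obtain u where u: "u \<one> = 0" "\<And>x. x \<notin> carrier G \<Longrightarrow> u x = 0"
    "\<And>g s. g \<in> carrier G \<Longrightarrow> s \<in> S \<Longrightarrow> u (g \<otimes> s) - u g = F g s"
    using potential_exists[OF S sym gen closed] by blast
  have "u (\<gamma> \<otimes> h) = u \<gamma> + u h" if \<gamma>: "\<gamma> \<in> N" and h: "h \<in> carrier G" for \<gamma> h
  proof -
    have \<gamma>c: "\<gamma> \<in> carrier G" using \<gamma> N by auto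
    define v where "v g = u (\<gamma> \<otimes> g) - u g" for g
    have "v (g \<otimes> s) = v g" if g: "g \<in> carrier G" and s: "s \<in> S" for g s
    proof -
      have sc: "s \<in> carrier G" using s S by auto
      have "u ((\<gamma> \<otimes> g) \<otimes> s) - u (\<gamma> \<otimes> g) = u (g \<otimes> s) - u g"
        using u(3)[OF g s] u(3)[of "\<gamma> \<otimes> g" s] invar[OF \<gamma> g s] g s \<gamma>c by simp
      then show ?thesis unfolding v_def using g sc \<gamma>c by (simp add: m_assoc algebra_simps)
    qed
    from invariant_constant[of S v, OF S sym gen this h] have "v h = v \<one>" .
    then show ?thesis using u(1) \<gamma>c by (simp add: v_def algebra_simps)
  qed
  then have "u \<in> quasi_hom G N" using u(2) by (auto simp: quasi_hom_def)
  then show ?thesis using u(3) by blast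
qed

subsection \<open>Cochains on finite graphs\<close>

text \<open>Cochains rather than vectors of the edge space: antisymmetric functions that vanish on
  nonadjacent pairs.\<close>

definition edge_fun :: "'v graph \<Rightarrow> ('v \<times> 'v \<Rightarrow> 'k::field) set" where
  "edge_fun H = {f. (\<forall>x y. f (x, y) = - f (y, x)) \<and> (\<forall>x y. \<not> adj H x y \<longrightarrow> f (x, y) = 0)}"

definition cyc_sum :: "('v \<times> 'v \<Rightarrow> 'k::field) \<Rightarrow> 'v list \<Rightarrow> 'k" where
  "cyc_sum f xs = (\<Sum>i<length xs. f (xs ! i, xs ! (Suc i mod length xs)))"

definition cocycles :: "nat \<Rightarrow> 'v graph \<Rightarrow> ('v \<times> 'v \<Rightarrow> 'k::field) set" where
  "cocycles q H = {f \<in> edge_fun H. \<forall>xs. is_cycle H xs \<and> length xs \<le> q \<longrightarrow> cyc_sum f xs = 0}"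

lemma edge_funI:
  assumes "\<And>x y. f (x, y) = - f (y, x)" "\<And>x y. \<not> adj H x y \<Longrightarrow> f (x, y) = 0"
  shows "f \<in> edge_fun H"
  unfolding edge_fun_def using assms by blast

lemma edge_fun_antisym: "f \<in> edge_fun H \<Longrightarrow> f (x, y) = - f (y, x)"
  unfolding edge_fun_def by blast

lemma edge_fun_nonadj: "f \<in> edge_fun H \<Longrightarrow> \<not> adj H x y \<Longrightarrow> f (x, y) = 0"
  unfolding edge_fun_def by blast

lemma subspace_edge_fun: "fv.subspace (edge_fun H)"
proof (rule fv.subspaceI)
  show "f + g \<in> edge_fun H" if "f \<in> edge_fun H" "g \<in> edge_fun H" for f g
  proof (rule edge_funI)
    fix x y
    show "(f + g) (x, y) = - (f + g) (y, x)"
      using edge_fun_antisym[OF that(1), of x y] edge_fun_antisym[OF that(2), of x y] by simp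
    show "(f + g) (x, y) = 0" if "\<not> adj H x y"
      using edge_fun_nonadj[OF \<open>f \<in> edge_fun H\<close> that] edge_fun_nonadj[OF \<open>g \<in> edge_fun H\<close> that] by simp
  qed
  show "fun_scale c f \<in> edge_fun H" if "f \<in> edge_fun H" for c f
  proof (rule edge_funI)
    fix x y
    show "fun_scale c f (x, y) = - fun_scale c f (y, x)"
      using edge_fun_antisym[OF that, of x y] by simp
    show "fun_scale c f (x, y) = 0" if "\<not> adj H x y"
      using edge_fun_nonadj[OF \<open>f \<in> edge_fun H\<close> that] by simp
  qed
qed (auto intro: edge_funI)

lemma subspace_cocycles: "fv.subspace (cocycles q H :: ('v \<times> 'v \<Rightarrow> 'k::field) set)"
proof -
  have "cyc_sum (f + g) xs = cyc_sum f xs + cyc_sum g xs" "cyc_sum (fun_scale c f) xs = c * cyc_sum f xs" "cyc_sum 0 xs = 0"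
    for f g :: "'v \<times> 'v \<Rightarrow> 'k" and c xs
    by (simp_all add: cyc_sum_def sum.distrib sum_distrib_left)
  note c = this
  show ?thesis
    by (rule fv.subspaceI)
      (simp_all add: cocycles_def c fv.subspace_0[OF subspace_edge_fun] fv.subspace_add[OF subspace_edge_fun]
        fv.subspace_scale[OF subspace_edge_fun])
qed

lemma adj_sym: "adj H x y \<longleftrightarrow> adj H y x"
  unfolding adj_def by (subst insert_commute) (rule refl)

lemma adj_irrefl: "simple_graph H \<Longrightarrow> \<not> adj H x x"
  by (auto simp: adj_def simple_graph_def)

lemma adj_verts: "simple_graph H \<Longrightarrow> adj H x y \<Longrightarrow> x \<in> verts H \<and> y \<in> verts H"
  by (auto simp: adj_def simple_graph_def)

lemma finite_edges: "simple_graph H \<Longrightarrow> finite (edges H)"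
  by (rule finite_subset[of _ "Pow (verts H)"]) (auto simp: simple_graph_def)

lemma orientation_exists:
  assumes H: "simple_graph H"
  shows "\<exists>Or. finite Or \<and> card Or = card (edges H) \<and> (\<forall>x y. (x, y) \<in> Or \<longrightarrow> adj H x y \<and> (y, x) \<notin> Or)
    \<and> (\<forall>x y. adj H x y \<longrightarrow> (x, y) \<in> Or \<or> (y, x) \<in> Or)"
proof -
  have "\<forall>e\<in>edges H. \<exists>p. e = {fst p, snd p} \<and> fst p \<noteq> snd p"
  proof
    fix e assume "e \<in> edges H"
    then have "card e = 2" using H by (auto simp: simple_graph_def)
    then obtain x y where "e = {x, y}" "x \<noteq> y" by (auto simp: card_2_iff)
    then show "\<exists>p. e = {fst p, snd p} \<and> fst p \<noteq> snd p" by (intro exI[of _ "(x, y)"]) auto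
  qed
  then obtain \<sigma> where \<sigma>: "\<And>e. e \<in> edges H \<Longrightarrow> e = {fst (\<sigma> e), snd (\<sigma> e)} \<and> fst (\<sigma> e) \<noteq> snd (\<sigma> e)" by metis
  have inj: "inj_on \<sigma> (edges H)" by (rule inj_onI) (metis \<sigma>)
  have un: "e = {x, y}" if "e \<in> edges H" "\<sigma> e = (x, y)" for e x y using \<sigma>[OF that(1)] that(2) by simp
  have ne: "x \<noteq> y" if "e \<in> edges H" "\<sigma> e = (x, y)" for e x y using \<sigma>[OF that(1)] that(2) by simp
  show ?thesis
  proof (intro exI[of _ "\<sigma> ` edges H"] conjI allI impI)
    show "finite (\<sigma> ` edges H)" using finite_edges[OF H] by simp
    show "card (\<sigma> ` edges H) = card (edges H)" using inj by (rule card_image)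
    fix x y
    show "adj H x y" if "(x, y) \<in> \<sigma> ` edges H"
      using that un unfolding adj_def by (metis imageE)
    show "(y, x) \<notin> \<sigma> ` edges H" if xy: "(x, y) \<in> \<sigma> ` edges H"
    proof
      assume "(y, x) \<in> \<sigma> ` edges H"
      then obtain e' where e': "e' \<in> edges H" "\<sigma> e' = (y, x)" by (metis imageE)
      obtain e where e: "e \<in> edges H" "\<sigma> e = (x, y)" using xy by (metis imageE)
      then have "e = e'" using un[OF e] un[OF e'] by auto
      then show False using e e' ne[OF e] by simp
    qed
    show "(x, y) \<in> \<sigma> ` edges H \<or> (y, x) \<in> \<sigma> ` edges H" if "adj H x y"
    proof -
      have e: "{x, y} \<in> edges H" using that by (simp add: adj_def)
      have "\<sigma> {x, y} = (x, y) \<or> \<sigma> {x, y} = (y, x)"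
        using \<sigma>[OF e] by (cases "\<sigma> {x, y}") (auto simp: doubleton_eq_iff)
      then show ?thesis using e by (metis imageI)
    qed
  qed
qed

lemma oriented_edge_edge_fun:
  assumes "adj H x y"
  shows "(oriented_edge x y :: _ \<Rightarrow> 'b::field) \<in> edge_fun H"
proof (rule edge_funI)
  fix a b
  have "(b, a) = (x, y) \<longleftrightarrow> (a, b) = (y, x)" "(b, a) = (y, x) \<longleftrightarrow> (a, b) = (x, y)" by auto
  then show "oriented_edge x y (a, b) = - (oriented_edge x y (b, a) :: 'b)"
    by (simp only: oriented_edge_def minus_diff_eq)
  assume "\<not> adj H a b"
  then have "(a, b) \<noteq> (x, y) \<and> (a, b) \<noteq> (y, x)" using assms adj_sym[of H a b] by auto
  then show "oriented_edge x y (a, b) = (0 :: 'b)" by (simp only: oriented_edge_def if_False diff_self)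
qed

lemma cycle_vec_edge_fun:
  assumes "is_cycle H xs"
  shows "cycle_vec xs \<in> edge_fun H"
  unfolding cycle_vec_def
  by (rule fv.subspace_sum[OF subspace_edge_fun]) (use assms in \<open>auto simp: is_cycle_def intro!: oriented_edge_edge_fun\<close>)

text \<open>Restriction to one orientation of each edge identifies antisymmetric functions with
  arbitrary functions on \<open>Or\<close>. The pairing with a cycle vector becomes the sum around
  the cycle, so the cocycles are the annihilator of the cycle vectors. Pairing over all ordered
  pairs would count every edge twice and fail in characteristic 2.\<close>

theorem dim_cocycles:
  fixes H :: "'v graph"
  assumes H: "simple_graph H"
  shows "fv.dim (cocycles q H :: ('v \<times> 'v \<Rightarrow> 'k::field) set) + dim_cycle_space TYPE('k) q H = card (edges H)"
proof -
  obtain Or where Or: "finite Or" "card Or = card (edges H)" "\<And>x y. (x, y) \<in> Or \<Longrightarrow> adj H x y \<and> (y, x) \<notin> Or"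
    "\<And>x y. adj H x y \<Longrightarrow> (x, y) \<in> Or \<or> (y, x) \<in> Or" using orientation_exists[OF H] by blast
  define r where "r f = (\<lambda>a. if a \<in> Or then f a else 0)" for f :: "'v \<times> 'v \<Rightarrow> 'k"
  define C where "C = {(cycle_vec xs :: 'v \<times> 'v \<Rightarrow> 'k) | xs. is_cycle H xs \<and> length xs \<le> q}"
  have lin: "Vector_Spaces.linear fun_scale fun_scale r" by (rule linear_funI) (auto simp: r_def fun_eq_iff)
  have inj: "inj_on r (edge_fun H)"
  proof (rule inj_onI)
    fix f g assume f: "f \<in> edge_fun H" and g: "g \<in> edge_fun H" and eq: "r f = r g"
    have "f (x, y) = g (x, y)" for x y
    proof (cases "adj H x y")
      case True
      have fo: "f a = g a" if "a \<in> Or" for a using fun_cong[OF eq, of a] that by (simp add: r_def)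
      have "f (x, y) = - f (y, x)" "g (x, y) = - g (y, x)" using f g by (auto intro: edge_fun_antisym)
      then show ?thesis using fo Or(4)[OF True] by auto
    next
      case False
      then show ?thesis using f g by (simp add: edge_fun_nonadj)
    qed
    then show "f = g" by auto
  qed
  have Cef: "C \<subseteq> edge_fun H" unfolding C_def by (auto intro!: cycle_vec_edge_fun)
  have spC: "fv.span C \<subseteq> edge_fun H" by (rule fv.span_minimal[OF Cef subspace_edge_fun])
  have dC: "fv.dim (r ` C) = fv.dim C" by (rule dim_inj_image[OF lin inj_on_subset[OF inj spC]])
  have rO: "r f \<in> supported Or" for f by (auto simp: r_def supported_def)
  have pair1: "(\<Sum>a\<in>Or. f a * oriented_edge x y a) = f (x, y)" if f: "f \<in> edge_fun H" and xy: "adj H x y" for f x y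
  proof -
    have ne: "x \<noteq> y" using adj_irrefl[OF H] xy by auto
    have fa: "f (y, x) = - f (x, y)" using f by (rule edge_fun_antisym)
    have "(\<Sum>a\<in>Or. f a * oriented_edge x y a) = (\<Sum>a\<in>Or. (if a = (x, y) then f a else 0) - (if a = (y, x) then f a else 0))"
      using ne by (intro sum.cong) (auto simp: oriented_edge_def)
    also have "\<dots> = (if (x, y) \<in> Or then f (x, y) else 0) - (if (y, x) \<in> Or then f (y, x) else 0)"
      using Or(1) by (simp add: sum_subtractf)
    also have "\<dots> = f (x, y)" using Or(3)[of x y] Or(4)[OF xy] fa by auto
    finally show ?thesis .
  qed
  have pair: "(\<Sum>a\<in>Or. f a * cycle_vec xs a) = cyc_sum f xs" if f: "f \<in> edge_fun H" and xs: "is_cycle H xs" for f xs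
  proof -
    have "(\<Sum>a\<in>Or. f a * cycle_vec xs a) = (\<Sum>i<length xs. \<Sum>a\<in>Or. f a * oriented_edge (xs ! i) (xs ! (Suc i mod length xs)) a)"
      unfolding cycle_vec_def by (simp add: sum_fun_apply sum_distrib_left) (subst sum.swap, rule refl)
    also have "\<dots> = cyc_sum f xs" unfolding cyc_sum_def using xs f by (intro sum.cong) (auto simp: is_cycle_def intro!: pair1)
    finally show ?thesis .
  qed
  have pr: "(\<Sum>a\<in>Or. r f a * r c a) = (\<Sum>a\<in>Or. f a * c a)" for f c by (rule sum.cong) (auto simp: r_def)
  have "annihilator Or (r ` C) = r ` cocycles q H"
  proof
    show "r ` cocycles q H \<subseteq> annihilator Or (r ` C)"
    proof
      fix g assume "g \<in> r ` cocycles q H"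
      then obtain f where f: "f \<in> edge_fun H" "g = r f" "\<And>xs. is_cycle H xs \<Longrightarrow> length xs \<le> q \<Longrightarrow> cyc_sum f xs = 0"
        by (auto simp: cocycles_def)
      show "g \<in> annihilator Or (r ` C)"
        unfolding annihilator_def f(2) C_def using rO pair[OF f(1)] f(3) by (auto simp: pr)
    qed
    show "annihilator Or (r ` C) \<subseteq> r ` cocycles q H"
    proof
      fix g assume g: "g \<in> annihilator Or (r ` C)"
      \<comment> \<open>The antisymmetric extension of a function given on the orientation.\<close>
      define f where "f = (\<lambda>(x, y). g (x, y) - g (y, x))"
      have g0: "g a = 0" if "a \<notin> Or" for a using g that unfolding annihilator_def supported_def by blast
      have ef: "f \<in> edge_fun H"
      proof (rule edge_funI)
        fix x y
        show "f (x, y) = - f (y, x)" by (simp add: f_def)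
        assume "\<not> adj H x y"
        then have "(x, y) \<notin> Or" "(y, x) \<notin> Or" using Or(3)[of x y] Or(3)[of y x] adj_sym[of H x y] by auto
        then show "f (x, y) = 0" using g0 by (simp add: f_def)
      qed
      have rf: "r f = g"
      proof
        fix a
        show "r f a = g a" using g0 Or(3) by (cases a) (auto simp: r_def f_def)
      qed
      have "f \<in> cocycles q H"
        unfolding cocycles_def
      proof (intro CollectI conjI ef allI impI)
        fix xs assume xs: "is_cycle H xs \<and> length xs \<le> q"
        have "cyc_sum f xs = (\<Sum>a\<in>Or. r f a * r (cycle_vec xs) a)" using pair[OF ef] xs pr by simp
        also have "\<dots> = 0" unfolding rf using g xs by (auto simp: annihilator_def C_def)
        finally show "cyc_sum f xs = 0" .
      qed
      then show "g \<in> r ` cocycles q H" using rf by blast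
    qed
  qed
  then have "fv.dim (r ` cocycles q H) + fv.dim (r ` C) = card Or"
    using dim_annihilator[OF Or(1), of "r ` C"] rO by auto
  moreover have "fv.dim (r ` cocycles q H) = fv.dim (cocycles q H :: ('v \<times> 'v \<Rightarrow> 'k) set)"
  proof (rule dim_inj_image[OF lin])
    have "fv.span (cocycles q H :: ('v \<times> 'v \<Rightarrow> 'k) set) \<subseteq> edge_fun H"
      by (rule fv.span_minimal[OF _ subspace_edge_fun]) (auto simp: cocycles_def)
    then show "inj_on r (fv.span (cocycles q H))" by (rule inj_on_subset[OF inj])
  qed
  moreover have "dim_cycle_space TYPE('k) q H = fv.dim C"
    unfolding dim_cycle_space_def C_def fscale_eq_fun_scale ..
  ultimately show ?thesis using dC Or(2) by simp
qed

section \<open>Walks, closed walks and graph metrics\<close>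

fun walk_sum :: "('v \<times> 'v \<Rightarrow> 'k::ab_group_add) \<Rightarrow> 'v list \<Rightarrow> 'k" where
  "walk_sum f [] = 0"
| "walk_sum f [x] = 0"
| "walk_sum f (x # y # zs) = f (x, y) + walk_sum f (y # zs)"

lemma walk_sum_split: "walk_sum f (as @ y # bs) = walk_sum f (as @ [y]) + walk_sum f (y # bs)"
proof (induction as)
  case (Cons a as)
  then show ?case by (cases as) (auto simp: add.assoc)
qed simp

lemma walk_sum_rev:
  assumes f: "\<And>x y. f (x, y) = - f (y, x)"
  shows "walk_sum f (rev xs) = - walk_sum f xs"
proof (induction xs rule: induct_list012)
  case (3 x y zs)
  have "walk_sum f (rev (x # y # zs)) = walk_sum f (rev (y # zs)) + f (y, x)"
    using walk_sum_split[of f "rev zs" y "[x]"] by simp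
  then show ?case using 3 f[of y x] by simp
qed auto

lemma walk_sum_eq_sum: "walk_sum f xs = (\<Sum>i<length xs - 1. f (xs ! i, xs ! Suc i))"
proof (induction xs rule: induct_list012)
  case (3 x y zs)
  then show ?case by (simp add: sum.lessThan_Suc_shift del: sum.lessThan_Suc)
qed auto

lemma cyc_sum_walk_sum:
  assumes "xs \<noteq> []"
  shows "cyc_sum f xs = walk_sum f (xs @ [hd xs])"
proof -
  have "walk_sum f (xs @ [hd xs]) = (\<Sum>i<length xs. f ((xs @ [hd xs]) ! i, (xs @ [hd xs]) ! Suc i))"
    by (simp add: walk_sum_eq_sum)
  also have "\<dots> = cyc_sum f xs"
    unfolding cyc_sum_def
  proof (rule sum.cong[OF refl])
    fix i assume i: "i \<in> {..<length xs}"
    have "(xs @ [hd xs]) ! Suc i = xs ! (Suc i mod length xs)"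
      using i assms by (cases "Suc i = length xs") (auto simp: nth_append hd_conv_nth)
    then show "f ((xs @ [hd xs]) ! i, (xs @ [hd xs]) ! Suc i) = f (xs ! i, xs ! (Suc i mod length xs))"
      using i by (simp add: nth_append)
  qed
  finally show ?thesis by simp
qed

text \<open>A generator can act trivially on a vertex of a quotient, so the projection of a word is
  a walk that may pause.\<close>

definition lazy_walk :: "'v graph \<Rightarrow> 'v list \<Rightarrow> bool" where
  "lazy_walk H p \<longleftrightarrow> p \<noteq> [] \<and> set p \<subseteq> verts H \<and> successively (\<lambda>x y. x = y \<or> adj H x y) p"

lemma walk_imp_lazy_walk: "walk H p \<Longrightarrow> lazy_walk H p"
  by (auto simp: walk_def lazy_walk_def successively_conv_nth)

lemma lazy_walk_rev: "lazy_walk H p \<Longrightarrow> lazy_walk H (rev p)"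
proof -
  have "(\<lambda>x y. y = x \<or> adj H y x) = (\<lambda>x y. x = y \<or> adj H x y)" using adj_sym[of H] by (intro ext) blast
  note eq = this
  show "lazy_walk H p \<Longrightarrow> lazy_walk H (rev p)" unfolding lazy_walk_def successively_rev eq by simp
qed

lemma lazy_walk_join:
  assumes p: "lazy_walk H p" "lazy_walk H p'" "last p = hd p'"
  shows "lazy_walk H (p @ tl p')" "hd (p @ tl p') = hd p" "last (p @ tl p') = last p'"
    "walk_sum f (p @ tl p') = walk_sum f p + walk_sum f p'"
    "length (p @ tl p') - 1 = (length p - 1) + (length p' - 1)"
proof -
  obtain z ps where p': "p' = z # ps" using p(2) by (cases p') (auto simp: lazy_walk_def)
  have ne: "p \<noteq> []" using p(1) by (simp add: lazy_walk_def)
  obtain qs where qs: "p = qs @ [z]" using ne p(3) p' by (metis append_butlast_last_id list.sel(1))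
  show "lazy_walk H (p @ tl p')"
    using p unfolding p' qs by (cases ps) (auto simp: lazy_walk_def successively_append_iff successively_Cons)
  show "hd (p @ tl p') = hd p" using ne by simp
  show "last (p @ tl p') = last p'" unfolding p' qs by simp
  show "walk_sum f (p @ tl p') = walk_sum f p + walk_sum f p'"
    unfolding p' qs using walk_sum_split[of f qs z ps] by simp
  show "length (p @ tl p') - 1 = (length p - 1) + (length p' - 1)" unfolding p' qs by simp
qed

lemma successively_split:
  "successively P (as @ y # bs) \<longleftrightarrow> successively P (as @ [y]) \<and> successively P (y # bs)"
proof (induction as)
  case (Cons a as)
  then show ?case by (cases as) auto
qed simp

text \<open>A closed walk splits at a repeated vertex, so a cochain that vanishes on short cycles
  vanishes on all short closed walks.\<close>

lemma closed_walk_sum_zero: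
  assumes H: "simple_graph H" and f: "f \<in> cocycles q H"
  shows "lazy_walk H xs \<Longrightarrow> hd xs = last xs \<Longrightarrow> length xs \<le> Suc q \<Longrightarrow> walk_sum f xs = 0"
proof (induction "length xs" arbitrary: xs rule: less_induct)
  case less
  have ef: "f \<in> edge_fun H" using f by (simp add: cocycles_def)
  have fxx: "f (x, x) = 0" for x using edge_fun_nonadj[OF ef adj_irrefl[OF H]] .
  have ne: "xs \<noteq> []" using less.prems(1) by (simp add: lazy_walk_def)
  obtain ys x where xs: "xs = ys @ [x]" using ne by (metis rev_exhaust)
  have suc: "successively (\<lambda>x y. x = y \<or> adj H x y) xs" and vs: "set xs \<subseteq> verts H"
    using less.prems(1) by (auto simp: lazy_walk_def)
  show ?case
  proof (cases "distinct ys")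
    case True
    \<comment> \<open>Without its last vertex the walk is injective. It is then a point, a pause, an
      edge traversed back and forth (cancelling by antisymmetry), or an honest cycle.\<close>
    consider "ys = []" | y where "ys = [y]" | y z where "ys = [y, z]" | "length ys \<ge> 3"
      by (cases ys; cases "tl ys"; cases "tl (tl ys)") auto
    then show ?thesis
    proof cases
      case 2
      then show ?thesis using xs less.prems(2) fxx by simp
    next
      case 3
      then show ?thesis using xs less.prems(2) edge_fun_antisym[OF ef, of y z] by simp
    next
      case 4
      then have ysne: "ys \<noteq> []" by auto
      have hx: "x = hd ys" using less.prems(2) ysne unfolding xs by simp
      have xs': "xs = ys @ [hd ys]" using xs hx by simp
      have "is_cycle H ys"
        unfolding is_cycle_def
      proof (intro conjI allI impI 4 True)
        show "set ys \<subseteq> verts H" using vs xs by auto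
        fix i assume i: "i < length ys"
        have nn: "xs ! i = ys ! i" "xs ! Suc i = ys ! (Suc i mod length ys)"
          using i ysne unfolding xs' by (cases "Suc i = length ys"; auto simp: nth_append hd_conv_nth)+
        have "ys ! i \<noteq> ys ! (Suc i mod length ys)"
        proof -
          have "Suc i mod length ys \<noteq> i" "Suc i mod length ys < length ys"
            using i 4 by (cases "Suc i = length ys"; auto)+
          then show ?thesis using True i by (metis nth_eq_iff_index_eq)
        qed
        moreover have "xs ! i = xs ! Suc i \<or> adj H (xs ! i) (xs ! Suc i)"
          using suc i xs' unfolding successively_conv_nth by simp
        ultimately show "adj H (ys ! i) (ys ! (Suc i mod length ys))" using nn by simp
      qed
      \<comment> \<open>A closed walk lists its starting vertex twice, so length at most
        \<open>Suc q\<close> leaves a cycle of length at most \<open>q\<close>.\<close>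
      moreover have "length ys \<le> q" using less.prems(3) xs by simp
      ultimately have "cyc_sum f ys = 0" using f by (simp add: cocycles_def)
      then show ?thesis using cyc_sum_walk_sum[OF ysne, of f] xs' by simp
    qed (use xs in simp)
  next
    case False
    \<comment> \<open>Cutting at the repeated vertex \<open>y\<close> leaves a closed walk from
      \<open>y\<close> to \<open>y\<close> and the remaining closed walk, both strictly
      shorter.\<close>
    then obtain as y bs cs where ys: "ys = as @ [y] @ bs @ [y] @ cs" using not_distinct_decomp by blast
    have xsd: "xs = as @ y # (bs @ y # (cs @ [x]))" using xs ys by simp
    have s1: "successively (\<lambda>x y. x = y \<or> adj H x y) (y # bs @ [y])"
      and s2: "successively (\<lambda>x y. x = y \<or> adj H x y) (as @ y # cs @ [x])"
    proof -
      let ?P = "\<lambda>x y. x = y \<or> adj H x y"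
      have a: "successively ?P (as @ [y]) \<and> successively ?P (y # bs @ y # (cs @ [x]))"
        using suc unfolding xsd by (rule successively_split[THEN iffD1])
      have "successively ?P ((y # bs) @ y # (cs @ [x]))" using a by simp
      then have b: "successively ?P ((y # bs) @ [y]) \<and> successively ?P (y # (cs @ [x]))"
        by (rule successively_split[THEN iffD1])
      show "successively ?P (y # bs @ [y])" using b by simp
      show "successively ?P (as @ y # cs @ [x])"
        by (rule successively_split[THEN iffD2]) (use a b in blast)
    qed
    have "walk_sum f xs = walk_sum f (as @ [y]) + (walk_sum f ((y # bs) @ [y]) + walk_sum f (y # cs @ [x]))"
      unfolding xsd using walk_sum_split[of f as y "bs @ y # cs @ [x]"] walk_sum_split[of f "y # bs" y "cs @ [x]"] by simp
    also have "\<dots> = walk_sum f (y # bs @ [y]) + walk_sum f (as @ y # cs @ [x])"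
      using walk_sum_split[of f as y "cs @ [x]"] by (simp add: algebra_simps)
    also have "walk_sum f (y # bs @ [y]) = 0"
    proof (rule less.hyps)
      show "lazy_walk H (y # bs @ [y])" using s1 vs by (simp add: lazy_walk_def xsd)
    qed (use less.prems(3) in \<open>simp_all add: xsd\<close>)
    also have "walk_sum f (as @ y # cs @ [x]) = 0"
    proof (rule less.hyps)
      show "lazy_walk H (as @ y # cs @ [x])" using s2 vs by (simp add: lazy_walk_def xsd)
      show "hd (as @ y # cs @ [x]) = last (as @ y # cs @ [x])" using less.prems(2) unfolding xsd by (cases as) simp_all
    qed (use less.prems(3) in \<open>simp_all add: xsd\<close>)
    finally show ?thesis by simp
  qed
qed

lemma gdist_le_imp_walk:
  assumes "gdist H x y \<le> enat L"
  shows "\<exists>p. walk H p \<and> hd p = x \<and> last p = y \<and> length p - 1 \<le> L"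
proof -
  let ?P = "{p. walk H p \<and> hd p = x \<and> last p = y}"
  let ?A = "(\<lambda>p. enat (length p - 1)) ` ?P"
  have "?P \<noteq> {}"
  proof
    assume "?P = {}"
    then have "gdist H x y = \<infinity>" unfolding gdist_def by (simp add: Inf_enat_def)
    then show False using assms by simp
  qed
  then obtain p0 where "p0 \<in> ?P" by blast
  then have "enat (length p0 - 1) \<in> ?A" by (rule imageI)
  then have "Inf ?A \<in> ?A" by (rule wellorder_InfI)
  then obtain p where "p \<in> ?P" "gdist H x y = enat (length p - 1)" unfolding gdist_def by auto
  then show ?thesis using assms by (intro exI[of _ p]) auto
qed

lemma gdist_le_walk: "walk H p \<Longrightarrow> gdist H (hd p) (last p) \<le> enat (length p - 1)"
  unfolding gdist_def by (rule INF_lower) auto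

lemma gdist_adj:
  assumes "simple_graph H" "adj H x y"
  shows "gdist H x y \<le> 1"
proof -
  have "walk H [x, y]" using assms adj_verts[OF assms] by (auto simp: walk_def less_Suc_eq)
  from gdist_le_walk[OF this] show ?thesis by (simp add: one_enat_def)
qed

text \<open>Every edge of the walk is replaced by a walk in the other graph and the pieces are
  joined. Vanishing of the sum is carried along so that the lemma serves cochains as well as
  distances.\<close>

lemma walk_transfer:
  assumes e: "\<And>x y. adj H x y \<Longrightarrow> \<exists>P. lazy_walk G P \<and> hd P = x \<and> last P = y \<and> length P - 1 \<le> L \<and> walk_sum f P = 0"
    and v: "verts H \<subseteq> verts G"
  shows "walk H zs \<Longrightarrow> \<exists>P. lazy_walk G P \<and> hd P = hd zs \<and> last P = last zs \<and> length P - 1 \<le> L * (length zs - 1) \<and> walk_sum f P = 0"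
proof (induction zs rule: induct_list012)
  case 1
  then show ?case by (simp add: walk_def)
next
  case (2 x)
  then show ?case using v by (intro exI[of _ "[x]"]) (auto simp: walk_def lazy_walk_def)
next
  case (3 x y zs)
  have w: "walk H (y # zs)" "adj H x y" using 3(3) unfolding walk_def by force+
  obtain P where P: "lazy_walk G P" "hd P = x" "last P = y" "length P - 1 \<le> L" "walk_sum f P = 0"
    using e[OF w(2)] by blast
  obtain P' where P': "lazy_walk G P'" "hd P' = y" "last P' = last (y # zs)" "length P' - 1 \<le> L * length zs" "walk_sum f P' = 0"
    using 3(2)[OF w(1)] by auto
  have "last P = hd P'" using P P' by simp
  note j = lazy_walk_join[OF P(1) P'(1) this]
  have "walk_sum f (P @ tl P') = 0" using j(4)[of f] P(5) P'(5) by simp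
  moreover have "length (P @ tl P') - 1 \<le> L * (length (x # y # zs) - 1)" using j(5) P(4) P'(4) by simp
  ultimately show ?case
    using j(1-3) P(2) P'(3) by (intro exI[of _ "P @ tl P'"] conjI) simp_all
qed

text \<open>The map \<open>\<Theta>\<close> records the sums of a cocycle along chosen walks for the
  oriented edges of \<open>H\<close>. It is injective: an edge of \<open>G\<close> can be replaced
  by a walk made of such pieces, and closing it gives a closed walk too short to carry a nonzero
  sum.\<close>

theorem dim_cocycles_le_edges:
  fixes G H :: "'v graph"
  assumes G: "simple_graph G" and H: "simple_graph H" and v: "verts H = verts G"
    and L1: "\<And>x y. x \<in> verts G \<Longrightarrow> y \<in> verts G \<Longrightarrow> gdist G x y \<le> enat L1 * gdist H x y"
    and L2: "\<And>x y. x \<in> verts G \<Longrightarrow> y \<in> verts G \<Longrightarrow> gdist H x y \<le> enat L2 * gdist G x y"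
  shows "fv.dim (cocycles (L1 * L2 + 1) G :: ('v \<times> 'v \<Rightarrow> 'k::field) set) \<le> card (edges H)"
proof -
  \<comment> \<open>An edge of \<open>G\<close> is bridged by at most \<open>L2\<close> edges of
    \<open>H\<close>, each replaced by at most \<open>L1\<close> steps in \<open>G\<close>; the edge
    itself closes the walk and adds 1.\<close>
  let ?q = "L1 * L2 + 1"
  let ?Z = "cocycles ?q G :: ('v \<times> 'v \<Rightarrow> 'k) set"
  obtain Or where Or: "finite Or" "card Or = card (edges H)" "\<And>x y. (x, y) \<in> Or \<Longrightarrow> adj H x y \<and> (y, x) \<notin> Or"
    "\<And>x y. adj H x y \<Longrightarrow> (x, y) \<in> Or \<or> (y, x) \<in> Or" using orientation_exists[OF H] by blast
  have "\<forall>a. a \<in> Or \<longrightarrow> (\<exists>p. lazy_walk G p \<and> hd p = fst a \<and> last p = snd a \<and> length p - 1 \<le> L1)"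
  proof (intro allI impI)
    fix a assume "a \<in> Or"
    then have a: "adj H (fst a) (snd a)" using Or(3)[of "fst a" "snd a"] by simp
    have "gdist G (fst a) (snd a) \<le> enat L1 * gdist H (fst a) (snd a)"
      using adj_verts[OF H a] v by (intro L1) auto
    also have "\<dots> \<le> enat L1 * 1" using gdist_adj[OF H a] by (intro mult_left_mono) auto
    finally have "gdist G (fst a) (snd a) \<le> enat L1" by simp
    from gdist_le_imp_walk[OF this] obtain p
      where p: "walk G p" "hd p = fst a" "last p = snd a" "length p - 1 \<le> L1" by blast
    show "\<exists>p. lazy_walk G p \<and> hd p = fst a \<and> last p = snd a \<and> length p - 1 \<le> L1"
      using walk_imp_lazy_walk[OF p(1)] p(2-4) by (intro exI[of _ p] conjI)
  qed
  then obtain P where P: "\<And>a. a \<in> Or \<Longrightarrow> lazy_walk G (P a) \<and> hd (P a) = fst a \<and> last (P a) = snd a \<and> length (P a) - 1 \<le> L1"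
    by metis
  define \<Theta> where "\<Theta> f = (\<lambda>a. if a \<in> Or then walk_sum f (P a) else 0)" for f :: "'v \<times> 'v \<Rightarrow> 'k"
  have lin: "Vector_Spaces.linear fun_scale fun_scale \<Theta>"
    by (rule linear_funI) (auto simp: \<Theta>_def fun_eq_iff walk_sum_eq_sum sum.distrib sum_distrib_left)
  have spZ: "fv.span ?Z = ?Z" using subspace_cocycles fv.span_eq_iff by blast
  have ker: "f = 0" if f: "f \<in> ?Z" and z: "\<Theta> f = 0" for f
  proof -
    have ef: "f \<in> edge_fun G" using f by (simp add: cocycles_def)
    have e: "\<exists>p. lazy_walk G p \<and> hd p = x \<and> last p = y \<and> length p - 1 \<le> L1 \<and> walk_sum f p = 0" if xy: "adj H x y" for x y
    proof (cases "(x, y) \<in> Or")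
      case True
      then show ?thesis using P[OF True] fun_cong[OF z, of "(x, y)"] by (intro exI[of _ "P (x, y)"]) (auto simp: \<Theta>_def)
    next
      case False
      then have yx: "(y, x) \<in> Or" using Or(4)[OF xy] by auto
      have "P (y, x) \<noteq> []" using P[OF yx] by (auto simp: lazy_walk_def)
      moreover have "walk_sum f (rev (P (y, x))) = 0"
        using walk_sum_rev[of f "P (y, x)", OF edge_fun_antisym[OF ef]] fun_cong[OF z, of "(y, x)"] yx by (simp add: \<Theta>_def)
      ultimately show ?thesis using P[OF yx] lazy_walk_rev[of G "P (y, x)"]
        by (intro exI[of _ "rev (P (y, x))"]) (auto simp: hd_rev last_rev)
    qed
    have "f (x, y) = 0" for x y
    proof (cases "adj G x y")
      case True
      have xyv: "x \<in> verts G" "y \<in> verts G" using adj_verts[OF G True] by auto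
      have "gdist H x y \<le> enat L2 * gdist G x y" using xyv by (rule L2)
      also have "\<dots> \<le> enat L2 * 1" using gdist_adj[OF G True] by (intro mult_left_mono) auto
      finally have "gdist H x y \<le> enat L2" by simp
      from gdist_le_imp_walk[OF this] obtain zs
        where zs: "walk H zs" "hd zs = x" "last zs = y" "length zs - 1 \<le> L2" by blast
      obtain p where p: "lazy_walk G p" "hd p = x" "last p = y" "length p - 1 \<le> L1 * (length zs - 1)" "walk_sum f p = 0"
        using walk_transfer[of H G L1 f zs, OF e _ zs(1)] v unfolding zs(2,3) by blast
      have yx: "lazy_walk G [y, x]" using True adj_sym[of G x y] xyv by (auto simp: lazy_walk_def)
      have "last p = hd [y, x]" using p by simp
      note j = lazy_walk_join[OF p(1) yx this]
      have "length p - 1 \<le> L1 * L2" using p(4) mult_le_mono2[OF zs(4), of L1] by linarith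
      then have "walk_sum f (p @ tl [y, x]) = 0"
        using j p by (intro closed_walk_sum_zero[OF G f]) auto
      then have "f (y, x) = 0" using j(4)[of f] p(5) by simp
      then show ?thesis using edge_fun_antisym[OF ef, of x y] by simp
    qed (use edge_fun_nonadj[OF ef] in auto)
    then show ?thesis by (auto simp: fun_eq_iff)
  qed
  have inj: "inj_on \<Theta> (fv.span ?Z)"
    unfolding spZ
  proof (rule inj_onI)
    fix f g assume fg: "f \<in> ?Z" "g \<in> ?Z" "\<Theta> f = \<Theta> g"
    have "\<Theta> (f - g) = 0" using vector_space_pair.linear_diff[OF fun_pair lin] fg(3) by simp
    moreover have "f - g \<in> ?Z" using fv.subspace_diff[OF subspace_cocycles] fg by blast
    ultimately show "f = g" using ker[of "f - g"] by simp
  qed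
  have "fv.dim ?Z = fv.dim (\<Theta> ` ?Z)" using dim_inj_image[OF lin inj] by simp
  also have "\<dots> \<le> fv.dim (supported Or :: ('v \<times> 'v \<Rightarrow> 'k) set)"
    by (rule dim_mono_supported[OF Or(1) order_refl]) (auto simp: supported_def \<Theta>_def)
  also have "\<dots> = card (edges H)" using dim_supported[OF Or(1), where 'k='k] Or(2) by simp
  finally show ?thesis .
qed

text \<open>The cycle length is determined by the two Lipschitz constants, so it is the same for all
  n, and the infimum over q admits a different one for each competing sequence.\<close>

theorem beta_le_cost:
  fixes Gs :: "nat \<Rightarrow> 'v graph"
  assumes Gs: "\<And>n. simple_graph (Gs n)"
  shows "beta TYPE('k::field) Gs \<le> cost Gs - 1"
proof -
  have "beta TYPE('k) Gs + 1 \<le> cost Gs"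
    unfolding cost_def
  proof (rule INF_greatest)
    fix Hs assume "Hs \<in> {Hs. graph_seq Hs \<and> (\<forall>n. verts (Hs n) = verts (Gs n)) \<and> graph_equiv Gs Hs}"
    then have Hs: "\<And>n. simple_graph (Hs n)" "\<And>n. verts (Hs n) = verts (Gs n)" "graph_prec Hs Gs" "graph_prec Gs Hs"
      by (auto simp: graph_seq_def graph_equiv_def)
    obtain L1 :: nat where L1: "\<And>n x y. x \<in> verts (Gs n) \<Longrightarrow> y \<in> verts (Gs n) \<Longrightarrow> gdist (Gs n) x y \<le> enat L1 * gdist (Hs n) x y"
      using Hs(3) unfolding graph_prec_def by blast
    obtain L2 :: nat where L2: "\<And>n x y. x \<in> verts (Gs n) \<Longrightarrow> y \<in> verts (Gs n) \<Longrightarrow> gdist (Hs n) x y \<le> enat L2 * gdist (Gs n) x y"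
      using Hs(4) unfolding graph_prec_def Hs(2) by blast
    let ?q = "L1 * L2 + 1"
    have le: "real (card (edges (Gs n))) - real (dim_cycle_space TYPE('k) ?q (Gs n)) \<le> real (card (edges (Hs n)))" for n
      using dim_cocycles_le_edges[OF Gs Hs(1,2) L1 L2, of n, where 'k='k] dim_cocycles[OF Gs, of ?q n, where 'k='k] by linarith
    have "liminf (\<lambda>n. ereal ((real (card (edges (Gs n))) - real (dim_cycle_space TYPE('k) ?q (Gs n))) / real (card (verts (Gs n)))))
        \<le> edge_density Hs"
      unfolding edge_density_def Hs(2)
      by (rule Liminf_mono, rule always_eventually) (use le in \<open>auto intro!: divide_right_mono\<close>)
    then have "s_q TYPE('k) ?q Gs + 1 \<le> edge_density Hs"
      unfolding s_q_def
      by (cases "liminf (\<lambda>n. ereal ((real (card (edges (Gs n))) - real (dim_cycle_space TYPE('k) ?q (Gs n))) / real (card (verts (Gs n)))))")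
        (auto simp: one_ereal_def)
    moreover have "beta TYPE('k) Gs + 1 \<le> s_q TYPE('k) ?q Gs + 1"
      unfolding beta_def by (intro add_right_mono INF_lower) auto
    ultimately show "beta TYPE('k) Gs + 1 \<le> edge_density Hs" by (rule order_trans[rotated])
  qed
  then show ?thesis by (cases "beta TYPE('k) Gs"; cases "cost Gs") (auto simp: one_ereal_def)
qed

section \<open>Change of generators and closed words of bounded length\<close>

context group
begin

lemma path_sum_concat:
  assumes ws: "\<And>t. t \<in> T \<Longrightarrow> set (ws t) \<subseteq> carrier G \<and> eval_word G (ws t) = t"
    and T: "T \<subseteq> carrier G" and g: "g \<in> carrier G" and w: "set w \<subseteq> T"
  shows "path_sum G F g (concat (map ws w)) = path_sum G (\<lambda>g t. path_sum G F g (ws t)) g w"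
    "eval_word G (concat (map ws w)) = eval_word G w"
proof -
  have "path_sum G F g (concat (map ws w)) = path_sum G (\<lambda>g t. path_sum G F g (ws t)) g w
    \<and> eval_word G (concat (map ws w)) = eval_word G w"
    using g w
  proof (induction w arbitrary: g)
    case (Cons t w)
    have t: "t \<in> T" "t \<in> carrier G" "set (ws t) \<subseteq> carrier G" "eval_word G (ws t) = t"
      using Cons.prems ws[of t] T by auto
    have cw: "set (concat (map ws w)) \<subseteq> carrier G" using Cons.prems ws by fastforce
    show ?case using Cons.IH[of "g \<otimes> t"] Cons.prems t cw
      by (simp add: path_sum_append eval_word_append)
  qed simp
  then show "path_sum G F g (concat (map ws w)) = path_sum G (\<lambda>g t. path_sum G F g (ws t)) g w"
    "eval_word G (concat (map ws w)) = eval_word G w" by auto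
qed

text \<open>Rewriting the relators of a finite presentation in the generators \<open>S\<close> shows that closed words
  in \<open>S\<close> are generated by closed words of bounded length.\<close>

lemma short_closed_words_suffice:
  assumes pres: "is_fin_pres G T R"
    and S: "S \<subseteq> carrier G" "finite S" and sym: "\<And>s. s \<in> S \<Longrightarrow> inv s \<in> S" and gen: "generate G S = carrier G"
  shows "\<exists>q. \<forall>F :: 'a \<Rightarrow> 'a \<Rightarrow> 'k::ab_group_add.
     (\<forall>g\<in>carrier G. \<forall>w. set w \<subseteq> S \<and> eval_word G w = \<one> \<and> length w \<le> q \<longrightarrow> path_sum G F g w = 0)
     \<longrightarrow> (\<forall>g\<in>carrier G. \<forall>w. set w \<subseteq> S \<and> eval_word G w = \<one> \<longrightarrow> path_sum G F g w = 0)"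
proof -
  have T: "T \<subseteq> carrier G" "finite T" "generate G T = carrier G" "finite R" and Ti: "\<And>t. t \<in> T \<Longrightarrow> inv t \<in> T"
    using pres unfolding is_fin_pres_def by blast+
  have "\<forall>t\<in>T. \<exists>w. set w \<subseteq> S \<and> eval_word G w = t" using generate_word[OF S(1) sym] gen T(1) by auto
  then obtain ws where ws: "\<And>t. t \<in> T \<Longrightarrow> set (ws t) \<subseteq> S \<and> eval_word G (ws t) = t" by metis
  have "\<forall>s\<in>S. \<exists>w. set w \<subseteq> T \<and> eval_word G w = s" using generate_word[OF T(1) Ti] T(3) S(1) by auto
  then obtain vs where vs: "\<And>s. s \<in> S \<Longrightarrow> set (vs s) \<subseteq> T \<and> eval_word G (vs s) = s" by metis
  have ws': "set (ws t) \<subseteq> carrier G \<and> eval_word G (ws t) = t" if "t \<in> T" for t using ws[OF that] S(1) by auto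
  have vs': "set (vs t) \<subseteq> carrier G \<and> eval_word G (vs t) = t" if "t \<in> S" for t using vs[OF that] T(1) by auto
  let ?P = "pres_rels G T R"
  have finP: "finite ?P"
  proof -
    have "{[t, inv t] |t. t \<in> T} = (\<lambda>t. [t, inv t]) ` T" by auto
    then show ?thesis unfolding pres_rels_def using T(2,4) by simp
  qed
  \<comment> \<open>A bound for two finite families of closed words in \<open>S\<close>: the
    rewritten relators, and each s followed by the twice rewritten word for its inverse. Sums take
    the place of maxima.\<close>
  define q where "q = (\<Sum>r\<in>?P. length (concat (map ws r))) + (\<Sum>s\<in>S. Suc (length (concat (map ws (vs (inv s))))))"
  have q1: "length (concat (map ws r)) \<le> q" if "r \<in> ?P" for r
    unfolding q_def using finP member_le_sum[OF that, of "\<lambda>r. length (concat (map ws r))"] by simp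
  have q2: "Suc (length (concat (map ws (vs (inv s))))) \<le> q" if "s \<in> S" for s
    unfolding q_def using S(2) member_le_sum[OF that, of "\<lambda>s. Suc (length (concat (map ws (vs (inv s)))))"] by simp
  show ?thesis
  proof (intro exI[of _ q] allI impI ballI)
    fix F :: "'a \<Rightarrow> 'a \<Rightarrow> 'k" and g w
    assume short: "\<forall>g\<in>carrier G. \<forall>w. set w \<subseteq> S \<and> eval_word G w = \<one> \<and> length w \<le> q \<longrightarrow> path_sum G F g w = 0"
      and g: "g \<in> carrier G" and w: "set w \<subseteq> S \<and> eval_word G w = \<one>"
    \<comment> \<open>The cochain induced on the edges of the presentation: follow the
      \<open>S\<close>-word of the generator t.\<close>
    define F' where "F' g t = path_sum G F g (ws t)" for g t
    have F'1: "path_sum G F g (concat (map ws v)) = path_sum G F' g v" if "g \<in> carrier G" "set v \<subseteq> T" for g v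
      unfolding F'_def by (rule path_sum_concat(1)[OF ws' T(1) that])
    have F'2: "eval_word G (concat (map ws v)) = eval_word G v" if "set v \<subseteq> T" for v
      by (rule path_sum_concat(2)[OF ws' T(1) one_closed that])
    have F'3: "set (concat (map ws v)) \<subseteq> S" if "set v \<subseteq> T" for v using ws that by fastforce
    have "path_sum G F' g r = 0" if g: "g \<in> carrier G" and r: "r \<in> ?P" for g r
    proof -
      note rp = pres_rels_props[OF pres r]
      have "path_sum G F g (concat (map ws r)) = 0"
        using short[rule_format, OF g, of "concat (map ws r)"] F'2[OF rp(1)] F'3[OF rp(1)] rp(2) q1[OF r] by simp
      then show ?thesis using F'1[OF g rp(1)] by simp
    qed
    then have clT: "path_sum G F' g v = 0" if "set v \<subseteq> T" "eval_word G v = \<one>" "g \<in> carrier G" for v g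
      using relators_imp_closed[OF pres _ that, of F'] by blast
    \<comment> \<open>The closed word made of s and a rewritten inverse is short, so its sum
      vanishes; in \<open>T\<close> the corresponding closed word has sum zero by the relators.
      Comparing the two expresses \<open>F\<close> on s through \<open>F'\<close>, so every closed
      word in \<open>S\<close> becomes a closed word in \<open>T\<close>.\<close>
    have Fs: "F g s = path_sum G F' g (vs s)" if g: "g \<in> carrier G" and s: "s \<in> S" for g s
    proof -
      have sc: "s \<in> carrier G" using s S by auto
      have iS: "inv s \<in> S" using sym[OF s] .
      let ?v = "vs (inv s)"
      have v: "set ?v \<subseteq> T" "eval_word G ?v = inv s" using vs[OF iS] by auto
      have gs: "g \<otimes> s \<in> carrier G" using g sc by simp
      have "path_sum G F g (s # concat (map ws ?v)) = 0"
      proof (rule short[rule_format, OF g], intro conjI)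
        show "set (s # concat (map ws ?v)) \<subseteq> S" using s F'3[OF v(1)] by simp
        show "eval_word G (s # concat (map ws ?v)) = \<one>" using F'2[OF v(1)] v(2) sc by simp
        show "length (s # concat (map ws ?v)) \<le> q" using q2[OF s] by simp
      qed
      then have e1: "F g s + path_sum G F' (g \<otimes> s) ?v = 0" using F'1[OF gs v(1)] by simp
      have "path_sum G F' g (vs s @ ?v) = 0"
        using vs[OF s] v vs'[OF s] vs'[OF iS] sc g by (intro clT) (auto simp: eval_word_append)
      then have "F g s + path_sum G F' (g \<otimes> s) ?v = path_sum G F' g (vs s) + path_sum G F' (g \<otimes> s) ?v"
        using vs'[OF s] g e1 by (simp add: path_sum_append)
      then show ?thesis by (simp only: add_right_cancel)
    qed
    have eq: "path_sum G F g w = path_sum G (\<lambda>g s. path_sum G F' g (vs s)) g w" if "set w \<subseteq> S" "g \<in> carrier G" for w g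
      using that
    proof (induction w arbitrary: g)
      case (Cons s w)
      then have "g \<otimes> s \<in> carrier G" using S(1) by auto
      then show ?case using Cons Fs by simp
    qed simp
    have wS: "set w \<subseteq> S" using w by blast
    have "path_sum G F g w = path_sum G F' g (concat (map vs w))"
      using eq[OF wS g] path_sum_concat(1)[of S vs g w F', OF vs' S(1) g wS] by simp
    also have "\<dots> = 0"
    proof (rule clT[OF _ _ g])
      show "set (concat (map vs w)) \<subseteq> T" using wS vs by fastforce
      show "eval_word G (concat (map vs w)) = \<one>"
        using path_sum_concat(2)[of S vs g w, OF vs' S(1) g wS] w by simp
    qed
    finally show "path_sum G F g w = 0" .
  qed
qed

end

subsection \<open>Cayley graphs of the quotients\<close>

locale cayley_chain = residual_chain G Ns for G (structure) and Ns +
  fixes S :: "'a set"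
  assumes S_fin: "finite S" and S_sub: "S \<subseteq> carrier G" and S_sym: "s \<in> S \<Longrightarrow> inv s \<in> S"
    and S_gen: "generate G S = carrier G"
begin

text \<open>Inverting turns the left multiplications of the Cayley graph into the right multiplications
  of the presentation complex: the vertex of \<open>h\<close> is the coset of \<open>inv h\<close>.\<close>

definition vert :: "nat \<Rightarrow> 'a \<Rightarrow> 'a set" where
  "vert n h = Ns n #> inv h"

lemma vert_mem: "h \<in> carrier G \<Longrightarrow> vert n h \<in> rcosets (Ns n)"
  by (auto simp: vert_def RCOSETS_def)

lemma vert_surj: "x \<in> rcosets (Ns n) \<Longrightarrow> \<exists>h\<in>carrier G. x = vert n h"
proof -
  assume "x \<in> rcosets (Ns n)"
  then obtain k where "k \<in> carrier G" "x = Ns n #> k" by (auto simp: RCOSETS_def)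
  then show ?thesis by (intro bexI[of _ "inv k"]) (auto simp: vert_def)
qed

lemma vert_mult_left:
  assumes "\<gamma> \<in> Ns n" "h \<in> carrier G"
  shows "vert n (\<gamma> \<otimes> h) = vert n h"
proof -
  have \<gamma>: "\<gamma> \<in> carrier G" using assms Ns_carrier by auto
  let ?\<nu> = "inv h \<otimes> inv \<gamma> \<otimes> h"
  have \<nu>: "?\<nu> \<in> Ns n"
    using normal.inv_op_closed1[OF normal assms(2)] subgroup.m_inv_closed[OF Ns_subgroup assms(1)] by blast
  have "inv (\<gamma> \<otimes> h) = ?\<nu> \<otimes> inv h" using \<gamma> assms(2) by (simp add: inv_mult_group m_assoc)
  then have "vert n (\<gamma> \<otimes> h) = (Ns n #> ?\<nu>) #> inv h"
    unfolding vert_def using assms(2) \<gamma> by (simp add: coset_mult_assoc[OF Ns_carrier])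
  also have "Ns n #> ?\<nu> = Ns n" using \<nu> \<gamma> assms(2) by (intro coset_join2[OF _ Ns_subgroup]) auto
  finally show ?thesis by (simp add: vert_def)
qed

lemma vert_eqD:
  assumes "vert n h = vert n k" "h \<in> carrier G" "k \<in> carrier G"
  shows "\<exists>\<gamma>\<in>Ns n. k = \<gamma> \<otimes> h"
proof -
  have "inv k \<in> Ns n #> inv h" using assms rcos_self[OF _ Ns_subgroup, of "inv k" n] by (simp add: vert_def)
  then obtain \<nu> where \<nu>: "\<nu> \<in> Ns n" "inv k = \<nu> \<otimes> inv h" by (auto simp: r_coset_def)
  have \<nu>c: "\<nu> \<in> carrier G" using \<nu> Ns_carrier by auto
  have "k = inv (\<nu> \<otimes> inv h)" using \<nu>(2) assms by (metis inv_inv)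
  also have "\<dots> = h \<otimes> inv \<nu>" using \<nu>c assms by (simp add: inv_mult_group)
  also have "\<dots> = (h \<otimes> inv \<nu> \<otimes> inv h) \<otimes> h" using \<nu>c assms by (simp add: m_assoc)
  finally have "k = (h \<otimes> inv \<nu> \<otimes> inv h) \<otimes> h" .
  moreover have "h \<otimes> inv \<nu> \<otimes> inv h \<in> Ns n"
    using normal.inv_op_closed2[OF normal assms(2)] subgroup.m_inv_closed[OF Ns_subgroup \<nu>(1)] by blast
  ultimately show ?thesis by blast
qed

lemma vert_right_mult_eq:
  assumes "vert n h = vert n k" "h \<in> carrier G" "k \<in> carrier G" "a \<in> carrier G"
  shows "vert n (h \<otimes> a) = vert n (k \<otimes> a)"
proof -
  obtain \<gamma> where \<gamma>: "\<gamma> \<in> Ns n" "k = \<gamma> \<otimes> h" using vert_eqD[OF assms(1-3)] by blast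
  have "\<gamma> \<in> carrier G" using \<gamma> Ns_carrier by blast
  then show ?thesis using vert_mult_left[of \<gamma> n "h \<otimes> a"] assms \<gamma> by (simp add: m_assoc)
qed

lemma vert_eq_self:
  assumes "vert n (h \<otimes> a) = vert n h" "h \<in> carrier G" "a \<in> carrier G"
  shows "a \<in> Ns n"
proof -
  obtain \<gamma> where \<gamma>: "\<gamma> \<in> Ns n" "h \<otimes> a = \<gamma> \<otimes> h" using vert_eqD[of n h "h \<otimes> a"] assms by auto
  have \<gamma>c: "\<gamma> \<in> carrier G" using \<gamma> Ns_carrier by auto
  have "a = inv h \<otimes> (h \<otimes> a)" using assms by (simp flip: m_assoc)
  also have "\<dots> = inv h \<otimes> \<gamma> \<otimes> h" using \<gamma>(2) \<gamma>c assms by (simp add: m_assoc)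
  finally show ?thesis using normal.inv_op_closed1[OF normal assms(2) \<gamma>(1)] by simp
qed

abbreviation Cay :: "nat \<Rightarrow> 'a set graph" where
  "Cay n \<equiv> cayley_quot G (Ns n) S"

lemma coset_mult_vert:
  assumes "s \<in> carrier G" "h \<in> carrier G"
  shows "(Ns n #> s) <#> vert n h = vert n (h \<otimes> inv s)"
  unfolding vert_def using assms by (simp add: normal.rcos_sum[OF normal] inv_mult_group)

lemma verts_Cay: "verts (Cay n) = rcosets (Ns n)"
  by (simp add: verts_def cayley_quot_def)

text \<open>Inverting in \<open>vert\<close> turns left multiplication by s into right
  multiplication by its inverse. An unordered edge may be read from either end, and symmetry of
  \<open>S\<close> absorbs the change.\<close>

lemma adj_Cay:
  assumes h: "h \<in> carrier G"
  shows "adj (Cay n) (vert n h) y \<longleftrightarrow> y \<noteq> vert n h \<and> (\<exists>s\<in>S. y = vert n (h \<otimes> s))"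
proof
  assume "adj (Cay n) (vert n h) y"
  then obtain x' y' s where e: "{vert n h, y} = {x', y'}" "x' \<in> rcosets (Ns n)" "y' \<in> rcosets (Ns n)" "x' \<noteq> y'"
    "s \<in> S" "y' = (Ns n #> s) <#> x'"
    unfolding adj_def edges_def cayley_quot_def by auto
  have sc: "s \<in> carrier G" "inv s \<in> S" "inv s \<in> carrier G" using e S_sub S_sym by auto
  from e(1) consider "vert n h = x'" "y = y'" | "vert n h = y'" "y = x'" by (auto simp: doubleton_eq_iff)
  then show "y \<noteq> vert n h \<and> (\<exists>s\<in>S. y = vert n (h \<otimes> s))"
  proof cases
    case 1
    then have "y = vert n (h \<otimes> inv s)" using e(6) coset_mult_vert[OF sc(1) h] by auto
    then show ?thesis using 1 e(4) sc(2) by auto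
  next
    case 2
    obtain k where k: "k \<in> carrier G" "y = vert n k" using vert_surj e(2) 2 by blast
    have "vert n (k \<otimes> inv s) = vert n h" using 2 e(6) coset_mult_vert[OF sc(1) k(1)] k(2) by auto
    then have "vert n ((k \<otimes> inv s) \<otimes> s) = vert n (h \<otimes> s)" using k(1) h sc(1,3) by (intro vert_right_mult_eq) simp_all
    then have "y = vert n (h \<otimes> s)" using k sc by (simp add: m_assoc)
    then show ?thesis using 2 e(4,5) by auto
  qed
next
  assume a: "y \<noteq> vert n h \<and> (\<exists>s\<in>S. y = vert n (h \<otimes> s))"
  then obtain s where s: "s \<in> S" "y = vert n (h \<otimes> s)" by blast
  have sc: "s \<in> carrier G" "inv s \<in> S" using s S_sub S_sym by auto
  have "y = (Ns n #> inv s) <#> vert n h" using s coset_mult_vert[of "inv s" h] sc h by simp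
  moreover have "y \<in> rcosets (Ns n)" using s sc h by (auto intro: vert_mem)
  ultimately show "adj (Cay n) (vert n h) y"
    unfolding adj_def edges_def cayley_quot_def snd_conv
    using a sc(2) vert_mem[OF h, of n] by (intro CollectI exI[of _ "vert n h"] exI[of _ y]) blast
qed

lemma simple_Cay: "simple_graph (Cay n)"
proof -
  have "finite (verts (Cay n))" using finidx by (simp add: verts_Cay)
  moreover have "e \<subseteq> verts (Cay n) \<and> card e = 2" if "e \<in> edges (Cay n)" for e
  proof -
    obtain x y where "e = {x, y}" "x \<in> rcosets (Ns n)" "y \<in> rcosets (Ns n)" "x \<noteq> y"
      using \<open>e \<in> edges (Cay n)\<close> unfolding edges_def cayley_quot_def by auto
    then show ?thesis by (auto simp: verts_Cay)
  qed
  ultimately show ?thesis by (simp add: simple_graph_def)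
qed

section \<open>Descent of potentials to cochains on the Cayley graphs\<close>

definition wball :: "nat \<Rightarrow> 'a set" where
  "wball q = eval_word G ` {w. set w \<subseteq> S \<and> length w \<le> q}"

lemma finite_wball: "finite (wball q)"
  unfolding wball_def using finite_lists_length_le[OF S_fin] by blast

lemma wballI: "set w \<subseteq> S \<Longrightarrow> length w \<le> q \<Longrightarrow> eval_word G w \<in> wball q"
  unfolding wball_def by blast

text \<open>The lift h of the vertex and the generator s are chosen from x, y and n alone. Since the
  choices do not involve \<open>u\<close>, the map is linear in \<open>u\<close> by definition,
  before any independence of choices is known.\<close>

definition cochain_of :: "nat \<Rightarrow> ('a \<Rightarrow> 'k::field) \<Rightarrow> 'a set \<times> 'a set \<Rightarrow> 'k" where
  "cochain_of n u = (\<lambda>(x, y). if adj (Cay n) x y then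
     (let h = (SOME h. h \<in> carrier G \<and> x = vert n h); s = (SOME s. s \<in> S \<and> y = vert n (h \<otimes> s)) in u (h \<otimes> s) - u h) else 0)"

text \<open>Two lifts of a vertex differ by a left factor in \<open>Ns n\<close>, which does not
  affect differences of \<open>u\<close>. Two generators with the same effect on a vertex differ by
  an element of \<open>Ns n\<close> of word length at most 2, hence coincide; this is where q \<ge>
  2 enters. If the step is a pause, the generator itself lies in \<open>Ns n\<close> and is
  trivial.\<close>

lemma cochain_of_eval:
  fixes u :: "'a \<Rightarrow> 'k::field"
  assumes sep: "Ns n \<inter> wball q \<subseteq> {\<one>}" and q: "q \<ge> 2" and u: "u \<in> quasi_hom G (Ns n)"
    and h: "h \<in> carrier G" and s: "s \<in> S"
  shows "cochain_of n u (vert n h, vert n (h \<otimes> s)) = u (h \<otimes> s) - u h"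
proof -
  have sc: "s \<in> carrier G" using s S_sub by auto
  show ?thesis
  proof (cases "adj (Cay n) (vert n h) (vert n (h \<otimes> s))")
    case True
    define h0 where "h0 = (SOME k. k \<in> carrier G \<and> vert n h = vert n k)"
    define s0 where "s0 = (SOME t. t \<in> S \<and> vert n (h \<otimes> s) = vert n (h0 \<otimes> t))"
    have h0: "h0 \<in> carrier G" "vert n h = vert n h0"
      unfolding h0_def using someI[of "\<lambda>k. k \<in> carrier G \<and> vert n h = vert n k" h] h by auto
    have hs: "vert n (h \<otimes> s) = vert n (h0 \<otimes> s)" using vert_right_mult_eq[OF h0(2) h h0(1) sc] .
    have s0: "s0 \<in> S" "vert n (h \<otimes> s) = vert n (h0 \<otimes> s0)"
      unfolding s0_def using someI[of "\<lambda>t. t \<in> S \<and> vert n (h \<otimes> s) = vert n (h0 \<otimes> t)" s] s hs by auto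
    have s0c: "s0 \<in> carrier G" using s0 S_sub by auto
    have "h0 \<otimes> s \<otimes> (inv s \<otimes> s0) = h0 \<otimes> s0"
      using m_assoc[of s "inv s" s0] h0 sc s0c by (simp add: m_assoc)
    then have "vert n (h0 \<otimes> s \<otimes> (inv s \<otimes> s0)) = vert n (h0 \<otimes> s)" using s0 hs by simp
    then have "inv s \<otimes> s0 \<in> Ns n" using vert_eq_self[of n "h0 \<otimes> s" "inv s \<otimes> s0"] h0 sc s0c by simp
    moreover have "inv s \<otimes> s0 \<in> wball q"
      using wballI[of "[inv s, s0]" q] S_sym[OF s] s0 s0c q by simp
    ultimately have "inv s \<otimes> s0 = \<one>" using sep by auto
    then have ss: "s0 = s" using sc s0c by (metis inv_equality inv_inv inv_closed)
    obtain \<gamma> where \<gamma>: "\<gamma> \<in> Ns n" "h = \<gamma> \<otimes> h0" using vert_eqD[OF h0(2)[symmetric] h0(1) h] by blast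
    have qh: "u (\<gamma> \<otimes> k) = u \<gamma> + u k" if "k \<in> carrier G" for k using u \<gamma>(1) that by (auto simp: quasi_hom_def)
    have "u (h \<otimes> s) - u h = u (h0 \<otimes> s) - u h0"
    proof -
      have "\<gamma> \<in> carrier G" using \<gamma> Ns_carrier by blast
      then show ?thesis using qh[of h0] qh[of "h0 \<otimes> s"] \<gamma>(2) h0 sc by (simp add: m_assoc)
    qed
    moreover have "cochain_of n u (vert n h, vert n (h \<otimes> s)) = u (h0 \<otimes> s0) - u h0"
      using True by (simp add: cochain_of_def Let_def h0_def[symmetric] s0_def[symmetric])
    ultimately show ?thesis using ss by simp
  next
    case False
    then have "vert n (h \<otimes> s) = vert n h" using adj_Cay[OF h] s by auto
    then have "s \<in> Ns n" using vert_eq_self h sc by blast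
    moreover have "s \<in> wball q" using wballI[of "[s]" q] s sc q by simp
    ultimately have "s = \<one>" using sep by auto
    then show ?thesis using False h by (simp add: cochain_of_def)
  qed
qed

lemma cochain_of_walk:
  fixes u :: "'a \<Rightarrow> 'k::field"
  assumes sep: "Ns n \<inter> wball q \<subseteq> {\<one>}" and q: "q \<ge> 2" and u: "u \<in> quasi_hom G (Ns n)"
  shows "successively (adj (Cay n)) zs \<Longrightarrow> zs \<noteq> [] \<Longrightarrow> hd zs = vert n h \<Longrightarrow> h \<in> carrier G \<Longrightarrow>
    \<exists>w. set w \<subseteq> S \<and> length w = length zs - 1 \<and> last zs = vert n (h \<otimes> eval_word G w)
      \<and> walk_sum (cochain_of n u) zs = u (h \<otimes> eval_word G w) - u h"
proof (induction zs arbitrary: h rule: induct_list012)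
  case (2 x)
  then show ?case by (intro exI[of _ "[]"]) auto
next
  case (3 x y zs)
  have x: "x = vert n h" using 3 by simp
  have a: "adj (Cay n) (vert n h) y" "successively (adj (Cay n)) (y # zs)" using 3 by auto
  obtain s where s: "s \<in> S" "y = vert n (h \<otimes> s)" using a(1) adj_Cay[OF 3(6)] by blast
  have sc: "s \<in> carrier G" using s S_sub by auto
  obtain w where w: "set w \<subseteq> S" "length w = length (y # zs) - 1" "last (y # zs) = vert n (h \<otimes> s \<otimes> eval_word G w)"
    "walk_sum (cochain_of n u) (y # zs) = u (h \<otimes> s \<otimes> eval_word G w) - u (h \<otimes> s)"
    using 3(2)[OF a(2), of "h \<otimes> s"] s sc 3(6) by auto
  have wc: "eval_word G w \<in> carrier G" using w(1) S_sub by (intro eval_word_closed) auto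
  have as: "h \<otimes> s \<otimes> eval_word G w = h \<otimes> (s \<otimes> eval_word G w)" using 3(6) sc wc by (simp add: m_assoc)
  have "walk_sum (cochain_of n u) (x # y # zs) = u (h \<otimes> eval_word G (s # w)) - u h"
    using cochain_of_eval[OF sep q u 3(6) s(1)] w(4) s(2) unfolding x as by simp
  then show ?case using w s(1) as by (intro exI[of _ "s # w"]) auto
qed simp

text \<open>A cycle of length at most q lifts to a word whose value lies in \<open>Ns n\<close> and
  in the ball of radius q. The value is thus trivial, and the telescoping sum of \<open>u\<close>
  along the lift vanishes.\<close>

lemma cochain_of_cocycle:
  fixes u :: "'a \<Rightarrow> 'k::field"
  assumes sep: "Ns n \<inter> wball q \<subseteq> {\<one>}" and q: "q \<ge> 2" and u: "u \<in> quasi_hom G (Ns n)"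
  shows "cochain_of n u \<in> cocycles q (Cay n)"
proof -
  have ef: "cochain_of n u \<in> edge_fun (Cay n)"
  proof (rule edge_funI)
    fix x y
    show z: "cochain_of n u (x, y) = 0" if "\<not> adj (Cay n) x y" for x y using that by (simp add: cochain_of_def)
    show "cochain_of n u (x, y) = - cochain_of n u (y, x)"
    proof (cases "adj (Cay n) x y")
      case True
      have "x \<in> rcosets (Ns n)" using adj_verts[OF simple_Cay True] by (simp add: verts_Cay)
      then obtain h where h: "h \<in> carrier G" "x = vert n h" using vert_surj by blast
      then obtain s where s: "s \<in> S" "y = vert n (h \<otimes> s)" using True adj_Cay by blast
      have sc: "s \<in> carrier G" using s S_sub by auto
      have "cochain_of n u (vert n (h \<otimes> s), vert n (h \<otimes> s \<otimes> inv s)) = u (h \<otimes> s \<otimes> inv s) - u (h \<otimes> s)"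
        using cochain_of_eval[OF sep q u _ S_sym[OF s(1)], of "h \<otimes> s"] h sc by simp
      moreover have "h \<otimes> s \<otimes> inv s = h" using h sc by (simp add: m_assoc)
      ultimately show ?thesis using cochain_of_eval[OF sep q u h(1) s(1)] h s by simp
    next
      case False
      then have "\<not> adj (Cay n) y x" using adj_sym by metis
      then show ?thesis using z False by simp
    qed
  qed
  have "cyc_sum (cochain_of n u) xs = 0" if xs: "is_cycle (Cay n) xs" "length xs \<le> q" for xs
  proof -
    have ne: "xs \<noteq> []" using xs by (auto simp: is_cycle_def)
    have suc: "successively (adj (Cay n)) (xs @ [hd xs])"
      unfolding successively_conv_nth
    proof (intro allI impI)
      fix i assume i: "Suc i < length (xs @ [hd xs])"
      then have il: "i < length xs" by simp
      have "(xs @ [hd xs]) ! i = xs ! i" "(xs @ [hd xs]) ! Suc i = xs ! (Suc i mod length xs)"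
        using il ne by (cases "Suc i = length xs"; auto simp: nth_append hd_conv_nth)+
      then show "adj (Cay n) ((xs @ [hd xs]) ! i) ((xs @ [hd xs]) ! Suc i)" using xs(1) il by (simp add: is_cycle_def)
    qed
    have "hd xs \<in> rcosets (Ns n)" using xs(1) ne by (auto simp: is_cycle_def verts_Cay)
    then obtain h where h: "h \<in> carrier G" "hd xs = vert n h" using vert_surj by blast
    have hd: "hd (xs @ [hd xs]) = vert n h" using ne h by simp
    obtain w where w: "set w \<subseteq> S" "length w = length xs" "vert n h = vert n (h \<otimes> eval_word G w)"
      "walk_sum (cochain_of n u) (xs @ [hd xs]) = u (h \<otimes> eval_word G w) - u h"
      using cochain_of_walk[OF sep q u suc _ hd h(1)] h(2) by auto
    have wc: "eval_word G w \<in> carrier G" using w(1) S_sub by (intro eval_word_closed) auto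
    have "eval_word G w \<in> Ns n" using vert_eq_self[OF w(3)[symmetric] h(1) wc] .
    moreover have "eval_word G w \<in> wball q" using wballI w xs by simp
    ultimately have "eval_word G w = \<one>" using sep by auto
    then show ?thesis using cyc_sum_walk_sum[OF ne, of "cochain_of n u"] w(4) h(1) by simp
  qed
  then show ?thesis using ef by (simp add: cocycles_def)
qed

primrec lift_walk :: "nat \<Rightarrow> 'a \<Rightarrow> 'a list \<Rightarrow> 'a set list" where
  "lift_walk n h [] = [vert n h]"
| "lift_walk n h (s # w) = vert n h # lift_walk n (h \<otimes> s) w"

lemma lift_walk_props:
  assumes "set w \<subseteq> S" "h \<in> carrier G"
  shows "lazy_walk (Cay n) (lift_walk n h w) \<and> hd (lift_walk n h w) = vert n h
    \<and> last (lift_walk n h w) = vert n (h \<otimes> eval_word G w) \<and> length (lift_walk n h w) = Suc (length w)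
    \<and> walk_sum f (lift_walk n h w) = path_sum G (\<lambda>h s. f (vert n h, vert n (h \<otimes> s))) h w"
  using assms
proof (induction w arbitrary: h)
  case Nil
  then show ?case using vert_mem by (auto simp: lazy_walk_def verts_Cay)
next
  case (Cons s w)
  have sc: "s \<in> S" "s \<in> carrier G" "h \<otimes> s \<in> carrier G" "set w \<subseteq> S" "set w \<subseteq> carrier G" using Cons.prems S_sub by auto
  note IH = Cons.IH[OF sc(4,3)]
  obtain ys where ys: "lift_walk n (h \<otimes> s) w = vert n (h \<otimes> s) # ys" by (cases w) auto
  have "vert n h = vert n (h \<otimes> s) \<or> adj (Cay n) (vert n h) (vert n (h \<otimes> s))"
    using adj_Cay[OF Cons.prems(2)] sc(1) by metis
  then show ?case using IH ys sc Cons.prems vert_mem[of h n]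
    by (auto simp: lazy_walk_def verts_Cay m_assoc)
qed

text \<open>A cocycle pulled back to the group vanishes on closed words of length at most q, because
  these project to short closed walks; by \<open>short\<close> it vanishes on all closed words and
  has a potential. Invariance under \<open>Ns n\<close> holds as it comes from the quotient.\<close>

lemma cochain_of_surj:
  fixes f :: "'a set \<times> 'a set \<Rightarrow> 'k::field"
  assumes sep: "Ns n \<inter> wball q \<subseteq> {\<one>}" and q: "q \<ge> 2" and f: "f \<in> cocycles q (Cay n)"
    and short: "\<And>F :: 'a \<Rightarrow> 'a \<Rightarrow> 'k. (\<forall>g\<in>carrier G. \<forall>w. set w \<subseteq> S \<and> eval_word G w = \<one> \<and> length w \<le> q \<longrightarrow> path_sum G F g w = 0)
     \<Longrightarrow> (\<forall>g\<in>carrier G. \<forall>w. set w \<subseteq> S \<and> eval_word G w = \<one> \<longrightarrow> path_sum G F g w = 0)"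
  shows "\<exists>u \<in> quasi_hom G (Ns n). cochain_of n u = f"
proof -
  define F where "F h s = f (vert n h, vert n (h \<otimes> s))" for h s
  have ef: "f \<in> edge_fun (Cay n)" using f by (simp add: cocycles_def)
  have "path_sum G F g w = 0" if g: "g \<in> carrier G" and w: "set w \<subseteq> S" "eval_word G w = \<one>" "length w \<le> q" for g w
  proof -
    note l = lift_walk_props[OF w(1) g, of n f]
    have "walk_sum f (lift_walk n g w) = 0"
      by (rule closed_walk_sum_zero[OF simple_Cay f]) (use l w g in auto)
    then show ?thesis using l unfolding F_def by simp
  qed
  then have cl: "path_sum G F g w = 0" if "g \<in> carrier G" "set w \<subseteq> S" "eval_word G w = \<one>" for g w
    using short[of F] that by blast
  have "\<exists>u \<in> quasi_hom G (Ns n). \<forall>g\<in>carrier G. \<forall>s\<in>S. u (g \<otimes> s) - u g = F g s"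
  proof (rule quasi_hom_potential[OF S_sub S_sym S_gen Ns_carrier])
    show "path_sum G F \<one> w = 0" if "set w \<subseteq> S" "eval_word G w = \<one>" for w using cl that by simp
    show "F (\<gamma> \<otimes> g) s = F g s" if "\<gamma> \<in> Ns n" "g \<in> carrier G" "s \<in> S" for \<gamma> g s
    proof -
      have "\<gamma> \<in> carrier G" "s \<in> carrier G" using that Ns_carrier S_sub by blast+
      then have "\<gamma> \<otimes> g \<otimes> s = \<gamma> \<otimes> (g \<otimes> s)" "g \<otimes> s \<in> carrier G" using that by (simp_all add: m_assoc)
      then show ?thesis unfolding F_def using that vert_mult_left by simp
    qed
  qed
  then obtain u where u: "u \<in> quasi_hom G (Ns n)" "\<And>g s. g \<in> carrier G \<Longrightarrow> s \<in> S \<Longrightarrow> u (g \<otimes> s) - u g = F g s" by blast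
  have "cochain_of n u (x, y) = f (x, y)" for x y
  proof (cases "adj (Cay n) x y")
    case True
    have "x \<in> rcosets (Ns n)" using adj_verts[OF simple_Cay True] by (simp add: verts_Cay)
    then obtain h where h: "h \<in> carrier G" "x = vert n h" using vert_surj by blast
    then obtain s where s: "s \<in> S" "y = vert n (h \<otimes> s)" using True adj_Cay by blast
    then show ?thesis using cochain_of_eval[OF sep q u(1) h(1) s(1)] u(2)[OF h(1) s(1)] h(2) by (simp add: F_def)
  next
    case False
    then show ?thesis using edge_fun_nonadj[OF ef False] by (simp add: cochain_of_def)
  qed
  then show ?thesis using u(1) by (intro bexI[of _ u]) auto
qed

text \<open>Surjectivity is the descent above. A potential with zero cochain is constant on the
  group, and its value at the identity is 0.\<close>

theorem dim_cocycles_Cay: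
  assumes sep: "Ns n \<inter> wball q \<subseteq> {\<one>}" and q: "q \<ge> 2"
    and short: "\<And>F :: 'a \<Rightarrow> 'a \<Rightarrow> 'k. (\<forall>g\<in>carrier G. \<forall>w. set w \<subseteq> S \<and> eval_word G w = \<one> \<and> length w \<le> q \<longrightarrow> path_sum G F g w = 0)
     \<Longrightarrow> (\<forall>g\<in>carrier G. \<forall>w. set w \<subseteq> S \<and> eval_word G w = \<one> \<longrightarrow> path_sum G F g w = 0)"
  shows "fv.dim (cocycles q (Cay n) :: ('a set \<times> 'a set \<Rightarrow> 'k::field) set) = fv.dim (quasi_hom G (Ns n) :: ('a \<Rightarrow> 'k) set)"
proof -
  let ?U = "quasi_hom G (Ns n) :: ('a \<Rightarrow> 'k) set"
  let ?\<Psi> = "cochain_of n :: ('a \<Rightarrow> 'k) \<Rightarrow> _"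
  have im: "?\<Psi> ` ?U = cocycles q (Cay n)"
  proof
    show "?\<Psi> ` ?U \<subseteq> cocycles q (Cay n)" using cochain_of_cocycle[OF sep q] by blast
    show "cocycles q (Cay n) \<subseteq> ?\<Psi> ` ?U" using cochain_of_surj[OF sep q _ short] by blast
  qed
  have lin: "Vector_Spaces.linear fun_scale fun_scale ?\<Psi>"
    by (rule linear_funI) (auto simp: cochain_of_def fun_eq_iff Let_def algebra_simps)
  have spU: "fv.span ?U = ?U" using subspace_quasi_hom fv.span_eq_iff by blast
  have ker: "u = 0" if u: "u \<in> ?U" and z: "?\<Psi> u = 0" for u
  proof
    fix g
    have "u (h \<otimes> s) = u h" if "h \<in> carrier G" "s \<in> S" for h s
      using cochain_of_eval[OF sep q u that] z by simp
    then have "u g = u \<one>" if "g \<in> carrier G" using invariant_constant[OF S_sub S_sym S_gen _ that, of u] by blast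
    moreover have "u g = 0" if "g \<notin> carrier G" using u that by (simp add: quasi_hom_def)
    ultimately show "u g = 0 g" using quasi_hom_one[OF Ns_subgroup u] by auto
  qed
  have "inj_on ?\<Psi> (fv.span ?U)"
    unfolding spU
  proof (rule inj_onI)
    fix f g assume fg: "f \<in> ?U" "g \<in> ?U" "?\<Psi> f = ?\<Psi> g"
    have "?\<Psi> (f - g) = 0" using vector_space_pair.linear_diff[OF fun_pair lin] fg(3) by simp
    moreover have "f - g \<in> ?U" using fv.subspace_diff[OF subspace_quasi_hom] fg by blast
    ultimately show "f = g" using ker[of "f - g"] by simp
  qed
  from dim_inj_image[OF lin this] show ?thesis unfolding im .
qed

end

subsection \<open>The presentation complex\<close>

text \<open>The column \<open>None\<close> stands for the divergence, the column
  \<open>Some r\<close> for the sum around the 2-cell of r. One operator thus expresses both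
  harmonicity conditions.\<close>

definition pres_cols :: "('a, 'b) monoid_scheme \<Rightarrow> 'a set \<Rightarrow> 'a list set \<Rightarrow> 'a list option set" where
  "pres_cols G T R = insert None (Some ` pres_rels G T R)"

definition pres_supp :: "('a, 'b) monoid_scheme \<Rightarrow> 'a set \<Rightarrow> 'a list set \<Rightarrow> 'a set" where
  "pres_supp G T R = insert \<one>\<^bsub>G\<^esub> ((\<lambda>t. inv\<^bsub>G\<^esub> t) ` T \<union> (\<Union>r\<in>pres_rels G T R. (\<lambda>i. eval_word G (take i r)) ` {..<length r}))"

text \<open>Column \<open>None\<close> carries 1 - inv t. Column \<open>Some r\<close> is the Fox
  derivative of the positive word r: it counts the occurrences of the letter t after a prefix with
  value a. Inverse letters need no sign, since t and its inverse are separate generators tied by the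
  relator [t, inv t].\<close>

definition pres_matrix :: "('a, 'b) monoid_scheme \<Rightarrow> 'a \<Rightarrow> 'a list option \<Rightarrow> 'a \<Rightarrow> int" where
  "pres_matrix G t q a = (case q of
      None \<Rightarrow> (if a = \<one>\<^bsub>G\<^esub> then 1 else 0) - (if a = inv\<^bsub>G\<^esub> t then 1 else 0)
    | Some r \<Rightarrow> int (card {i \<in> {..<length r}. r ! i = t \<and> eval_word G (take i r) = a}))"

context group
begin

lemma finite_pres_rels: "is_fin_pres G T R \<Longrightarrow> finite (pres_rels G T R)"
proof -
  assume "is_fin_pres G T R"
  then have "finite T" "finite R" unfolding is_fin_pres_def by blast+
  moreover have "{[t, inv t] |t. t \<in> T} = (\<lambda>t. [t, inv t]) ` T" by auto
  ultimately show ?thesis unfolding pres_rels_def by simp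
qed

lemma pres_finite:
  assumes pres: "is_fin_pres G T R"
  shows "finite T" "finite (pres_cols G T R)" "finite (pres_supp G T R)" "pres_supp G T R \<subseteq> carrier G"
proof -
  have T: "finite T" "T \<subseteq> carrier G" using pres unfolding is_fin_pres_def by blast+
  show "finite T" by (rule T)
  show "finite (pres_cols G T R)" unfolding pres_cols_def using finite_pres_rels[OF pres] by simp
  show "finite (pres_supp G T R)" unfolding pres_supp_def using finite_pres_rels[OF pres] T by auto
  have "eval_word G (take i r) \<in> carrier G" if "r \<in> pres_rels G T R" for i r
    using pres_rels_props(1)[OF pres that] T(2) by (intro eval_word_closed) (auto dest: in_set_takeD)
  then show "pres_supp G T R \<subseteq> carrier G" unfolding pres_supp_def using T by auto
qed

end

lemma pres_D:
  fixes G (structure)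
  assumes grp: "group G" and pres: "is_fin_pres G T R"
    and act: "right_action G V act" and v: "v \<in> V"
  shows "group_ring_matrix.D V act T (pres_cols G T R) (pres_supp G T R) (pres_matrix G) f (v, None)
      = (\<Sum>t\<in>T. f (v, t)) - (\<Sum>t\<in>T. f (act v (inv\<^bsub>G\<^esub> t), t))"
    and "r \<in> pres_rels G T R \<Longrightarrow>
      group_ring_matrix.D V act T (pres_cols G T R) (pres_supp G T R) (pres_matrix G) f (v, Some r)
      = (\<Sum>i<length r. f (act v (eval_word G (take i r)), r ! i))"
proof -
  interpret group G by (rule grp)
  interpret right_action G V act by (rule act)
  interpret M: group_ring_matrix G V act T "pres_cols G T R" "pres_supp G T R" "pres_matrix G"
    by (intro group_ring_matrix.intro group_ring_matrix_axioms.intro act pres_finite[OF pres])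
  let ?A = "pres_supp G T R"
  have finA: "finite ?A" and finT: "finite T" using pres_finite[OF pres] by auto
  have "M.D f (v, None) = (\<Sum>t\<in>T. \<Sum>a\<in>?A. (if a = \<one> then f (act v a, t) else 0) - (if a = inv t then f (act v a, t) else 0))"
    unfolding M.D_def using v by (auto simp: pres_cols_def pres_matrix_def intro!: sum.cong)
  also have "\<dots> = (\<Sum>t\<in>T. f (act v \<one>, t) - f (act v (inv t), t))"
  proof (rule sum.cong[OF refl])
    fix t assume "t \<in> T"
    then have "\<one> \<in> ?A" "inv t \<in> ?A" by (auto simp: pres_supp_def)
    then show "(\<Sum>a\<in>?A. (if a = \<one> then f (act v a, t) else 0) - (if a = inv t then f (act v a, t) else 0))
        = f (act v \<one>, t) - f (act v (inv t), t)"
      using finA by (simp add: sum_subtractf)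
  qed
  finally show "M.D f (v, None) = (\<Sum>t\<in>T. f (v, t)) - (\<Sum>t\<in>T. f (act v (inv t), t))"
    using act_one[OF v] by (simp add: sum_subtractf)
  assume r: "r \<in> pres_rels G T R"
  let ?e = "\<lambda>i. eval_word G (take i r)"
  have "M.D f (v, Some r) = (\<Sum>t\<in>T. \<Sum>a\<in>?A. \<Sum>i<length r. (if r ! i = t \<and> ?e i = a then f (act v a, t) else 0))"
    unfolding M.D_def using v r
    by (auto simp: pres_cols_def pres_matrix_def sum.inter_filter[symmetric] intro!: sum.cong)
  also have "\<dots> = (\<Sum>t\<in>T. \<Sum>i<length r. \<Sum>a\<in>?A. (if r ! i = t \<and> ?e i = a then f (act v a, t) else 0))"
    by (intro sum.cong refl sum.swap)
  also have "\<dots> = (\<Sum>i<length r. \<Sum>t\<in>T. \<Sum>a\<in>?A. (if r ! i = t \<and> ?e i = a then f (act v a, t) else 0))"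
    by (rule sum.swap)
  also have "\<dots> = (\<Sum>i<length r. f (act v (?e i), r ! i))"
  proof (rule sum.cong[OF refl])
    fix i assume i: "i \<in> {..<length r}"
    have "r ! i \<in> T" using pres_rels_props(1)[OF pres r] i by auto
    moreover have "?e i \<in> ?A" unfolding pres_supp_def using r i by blast
    ultimately have "(\<Sum>t\<in>T. \<Sum>a\<in>?A. (if r ! i = t \<and> ?e i = a then f (act v a, t) else 0))
        = (\<Sum>t\<in>T. if r ! i = t then f (act v (?e i), t) else 0)"
      using finA by (intro sum.cong) (auto simp: if_distrib cong: if_cong)
    then show "(\<Sum>t\<in>T. \<Sum>a\<in>?A. (if r ! i = t \<and> ?e i = a then f (act v a, t) else 0)) = f (act v (?e i), r ! i)"
      using \<open>r ! i \<in> T\<close> finT by simp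
  qed
  finally show "M.D f (v, Some r) = (\<Sum>i<length r. f (act v (?e i), r ! i))" .
qed

context residual_chain
begin

text \<open>The kernel of the operator splits column by column into the two conditions that define
  \<open>l2_harmonic\<close>.\<close>

lemma l2harm_eq_l2_harmonic:
  assumes pres: "is_fin_pres G T R"
  shows "group_ring_matrix.l2harm (carrier G) (\<otimes>) T (pres_cols G T R) (pres_supp G T R) (pres_matrix G) = l2_harmonic G T R"
proof -
  interpret M: group_ring_matrix G "carrier G" "(\<otimes>)" T "pres_cols G T R" "pres_supp G T R" "pres_matrix G"
    by (intro group_ring_matrix.intro group_ring_matrix_axioms.intro self_action pres_finite[OF pres])
  note D = pres_D[OF is_group pres self_action]
  have e1: "M.D f = (\<lambda>_. 0) \<longleftrightarrow> (\<forall>v\<in>carrier G. (\<Sum>t\<in>T. f (v, t)) - (\<Sum>t\<in>T. f (v \<otimes> inv t, t)) = 0)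
      \<and> (\<forall>g\<in>carrier G. \<forall>r\<in>pres_rels G T R. (\<Sum>i<length r. f (g \<otimes> eval_word G (take i r), r ! i)) = 0)" (is "?l \<longleftrightarrow> ?r") for f
  proof
    assume l: ?l
    have z: "M.D f k = 0" for k using l by simp
    show ?r
    proof (intro conjI ballI)
      fix v assume v: "v \<in> carrier G"
      show "(\<Sum>t\<in>T. f (v, t)) - (\<Sum>t\<in>T. f (v \<otimes> inv t, t)) = 0" using z[of "(v, None)"] D(1)[OF v, of f] by simp
      fix r assume r: "r \<in> pres_rels G T R"
      show "(\<Sum>i<length r. f (v \<otimes> eval_word G (take i r), r ! i)) = 0" using z[of "(v, Some r)"] D(2)[OF v r, of f] by simp
    qed
  next
    assume r: ?r
    show ?l
    proof
      fix k :: "'a \<times> 'a list option"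
      obtain v q where k: "k = (v, q)" by (cases k)
      show "M.D f k = 0"
      proof (cases "v \<in> carrier G \<and> q \<in> pres_cols G T R")
        case False
        then show ?thesis unfolding k M.D_def by auto
      next
        case True
        then consider "q = None" | rr where "q = Some rr" "rr \<in> pres_rels G T R" by (auto simp: pres_cols_def)
        then show ?thesis
        proof cases
          case 1
          then show ?thesis using D(1)[of v f] r True k by simp
        next
          case 2
          then show ?thesis using D(2)[of v rr f] r True k by simp
        qed
      qed
    qed
  qed
  have e2: "f \<in> supported (carrier G \<times> T) \<longleftrightarrow> (\<forall>a. f a \<noteq> 0 \<longrightarrow> a \<in> carrier G \<times> T)" for f :: "'a \<times> 'a \<Rightarrow> real"
    unfolding supported_def by blast
  show ?thesis
    unfolding M.l2harm_def l2_harmonic_def by (rule Collect_cong) (simp only: e1 e2 conj_assoc)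
qed

lemma coset_eqD:
  assumes "Ns n #> h = Ns n #> k" "h \<in> carrier G" "k \<in> carrier G"
  shows "\<exists>\<gamma>\<in>Ns n. k = \<gamma> \<otimes> h"
  using rcos_self[OF assms(3) Ns_subgroup, of n] assms(1) by (auto simp: r_coset_def)

lemma coset_mult_left:
  assumes "\<gamma> \<in> Ns n" "h \<in> carrier G"
  shows "Ns n #> (\<gamma> \<otimes> h) = Ns n #> h"
proof -
  have \<gamma>: "\<gamma> \<in> carrier G" using assms Ns_carrier by blast
  have "Ns n #> (\<gamma> \<otimes> h) = (Ns n #> \<gamma>) #> h" using \<gamma> assms by (simp add: coset_mult_assoc[OF Ns_carrier])
  then show ?thesis using coset_join2[OF \<gamma> Ns_subgroup assms(1)] by simp
qed

text \<open>The counterpart of \<open>cochain_of\<close> on the presentation complex. Edges are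
  pairs of a coset and a generator, so only the lift of the coset has to be chosen.\<close>

definition cochain_right :: "nat \<Rightarrow> 'a set \<Rightarrow> ('a \<Rightarrow> real) \<Rightarrow> 'a set \<times> 'a \<Rightarrow> real" where
  "cochain_right n T u = (\<lambda>(x, t). if x \<in> rcosets (Ns n) \<and> t \<in> T then
     (let h = (SOME h. h \<in> carrier G \<and> x = Ns n #> h) in u (h \<otimes> t) - u h) else 0)"

lemma cochain_right_eval:
  assumes u: "u \<in> quasi_hom G (Ns n)" and h: "h \<in> carrier G" and t: "t \<in> T" "t \<in> carrier G"
  shows "cochain_right n T u (Ns n #> h, t) = u (h \<otimes> t) - u h"
proof -
  define k where "k = (SOME k. k \<in> carrier G \<and> Ns n #> h = Ns n #> k)"
  have k: "k \<in> carrier G" "Ns n #> h = Ns n #> k"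
    unfolding k_def using someI[of "\<lambda>k. k \<in> carrier G \<and> Ns n #> h = Ns n #> k" h] h by auto
  obtain \<gamma> where \<gamma>: "\<gamma> \<in> Ns n" "k = \<gamma> \<otimes> h" using coset_eqD[OF k(2) h k(1)] by blast
  have \<gamma>c: "\<gamma> \<in> carrier G" using \<gamma> Ns_carrier by blast
  have qh: "u (\<gamma> \<otimes> g) = u \<gamma> + u g" if "g \<in> carrier G" for g using u \<gamma>(1) that by (auto simp: quasi_hom_def)
  have "u (k \<otimes> t) - u k = u (h \<otimes> t) - u h"
    using qh[OF h] qh[of "h \<otimes> t"] \<gamma> \<gamma>c h t by (simp add: m_assoc)
  moreover have "Ns n #> h \<in> rcosets (Ns n)" using h by (auto simp: RCOSETS_def)
  ultimately show ?thesis using t by (simp add: cochain_right_def Let_def k_def[symmetric])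
qed

text \<open>Finite Hodge theory on the quotient complex: the cocycles \<open>Z\<close> are the
  orthogonal sum of harmonic chains and coboundaries \<open>C\<close>. Connectedness gives
  \<open>C\<close> the dimension index minus 1, and \<open>Z\<close> corresponds to the
  quasi-homomorphisms by integration on the group.\<close>

theorem dim_harmonic_quotient:
  assumes pres: "is_fin_pres G T R"
  shows "fv.dim (group_ring_matrix.Ker (rcosets (Ns n)) (\<lambda>x g. x #> g) T (pres_cols G T R) (pres_supp G T R) (pres_matrix G))
    + card (rcosets (Ns n)) = fv.dim (quasi_hom G (Ns n) :: ('a \<Rightarrow> real) set) + 1"
proof -
  let ?V = "rcosets (Ns n)"
  have V: "finite ?V" by (rule finidx)
  have T: "finite T" "T \<subseteq> carrier G" "generate G T = carrier G" and Ti: "\<And>t. t \<in> T \<Longrightarrow> inv t \<in> T"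
    using pres unfolding is_fin_pres_def by blast+
  interpret M: group_ring_matrix G ?V "\<lambda>x g. x #> g" T "pres_cols G T R" "pres_supp G T R" "pres_matrix G"
    by (intro group_ring_matrix.intro group_ring_matrix_axioms.intro coset_action pres_finite[OF pres])
  note D = pres_D[OF is_group pres coset_action]
  let ?I = "?V \<times> T"
  have I: "finite ?I" using V T by simp
  have Vh: "\<exists>h\<in>carrier G. x = Ns n #> h" if "x \<in> ?V" for x using that by (auto simp: RCOSETS_def)
  have hV: "Ns n #> h \<in> ?V" if "h \<in> carrier G" for h using that by (auto simp: RCOSETS_def)
  have ca: "(Ns n #> h) #> g = Ns n #> (h \<otimes> g)" if "h \<in> carrier G" "g \<in> carrier G" for h g
    using that by (simp add: coset_mult_assoc[OF Ns_carrier])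
  have rT: "set r \<subseteq> carrier G" "\<And>i. i < length r \<Longrightarrow> r ! i \<in> T" "\<And>i. eval_word G (take i r) \<in> carrier G" if "r \<in> pres_rels G T R" for r
  proof -
    have rr: "set r \<subseteq> T" using pres_rels_props(1)[OF pres that] .
    then show "set r \<subseteq> carrier G" using T(2) by blast
    show "r ! i \<in> T" if "i < length r" for i using rr that nth_mem by blast
    show "eval_word G (take i r) \<in> carrier G" for i
      using rr T(2) by (intro eval_word_closed) (auto dest: in_set_takeD)
  qed
  define Z where "Z = {f \<in> supported ?I. \<forall>v\<in>?V. \<forall>r\<in>pres_rels G T R. M.D f (v, Some r) = 0}"
  have ZI: "Z \<subseteq> supported ?I" by (auto simp: Z_def)
  have subZ: "fv.subspace Z"
  proof (rule fv.subspaceI)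
    have "M.D 0 = 0" by (auto simp: M.D_def fun_eq_iff)
    then show "0 \<in> Z" by (auto simp: Z_def supported_def)
  qed (auto simp: Z_def supported_def M.D_add M.D_scale)
  define dl where "dl c = (\<lambda>(x, t). if x \<in> ?V \<and> t \<in> T then c (x #> t) - c x else 0)" for c :: "'a set \<Rightarrow> real"
  have dladd: "dl (f + g) = dl f + dl g" and dlscale: "dl (fun_scale a f) = fun_scale a (dl f)" for f g a
    by (auto simp: dl_def fun_eq_iff algebra_simps)
  have dllin: "Vector_Spaces.linear fun_scale fun_scale dl" by (rule linear_funI) (rule dladd, rule dlscale)
  define C where "C = range dl"
  have subC: "fv.subspace C"
  proof (rule fv.subspaceI)
    have "dl 0 = 0" by (auto simp: dl_def fun_eq_iff)
    then show "0 \<in> C" unfolding C_def using rangeI[of dl 0] by simp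
    show "x + y \<in> C" if xy: "x \<in> C" "y \<in> C" for x y
    proof -
      obtain c d where "x = dl c" "y = dl d" using xy unfolding C_def by blast
      then show ?thesis unfolding C_def using rangeI[of dl "c + d"] dladd[of c d] by simp
    qed
    show "fun_scale a x \<in> C" if xC: "x \<in> C" for x a
    proof -
      obtain c where "x = dl c" using xC unfolding C_def by blast
      then show ?thesis unfolding C_def using rangeI[of dl "fun_scale a c"] dlscale[of a c] by simp
    qed
  qed
  have CZ: "C \<subseteq> Z"
  proof
    fix b assume "b \<in> C"
    then obtain c where b: "b = dl c" by (auto simp: C_def)
    have "M.D b (x, Some r) = 0" if x: "x \<in> ?V" and r: "r \<in> pres_rels G T R" for x r
    proof -
      obtain h where h: "h \<in> carrier G" "x = Ns n #> h" using Vh[OF x] by blast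
      define u where "u g = c (Ns n #> g)" for g
      have "M.D b (x, Some r) = (\<Sum>i<length r. b (x #> eval_word G (take i r), r ! i))" by (rule D(2)[OF x r])
      also have "\<dots> = (\<Sum>i<length r. u (h \<otimes> eval_word G (take i r) \<otimes> r ! i) - u (h \<otimes> eval_word G (take i r)))"
      proof (rule sum.cong[OF refl])
        fix i assume "i \<in> {..<length r}"
        then have i: "r ! i \<in> T" "r ! i \<in> carrier G" using rT(2)[OF r] T(2) by auto
        have he: "h \<otimes> eval_word G (take i r) \<in> carrier G" using h rT(3)[OF r] by simp
        show "b (x #> eval_word G (take i r), r ! i) = u (h \<otimes> eval_word G (take i r) \<otimes> r ! i) - u (h \<otimes> eval_word G (take i r))"
          unfolding b dl_def u_def h(2) using h(1) rT(3)[OF r] i he hV[OF he] by (simp add: ca)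
      qed
      also have "\<dots> = path_sum G (\<lambda>g t. u (g \<otimes> t) - u g) h r"
        using path_sum_eq_sum[OF h(1) rT(1)[OF r], of "\<lambda>g t. u (g \<otimes> t) - u g"] by simp
      also have "\<dots> = u (h \<otimes> eval_word G r) - u h" by (rule path_sum_diff[OF h(1) rT(1)[OF r]]) simp
      also have "\<dots> = 0" using pres_rels_props(2)[OF pres r] h(1) by simp
      finally show ?thesis .
    qed
    then show "b \<in> Z" unfolding Z_def by (auto simp: b dl_def supported_def)
  qed
  \<comment> \<open>Summation by parts: the coboundary is minus the adjoint of the divergence, so
    orthogonality to \<open>C\<close> means zero divergence.\<close>
  have pairing: "(\<Sum>i\<in>?I. z i * dl c i) = - (\<Sum>x\<in>?V. c x * M.D z (x, None))" for z c
  proof -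
    have bij: "bij_betw (\<lambda>x. x #> inv t) ?V ?V" if "t \<in> T" for t
      using M.act_bij[of "inv t"] T(2) that by auto
    have "(\<Sum>i\<in>?I. z i * dl c i) = (\<Sum>x\<in>?V. \<Sum>t\<in>T. z (x, t) * (c (x #> t) - c x))"
      unfolding sum.cartesian_product by (rule sum.cong) (auto simp: dl_def)
    also have "\<dots> = (\<Sum>t\<in>T. \<Sum>x\<in>?V. z (x, t) * c (x #> t)) - (\<Sum>x\<in>?V. \<Sum>t\<in>T. z (x, t) * c x)"
      by (subst (2) sum.swap) (simp add: right_diff_distrib sum_subtractf)
    also have "(\<Sum>t\<in>T. \<Sum>x\<in>?V. z (x, t) * c (x #> t)) = (\<Sum>t\<in>T. \<Sum>x\<in>?V. z (x #> inv t, t) * c x)"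
    proof (rule sum.cong[OF refl])
      fix t assume t: "t \<in> T"
      have tc: "t \<in> carrier G" using t T(2) by blast
      have "(\<Sum>x\<in>?V. z (x, t) * c (x #> t)) = (\<Sum>x\<in>?V. z (x #> inv t, t) * c ((x #> inv t) #> t))"
        by (rule sum.reindex_bij_betw[OF bij[OF t], symmetric])
      then show "(\<Sum>x\<in>?V. z (x, t) * c (x #> t)) = (\<Sum>x\<in>?V. z (x #> inv t, t) * c x)"
        using M.act_inv2[OF _ tc] by simp
    qed
    also have "\<dots> = (\<Sum>x\<in>?V. \<Sum>t\<in>T. z (x #> inv t, t) * c x)" by (rule sum.swap)
    also have "\<dots> - (\<Sum>x\<in>?V. \<Sum>t\<in>T. z (x, t) * c x) = (\<Sum>x\<in>?V. - (c x * M.D z (x, None)))"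
      unfolding sum_subtractf[symmetric]
    proof (rule sum.cong[OF refl])
      fix x assume x: "x \<in> ?V"
      show "(\<Sum>t\<in>T. z (x #> inv t, t) * c x - z (x, t) * c x) = - (c x * M.D z (x, None))"
        unfolding D(1)[OF x, of z] by (simp add: sum_subtractf right_diff_distrib sum_distrib_left mult.commute)
    qed
    also have "\<dots> = - (\<Sum>x\<in>?V. c x * M.D z (x, None))" by (rule sum_negf)
    finally show ?thesis .
  qed
  have Ker: "M.Ker = {z \<in> Z. \<forall>c\<in>C. (\<Sum>i\<in>?I. z i * c i) = 0}"
  proof
    show "M.Ker \<subseteq> {z \<in> Z. \<forall>c\<in>C. (\<Sum>i\<in>?I. z i * c i) = 0}"
    proof
      fix z assume z: "z \<in> M.Ker"
      have Dz: "M.D z k = 0" for k using z by (simp add: M.Ker_def)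
      have "z \<in> Z" using z Dz by (auto simp: Z_def M.Ker_def)
      moreover have "(\<Sum>i\<in>?I. z i * dl c i) = 0" for c unfolding pairing using Dz by simp
      ultimately show "z \<in> {z \<in> Z. \<forall>c\<in>C. (\<Sum>i\<in>?I. z i * c i) = 0}" by (auto simp: C_def)
    qed
    show "{z \<in> Z. \<forall>c\<in>C. (\<Sum>i\<in>?I. z i * c i) = 0} \<subseteq> M.Ker"
    proof
      fix z assume "z \<in> {z \<in> Z. \<forall>c\<in>C. (\<Sum>i\<in>?I. z i * c i) = 0}"
      then have z: "z \<in> Z" "\<And>c. (\<Sum>i\<in>?I. z i * dl c i) = 0" by (auto simp: C_def)
      have "M.D z k = 0" for k
      proof -
        obtain v q where k: "k = (v, q)" by (cases k)
        show ?thesis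
        proof (cases "v \<in> ?V \<and> q \<in> pres_cols G T R")
          case False
          then show ?thesis unfolding k M.D_def by auto
        next
          case True
          then consider "q = None" | r where "q = Some r" "r \<in> pres_rels G T R" by (auto simp: pres_cols_def)
          then show ?thesis
          proof cases
            case 1
            have "(\<Sum>x\<in>?V. (if x = v then 1 else 0) * M.D z (x, None)) = 0"
              using pairing[of z "\<lambda>x. if x = v then 1 else 0"] z(2) by simp
            moreover have "(\<Sum>x\<in>?V. (if x = v then 1 else 0) * M.D z (x, None)) = (\<Sum>x\<in>?V. if x = v then M.D z (x, None) else 0)"
              by (rule sum.cong) auto
            ultimately show ?thesis using True V 1 k by simp
          next
            case 2
            then show ?thesis using z(1) True k by (auto simp: Z_def)
          qed
        qed
      qed
      then show "z \<in> M.Ker" using z(1) by (auto simp: M.Ker_def Z_def)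
    qed
  qed
  have dims: "fv.dim M.Ker + fv.dim C = fv.dim Z"
    unfolding Ker by (rule ortho_complement_dim[OF I ZI subZ CZ subC])
  have N1: "Ns n = Ns n #> \<one>" using coset_mult_one[OF Ns_carrier] by simp
  have NV: "Ns n \<in> ?V" using hV[of \<one>] N1 by simp
  have dimC: "fv.dim C = card ?V - 1"
  proof -
    let ?W = "supported (?V - {Ns n}) :: ('a set \<Rightarrow> real) set"
    have "dl ` ?W = C"
    proof
      show "C \<subseteq> dl ` ?W"
      proof
        fix b assume "b \<in> C"
        then obtain c where b: "b = dl c" by (auto simp: C_def)
        \<comment> \<open>Subtracting a constant leaves the coboundary unchanged, so a function may
          be normalised to vanish at the trivial coset.\<close>
        define c' where "c' x = (if x \<in> ?V then c x - c (Ns n) else 0)" for x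
        have "dl c' = b"
        proof
          fix k :: "'a set \<times> 'a"
          obtain x t where k: "k = (x, t)" by (cases k)
          show "dl c' k = b k"
          proof (cases "x \<in> ?V \<and> t \<in> T")
            case True
            then have "x #> t \<in> ?V" using M.act_closed[of x t] T(2) by blast
            then show ?thesis using True unfolding k b dl_def c'_def by simp
          qed (auto simp: k b dl_def)
        qed
        moreover have "c' \<in> ?W" by (auto simp: c'_def supported_def)
        ultimately show "b \<in> dl ` ?W" by blast
      qed
    qed (auto simp: C_def)
    moreover have "inj_on dl (fv.span ?W)"
    proof -
      have spW: "fv.span ?W = ?W" using subspace_supported fv.span_eq_iff by blast
      have ker: "c = 0" if c: "c \<in> ?W" "dl c = 0" for c
      proof
        fix x
        show "c x = 0 x"
        proof (cases "x \<in> ?V")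
          case False
          then show ?thesis using c(1) by (auto simp: supported_def)
        next
          case True
          then obtain h where h: "h \<in> carrier G" "x = Ns n #> h" using Vh by blast
          have "c (Ns n #> (g \<otimes> t)) = c (Ns n #> g)" if "g \<in> carrier G" "t \<in> T" for g t
          proof -
            have tc: "t \<in> carrier G" using that T(2) by blast
            have "dl c (Ns n #> g, t) = 0" using c(2) by simp
            then show ?thesis using hV[OF that(1)] that tc by (simp add: dl_def ca)
          qed
          from invariant_constant[of T "\<lambda>g. c (Ns n #> g)", OF T(2) Ti T(3) this h(1)]
          have "c x = c (Ns n)" using h(2) N1 by simp
          also have "\<dots> = 0" using c(1) by (auto simp: supported_def)
          finally show ?thesis by simp
        qed
      qed
      show ?thesis
        unfolding spW
      proof (rule inj_onI)
        fix f g assume fg: "f \<in> ?W" "g \<in> ?W" "dl f = dl g"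
        have "dl (f - g) = 0" using vector_space_pair.linear_diff[OF fun_pair dllin] fg(3) by simp
        moreover have "f - g \<in> ?W" using fv.subspace_diff[OF subspace_supported] fg by blast
        ultimately show "f = g" using ker[of "f - g"] by simp
      qed
    qed
    ultimately have "fv.dim C = fv.dim ?W" using dim_inj_image[OF dllin, of ?W] by simp
    then show ?thesis using dim_supported[of "?V - {Ns n}", where 'k=real] V NV by simp
  qed
  have dimZ: "fv.dim Z = fv.dim (quasi_hom G (Ns n) :: ('a \<Rightarrow> real) set)"
  proof -
    let ?U = "quasi_hom G (Ns n) :: ('a \<Rightarrow> real) set"
    let ?\<Phi> = "cochain_right n T"
    have lin: "Vector_Spaces.linear fun_scale fun_scale ?\<Phi>"
      by (rule linear_funI) (auto simp: cochain_right_def fun_eq_iff Let_def algebra_simps)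
    have spU: "fv.span ?U = ?U" using subspace_quasi_hom fv.span_eq_iff by blast
    have ev: "?\<Phi> u (Ns n #> h, t) = u (h \<otimes> t) - u h" if "u \<in> ?U" "h \<in> carrier G" "t \<in> T" for u h t
      using that T(2) by (intro cochain_right_eval) auto
    have relD: "M.D f (Ns n #> h, Some r) = path_sum G (\<lambda>h t. f (Ns n #> h, t)) h r" if "h \<in> carrier G" "r \<in> pres_rels G T R" for f h r
    proof -
      have "M.D f (Ns n #> h, Some r) = (\<Sum>i<length r. f ((Ns n #> h) #> eval_word G (take i r), r ! i))"
        by (rule D(2)[OF hV[OF that(1)] that(2)])
      also have "\<dots> = path_sum G (\<lambda>h t. f (Ns n #> h, t)) h r"
        using path_sum_eq_sum[OF that(1) rT(1)[OF that(2)], of "\<lambda>h t. f (Ns n #> h, t)"] that rT(3)[OF that(2)] by (simp add: ca)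
      finally show ?thesis .
    qed
    have "?\<Phi> ` ?U = Z"
    proof
      show "?\<Phi> ` ?U \<subseteq> Z"
      proof
        fix f assume "f \<in> ?\<Phi> ` ?U"
        then obtain u where u: "u \<in> ?U" "f = ?\<Phi> u" by blast
        have "M.D f (x, Some r) = 0" if x: "x \<in> ?V" and r: "r \<in> pres_rels G T R" for x r
        proof -
          obtain h where h: "h \<in> carrier G" "x = Ns n #> h" using Vh[OF x] by blast
          have "M.D f (x, Some r) = path_sum G (\<lambda>h t. f (Ns n #> h, t)) h r" using relD[OF h(1) r] h(2) by simp
          also have "\<dots> = u (h \<otimes> eval_word G r) - u h"
            using ev[OF u(1)] pres_rels_props(1)[OF pres r] unfolding u(2) by (intro path_sum_diff[OF h(1) rT(1)[OF r]]) auto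
          also have "\<dots> = 0" using pres_rels_props(2)[OF pres r] h(1) by simp
          finally show ?thesis .
        qed
        moreover have "f \<in> supported ?I" unfolding u(2) by (auto simp: cochain_right_def supported_def)
        ultimately show "f \<in> Z" by (simp add: Z_def)
      qed
      show "Z \<subseteq> ?\<Phi> ` ?U"
      proof
        fix f assume f: "f \<in> Z"
        define F where "F h t = f (Ns n #> h, t)" for h t
        have rel: "path_sum G F g r = 0" if "g \<in> carrier G" "r \<in> pres_rels G T R" for g r
          using relD[OF that, of f] f hV[OF that(1)] that(2) unfolding F_def by (simp add: Z_def)
        have "\<exists>u \<in> quasi_hom G (Ns n). \<forall>g\<in>carrier G. \<forall>t\<in>T. u (g \<otimes> t) - u g = F g t"
        proof (rule quasi_hom_potential[OF T(2) Ti T(3) Ns_carrier])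
          show "path_sum G F \<one> w = 0" if "set w \<subseteq> T" "eval_word G w = \<one>" for w
            by (rule relators_imp_closed[OF pres rel that one_closed])
          show "F (\<gamma> \<otimes> g) t = F g t" if "\<gamma> \<in> Ns n" "g \<in> carrier G" "t \<in> T" for \<gamma> g t
            using coset_mult_left[OF that(1,2)] by (simp add: F_def)
        qed
        then obtain u where u: "u \<in> ?U" "\<And>g t. g \<in> carrier G \<Longrightarrow> t \<in> T \<Longrightarrow> u (g \<otimes> t) - u g = F g t" by blast
        have "?\<Phi> u = f"
        proof
          fix k :: "'a set \<times> 'a"
          obtain x t where k: "k = (x, t)" by (cases k)
          show "?\<Phi> u k = f k"
          proof (cases "x \<in> ?V \<and> t \<in> T")
            case True
            then obtain h where h: "h \<in> carrier G" "x = Ns n #> h" using Vh by blast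
            then show ?thesis using ev[OF u(1) h(1), of t] u(2)[OF h(1), of t] True k by (simp add: F_def)
          next
            case False
            then show ?thesis using f k by (auto simp: Z_def supported_def cochain_right_def)
          qed
        qed
        then show "f \<in> ?\<Phi> ` ?U" using u(1) by blast
      qed
    qed
    moreover have "inj_on ?\<Phi> (fv.span ?U)"
      unfolding spU
    proof (rule inj_onI)
      fix f g assume fg: "f \<in> ?U" "g \<in> ?U" "?\<Phi> f = ?\<Phi> g"
      let ?u = "f - g"
      have z: "?\<Phi> ?u = 0" using vector_space_pair.linear_diff[OF fun_pair lin] fg(3) by simp
      have u: "?u \<in> ?U" using fv.subspace_diff[OF subspace_quasi_hom] fg by blast
      have "?u (h \<otimes> t) = ?u h" if "h \<in> carrier G" "t \<in> T" for h t using ev[OF u that] z by simp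
      then have c: "?u x = ?u \<one>" if "x \<in> carrier G" for x using invariant_constant[OF T(2) Ti T(3) _ that, of ?u] by blast
      have "?u x = 0" for x
      proof (cases "x \<in> carrier G")
        case True
        then show ?thesis using c[OF True] quasi_hom_one[OF Ns_subgroup u] by (simp only:)
      next
        case False
        then show ?thesis using u unfolding quasi_hom_def by blast
      qed
      then show "f = g" by (auto simp: fun_eq_iff)
    qed
    ultimately show ?thesis using dim_inj_image[OF lin, of ?U] by simp
  qed
  have "card ?V \<ge> 1" using index_pos[of n] by simp
  then show ?thesis using dims dimC dimZ by linarith
qed

theorem quasi_hom_limit:
  assumes pres: "is_fin_pres G T R"
  shows "(\<lambda>n. (real (fv.dim (quasi_hom G (Ns n) :: ('a \<Rightarrow> real) set)) + 1 - real (card (rcosets (Ns n)))) / real (card (rcosets (Ns n))))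
    \<longlonglongrightarrow> l2_betti1_pres G T R"
proof -
  have "real (fv.dim (group_ring_matrix.Ker (rcosets (Ns n)) (\<lambda>x g. x #> g) T (pres_cols G T R) (pres_supp G T R) (pres_matrix G)))
      = real (fv.dim (quasi_hom G (Ns n) :: ('a \<Rightarrow> real) set)) + 1 - real (card (rcosets (Ns n)))" for n
    using dim_harmonic_quotient[OF pres, of n] by linarith
  moreover have "(\<Sum>t\<in>T. (SUP h \<in> {h \<in> group_ring_matrix.l2harm (carrier G) (\<otimes>) T (pres_cols G T R) (pres_supp G T R) (pres_matrix G).
          sqrt (infsum (\<lambda>a. (h a)\<^sup>2) UNIV) \<le> 1}. h (\<one>, t))\<^sup>2) = l2_betti1_pres G T R"
    unfolding l2_betti1_pres_def l2harm_eq_l2_harmonic[OF pres] l2_norm_def ..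
  ultimately show ?thesis
    using lueck_approximation[OF pres_finite[OF pres], of "pres_matrix G"] by simp
qed

end

subsection \<open>Schreier generators and the rank gradient\<close>

context group
begin

text \<open>A spanning tree of the Schreier graph grown one coset at a time. The pairs in
  \<open>E\<close> are its edges, and the representatives \<open>\<rho>\<close> are compatible along
  them, so their Schreier generators are trivial.\<close>

lemma partial_transversal:
  assumes Y: "Y \<subseteq> carrier G" and K: "generate G Y = K" and H: "subgroup H G"
    and V: "finite ((\<lambda>k. H #> k) ` K)"
  shows "m < card ((\<lambda>k. H #> k) ` K) \<Longrightarrow> \<exists>C \<rho> E. C \<subseteq> (\<lambda>k. H #> k) ` K \<and> card C = Suc m \<and> H \<in> C
     \<and> (\<forall>c\<in>C. \<rho> c \<in> K \<and> c = H #> \<rho> c) \<and> \<rho> H = \<one> \<and> E \<subseteq> C \<times> Y \<and> finite E \<and> card E = m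
     \<and> (\<forall>(c, y)\<in>E. c #> y \<in> C \<and> \<rho> c \<otimes> y = \<rho> (c #> y))"
proof (induction m)
  case 0
  have "\<one> \<in> K" using generate.one[of G Y] K by simp
  moreover have "H = H #> \<one>" using coset_mult_one[OF subgroup.subset[OF H]] by simp
  ultimately show ?case by (intro exI[of _ "{H}"] exI[of _ "\<lambda>_. \<one>"] exI[of _ "{}"]) auto
next
  case (Suc m)
  let ?V = "(\<lambda>k. H #> k) ` K"
  have Hc: "H \<subseteq> carrier G" using subgroup.subset[OF H] .
  have Ks: "subgroup K G" using generate_is_subgroup[OF Y] K by simp
  have Kc: "K \<subseteq> carrier G" using subgroup.subset[OF Ks] .
  have YK: "Y \<subseteq> K" using generate.incl[of _ Y G] K by blast
  obtain C \<rho> E where C: "C \<subseteq> ?V" "card C = Suc m" "H \<in> C" "\<And>c. c \<in> C \<Longrightarrow> \<rho> c \<in> K \<and> c = H #> \<rho> c" "\<rho> H = \<one>"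
    "E \<subseteq> C \<times> Y" "finite E" "card E = m" "\<And>c y. (c, y) \<in> E \<Longrightarrow> c #> y \<in> C \<and> \<rho> c \<otimes> y = \<rho> (c #> y)"
    using Suc.IH[OF Suc_lessD[OF Suc.prems]] by blast
  have finC: "finite C" using C(1) V finite_subset by blast
  have \<rho>c: "\<rho> c \<in> carrier G" if "c \<in> C" for c using C(4)[OF that] Kc by blast
  have cy: "c #> y = H #> (\<rho> c \<otimes> y)" if "c \<in> C" "y \<in> carrier G" for c y
  proof -
    have "c #> y = (H #> \<rho> c) #> y" using C(4)[OF that(1)] by simp
    also have "\<dots> = H #> (\<rho> c \<otimes> y)" using coset_mult_assoc[OF Hc \<rho>c[OF that(1)] that(2)] .
    finally show ?thesis .
  qed
  \<comment> \<open>If no generator or inverse led out of \<open>C\<close>, then \<open>C\<close>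
    would be invariant under \<open>K\<close> and contain all cosets.\<close>
  have "\<exists>c\<in>C. \<exists>y\<in>Y. c #> y \<notin> C \<or> c #> inv y \<notin> C"
  proof (rule ccontr)
    assume "\<not> ?thesis"
    then have cl: "c #> y \<in> C" "c #> inv y \<in> C" if "c \<in> C" "y \<in> Y" for c y using that by blast+
    have "\<forall>c\<in>C. c #> k \<in> C" if "k \<in> generate G Y" for k
      using that
    proof (induction rule: generate.induct)
      case one
      show ?case using cy[OF _ one_closed] C(4) \<rho>c by auto
    next
      case (eng h1 h2)
      have h: "h1 \<in> carrier G" "h2 \<in> carrier G" using eng.hyps generate_in_carrier[OF Y] by auto
      show ?case
      proof
        fix c assume c: "c \<in> C"
        have "c \<subseteq> carrier G" using C(4)[OF c] r_coset_subset_G[OF Hc \<rho>c[OF c]] by blast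
        then have "c #> (h1 \<otimes> h2) = (c #> h1) #> h2" using coset_mult_assoc h by simp
        then show "c #> (h1 \<otimes> h2) \<in> C" using eng.IH c by simp
      qed
    qed (use cl in auto)
    then have "H #> k \<in> C" if "k \<in> K" for k using C(3) K that by blast
    then have "?V \<subseteq> C" by blast
    then have "card ?V \<le> card C" using card_mono[OF finC] by blast
    then show False using Suc.prems C(2) by simp
  qed
  then obtain c y where c: "c \<in> C" and y: "y \<in> Y" and ex: "c #> y \<notin> C \<or> c #> inv y \<notin> C" by blast
  have yc: "y \<in> carrier G" "y \<in> K" "inv y \<in> K" using y Y YK subgroup.m_inv_closed[OF Ks] by auto
  have step: ?case if c': "c' = H #> k" "k \<in> K" "c' \<notin> C" and e: "e \<notin> E" "e \<in> insert c' C \<times> Y"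
    and ee: "fst e #> snd e \<in> insert c' C" "(\<rho>(c' := k)) (fst e) \<otimes> snd e = (\<rho>(c' := k)) (fst e #> snd e)" for c' k e
  proof (intro exI[of _ "insert c' C"] exI[of _ "\<rho>(c' := k)"] exI[of _ "insert e E"] conjI)
    show "insert c' C \<subseteq> ?V" using C(1) c' by blast
    show "card (insert c' C) = Suc (Suc m)" using finC c'(3) C(2) by simp
    show "H \<in> insert c' C" using C(3) by simp
    show "\<forall>d\<in>insert c' C. (\<rho>(c' := k)) d \<in> K \<and> d = H #> (\<rho>(c' := k)) d" using C(4) c' by auto
    show "(\<rho>(c' := k)) H = \<one>" using C(3,5) c'(3) by auto
    show "insert e E \<subseteq> insert c' C \<times> Y" using C(6) e(2) by blast
    show "finite (insert e E)" using C(7) by simp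
    show "card (insert e E) = Suc m" using C(7,8) e(1) by simp
    have old: "d #> z \<in> insert c' C \<and> (\<rho>(c' := k)) d \<otimes> z = (\<rho>(c' := k)) (d #> z)" if dz: "(d, z) \<in> E" for d z
    proof -
      have "d \<in> C" "d #> z \<in> C" using C(6) C(9)[OF dz] dz by auto
      then show ?thesis using C(9)[OF dz] c'(3) by auto
    qed
    show "\<forall>(d, z)\<in>insert e E. d #> z \<in> insert c' C \<and> (\<rho>(c' := k)) d \<otimes> z = (\<rho>(c' := k)) (d #> z)"
      using old ee by (cases e) auto
  qed
  show ?case
  proof (cases "c #> y \<in> C")
    case False
    show ?thesis
    proof (rule step[of "c #> y" "\<rho> c \<otimes> y" "(c, y)"])
      show "c #> y = H #> (\<rho> c \<otimes> y)" by (rule cy[OF c yc(1)])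
      show "\<rho> c \<otimes> y \<in> K" using subgroup.m_closed[OF Ks] C(4)[OF c] yc by blast
      show "(c, y) \<notin> E" using C(9)[of c y] False by blast
    qed (use False c y in auto)
  next
    case True
    \<comment> \<open>\<open>Y\<close> is not closed under inverses, so a tree edge reached
      backwards is stored as the pair that starts at the new coset and leads back by y.\<close>
    then have nc: "c #> inv y \<notin> C" using ex by blast
    have "(c #> inv y) #> y = c"
    proof -
      have "(c #> inv y) #> y = (H #> (\<rho> c \<otimes> inv y)) #> y" using cy[OF c] yc by simp
      also have "\<dots> = H #> (\<rho> c \<otimes> inv y \<otimes> y)" using coset_mult_assoc[OF Hc] \<rho>c[OF c] yc by simp
      also have "\<rho> c \<otimes> inv y \<otimes> y = \<rho> c" using \<rho>c[OF c] yc by (simp add: m_assoc)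
      finally show ?thesis using C(4)[OF c] by simp
    qed
    note cc = this
    show ?thesis
    proof (rule step[of "c #> inv y" "\<rho> c \<otimes> inv y" "(c #> inv y, y)"])
      show "c #> inv y = H #> (\<rho> c \<otimes> inv y)" using cy[OF c] yc by simp
      show "\<rho> c \<otimes> inv y \<in> K" using subgroup.m_closed[OF Ks] C(4)[OF c] yc by blast
      show "(c #> inv y, y) \<notin> E" using C(6) nc by blast
      have "c \<noteq> c #> inv y" using c nc by auto
      then show "(\<rho>(c #> inv y := \<rho> c \<otimes> inv y)) (fst (c #> inv y, y)) \<otimes> snd (c #> inv y, y)
          = (\<rho>(c #> inv y := \<rho> c \<otimes> inv y)) (fst (c #> inv y, y) #> snd (c #> inv y, y))"
        using cc \<rho>c[OF c] yc by (simp add: m_assoc)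
    qed (use nc c y cc in auto)
  qed
qed

text \<open>Of the card \<open>Y\<close> times index many Schreier generators, those on the index -
  1 edges of a spanning tree are trivial and are left out. This gives the count in the index
  formula.\<close>

theorem schreier_generators:
  assumes Y: "finite Y" "Y \<subseteq> carrier G" and K: "generate G Y = K" and H: "subgroup H G" and HK: "H \<subseteq> K"
    and V: "finite ((\<lambda>k. H #> k) ` K)"
  shows "\<exists>B. finite B \<and> B \<subseteq> H \<and> generate G B = H
     \<and> card B + card ((\<lambda>k. H #> k) ` K) \<le> card Y * card ((\<lambda>k. H #> k) ` K) + 1"
proof -
  let ?V = "(\<lambda>k. H #> k) ` K"
  have Hc: "H \<subseteq> carrier G" using subgroup.subset[OF H] .
  have Ks: "subgroup K G" using generate_is_subgroup[OF Y(2)] K by simp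
  have Kc: "K \<subseteq> carrier G" using subgroup.subset[OF Ks] .
  have YK: "Y \<subseteq> K" using generate.incl[of _ Y G] K by blast
  have cV: "card ?V > 0" using V generate.one[of G Y] K by (auto simp: card_gt_0_iff)
  define l where "l = card ?V - 1"
  have lt: "l < card ?V" and Sl: "Suc l = card ?V" using cV by (simp_all add: l_def)
  obtain C \<rho> E where C: "C \<subseteq> ?V" "card C = Suc l" and HC: "H \<in> C" and C': "\<And>c. c \<in> C \<Longrightarrow> \<rho> c \<in> K \<and> c = H #> \<rho> c" "\<rho> H = \<one>"
    "E \<subseteq> C \<times> Y" "finite E" "card E = l" "\<And>c y. (c, y) \<in> E \<Longrightarrow> c #> y \<in> C \<and> \<rho> c \<otimes> y = \<rho> (c #> y)"
    using partial_transversal[OF Y(2) K H V lt] by blast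
  have CV: "C = ?V" using card_subset_eq[OF V C(1)] C(2) Sl by simp
  define \<sigma> where "\<sigma> = (\<lambda>(c, y). \<rho> c \<otimes> y \<otimes> inv (\<rho> (c #> y)))"
  define B where "B = \<sigma> ` (?V \<times> Y - E)"
  have finB: "finite B" unfolding B_def using V Y(1) by simp
  have EV: "E \<subseteq> ?V \<times> Y" using C'(3) CV by simp
  have "card B \<le> card (?V \<times> Y - E)" unfolding B_def using V Y(1) by (intro card_image_le) simp
  also have "\<dots> = card ?V * card Y - l"
    using card_Diff_subset[OF C'(4) EV] C'(5) by (simp add: card_cartesian_product)
  finally have cB: "card B \<le> card ?V * card Y - l" .
  have "card E \<le> card (?V \<times> Y)" using EV V Y(1) by (intro card_mono) auto
  then have cE: "l \<le> card ?V * card Y" using C'(5) by (simp add: card_cartesian_product)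
  have \<rho>K: "\<rho> c \<in> K" "c = H #> \<rho> c" "\<rho> c \<in> carrier G" if "c \<in> ?V" for c using C'(1)[of c] CV that Kc by auto
  have cg: "c #> g \<in> ?V" "c #> g = H #> (\<rho> c \<otimes> g)" if c: "c \<in> ?V" and g: "g \<in> K" for c g
  proof -
    have gc: "g \<in> carrier G" using g Kc by blast
    have "c #> g = (H #> \<rho> c) #> g" using \<rho>K(2)[OF c] by simp
    also have "\<dots> = H #> (\<rho> c \<otimes> g)" using coset_mult_assoc[OF Hc \<rho>K(3)[OF c] gc] .
    finally show e: "c #> g = H #> (\<rho> c \<otimes> g)" .
    show "c #> g \<in> ?V" unfolding e using subgroup.m_closed[OF Ks \<rho>K(1)[OF c] g] by blast
  qed
  have cc: "(c #> g) #> h = c #> (g \<otimes> h)" if "c \<in> ?V" "g \<in> K" "h \<in> K" for c g h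
  proof -
    have gh: "g \<in> carrier G" "h \<in> carrier G" using that Kc by auto
    have "(c #> g) #> h = (H #> (\<rho> c \<otimes> g)) #> h" using cg(2)[OF that(1,2)] by simp
    also have "\<dots> = H #> (\<rho> c \<otimes> (g \<otimes> h))" using coset_mult_assoc[OF Hc] \<rho>K(3)[OF that(1)] gh by (simp add: m_assoc)
    also have "\<dots> = c #> (g \<otimes> h)" using cg(2)[OF that(1) subgroup.m_closed[OF Ks that(2,3)]] by simp
    finally show ?thesis .
  qed
  have \<sigma>H: "\<rho> c \<otimes> g \<otimes> inv (\<rho> (c #> g)) \<in> H" if c: "c \<in> ?V" and g: "g \<in> K" for c g
  proof -
    have gc: "g \<in> carrier G" using g Kc by blast
    have "\<rho> c \<otimes> g \<in> c #> g" using cg(2)[OF c g] rcos_self[OF _ H, of "\<rho> c \<otimes> g"] \<rho>K(3)[OF c] gc by simp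
    then have "\<rho> c \<otimes> g \<in> H #> \<rho> (c #> g)" using \<rho>K(2)[OF cg(1)[OF c g]] by simp
    then obtain h where h: "h \<in> H" "\<rho> c \<otimes> g = h \<otimes> \<rho> (c #> g)" by (auto simp: r_coset_def)
    have "h \<in> carrier G" using h Hc by blast
    then show ?thesis using h \<rho>K(3)[OF cg(1)[OF c g]] by (simp add: m_assoc)
  qed
  have BH: "B \<subseteq> H" unfolding B_def \<sigma>_def using \<sigma>H YK by auto
  have Bc: "B \<subseteq> carrier G" using BH Hc by blast
  let ?L = "generate G B"
  have L: "subgroup ?L G" using generate_is_subgroup[OF Bc] .
  have LH: "?L \<subseteq> H" using generate_subgroup_incl[OF BH H] .
  have base: "\<rho> c \<otimes> y \<otimes> inv (\<rho> (c #> y)) \<in> ?L" if c: "c \<in> ?V" and y: "y \<in> Y" for c y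
  proof (cases "(c, y) \<in> E")
    case True
    have yK: "y \<in> K" using y YK by blast
    have "\<rho> c \<otimes> y \<otimes> inv (\<rho> (c #> y)) = \<one>"
      using C'(6)[OF True] \<rho>K(3)[OF cg(1)[OF c yK]] by simp
    then show ?thesis using subgroup.one_closed[OF L] by simp
  next
    case False
    then have "\<sigma> (c, y) \<in> B" unfolding B_def using c y by blast
    then have "\<sigma> (c, y) \<in> ?L" by (rule generate.incl)
    then show ?thesis by (simp add: \<sigma>_def)
  qed
  \<comment> \<open>The elements rho(c) g rho(c g)^-1 multiply like a cocycle: the one for g h is
    the product of the one for g at c and the one for h at c g. Membership thus passes from
    generators to all of \<open>K\<close>.\<close>
  have all: "\<forall>c\<in>?V. \<rho> c \<otimes> g \<otimes> inv (\<rho> (c #> g)) \<in> ?L" if "g \<in> generate G Y" for g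
    using that
  proof (induction rule: generate.induct)
    case one
    show ?case
    proof
      fix c assume c: "c \<in> ?V"
      have "c #> \<one> = c" using cg(2)[OF c] \<rho>K[OF c] subgroup.one_closed[OF Ks] by simp
      then show "\<rho> c \<otimes> \<one> \<otimes> inv (\<rho> (c #> \<one>)) \<in> ?L" using \<rho>K[OF c] subgroup.one_closed[OF L] by simp
    qed
  next
    case (incl h)
    then show ?case using base by blast
  next
    case (inv h)
    show ?case
    proof
      fix c assume c: "c \<in> ?V"
      have hK: "h \<in> K" "inv h \<in> K" "h \<in> carrier G" using inv YK subgroup.m_inv_closed[OF Ks] Kc by auto
      let ?d = "c #> inv h"
      have d: "?d \<in> ?V" using cg(1)[OF c hK(2)] .
      have dh: "?d #> h = c" using cc[OF c hK(2,1)] hK(3) cg(2)[OF c subgroup.one_closed[OF Ks]] \<rho>K[OF c] by simp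
      have "inv (\<rho> ?d \<otimes> h \<otimes> inv (\<rho> (?d #> h))) \<in> ?L" using base[OF d inv] subgroup.m_inv_closed[OF L] by blast
      moreover have "inv (\<rho> ?d \<otimes> h \<otimes> inv (\<rho> c)) = \<rho> c \<otimes> inv h \<otimes> inv (\<rho> ?d)"
        using \<rho>K(3)[OF c] \<rho>K(3)[OF d] hK by (simp add: inv_mult_group m_assoc)
      ultimately show "\<rho> c \<otimes> inv h \<otimes> inv (\<rho> ?d) \<in> ?L" using dh by simp
    qed
  next
    case (eng g h)
    show ?case
    proof
      fix c assume c: "c \<in> ?V"
      have gh: "g \<in> K" "h \<in> K" using eng.hyps K by auto
      then have ghc: "g \<in> carrier G" "h \<in> carrier G" using Kc by auto
      let ?d = "c #> g"
      have d: "?d \<in> ?V" using cg(1)[OF c gh(1)] .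
      have e: "?d #> h \<in> ?V" using cg(1)[OF d gh(2)] .
      have "(\<rho> c \<otimes> g \<otimes> inv (\<rho> ?d)) \<otimes> (\<rho> ?d \<otimes> h \<otimes> inv (\<rho> (?d #> h))) \<in> ?L"
        using eng.IH c d subgroup.m_closed[OF L] by blast
      moreover have "(\<rho> c \<otimes> g \<otimes> inv (\<rho> ?d)) \<otimes> (\<rho> ?d \<otimes> h \<otimes> inv (\<rho> (?d #> h))) = \<rho> c \<otimes> (g \<otimes> h) \<otimes> inv (\<rho> (?d #> h))"
      proof -
        have "inv (\<rho> ?d) \<otimes> (\<rho> ?d \<otimes> (h \<otimes> inv (\<rho> (?d #> h)))) = h \<otimes> inv (\<rho> (?d #> h))"
          using m_assoc[of "inv (\<rho> ?d)" "\<rho> ?d" "h \<otimes> inv (\<rho> (?d #> h))"] \<rho>K(3)[OF d] \<rho>K(3)[OF e] ghc by simp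
        then show ?thesis using \<rho>K(3)[OF c] \<rho>K(3)[OF d] \<rho>K(3)[OF e] ghc by (simp add: m_assoc)
      qed
      ultimately show "\<rho> c \<otimes> (g \<otimes> h) \<otimes> inv (\<rho> (c #> (g \<otimes> h))) \<in> ?L" using cc[OF c gh] by simp
    qed
  qed
  have "H \<subseteq> ?L"
  proof
    fix g assume g: "g \<in> H"
    have gc: "g \<in> carrier G" using g Hc by blast
    have "H #> \<one> \<in> ?V" using subgroup.one_closed[OF Ks] by blast
    then have HV: "H \<in> ?V" using coset_mult_one[OF Hc] by simp
    have "\<rho> H \<otimes> g \<otimes> inv (\<rho> (H #> g)) \<in> ?L" using all[of g] HV g HK K by blast
    moreover have "H #> g = H" using coset_join2[OF gc H g] .
    ultimately show "g \<in> ?L" using C'(2) gc by simp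
  qed
  then have "?L = H" using LH by blast
  moreover have "card B + card ?V \<le> card Y * card ?V + 1" using cB cE Sl[symmetric] by (simp add: mult.commute)
  ultimately show ?thesis using finB BH by blast
qed

end

section \<open>Indices and ranks along the chain\<close>

context residual_chain
begin

definition rel_cosets :: "nat \<Rightarrow> nat \<Rightarrow> 'a set set" where
  "rel_cosets n m = (\<lambda>k. Ns n #> k) ` Ns m"

lemma rel_cosets_subset: "rel_cosets n m \<subseteq> rcosets (Ns n)"
  using Ns_carrier by (auto simp: rel_cosets_def RCOSETS_def)

lemma finite_rel_cosets: "finite (rel_cosets n m)"
  using rel_cosets_subset finidx by (rule finite_subset)

lemma index_mult:
  assumes nm: "m \<le> n"
  shows "card (rcosets (Ns n)) = card (rcosets (Ns m)) * card (rel_cosets n m)"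
proof -
  have sub: "Ns n \<subseteq> Ns m" using Ns_antimono[OF nm] .
  have "\<forall>v\<in>rcosets (Ns m). \<exists>r. r \<in> carrier G \<and> v = Ns m #> r" by (auto simp: RCOSETS_def)
  then obtain \<rho> where \<rho>: "\<And>v. v \<in> rcosets (Ns m) \<Longrightarrow> \<rho> v \<in> carrier G \<and> v = Ns m #> \<rho> v" by metis
  let ?f = "\<lambda>(v, w). w #> \<rho> v"
  have eq: "(Ns n #> k) #> \<rho> v = Ns n #> (k \<otimes> \<rho> v)" if "v \<in> rcosets (Ns m)" "k \<in> Ns m" for v k
    using that \<rho> Ns_carrier by (intro coset_mult_assoc) auto
  have "bij_betw ?f ((rcosets (Ns m)) \<times> rel_cosets n m) (rcosets (Ns n))"
  proof (rule bij_betw_imageI)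
    show "inj_on ?f ((rcosets (Ns m)) \<times> rel_cosets n m)"
    proof (rule inj_onI, clarify)
      fix v w v' w' assume v: "v \<in> rcosets (Ns m)" "v' \<in> rcosets (Ns m)" and w: "w \<in> rel_cosets n m" "w' \<in> rel_cosets n m"
        and e: "w #> \<rho> v = w' #> \<rho> v'"
      obtain k k' where k: "k \<in> Ns m" "w = Ns n #> k" "k' \<in> Ns m" "w' = Ns n #> k'" using w by (auto simp: rel_cosets_def)
      have kc: "k \<in> carrier G" "k' \<in> carrier G" using k Ns_carrier by blast+
      have r: "\<rho> v \<in> carrier G" "\<rho> v' \<in> carrier G" using \<rho> v by blast+
      have e': "Ns n #> (k \<otimes> \<rho> v) = Ns n #> (k' \<otimes> \<rho> v')" using e eq v k by simp
      have "k \<otimes> \<rho> v \<in> Ns n #> (k' \<otimes> \<rho> v')" using rcos_self[OF _ Ns_subgroup, of "k \<otimes> \<rho> v" n] kc r e' by simp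
      then obtain \<gamma> where \<gamma>: "\<gamma> \<in> Ns n" "k \<otimes> \<rho> v = \<gamma> \<otimes> (k' \<otimes> \<rho> v')" by (auto simp: r_coset_def)
      have \<gamma>c: "\<gamma> \<in> carrier G" "\<gamma> \<in> Ns m" using \<gamma> sub Ns_carrier by blast+
      have a: "Ns m #> (j \<otimes> g) = Ns m #> g" if "j \<in> Ns m" "g \<in> carrier G" for j g
      proof -
        have j: "j \<in> carrier G" using that Ns_carrier by blast
        have "Ns m #> (j \<otimes> g) = (Ns m #> j) #> g" using j that by (simp add: coset_mult_assoc[OF Ns_carrier])
        then show ?thesis using coset_join2[OF j Ns_subgroup that(1)] by simp
      qed
      have "v = Ns m #> (k \<otimes> \<rho> v)" using a[OF k(1) r(1)] \<rho>[OF v(1)] by simp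
      also have "\<dots> = Ns m #> (k' \<otimes> \<rho> v')" unfolding \<gamma>(2) using a[OF \<gamma>c(2)] kc r by simp
      also have "\<dots> = v'" using a[OF k(3) r(2)] \<rho>[OF v(2)] by simp
      finally have vv: "v = v'" .
      have "(Ns n #> (k \<otimes> \<rho> v)) #> inv (\<rho> v) = (Ns n #> (k' \<otimes> \<rho> v)) #> inv (\<rho> v)" using e' vv by simp
      then have "w = w'" unfolding k using kc r by (simp add: coset_mult_assoc[OF Ns_carrier] m_assoc)
      then show "v = v' \<and> w = w'" using vv by simp
    qed
    show "?f ` ((rcosets (Ns m)) \<times> rel_cosets n m) = rcosets (Ns n)"
    proof
      show "?f ` ((rcosets (Ns m)) \<times> rel_cosets n m) \<subseteq> rcosets (Ns n)"
      proof clarify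
        fix v w assume "v \<in> rcosets (Ns m)" "w \<in> rel_cosets n m"
        then show "w #> \<rho> v \<in> rcosets (Ns n)"
          using right_action.act_closed[OF coset_action[of n]] rel_cosets_subset \<rho> by blast
      qed
      show "rcosets (Ns n) \<subseteq> ?f ` ((rcosets (Ns m)) \<times> rel_cosets n m)"
      proof
        fix x assume "x \<in> rcosets (Ns n)"
        then obtain g where g: "g \<in> carrier G" "x = Ns n #> g" by (auto simp: RCOSETS_def)
        let ?v = "Ns m #> g"
        have v: "?v \<in> rcosets (Ns m)" using g by (auto simp: RCOSETS_def)
        have "g \<in> Ns m #> \<rho> ?v" using \<rho>[OF v] rcos_self[OF g(1) Ns_subgroup, of m] by auto
        then obtain k where k: "k \<in> Ns m" "g = k \<otimes> \<rho> ?v" by (auto simp: r_coset_def)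
        have "x = ?f (?v, Ns n #> k)" using eq[OF v k(1)] k(2) g(2) by simp
        then show "x \<in> ?f ` ((rcosets (Ns m)) \<times> rel_cosets n m)" using v k(1) by (auto simp: rel_cosets_def)
      qed
    qed
  qed
  from bij_betw_same_card[OF this] show ?thesis by (simp add: card_cartesian_product)
qed

lemma min_gens_le:
  assumes "finite A" "A \<subseteq> H" "generate G A = H"
  shows "min_gens G H \<le> card A"
  unfolding min_gens_def by (rule Least_le) (use assms in blast)

lemma min_gens_attained:
  assumes "finite A" "A \<subseteq> H" "generate G A = H"
  shows "\<exists>B. finite B \<and> B \<subseteq> H \<and> card B = min_gens G H \<and> generate G B = H"
  unfolding min_gens_def by (rule LeastI_ex) (use assms in blast)

lemma Ns_fin_gen:
  assumes fg: "fin_gen G"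
  shows "\<exists>A. finite A \<and> A \<subseteq> Ns n \<and> card A = min_gens G (Ns n) \<and> generate G A = Ns n"
proof -
  obtain Y where Y: "finite Y" "Y \<subseteq> carrier G" "generate G Y = carrier G" using fg unfolding fin_gen_def by blast
  have "(\<lambda>k. Ns n #> k) ` carrier G = rcosets (Ns n)" by (auto simp: RCOSETS_def)
  then obtain B where "finite B" "B \<subseteq> Ns n" "generate G B = Ns n"
    using schreier_generators[OF Y Ns_subgroup Ns_carrier, of n] finidx by auto
  then show ?thesis by (rule min_gens_attained)
qed

text \<open>The Schreier index formula bounds d - 1 at the next stage by the relative index times d
  - 1, and indices multiply. Subtracting 1 from the rank makes the quotient monotone.\<close>

lemma rank_decreasing:
  assumes fg: "fin_gen G"
  shows "(real (min_gens G (Ns (Suc n))) - 1) / real (card (rcosets (Ns (Suc n))))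
       \<le> (real (min_gens G (Ns n)) - 1) / real (card (rcosets (Ns n)))"
proof -
  let ?W = "rel_cosets (Suc n) n"
  obtain Y where Y: "finite Y" "Y \<subseteq> Ns n" "card Y = min_gens G (Ns n)" "generate G Y = Ns n"
    using Ns_fin_gen[OF fg] by blast
  obtain B where B: "finite B" "B \<subseteq> Ns (Suc n)" "generate G B = Ns (Suc n)" "card B + card ?W \<le> card Y * card ?W + 1"
    using schreier_generators[OF Y(1) subset_trans[OF Y(2) Ns_carrier] Y(4) Ns_subgroup nested[of n]] finite_rel_cosets[of "Suc n" n]
    unfolding rel_cosets_def by blast
  have "min_gens G (Ns (Suc n)) + card ?W \<le> min_gens G (Ns n) * card ?W + 1"
    using min_gens_le[OF B(1-3)] B(4) Y(3) by simp
  then have "real (min_gens G (Ns (Suc n)) + card ?W) \<le> real (min_gens G (Ns n) * card ?W + 1)"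
    by (simp only: of_nat_le_iff)
  then have le: "real (min_gens G (Ns (Suc n))) - 1 \<le> (real (min_gens G (Ns n)) - 1) * real (card ?W)"
    by (simp add: algebra_simps)
  have idx: "card (rcosets (Ns (Suc n))) = card (rcosets (Ns n)) * card ?W" using index_mult[of n "Suc n"] by simp
  have W: "card ?W > 0" using index_pos[of "Suc n"] idx by (cases "card ?W") auto
  have "(real (min_gens G (Ns (Suc n))) - 1) / real (card (rcosets (Ns (Suc n))))
      \<le> ((real (min_gens G (Ns n)) - 1) * real (card ?W)) / real (card (rcosets (Ns (Suc n))))"
    using le by (intro divide_right_mono) auto
  also have "\<dots> = (real (min_gens G (Ns n)) - 1) / real (card (rcosets (Ns n)))"
    unfolding idx using W by simp
  finally show ?thesis .
qed

text \<open>Once \<open>Ns n\<close> avoids the nontrivial quotients x y^-1 of a finite set, its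
  elements lie in distinct cosets.\<close>

lemma index_at_top:
  assumes inf: "infinite (carrier G)"
  shows "filterlim (\<lambda>n. card (rcosets (Ns n))) at_top sequentially"
  unfolding filterlim_at_top
proof
  fix M :: nat
  obtain F where F: "F \<subseteq> carrier G" "finite F" "card F = M" using infinite_arbitrarily_large[OF inf] by blast
  have "finite ((\<lambda>(x, y). x \<otimes> inv y) ` (F \<times> F))" using F by simp
  from eventually_separates[OF this] show "\<forall>\<^sub>F n in sequentially. M \<le> card (rcosets (Ns n))"
  proof (rule eventually_mono)
    fix n assume sep: "Ns n \<inter> (\<lambda>(x, y). x \<otimes> inv y) ` (F \<times> F) \<subseteq> {\<one>}"
    have "inj_on (\<lambda>x. Ns n #> x) F"
    proof (rule inj_onI)
      fix x y assume xy: "x \<in> F" "y \<in> F" "Ns n #> x = Ns n #> y"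
      have c: "x \<in> carrier G" "y \<in> carrier G" using xy F by auto
      have "x \<in> Ns n #> y" using xy(3) rcos_self[OF c(1) Ns_subgroup, of n] by simp
      then obtain \<gamma> where \<gamma>: "\<gamma> \<in> Ns n" "x = \<gamma> \<otimes> y" by (auto simp: r_coset_def)
      have \<gamma>c: "\<gamma> \<in> carrier G" using \<gamma> Ns_carrier by blast
      have "x \<otimes> inv y = \<gamma>" using \<gamma> \<gamma>c c by (simp add: m_assoc)
      moreover have "x \<otimes> inv y \<in> (\<lambda>(x, y). x \<otimes> inv y) ` (F \<times> F)" using xy by force
      ultimately have "\<gamma> = \<one>" using sep \<gamma>(1) by blast
      then show "x = y" using \<gamma>(2) c by simp
    qed
    moreover have "(\<lambda>x. Ns n #> x) ` F \<subseteq> rcosets (Ns n)" using F(1) by (auto simp: RCOSETS_def)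
    ultimately show "M \<le> card (rcosets (Ns n))" using card_inj_on_le[OF _ _ finidx] F(3) by blast
  qed
qed

lemma inverse_index_tendsto:
  assumes inf: "infinite (carrier G)"
  shows "(\<lambda>n. 1 / real (card (rcosets (Ns n)))) \<longlonglongrightarrow> 0"
proof -
  have "filterlim (\<lambda>n. real (card (rcosets (Ns n)))) at_top sequentially"
    by (rule filterlim_compose[OF filterlim_real_sequentially index_at_top[OF inf]])
  then show ?thesis using tendsto_inverse_0_at_top by (simp add: divide_inverse)
qed

text \<open>Monotonicity and the lower bound -1 give convergence; the infinite index lets the
  summand 1/index disappear, so the limit is the rank gradient.\<close>

theorem rk_grad_limit:
  assumes inf: "infinite (carrier G)" and fg: "fin_gen G"
  shows "(\<lambda>n. (real (min_gens G (Ns n)) - 1) / real (card (rcosets (Ns n)))) \<longlonglongrightarrow> rk_grad G Ns"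
proof -
  define x where "x n = (real (min_gens G (Ns n)) - 1) / real (card (rcosets (Ns n)))" for n
  have "decseq x" unfolding x_def using rank_decreasing[OF fg] by (intro decseq_SucI)
  moreover have "- 1 \<le> x n" for n
    using index_pos[of n] by (simp add: x_def field_simps)
  ultimately obtain r where r: "x \<longlonglongrightarrow> r" using decseq_convergent[of x "- 1"] by blast
  have "(\<lambda>n. x n + 1 / real (card (rcosets (Ns n)))) \<longlonglongrightarrow> r + 0"
    by (rule tendsto_add[OF r inverse_index_tendsto[OF inf]])
  moreover have "x n + 1 / real (card (rcosets (Ns n))) = real (min_gens G (Ns n)) / real (group_index G (Ns n))" for n
    by (simp add: x_def group_index_def flip: add_divide_distrib)
  ultimately have "(\<lambda>n. real (min_gens G (Ns n)) / real (group_index G (Ns n))) \<longlonglongrightarrow> r" by simp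
  then have "rk_grad G Ns = r" unfolding rk_grad_def by (rule limI)
  then show ?thesis using r unfolding x_def by simp
qed

end

section \<open>Upper bound for the cost by competing graphs\<close>

lemma lazy_walk_imp_walk:
  "lazy_walk H p \<Longrightarrow> \<exists>p'. walk H p' \<and> hd p' = hd p \<and> last p' = last p \<and> length p' \<le> length p"
proof (induction p rule: induct_list012)
  case 1
  then show ?case by (simp add: lazy_walk_def)
next
  case (2 x)
  then show ?case by (intro exI[of _ "[x]"]) (auto simp: lazy_walk_def walk_def)
next
  case (3 x y zs)
  have w: "lazy_walk H (y # zs)" "x = y \<or> adj H x y" "x \<in> verts H" using 3(3) by (auto simp: lazy_walk_def)
  obtain p' where p': "walk H p'" "hd p' = y" "last p' = last (y # zs)" "length p' \<le> length (y # zs)"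
    using 3(2)[OF w(1)] by auto
  show ?case
  proof (cases "x = y")
    case True
    then show ?thesis using p' by (intro exI[of _ p']) auto
  next
    case False
    then have a: "adj H x y" using w(2) by simp
    have ne: "p' \<noteq> []" using p'(1) by (simp add: walk_def)
    have "adj H ((x # p') ! i) ((x # p') ! Suc i)" if "Suc i < length (x # p')" for i
      using that p'(1,2) a ne by (cases i) (auto simp: walk_def hd_conv_nth)
    then have "walk H (x # p')" using p'(1) w(3) by (auto simp: walk_def)
    then show ?thesis using p' ne by (intro exI[of _ "x # p'"]) auto
  qed
qed

text \<open>\<open>walk_transfer\<close> with the zero cochain is a purely metric statement. An
  infinite distance is handled by L > 0, which keeps the right-hand side infinite.\<close>

lemma gdist_lipschitz:
  assumes e: "\<And>x y. adj H x y \<Longrightarrow> \<exists>P. lazy_walk G P \<and> hd P = x \<and> last P = y \<and> length P - 1 \<le> L"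
    and v: "verts H \<subseteq> verts G" and L: "L > 0"
  shows "gdist G x y \<le> enat L * gdist H x y"
proof (cases "gdist H x y")
  case (enat k)
  obtain zs where zs: "walk H zs" "hd zs = x" "last zs = y" "length zs - 1 \<le> k"
    using gdist_le_imp_walk[of H x y k] enat by auto
  have z: "walk_sum (\<lambda>_. 0::int) P = 0" for P :: "'a list" by (simp add: walk_sum_eq_sum)
  have e': "\<exists>P. lazy_walk G P \<and> hd P = x \<and> last P = y \<and> length P - 1 \<le> L \<and> walk_sum (\<lambda>_. 0::int) P = 0"
    if "adj H x y" for x y using e[OF that] z by blast
  obtain P where P: "lazy_walk G P" "hd P = x" "last P = y" "length P - 1 \<le> L * (length zs - 1)"
    using walk_transfer[OF e' v zs(1)] unfolding zs(2,3) by blast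
  obtain p' where p': "walk G p'" "hd p' = x" "last p' = y" "length p' \<le> length P"
    using lazy_walk_imp_walk[OF P(1)] P(2,3) by auto
  have "gdist G x y \<le> enat (length p' - 1)" using gdist_le_walk[OF p'(1)] p'(2,3) by simp
  also have "length p' - 1 \<le> L * k"
    using p'(4) P(4) mult_le_mono2[OF zs(4), of L] by linarith
  then have "enat (length p' - 1) \<le> enat L * enat k" by simp
  finally show ?thesis using enat by simp
qed (use L in auto)

context cayley_chain
begin

text \<open>Edges labelled by \<open>B\<close> need to exist only at lifts in \<open>D\<close>; a
  word in \<open>B\<close> that starts in \<open>D\<close> stays there. In the application
  \<open>D\<close> is the subgroup \<open>Ns m\<close>.\<close>

lemma lift_walk_general:
  assumes D: "D \<subseteq> carrier G" and B: "B \<subseteq> carrier G" and v: "verts H = rcosets (Ns n)"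
    and st: "\<And>h b. h \<in> D \<Longrightarrow> b \<in> B \<Longrightarrow> h \<otimes> b \<in> D \<and> (vert n h = vert n (h \<otimes> b) \<or> adj H (vert n h) (vert n (h \<otimes> b)))"
  shows "set w \<subseteq> B \<Longrightarrow> h \<in> D \<Longrightarrow> lazy_walk H (lift_walk n h w) \<and> hd (lift_walk n h w) = vert n h
    \<and> last (lift_walk n h w) = vert n (h \<otimes> eval_word G w) \<and> length (lift_walk n h w) = Suc (length w)"
proof (induction w arbitrary: h)
  case Nil
  then have "h \<in> carrier G" using D by blast
  then show ?case using vert_mem[of h n] v by (simp add: lazy_walk_def)
next
  case (Cons b w)
  have c: "h \<in> carrier G" "b \<in> carrier G" "set w \<subseteq> carrier G" "set w \<subseteq> B" using Cons.prems D B by auto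
  note s = st[of h b]
  have s': "h \<otimes> b \<in> D" "vert n h = vert n (h \<otimes> b) \<or> adj H (vert n h) (vert n (h \<otimes> b))" using s Cons.prems by auto
  note IH = Cons.IH[OF c(4) s'(1)]
  obtain ys where ys: "lift_walk n (h \<otimes> b) w = vert n (h \<otimes> b) # ys" by (cases w) auto
  have "lazy_walk H (vert n h # lift_walk n (h \<otimes> b) w)"
    using IH s'(2) vert_mem[OF c(1), of n] v unfolding ys by (auto simp: lazy_walk_def)
  then show ?case using IH ys c by (simp add: m_assoc)
qed

lemma degree_bound:
  assumes A: "finite A" "A \<subseteq> carrier G" and e: "\<And>e. e \<in> edges H \<Longrightarrow> \<exists>k\<in>carrier G. \<exists>a\<in>A. e = {vert n k, vert n (k \<otimes> a)}"
    and v: "v \<in> rcosets (Ns n)"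
  shows "degree H v \<le> card (A \<union> (\<lambda>a. inv a) ` A)"
proof -
  obtain h where h: "h \<in> carrier G" "v = vert n h" using vert_surj[OF v] by blast
  have "{e \<in> edges H. v \<in> e} \<subseteq> (\<lambda>a. {v, vert n (h \<otimes> a)}) ` (A \<union> (\<lambda>a. inv a) ` A)"
  proof
    fix e' assume "e' \<in> {e \<in> edges H. v \<in> e}"
    then have e': "e' \<in> edges H" "v \<in> e'" by auto
    obtain k a where ka: "k \<in> carrier G" "a \<in> A" "e' = {vert n k, vert n (k \<otimes> a)}" using e[OF e'(1)] by blast
    have ac: "a \<in> carrier G" using ka A by blast
    from e'(2) ka(3) consider "v = vert n k" | "v = vert n (k \<otimes> a)" by auto
    then show "e' \<in> (\<lambda>a. {v, vert n (h \<otimes> a)}) ` (A \<union> (\<lambda>a. inv a) ` A)"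
    proof cases
      case 1
      then have "vert n (h \<otimes> a) = vert n (k \<otimes> a)" using h ka ac by (intro vert_right_mult_eq) auto
      then show ?thesis using 1 ka by auto
    next
      case 2
      then have "vert n (h \<otimes> inv a) = vert n (k \<otimes> a \<otimes> inv a)" using h ka ac by (intro vert_right_mult_eq) auto
      then have "vert n (h \<otimes> inv a) = vert n k" using ka ac by (simp add: m_assoc)
      then have "e' = {v, vert n (h \<otimes> inv a)}" using 2 ka(3) by auto
      then show ?thesis using ka(2) by blast
    qed
  qed
  then have "card {e \<in> edges H. v \<in> e} \<le> card ((\<lambda>a. {v, vert n (h \<otimes> a)}) ` (A \<union> (\<lambda>a. inv a) ` A))"
    using A by (intro card_mono) auto
  also have "\<dots> \<le> card (A \<union> (\<lambda>a. inv a) ` A)" using A by (intro card_image_le) auto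
  finally show ?thesis by (simp add: degree_def)
qed

lemma Cay_edges:
  assumes "e \<in> edges (Cay n)"
  shows "\<exists>k\<in>carrier G. \<exists>a\<in>S. e = {vert n k, vert n (k \<otimes> a)}"
proof -
  obtain x y where xy: "e = {x, y}" "x \<in> rcosets (Ns n)" using assms unfolding edges_def cayley_quot_def by auto
  obtain h where h: "h \<in> carrier G" "x = vert n h" using vert_surj[OF xy(2)] by blast
  have "adj (Cay n) (vert n h) y" using assms xy h by (simp add: adj_def)
  then obtain s where s: "s \<in> S" "y = vert n (h \<otimes> s)" using adj_Cay[OF h(1), of n y] by blast
  then have "e = {vert n h, vert n (h \<otimes> s)}" using xy h by simp
  then show ?thesis using h(1) s(1) by blast
qed

text \<open>The competing graphs: Cayley graphs of \<open>Ns m / Ns n\<close> for a minimal generating set of \<open>Ns m\<close>,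
  with every other vertex attached to them by a single edge.\<close>

theorem cost_le:
  assumes inf: "infinite (carrier G)" and fg: "fin_gen G"
  shows "cost (\<lambda>n. Cay n) \<le> ereal (1 + (real (min_gens G (Ns m)) - 1) / real (card (rcosets (Ns m))))"
proof -
  obtain Y where Y: "finite Y" "Y \<subseteq> Ns m" "card Y = min_gens G (Ns m)" "generate G Y = Ns m"
    using Ns_fin_gen[OF fg] by blast
  have Yc: "Y \<subseteq> carrier G" using Y(2) Ns_carrier by blast
  let ?Vm = "rcosets (Ns m)"
  \<comment> \<open>Choosing 1 for the trivial coset makes \<open>r\<close> trivial on
    \<open>Ns m\<close>, so the vertices of \<open>W n\<close> receive no attaching edge.\<close>
  have "\<forall>v\<in>?Vm. \<exists>r. r \<in> carrier G \<and> v = Ns m #> r \<and> (v = Ns m \<longrightarrow> r = \<one>)"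
  proof
    fix v assume "v \<in> ?Vm"
    then obtain g where "g \<in> carrier G" "v = Ns m #> g" by (auto simp: RCOSETS_def)
    then show "\<exists>r. r \<in> carrier G \<and> v = Ns m #> r \<and> (v = Ns m \<longrightarrow> r = \<one>)"
      using coset_mult_one[OF Ns_carrier[of m]] by (cases "v = Ns m") auto
  qed
  then obtain \<rho> where \<rho>: "\<And>v. v \<in> ?Vm \<Longrightarrow> \<rho> v \<in> carrier G \<and> v = Ns m #> \<rho> v \<and> (v = Ns m \<longrightarrow> \<rho> v = \<one>)" by metis
  define r where "r h = \<rho> (Ns m #> h)" for h
  have r: "r h \<in> carrier G" "h \<otimes> inv (r h) \<in> Ns m" "r h \<in> \<rho> ` ?Vm" "h \<in> Ns m \<Longrightarrow> r h = \<one>" if h: "h \<in> carrier G" for h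
  proof -
    have v: "Ns m #> h \<in> ?Vm" using h by (auto simp: RCOSETS_def)
    show rc: "r h \<in> carrier G" "r h \<in> \<rho> ` ?Vm" using \<rho>[OF v] v by (auto simp: r_def)
    have "h \<in> Ns m #> r h" using \<rho>[OF v] rcos_self[OF h Ns_subgroup, of m] by (simp add: r_def)
    then obtain \<gamma> where \<gamma>: "\<gamma> \<in> Ns m" "h = \<gamma> \<otimes> r h" by (auto simp: r_coset_def)
    have "\<gamma> \<in> carrier G" using \<gamma> Ns_carrier by blast
    then have "h \<otimes> inv (r h) = \<gamma>" using \<gamma>(2) rc(1) h by (metis inv_solve_right)
    then show "h \<otimes> inv (r h) \<in> Ns m" using \<gamma> by simp
    show "r h = \<one>" if "h \<in> Ns m" using \<rho>[OF v] coset_join2[OF h Ns_subgroup that] by (simp add: r_def)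
  qed
  have r_inv: "r (\<gamma> \<otimes> h) = r h" if "\<gamma> \<in> Ns m" "h \<in> carrier G" for \<gamma> h
    using coset_mult_left[OF that] by (simp add: r_def)
  define Rs where "Rs = \<rho> ` ?Vm"
  have Rs: "finite Rs" "Rs \<subseteq> carrier G" using finidx[of m] \<rho> by (auto simp: Rs_def)
  define W where "W n = vert n ` Ns m" for n
  define E1 where "E1 n = {{vert n \<gamma>, vert n (\<gamma> \<otimes> y)} | \<gamma> y. \<gamma> \<in> Ns m \<and> y \<in> Y \<and> vert n \<gamma> \<noteq> vert n (\<gamma> \<otimes> y)}" for n
  define E2 where "E2 n = {{vert n h, vert n (h \<otimes> inv (r h))} | h. h \<in> carrier G \<and> vert n h \<notin> W n}" for n
  define Hn where "Hn n = (rcosets (Ns n), E1 n \<union> E2 n)" for n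
  have vH: "verts (Hn n) = rcosets (Ns n)" for n by (simp add: Hn_def verts_def)
  have eH: "edges (Hn n) = E1 n \<union> E2 n" for n by (simp add: Hn_def edges_def)
  have WV: "W n \<subseteq> rcosets (Ns n)" for n unfolding W_def using vert_mem Ns_carrier by blast
  have finW: "finite (W n)" for n using WV finidx finite_subset by blast
  have Wmem: "h \<in> Ns m" if mn: "m \<le> n" and hc: "h \<in> carrier G" and hW: "vert n h \<in> W n" for n h
  proof -
    obtain \<gamma> where \<gamma>: "\<gamma> \<in> Ns m" "vert n h = vert n \<gamma>" using hW by (auto simp: W_def)
    have \<gamma>c: "\<gamma> \<in> carrier G" using \<gamma> Ns_carrier by blast
    obtain \<delta> where "\<delta> \<in> Ns n" "h = \<delta> \<otimes> \<gamma>" using vert_eqD[OF \<gamma>(2)[symmetric] \<gamma>c hc] by blast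
    then show ?thesis using \<gamma>(1) Ns_antimono[OF mn] subgroup.m_closed[OF Ns_subgroup] by blast
  qed
  have cardW: "card (W n) = card (rel_cosets n m)" for n
  proof -
    have "W n = rel_cosets n m"
    proof
      show "W n \<subseteq> rel_cosets n m"
        unfolding W_def rel_cosets_def vert_def using subgroup.m_inv_closed[OF Ns_subgroup] by blast
      show "rel_cosets n m \<subseteq> W n"
      proof
        fix x assume "x \<in> rel_cosets n m"
        then obtain k where k: "k \<in> Ns m" "x = Ns n #> k" by (auto simp: rel_cosets_def)
        have "k \<in> carrier G" using k Ns_carrier by blast
        then have "x = vert n (inv k)" using k by (simp add: vert_def)
        then show "x \<in> W n" unfolding W_def using subgroup.m_inv_closed[OF Ns_subgroup k(1)] by blast
      qed
    qed
    then show ?thesis by simp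
  qed
  have cE1: "card (E1 n) \<le> card (W n) * card Y" for n
  proof -
    have "E1 n \<subseteq> (\<lambda>(w, y). {w, (Ns n #> inv y) <#> w}) ` (W n \<times> Y)"
    proof
      fix e assume "e \<in> E1 n"
      then obtain \<gamma> y where e: "e = {vert n \<gamma>, vert n (\<gamma> \<otimes> y)}" "\<gamma> \<in> Ns m" "y \<in> Y" by (auto simp: E1_def)
      have c: "\<gamma> \<in> carrier G" "y \<in> carrier G" using e Ns_carrier Yc by blast+
      have "(Ns n #> inv y) <#> vert n \<gamma> = vert n (\<gamma> \<otimes> y)" using coset_mult_vert[of "inv y" \<gamma> n] c by simp
      then have "e = (\<lambda>(w, y). {w, (Ns n #> inv y) <#> w}) (vert n \<gamma>, y)" using e(1) by simp
      then show "e \<in> (\<lambda>(w, y). {w, (Ns n #> inv y) <#> w}) ` (W n \<times> Y)" using e(2,3) by (auto simp: W_def)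
    qed
    then have "card (E1 n) \<le> card ((\<lambda>(w, y). {w, (Ns n #> inv y) <#> w}) ` (W n \<times> Y))"
      using finW Y(1) by (intro card_mono) auto
    also have "\<dots> \<le> card (W n \<times> Y)" using finW Y(1) by (intro card_image_le) auto
    finally show ?thesis by (simp add: card_cartesian_product)
  qed
  \<comment> \<open>For m \<le> n two lifts of a vertex differ by an element of \<open>Ns m\<close>,
    so they have the same representative and give the same edge. Hence there is at most one
    attaching edge per vertex outside \<open>W n\<close>.\<close>
  have cE2: "card (E2 n) \<le> card (rcosets (Ns n)) - card (W n)" if mn: "m \<le> n" for n
  proof -
    define f where "f z = (let h = (SOME h. h \<in> carrier G \<and> z = vert n h) in {z, vert n (h \<otimes> inv (r h))})" for z
    have "E2 n \<subseteq> f ` (rcosets (Ns n) - W n)"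
    proof
      fix e assume "e \<in> E2 n"
      then obtain h where e: "e = {vert n h, vert n (h \<otimes> inv (r h))}" "h \<in> carrier G" "vert n h \<notin> W n" by (auto simp: E2_def)
      define k where "k = (SOME k. k \<in> carrier G \<and> vert n h = vert n k)"
      have k: "k \<in> carrier G" "vert n h = vert n k"
        unfolding k_def using someI[of "\<lambda>k. k \<in> carrier G \<and> vert n h = vert n k" h] e(2) by auto
      obtain \<gamma> where \<gamma>: "\<gamma> \<in> Ns n" "k = \<gamma> \<otimes> h" using vert_eqD[OF k(2) e(2) k(1)] by blast
      have "r k = r h" using r_inv[of \<gamma> h] \<gamma> Ns_antimono[OF mn] e(2) by blast
      moreover have "vert n (h \<otimes> inv (r h)) = vert n (k \<otimes> inv (r h))"
        using k e(2) r(1)[OF e(2)] by (intro vert_right_mult_eq) auto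
      ultimately have "f (vert n h) = e" unfolding f_def k_def[symmetric] Let_def e(1) by simp
      then show "e \<in> f ` (rcosets (Ns n) - W n)" using e(2,3) vert_mem by blast
    qed
    then have "card (E2 n) \<le> card (f ` (rcosets (Ns n) - W n))" using finidx by (intro card_mono) auto
    also have "\<dots> \<le> card (rcosets (Ns n) - W n)" using finidx by (intro card_image_le) auto
    also have "\<dots> = card (rcosets (Ns n)) - card (W n)" using card_Diff_subset[OF finW WV] .
    finally show ?thesis .
  qed
  have simH: "simple_graph (Hn n)" if mn: "m \<le> n" for n
    unfolding simple_graph_def vH eH
  proof (intro conjI ballI)
    show "finite (rcosets (Ns n))" by (rule finidx)
    fix e assume "e \<in> E1 n \<union> E2 n"
    then have "\<exists>x y. e = {x, y} \<and> x \<in> rcosets (Ns n) \<and> y \<in> rcosets (Ns n) \<and> x \<noteq> y"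
    proof
      assume "e \<in> E1 n"
      then obtain \<gamma> y where e: "e = {vert n \<gamma>, vert n (\<gamma> \<otimes> y)}" "\<gamma> \<in> Ns m" "y \<in> Y" "vert n \<gamma> \<noteq> vert n (\<gamma> \<otimes> y)" by (auto simp: E1_def)
      have "\<gamma> \<in> carrier G" "y \<in> carrier G" using e Ns_carrier Yc by blast+
      then show ?thesis using e vert_mem[of \<gamma> n] vert_mem[of "\<gamma> \<otimes> y" n] by blast
    next
      assume "e \<in> E2 n"
      then obtain h where e: "e = {vert n h, vert n (h \<otimes> inv (r h))}" "h \<in> carrier G" "vert n h \<notin> W n" by (auto simp: E2_def)
      have w: "vert n (h \<otimes> inv (r h)) \<in> W n" unfolding W_def using r(2)[OF e(2)] by (rule imageI)
      have "vert n h \<noteq> vert n (h \<otimes> inv (r h))" using w e(3) by metis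
      moreover have "vert n (h \<otimes> inv (r h)) \<in> rcosets (Ns n)" using w WV[of n] by (rule subsetD[rotated])
      ultimately show ?thesis using e(1) vert_mem[OF e(2), of n]
        by (intro exI[of _ "vert n h"] exI[of _ "vert n (h \<otimes> inv (r h))"] conjI)
    qed
    then obtain x y where "e = {x, y}" "x \<in> rcosets (Ns n)" "y \<in> rcosets (Ns n)" "x \<noteq> y" by (elim exE conjE)
    then show "e \<subseteq> rcosets (Ns n)" "card e = 2" by (simp_all only: card_2_iff insert_subset) blast+
  qed
  \<comment> \<open>All elements by which an edge moves a lift. The set is finite and the same for
    every n, which yields the degree bound and the constant \<open>L1\<close>.\<close>
  define A where "A = S \<union> (Y \<union> (\<lambda>a. inv a) ` Rs)"
  have A: "finite A" "A \<subseteq> carrier G" using S_fin S_sub Y(1) Yc Rs by (auto simp: A_def)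
  have Hedge: "\<exists>k\<in>carrier G. \<exists>a\<in>A. e = {vert n k, vert n (k \<otimes> a)}" if "e \<in> edges (Hn n)" for e n
    using that unfolding eH
  proof
    assume "e \<in> E1 n"
    then obtain \<gamma> y where e: "e = {vert n \<gamma>, vert n (\<gamma> \<otimes> y)}" "\<gamma> \<in> Ns m" "y \<in> Y" by (auto simp: E1_def)
    have "\<gamma> \<in> carrier G" "y \<in> A" using e(2,3) Ns_carrier[of m] by (auto simp: A_def)
    then show ?thesis using e(1) by (intro bexI[of _ \<gamma>] bexI[of _ y])
  next
    assume "e \<in> E2 n"
    then obtain h where e: "e = {vert n h, vert n (h \<otimes> inv (r h))}" "h \<in> carrier G" by (auto simp: E2_def)
    have "inv (r h) \<in> A" using r(3)[OF e(2)] by (auto simp: A_def Rs_def)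
    then show ?thesis using e by (intro bexI[of _ h] bexI[of _ "inv (r h)"])
  qed
  \<comment> \<open>The construction is for m \<le> n; before that the Cayley graph itself fills in.
    Finitely many terms do not affect the lower limit of the densities.\<close>
  define Hs where "Hs n = (if n < m then Cay n else Hn n)" for n
  have vHs: "verts (Hs n) = verts (Cay n)" for n by (simp add: Hs_def vH verts_Cay)
  have Hsedge: "\<exists>k\<in>carrier G. \<exists>a\<in>A. e = {vert n k, vert n (k \<otimes> a)}" if "e \<in> edges (Hs n)" for e n
  proof (cases "n < m")
    case True
    then have "e \<in> edges (Cay n)" using that by (simp add: Hs_def)
    then obtain k a where ka: "k \<in> carrier G" "a \<in> S" "e = {vert n k, vert n (k \<otimes> a)}" using Cay_edges by metis
    have "a \<in> A" using ka(2) by (simp add: A_def)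
    then show ?thesis using ka by (intro bexI[of _ k] bexI[of _ a])
  next
    case False
    then show ?thesis using Hedge[of e n] that by (simp add: Hs_def)
  qed
  have seqH: "graph_seq Hs"
    unfolding graph_seq_def
  proof (intro conjI allI)
    show "simple_graph (Hs n)" for n using simple_Cay simH by (simp add: Hs_def)
    show "\<exists>D. \<forall>n. \<forall>v\<in>verts (Hs n). degree (Hs n) v \<le> D"
      by (intro exI[of _ "card (A \<union> (\<lambda>a. inv a) ` A)"] allI ballI degree_bound[OF A Hsedge]) (simp_all add: vHs verts_Cay)
    show "LIM n sequentially. card (verts (Hs n)) :> at_top"
      using index_at_top[OF inf] by (simp add: vHs verts_Cay)
  qed
  have "\<forall>a\<in>A. \<exists>w. set w \<subseteq> S \<and> eval_word G w = a" using generate_word[OF S_sub S_sym] S_gen A(2) by auto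
  then obtain ws where ws: "\<And>a. a \<in> A \<Longrightarrow> set (ws a) \<subseteq> S \<and> eval_word G (ws a) = a" by metis
  define L1 where "L1 = Suc (\<Sum>a\<in>A. length (ws a))"
  have wsL: "length (ws a) \<le> L1" if "a \<in> A" for a
    unfolding L1_def using member_le_sum[OF that, of "\<lambda>a. length (ws a)"] A(1) by simp
  have lip1: "\<exists>P. lazy_walk (Cay n) P \<and> hd P = x \<and> last P = y \<and> length P - 1 \<le> L1" if xy: "adj (Hs n) x y" for n x y
  proof -
    obtain k a where ka: "k \<in> carrier G" "a \<in> A" "{x, y} = {vert n k, vert n (k \<otimes> a)}"
      using Hsedge[of "{x, y}" n] xy by (auto simp: adj_def)
    let ?P = "lift_walk n k (ws a)"
    have P: "lazy_walk (Cay n) ?P" "hd ?P = vert n k" "last ?P = vert n (k \<otimes> a)" "length ?P - 1 \<le> L1"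
      using lift_walk_props[OF _ ka(1), of "ws a" n "\<lambda>_. 0::int"] ws[OF ka(2)] wsL[OF ka(2)] by auto
    have ne: "?P \<noteq> []" using P(1) by (simp add: lazy_walk_def)
    from ka(3) consider "x = vert n k" "y = vert n (k \<otimes> a)" | "x = vert n (k \<otimes> a)" "y = vert n k" by (auto simp: doubleton_eq_iff)
    then show ?thesis
    proof cases
      case 1
      then show ?thesis using P by (intro exI[of _ ?P]) simp
    next
      case 2
      then show ?thesis using P ne lazy_walk_rev[OF P(1)] by (intro exI[of _ "rev ?P"]) (simp add: hd_rev last_rev)
    qed
  qed
  define Yi where "Yi = Y \<union> (\<lambda>y. inv y) ` Y"
  have Yi1: "Yi \<subseteq> Ns m" using Y(2) subgroup.m_inv_closed[OF Ns_subgroup[of m]] unfolding Yi_def by blast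
  have Yi: "Yi \<subseteq> Ns m" "Yi \<subseteq> carrier G" by (rule Yi1, rule subset_trans[OF Yi1 Ns_carrier[of m]])
  have Yisym: "inv y \<in> Yi" if "y \<in> Yi" for y using that Yc by (auto simp: Yi_def)
  have genYi: "g \<in> generate G Yi" if "g \<in> Ns m" for g
    using mono_generate[of Y Yi] Y(4) that by (auto simp: Yi_def)
  have "\<forall>g\<in>Ns m. \<exists>w. set w \<subseteq> Yi \<and> eval_word G w = g" using generate_word[OF Yi(2) Yisym] genYi by auto
  then obtain yw where yw: "\<And>g. g \<in> Ns m \<Longrightarrow> set (yw g) \<subseteq> Yi \<and> eval_word G (yw g) = g" by metis
  \<comment> \<open>Contains every element of \<open>Ns m\<close> that arises from crossing an edge
    of the Cayley graph. It is finite and independent of n.\<close>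
  define Fm where "Fm = (\<lambda>(a, s, b). a \<otimes> s \<otimes> inv b) ` (Rs \<times> S \<times> Rs)"
  have finFm: "finite Fm" unfolding Fm_def using Rs(1) S_fin by simp
  \<comment> \<open>Bounds the length of a word in the generators of \<open>Ns m\<close> for such an
    element; the 2 pays for the attaching edges at both ends.\<close>
  define L2 where "L2 = (\<Sum>a\<in>Fm. length (yw a)) + 2"
  have ywL: "length (yw a) + 2 \<le> L2" if "a \<in> Fm" for a
    unfolding L2_def using member_le_sum[OF that, of "\<lambda>a. length (yw a)"] finFm by simp
  have lip2: "\<exists>P. lazy_walk (Hs n) P \<and> hd P = x \<and> last P = y \<and> length P - 1 \<le> L2" if xy: "adj (Cay n) x y" for n x y
  proof (cases "n < m")
    case True
    have "lazy_walk (Cay n) [x, y]" using xy adj_verts[OF simple_Cay xy] by (simp add: lazy_walk_def)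
    then show ?thesis using True by (intro exI[of _ "[x, y]"]) (simp add: Hs_def L2_def)
  next
    case False
    then have mn: "m \<le> n" and HH: "Hs n = Hn n" by (auto simp: Hs_def)
    have "x \<in> rcosets (Ns n)" using adj_verts[OF simple_Cay xy] by (simp add: verts_Cay)
    then obtain h where h: "h \<in> carrier G" "x = vert n h" using vert_surj by blast
    then obtain s where s: "s \<in> S" "y = vert n (h \<otimes> s)" using xy adj_Cay by blast
    have sc: "s \<in> carrier G" using s S_sub by blast
    have link: "lazy_walk (Hn n) [vert n g, vert n (g \<otimes> inv (r g))]" if g: "g \<in> carrier G" for g
    proof -
      have "vert n g = vert n (g \<otimes> inv (r g)) \<or> adj (Hn n) (vert n g) (vert n (g \<otimes> inv (r g)))"
      proof (cases "vert n g \<in> W n")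
        case True
        then have "r g = \<one>" using r(4)[OF g] Wmem[OF mn g] by blast
        then show ?thesis using g by simp
      next
        case False
        then show ?thesis unfolding adj_def eH E2_def using g by blast
      qed
      then show ?thesis using vert_mem[OF g, of n] vert_mem[of "g \<otimes> inv (r g)" n] g r(1)[OF g]
        by (simp add: lazy_walk_def vH)
    qed
    define g where "g = h \<otimes> s"
    have gc: "g \<in> carrier G" using h sc by (simp add: g_def)
    define \<gamma> where "\<gamma> = h \<otimes> inv (r h)"
    define \<delta> where "\<delta> = g \<otimes> inv (r g)"
    have \<gamma>: "\<gamma> \<in> Ns m" "\<gamma> \<in> carrier G" using r(1,2)[OF h(1)] h by (auto simp: \<gamma>_def)
    have \<delta>: "\<delta> \<in> Ns m" "\<delta> \<in> carrier G" using r(1,2)[OF gc] gc by (auto simp: \<delta>_def)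
    \<comment> \<open>The Schreier element of the edge from h to g: it carries the attaching point
      of h to that of g inside \<open>Ns m\<close>.\<close>
    define a where "a = r h \<otimes> s \<otimes> inv (r g)"
    have ac: "a \<in> carrier G" using r(1)[OF h(1)] r(1)[OF gc] sc by (simp add: a_def)
    have \<gamma>a: "\<gamma> \<otimes> a = \<delta>"
    proof -
      have "inv (r h) \<otimes> (r h \<otimes> (s \<otimes> inv (r g))) = s \<otimes> inv (r g)"
        using m_assoc[of "inv (r h)" "r h" "s \<otimes> inv (r g)"] r(1)[OF h(1)] r(1)[OF gc] sc by simp
      then show ?thesis unfolding \<gamma>_def \<delta>_def a_def g_def using h sc r(1)[OF h(1)] r(1)[OF gc]
        by (simp add: m_assoc g_def)
    qed
    have am: "a \<in> Ns m"
    proof -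
      have "a = inv \<gamma> \<otimes> \<delta>" using \<gamma>a \<gamma>(2) \<delta>(2) ac by (metis inv_solve_left)
      then show ?thesis using subgroup.m_closed[OF Ns_subgroup subgroup.m_inv_closed[OF Ns_subgroup \<gamma>(1)] \<delta>(1)] by simp
    qed
    have aF: "a \<in> Fm" unfolding Fm_def a_def using r(3)[OF h(1)] r(3)[OF gc] s(1) by (force simp: Rs_def)
    have "lazy_walk (Hn n) (lift_walk n \<gamma> (yw a)) \<and> hd (lift_walk n \<gamma> (yw a)) = vert n \<gamma>
      \<and> last (lift_walk n \<gamma> (yw a)) = vert n (\<gamma> \<otimes> eval_word G (yw a)) \<and> length (lift_walk n \<gamma> (yw a)) = Suc (length (yw a))"
    proof (rule lift_walk_general[where D = "Ns m" and B = Yi])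
      fix k b assume k: "k \<in> Ns m" and b: "b \<in> Yi"
      have kb: "k \<otimes> b \<in> Ns m" using subgroup.m_closed[OF Ns_subgroup k] Yi(1) b by blast
      have kc: "k \<in> carrier G" using k Ns_carrier by blast
      have "vert n k = vert n (k \<otimes> b) \<or> {vert n k, vert n (k \<otimes> b)} \<in> E1 n"
      proof (cases "b \<in> Y")
        case True
        then show ?thesis unfolding E1_def using k by blast
      next
        case False
        then obtain z where z: "z \<in> Y" "b = inv z" using b by (auto simp: Yi_def)
        have zc: "z \<in> carrier G" using z Yc by blast
        have "k \<otimes> b \<otimes> z = k" using z zc kc by (simp add: m_assoc)
        then have "{vert n (k \<otimes> b), vert n k} \<in> E1 n \<or> vert n (k \<otimes> b) = vert n k"
          unfolding E1_def using kb z(1) by force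
        then show ?thesis by (auto simp: insert_commute)
      qed
      then show "k \<otimes> b \<in> Ns m \<and> (vert n k = vert n (k \<otimes> b) \<or> adj (Hn n) (vert n k) (vert n (k \<otimes> b)))"
        using kb unfolding adj_def eH by blast
    qed (use Ns_carrier Yi(2) vH yw[OF am] \<gamma>(1) in auto)
    then have P2: "lazy_walk (Hn n) (lift_walk n \<gamma> (yw a))" "hd (lift_walk n \<gamma> (yw a)) = vert n \<gamma>"
      "last (lift_walk n \<gamma> (yw a)) = vert n \<delta>" "length (lift_walk n \<gamma> (yw a)) = Suc (length (yw a))"
      using yw[OF am] \<gamma>a by auto
    let ?P2 = "lift_walk n \<gamma> (yw a)"
    have P1: "lazy_walk (Hn n) [vert n h, vert n \<gamma>]" using link[OF h(1)] by (simp add: \<gamma>_def)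
    have P3: "lazy_walk (Hn n) [vert n \<delta>, vert n g]" using lazy_walk_rev[OF link[OF gc]] by (simp add: \<delta>_def)
    have "last [vert n h, vert n \<gamma>] = hd ?P2" using P2 by simp
    note j1 = lazy_walk_join[OF P1 P2(1) this]
    have "last ([vert n h, vert n \<gamma>] @ tl ?P2) = hd [vert n \<delta>, vert n g]" using j1(3) P2(3) by simp
    note j2 = lazy_walk_join[OF j1(1) P3 this]
    have len: "length (([vert n h, vert n \<gamma>] @ tl ?P2) @ tl [vert n \<delta>, vert n g]) - 1 \<le> L2"
      unfolding j2(5) j1(5) using P2(4) ywL[OF aF] by simp
    show ?thesis unfolding HH
      using j2(1-3) j1(2) len h(2) s(2) by (intro exI conjI) (auto simp: g_def)
  qed
  have "graph_equiv (\<lambda>n. Cay n) Hs"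
    unfolding graph_equiv_def graph_prec_def
  proof (intro conjI exI allI ballI)
    show "L1 > 0" "L2 > 0" by (auto simp: L1_def L2_def)
    fix n x y
    show "gdist (Cay n) x y \<le> enat L1 * gdist (Hs n) x y"
      by (rule gdist_lipschitz[OF lip1]) (auto simp: vHs L1_def)
    show "gdist (Hs n) x y \<le> enat L2 * gdist (Cay n) x y"
      by (rule gdist_lipschitz[OF lip2]) (auto simp: vHs L2_def)
  qed
  then have "cost (\<lambda>n. Cay n) \<le> edge_density Hs"
    unfolding cost_def using seqH vHs by (intro INF_lower) auto
  also have "edge_density Hs \<le> liminf (\<lambda>n. ereal (1 + (real (min_gens G (Ns m)) - 1) / real (card ?Vm)))"
    unfolding edge_density_def
  proof (rule Liminf_mono)
    show "\<forall>\<^sub>F n in sequentially. ereal (real (card (edges (Hs n))) / real (card (verts (Hs n))))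
        \<le> ereal (1 + (real (min_gens G (Ns m)) - 1) / real (card ?Vm))"
      using eventually_ge_at_top[of m]
    proof (rule eventually_mono)
      fix n assume mn: "m \<le> n"
      have V: "card (rcosets (Ns n)) = card ?Vm * card (W n)" using index_mult[OF mn] cardW by simp
      have Wp: "card (W n) > 0" using index_pos[of n] V by (cases "card (W n)") auto
      have WV': "card (W n) \<le> card (rcosets (Ns n))" using card_mono[OF finidx WV] .
      have "card (edges (Hs n)) \<le> card (E1 n) + card (E2 n)" using mn card_Un_le by (simp add: Hs_def eH)
      also have "\<dots> \<le> card (W n) * card Y + (card (rcosets (Ns n)) - card (W n))"
        using cE1[of n] cE2[OF mn] by linarith
      finally have "real (card (edges (Hs n))) \<le> real (card (W n)) * real (card Y) + (real (card (rcosets (Ns n))) - real (card (W n)))"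
        using WV' by (simp flip: of_nat_mult of_nat_add of_nat_diff)
      \<comment> \<open>Here card \<open>(W n)\<close> is the index of \<open>Ns n\<close> divided
        by the index of \<open>Ns m\<close>.\<close>
      also have "\<dots> = real (card (rcosets (Ns n))) * (1 + (real (card Y) - 1) / real (card ?Vm))"
        unfolding V using index_pos[of m] by (simp add: field_simps)
      finally show "ereal (real (card (edges (Hs n))) / real (card (verts (Hs n))))
        \<le> ereal (1 + (real (min_gens G (Ns m)) - 1) / real (card ?Vm))"
        unfolding vHs verts_Cay Y(3)[symmetric] using index_pos[of n] by (simp add: field_simps)
    qed
  qed
  also have "\<dots> = ereal (1 + (real (min_gens G (Ns m)) - 1) / real (card ?Vm))" by (simp add: Liminf_const)
  finally show ?thesis .
qed

theorem cost_le_rk_grad: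
  assumes inf: "infinite (carrier G)" and fg: "fin_gen G"
  shows "cost (\<lambda>n. Cay n) - 1 \<le> ereal (rk_grad G Ns)"
proof -
  have lim: "(\<lambda>m. ereal (1 + (real (min_gens G (Ns m)) - 1) / real (card (rcosets (Ns m))))) \<longlonglongrightarrow> ereal (1 + rk_grad G Ns)"
    using rk_grad_limit[OF inf fg] by (intro tendsto_intros)
  then have "cost (\<lambda>n. Cay n) \<le> ereal (1 + rk_grad G Ns)"
    by (rule LIMSEQ_le_const) (use cost_le[OF inf fg] in blast)
  then show ?thesis by (cases "cost (\<lambda>n. Cay n)") (auto simp: one_ereal_def)
qed

end

subsection \<open>Homomorphisms to the prime field\<close>

text \<open>Translation by 1 permutes the field, so the sum of all elements is unchanged when the
  cardinality is added to it.\<close>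

lemma of_nat_CARD_eq_0: "of_nat CARD('k) = (0::'k::{field,finite})"
proof -
  have "bij_betw (\<lambda>x::'k. x + 1) UNIV UNIV"
    by (rule bij_betw_byWitness[where f' = "\<lambda>x. x - 1"]) auto
  then have "(\<Sum>x\<in>UNIV. x + 1 :: 'k) = (\<Sum>x\<in>UNIV. x)" by (rule sum.reindex_bij_betw)
  then show ?thesis by (simp add: sum.distrib)
qed

context group
begin

text \<open>Homomorphisms from \<open>K\<close> to the additive group of the field that are trivial
  on \<open>P\<close>, extended by 0 so that they can be counted as functions.\<close>

definition pchar :: "'a set \<Rightarrow> 'a set \<Rightarrow> ('a \<Rightarrow> 'k::field) set" where
  "pchar P K = {\<phi>. (\<forall>x. x \<notin> K \<longrightarrow> \<phi> x = 0) \<and> (\<forall>x\<in>K. \<forall>y\<in>K. \<phi> (x \<otimes> y) = \<phi> x + \<phi> y) \<and> (\<forall>x\<in>P. \<phi> x = 0)}"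

text \<open>Adjoining one element to a subgroup between \<open>P\<close> and \<open>H\<close> multiplies both the number of
  characters and the index over \<open>P\<close> by \<open>p\<close>.\<close>

lemma pchar_adjoin:
  fixes p :: nat
  assumes p: "Factorial_Ring.prime p" "CARD('k::{field,finite}) = p"
    and P: "subgroup P G" and K: "subgroup K G" and H: "subgroup H G" and PK: "P \<subseteq> K" and KH: "K \<subseteq> H"
    and comm: "\<And>x y. x \<in> H \<Longrightarrow> y \<in> H \<Longrightarrow> x \<otimes> y \<otimes> inv x \<otimes> inv y \<in> P"
    and pow: "\<And>x. x \<in> H \<Longrightarrow> x [^] p \<in> P"
    and a: "a \<in> H" "a \<notin> K"
    and fin: "finite ((\<lambda>x. P #> x) ` K)"
    and eq: "finite (pchar P K :: ('a \<Rightarrow> 'k) set)" "card (pchar P K :: ('a \<Rightarrow> 'k) set) = card ((\<lambda>x. P #> x) ` K)"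
  defines "K' \<equiv> {k \<otimes> a [^] i | k i. k \<in> K \<and> i < p}"
  shows "subgroup K' G" "K \<subseteq> K'" "a \<in> K'" "K' \<subseteq> H"
    "finite ((\<lambda>x. P #> x) ` K')" "finite (pchar P K' :: ('a \<Rightarrow> 'k) set)"
    "card (pchar P K' :: ('a \<Rightarrow> 'k) set) = card ((\<lambda>x. P #> x) ` K')"
proof -
  have p1: "p > 1" using p(1) prime_gt_1_nat by blast
  have Hc: "H \<subseteq> carrier G" and Kc: "K \<subseteq> carrier G" and Pc: "P \<subseteq> carrier G"
    using subgroup.subset H K P by blast+
  have ac: "a \<in> carrier G" using a Hc by blast
  have aiH: "a [^] (i::nat) \<in> H" for i
  proof (induction i)
    case 0
    then show ?case using subgroup.one_closed[OF H] by simp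
  next
    case (Suc i)
    then show ?case using subgroup.m_closed[OF H Suc a(1)] by simp
  qed
  have aic: "a [^] (i::nat) \<in> carrier G" for i using ac by simp
  have swap: "\<exists>z\<in>P. y \<otimes> x = z \<otimes> x \<otimes> y" if "x \<in> H" "y \<in> H" for x y
  proof (rule bexI[of _ "y \<otimes> x \<otimes> inv y \<otimes> inv x"])
    have c: "x \<in> carrier G" "y \<in> carrier G" using that Hc by blast+
    show "y \<otimes> x = y \<otimes> x \<otimes> inv y \<otimes> inv x \<otimes> x \<otimes> y" using c by (simp add: m_assoc)
    show "y \<otimes> x \<otimes> inv y \<otimes> inv x \<in> P" using comm that by blast
  qed
  have pK: "a [^] (p * j) \<in> P" for j :: nat
  proof -
    have "a [^] (p * j) = (a [^] p) [^] j" using ac by (simp add: nat_pow_pow)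
    moreover have "(a [^] p) [^] j \<in> P"
      using pow[OF a(1)] subgroup.m_closed[OF P] subgroup.one_closed[OF P] by (induction j) auto
    ultimately show ?thesis by simp
  qed
  \<comment> \<open>Since p-th powers lie in \<open>P\<close>, exponents of a count modulo p up to
    factors in \<open>P\<close>.\<close>
  have red: "\<exists>z\<in>P. a [^] n = z \<otimes> a [^] (n mod p)" for n :: nat
  proof (rule bexI[of _ "a [^] (p * (n div p))"])
    have "p * (n div p) + n mod p = n" by simp
    then show "a [^] n = a [^] (p * (n div p)) \<otimes> a [^] (n mod p)" using nat_pow_mult[OF ac, of "p * (n div p)" "n mod p"] by simp
  qed (rule pK)
  have inK': "k \<otimes> a [^] n \<in> K'" if "k \<in> K" for k and n :: nat
  proof -
    obtain z where z: "z \<in> P" "a [^] n = z \<otimes> a [^] (n mod p)" using red by blast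
    have "k \<otimes> a [^] n = (k \<otimes> z) \<otimes> a [^] (n mod p)" unfolding z(2) using that z(1) Kc Pc aic by (simp add: m_assoc subset_iff)
    moreover have "k \<otimes> z \<in> K" using subgroup.m_closed[OF K that] z(1) PK by blast
    ultimately show ?thesis unfolding K'_def using p1 by fastforce
  qed
  have mulform: "\<exists>z\<in>P. (k \<otimes> a [^] i) \<otimes> (l \<otimes> a [^] j) = (k \<otimes> z \<otimes> l) \<otimes> a [^] (i + j)" if "k \<in> K" "l \<in> K" for k l and i j :: nat
  proof -
    have lH: "l \<in> H" using that KH by blast
    obtain z where z: "z \<in> P" "a [^] i \<otimes> l = z \<otimes> l \<otimes> a [^] i" using swap[OF lH aiH[of i]] by blast
    have c: "k \<in> carrier G" "l \<in> carrier G" "z \<in> carrier G" using that z Kc Pc by blast+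
    have "(k \<otimes> a [^] i) \<otimes> (l \<otimes> a [^] j) = k \<otimes> (a [^] i \<otimes> l) \<otimes> a [^] j" using c aic by (simp add: m_assoc)
    also have "\<dots> = (k \<otimes> z \<otimes> l) \<otimes> (a [^] i \<otimes> a [^] j)" unfolding z(2) using c aic by (simp add: m_assoc)
    also have "a [^] i \<otimes> a [^] j = a [^] (i + j)" using ac by (simp add: nat_pow_mult)
    finally show ?thesis using z(1) by blast
  qed
  have K'H: "K' \<subseteq> H" unfolding K'_def using KH aiH subgroup.m_closed[OF H] by blast
  have K'mul: "x \<otimes> y \<in> K'" if xy: "x \<in> K'" "y \<in> K'" for x y
  proof -
    obtain k i l j where e: "k \<in> K" "x = k \<otimes> a [^] (i::nat)" "l \<in> K" "y = l \<otimes> a [^] (j::nat)" using xy unfolding K'_def by blast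
    obtain z where z: "z \<in> P" "x \<otimes> y = (k \<otimes> z \<otimes> l) \<otimes> a [^] (i + j)" using mulform[OF e(1,3)] e(2,4) by blast
    have "k \<otimes> z \<otimes> l \<in> K" using subgroup.m_closed[OF K] e z PK by blast
    then show ?thesis using inK' z(2) by simp
  qed
  show KK': "K \<subseteq> K'"
  proof
    fix k assume k: "k \<in> K"
    have "k \<otimes> a [^] (0::nat) = k" using k Kc by auto
    then show "k \<in> K'" using inK'[OF k, of 0] by simp
  qed
  show aK': "a \<in> K'"
  proof -
    have "\<one> \<otimes> a [^] (1::nat) = a" using ac by simp
    then show ?thesis using inK'[OF subgroup.one_closed[OF K], of 1] by simp
  qed
  show "K' \<subseteq> H" by (rule K'H)
  show K'sub: "subgroup K' G"
  proof (rule subgroupI)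
    show "K' \<subseteq> carrier G" using K'H Hc by blast
    show "K' \<noteq> {}" using aK' by blast
    show "x \<otimes> y \<in> K'" if "x \<in> K'" "y \<in> K'" for x y using K'mul that by blast
    fix x assume "x \<in> K'"
    then obtain k i where e: "k \<in> K" "x = k \<otimes> a [^] (i::nat)" "i < p" unfolding K'_def by blast
    have kc: "k \<in> carrier G" using e Kc by blast
    let ?b = "a [^] p"
    have b: "?b \<in> P" using pow a(1) by blast
    have bc: "?b \<in> carrier G" using b Pc by blast
    have "a [^] i \<otimes> a [^] (p - i) = ?b" using nat_pow_mult[OF ac] e(3) by simp
    then have "a [^] (p - i) = inv (a [^] i) \<otimes> ?b" using aic bc by (metis inv_solve_left)
    then have "inv (a [^] i) = a [^] (p - i) \<otimes> inv ?b" using aic bc by (metis inv_closed inv_solve_right)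
    then have "inv x = a [^] (p - i) \<otimes> (inv ?b \<otimes> inv k)" using e kc aic bc by (simp add: inv_mult_group m_assoc)
    moreover have "inv ?b \<otimes> inv k \<in> K'" using subgroup.m_closed[OF K] subgroup.m_inv_closed[OF K] e(1) b PK KK' by blast
    moreover have "a [^] (p - i) \<in> K'"
      using inK'[OF subgroup.one_closed[OF K], of "p - i"] aic by simp
    ultimately show "inv x \<in> K'" using K'mul by simp
  qed
  \<comment> \<open>Uniqueness of the form k a^i. Otherwise some a^d with 0 < d < p lies in
    \<open>K\<close>; as d is invertible modulo p and p-th powers lie in \<open>P\<close>, a itself
    would lie in \<open>K\<close>.\<close>
  have Kmem: "i = j \<and> k = l" if e: "k \<in> K" "l \<in> K" "i < p" "j < p" "k \<otimes> a [^] i = l \<otimes> a [^] j" for k l and i j :: nat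
  proof -
    have key: False if ij: "i < j" "j < p" and kl: "k \<in> K" "l \<in> K" and eq: "k \<otimes> a [^] i = l \<otimes> a [^] j" for i j :: nat and k l
    proof -
      have c: "k \<in> carrier G" "l \<in> carrier G" using kl Kc by blast+
      have "l \<otimes> a [^] j = l \<otimes> a [^] (j - i) \<otimes> a [^] i"
        using nat_pow_mult[OF ac, of "j - i" i] ij c aic by (simp add: m_assoc)
      then have "k = l \<otimes> a [^] (j - i)" using eq c aic by (metis m_closed r_cancel)
      then have "a [^] (j - i) = inv l \<otimes> k" using c aic by (metis inv_solve_left)
      then have d: "a [^] (j - i) \<in> K" using subgroup.m_closed[OF K subgroup.m_inv_closed[OF K kl(2)] kl(1)] by simp
      have "coprime (j - i) p"
        using p(1) ij by (metis coprime_commute nat_dvd_not_less prime_imp_coprime diff_less_mono2 less_imp_diff_less zero_less_diff)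
      then obtain u v where uv: "(j - i) * u = p * v + 1"
        using coprime_bezout_strong[of "j - i" p] p1 by auto
      have "(a [^] (j - i)) [^] u \<in> K" using d subgroup.m_closed[OF K] subgroup.one_closed[OF K] by (induction u) auto
      then have "a [^] (p * v) \<otimes> a \<in> K" using uv ac by (simp add: nat_pow_pow)
      moreover have "inv (a [^] (p * v)) \<in> K" using subgroup.m_inv_closed[OF P pK] PK by blast
      ultimately have "inv (a [^] (p * v)) \<otimes> (a [^] (p * v) \<otimes> a) \<in> K" using subgroup.m_closed[OF K] by blast
      moreover have "inv (a [^] (p * v)) \<otimes> (a [^] (p * v) \<otimes> a) = a"
        using ac by (simp flip: m_assoc)
      ultimately show False using a(2) by simp
    qed
    have "i = j"
    proof (rule ccontr)
      assume "i \<noteq> j"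
      then consider "i < j" | "j < i" by linarith
      then show False using key[of i j k l] key[of j i l k] e by cases auto
    qed
    moreover have "k = l" using e calculation Kc aic by (metis r_cancel subsetD)
    ultimately show ?thesis by simp
  qed
  define f where "f = (\<lambda>(c, i::nat). c #> a [^] i)"
  have fP: "(P #> k) #> a [^] (i::nat) = P #> (k \<otimes> a [^] i)" if "k \<in> K" for k i
    using that Kc aic by (intro coset_mult_assoc[OF Pc]) auto
  have bij: "bij_betw f ((\<lambda>x. P #> x) ` K \<times> {..<p}) ((\<lambda>x. P #> x) ` K')"
  proof (rule bij_betw_imageI)
    show "inj_on f ((\<lambda>x. P #> x) ` K \<times> {..<p})"
    proof (rule inj_onI)
      fix s t assume st: "s \<in> (\<lambda>x. P #> x) ` K \<times> {..<p}" "t \<in> (\<lambda>x. P #> x) ` K \<times> {..<p}" "f s = f t"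
      obtain k i where s: "s = (P #> k, i)" "k \<in> K" "i < p" using st(1) by auto
      obtain l j where t: "t = (P #> l, j)" "l \<in> K" "j < p" using st(2) by auto
      have c: "k \<in> carrier G" "l \<in> carrier G" using s t Kc by blast+
      have "P #> (k \<otimes> a [^] i) = P #> (l \<otimes> a [^] j)" using st(3) s t fP by (simp add: f_def)
      then have "k \<otimes> a [^] i \<in> P #> (l \<otimes> a [^] j)" using rcos_self[OF _ P, of "k \<otimes> a [^] i"] c aic by simp
      then obtain z where z: "z \<in> P" "k \<otimes> a [^] i = z \<otimes> (l \<otimes> a [^] j)" by (auto simp: r_coset_def)
      have zc: "z \<in> carrier G" using z Pc by blast
      have zl: "z \<otimes> l \<in> K" using subgroup.m_closed[OF K] z(1) PK t(2) by blast
      have "i = j \<and> k = z \<otimes> l" using Kmem[OF s(2) zl s(3) t(3)] z(2) zc c aic by (simp add: m_assoc)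
      moreover have "P #> (z \<otimes> l) = P #> l"
      proof -
        have "P #> (z \<otimes> l) = (P #> z) #> l" using zc c by (simp add: coset_mult_assoc[OF Pc])
        then show ?thesis using coset_join2[OF zc P z(1)] by simp
      qed
      ultimately show "s = t" using s t by simp
    qed
    show "f ` ((\<lambda>x. P #> x) ` K \<times> {..<p}) = (\<lambda>x. P #> x) ` K'"
    proof
      show "f ` ((\<lambda>x. P #> x) ` K \<times> {..<p}) \<subseteq> (\<lambda>x. P #> x) ` K'"
      proof
        fix x assume "x \<in> f ` ((\<lambda>x. P #> x) ` K \<times> {..<p})"
        then obtain k i where "k \<in> K" "x = (P #> k) #> a [^] (i::nat)" by (auto simp: f_def)
        then show "x \<in> (\<lambda>x. P #> x) ` K'" using fP inK' by blast
      qed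
      show "(\<lambda>x. P #> x) ` K' \<subseteq> f ` ((\<lambda>x. P #> x) ` K \<times> {..<p})"
      proof
        fix x assume "x \<in> (\<lambda>x. P #> x) ` K'"
        then obtain k i where k: "k \<in> K" "i < p" "x = P #> (k \<otimes> a [^] (i::nat))" unfolding K'_def by blast
        then have "x = f (P #> k, i)" using fP by (simp add: f_def)
        then show "x \<in> f ` ((\<lambda>x. P #> x) ` K \<times> {..<p})" using k by blast
      qed
    qed
  qed
  show finK': "finite ((\<lambda>x. P #> x) ` K')" using bij_betw_finite[OF bij] fin by simp
  have cardK': "card ((\<lambda>x. P #> x) ` K') = card ((\<lambda>x. P #> x) ` K) * p"
    using bij_betw_same_card[OF bij] by (simp add: card_cartesian_product)
  have char: "of_nat p = (0::'k)"
  proof -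
    have "of_nat CARD('k) = (0::'k)" by (rule of_nat_CARD_eq_0)
    then show ?thesis using p(2) by simp
  qed
  have ofmod: "(of_nat (n mod p) :: 'k) = of_nat n" for n
  proof -
    have "(of_nat n :: 'k) = of_nat (p * (n div p) + n mod p)" by simp
    also have "\<dots> = of_nat p * of_nat (n div p) + of_nat (n mod p)" by (simp only: of_nat_add of_nat_mult)
    also have "\<dots> = of_nat (n mod p)" by (simp only: char mult_zero_left add_0)
    finally show ?thesis by (rule sym)
  qed
  \<comment> \<open>A character of K' amounts to its restriction to \<open>K\<close> and its value
    at a, which is arbitrary. This multiplies the number of characters by p.\<close>
  define res where "res \<psi> = ((\<lambda>x. if x \<in> K then \<psi> x else 0), \<psi> a)" for \<psi> :: "'a \<Rightarrow> 'k"
  have \<psi>form: "\<psi> (k \<otimes> a [^] i) = \<psi> k + of_nat i * \<psi> a" if \<psi>: "\<psi> \<in> pchar P K'" and k: "k \<in> K" for \<psi> :: "'a \<Rightarrow> 'k" and k and i :: nat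
  proof -
    have hom: "\<psi> (x \<otimes> y) = \<psi> x + \<psi> y" if "x \<in> K'" "y \<in> K'" for x y using \<psi> that by (auto simp: pchar_def)
    have "\<psi> \<one> = 0" using \<psi> subgroup.one_closed[OF P] by (auto simp: pchar_def)
    then have "\<psi> (a [^] i) = of_nat i * \<psi> a"
    proof (induction i)
      case (Suc i)
      have "a [^] i \<in> K'" using inK'[OF subgroup.one_closed[OF K], of i] aic by simp
      then show ?case using Suc hom aK' by (simp add: algebra_simps)
    qed simp
    moreover have "a [^] i \<in> K'" using inK'[OF subgroup.one_closed[OF K], of i] aic by simp
    ultimately show ?thesis using hom k KK' by auto
  qed
  have bijc: "bij_betw res (pchar P K' :: ('a \<Rightarrow> 'k) set) (pchar P K \<times> UNIV)"
  proof (rule bij_betw_imageI)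
    show "inj_on res (pchar P K' :: ('a \<Rightarrow> 'k) set)"
    proof (rule inj_onI)
      fix \<phi> \<psi> :: "'a \<Rightarrow> 'k" assume h: "\<phi> \<in> pchar P K'" "\<psi> \<in> pchar P K'" "res \<phi> = res \<psi>"
      have ra: "\<phi> a = \<psi> a" using h(3) by (simp add: res_def)
      have rk: "\<phi> k = \<psi> k" if "k \<in> K" for k
      proof -
        have "(\<lambda>x. if x \<in> K then \<phi> x else 0) = (\<lambda>x. if x \<in> K then \<psi> x else 0)" using h(3) by (simp add: res_def)
        from fun_cong[OF this, of k] show ?thesis using that by simp
      qed
      show "\<phi> = \<psi>"
      proof
        fix x
        show "\<phi> x = \<psi> x"
        proof (cases "x \<in> K'")
          case True
          then obtain k i where "k \<in> K" "x = k \<otimes> a [^] (i::nat)" unfolding K'_def by blast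
          then show ?thesis using \<psi>form[OF h(1)] \<psi>form[OF h(2)] ra rk by simp
        next
          case False
          then show ?thesis using h by (simp add: pchar_def)
        qed
      qed
    qed
    show "res ` (pchar P K' :: ('a \<Rightarrow> 'k) set) = pchar P K \<times> UNIV"
    proof
      show "res ` (pchar P K' :: ('a \<Rightarrow> 'k) set) \<subseteq> pchar P K \<times> UNIV"
        using KK' PK subgroup.m_closed[OF K] by (auto simp: res_def pchar_def subset_iff)
      show "pchar P K \<times> UNIV \<subseteq> res ` (pchar P K' :: ('a \<Rightarrow> 'k) set)"
      proof
        fix s :: "('a \<Rightarrow> 'k) \<times> 'k" assume "s \<in> pchar P K \<times> UNIV"
        then obtain \<phi> c where s: "s = (\<phi>, c)" and \<phi>: "\<phi> \<in> pchar P K" by auto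
        have \<phi>hom: "\<phi> (x \<otimes> y) = \<phi> x + \<phi> y" if "x \<in> K" "y \<in> K" for x y using \<phi> that by (auto simp: pchar_def)
        have \<phi>P: "\<phi> x = 0" if "x \<in> P" for x using \<phi> that by (auto simp: pchar_def)
        define \<psi> where "\<psi> x = (if x \<in> K' then (let ki = (SOME ki. fst ki \<in> K \<and> snd ki < p \<and> x = fst ki \<otimes> a [^] (snd ki :: nat)) in \<phi> (fst ki) + of_nat (snd ki) * c) else 0)" for x
        have \<psi>0: "\<psi> (k \<otimes> a [^] i) = \<phi> k + of_nat i * c" if k: "k \<in> K" and i: "i < p" for k and i :: nat
        proof -
          let ?Q = "\<lambda>ki. fst ki \<in> K \<and> snd ki < p \<and> k \<otimes> a [^] i = fst ki \<otimes> a [^] (snd ki :: nat)"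
          define r where "r = (SOME ki. ?Q ki)"
          have Q: "?Q r" unfolding r_def by (rule someI[of ?Q "(k, i)"]) (use k i in simp)
          have "i = snd r \<and> k = fst r" by (rule Kmem[OF k _ i]) (use Q in auto)
          moreover have "\<psi> (k \<otimes> a [^] i) = \<phi> (fst r) + of_nat (snd r) * c"
            unfolding \<psi>_def Let_def r_def[symmetric] using inK'[OF k, of i] by simp
          ultimately show ?thesis by simp
        qed
        \<comment> \<open>Beyond exponent p the reduction produces a factor in \<open>P\<close>,
          which \<phi> kills, and the exponent changes by a multiple of p, which is 0 in the
          field.\<close>
        have \<psi>1: "\<psi> (k \<otimes> a [^] n) = \<phi> k + of_nat n * c" if k: "k \<in> K" for k and n :: nat
        proof -
          obtain z where z: "z \<in> P" "a [^] n = z \<otimes> a [^] (n mod p)" using red by blast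
          have c': "k \<in> carrier G" "z \<in> carrier G" "z \<in> K" using z k Kc Pc PK by blast+
          have "k \<otimes> a [^] n = (k \<otimes> z) \<otimes> a [^] (n mod p)" unfolding z(2) using c' aic by (simp add: m_assoc)
          then have "\<psi> (k \<otimes> a [^] n) = \<phi> (k \<otimes> z) + of_nat (n mod p) * c"
            using \<psi>0[OF subgroup.m_closed[OF K k c'(3)], of "n mod p"] p1 by simp
          then show ?thesis using \<phi>hom[OF k c'(3)] \<phi>P[OF z(1)] ofmod by simp
        qed
        have \<psi>K: "\<psi> k = \<phi> k" if "k \<in> K" for k
        proof -
          have "k \<otimes> a [^] (0::nat) = k" using that Kc by auto
          then show ?thesis using \<psi>1[OF that, of 0] by simp
        qed
        have "\<psi> \<in> pchar P K'"
          unfolding pchar_def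
        proof (intro CollectI conjI allI impI ballI)
          show "\<psi> x = 0" if "x \<notin> K'" for x using that by (simp add: \<psi>_def)
          show "\<psi> x = 0" if "x \<in> P" for x using \<psi>K[of x] \<phi>P[OF that] that PK by auto
          fix x y assume "x \<in> K'" "y \<in> K'"
          then obtain k i l j where e: "k \<in> K" "x = k \<otimes> a [^] (i::nat)" "l \<in> K" "y = l \<otimes> a [^] (j::nat)" unfolding K'_def by blast
          obtain z where z: "z \<in> P" "x \<otimes> y = (k \<otimes> z \<otimes> l) \<otimes> a [^] (i + j)" using mulform[OF e(1,3)] e(2,4) by blast
          have zK: "z \<in> K" "k \<otimes> z \<in> K" "k \<otimes> z \<otimes> l \<in> K" using subgroup.m_closed[OF K] e z PK by blast+
          have "\<psi> (x \<otimes> y) = \<phi> (k \<otimes> z \<otimes> l) + of_nat (i + j) * c" unfolding z(2) by (rule \<psi>1[OF zK(3)])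
          also have "\<dots> = (\<phi> k + of_nat i * c) + (\<phi> l + of_nat j * c)"
            using \<phi>hom[OF zK(2) e(3)] \<phi>hom[OF e(1) zK(1)] \<phi>P[OF z(1)] by (simp add: algebra_simps)
          also have "\<dots> = \<psi> x + \<psi> y" using \<psi>1[OF e(1)] \<psi>1[OF e(3)] e(2,4) by simp
          finally show "\<psi> (x \<otimes> y) = \<psi> x + \<psi> y" .
        qed
        moreover have "res \<psi> = s"
        proof -
          have "\<psi> a = c"
          proof -
            have "\<one> \<otimes> a [^] (1::nat) = a" using ac by simp
            then show ?thesis using \<psi>1[OF subgroup.one_closed[OF K], of 1] \<phi>P[OF subgroup.one_closed[OF P]] by simp
          qed
          moreover have "(\<lambda>x. if x \<in> K then \<psi> x else 0) = \<phi>"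
            using \<psi>K \<phi> by (auto simp: fun_eq_iff pchar_def)
          ultimately show ?thesis by (simp add: res_def s)
        qed
        ultimately show "s \<in> res ` (pchar P K' :: ('a \<Rightarrow> 'k) set)" by blast
      qed
    qed
  qed
  show "finite (pchar P K' :: ('a \<Rightarrow> 'k) set)" using bij_betw_finite[OF bijc] eq(1) by simp
  have "card (pchar P K' :: ('a \<Rightarrow> 'k) set) = card (pchar P K :: ('a \<Rightarrow> 'k) set) * p"
    using bij_betw_same_card[OF bijc] p(2) by (simp add: card_cartesian_product)
  then show "card (pchar P K' :: ('a \<Rightarrow> 'k) set) = card ((\<lambda>x. P #> x) ` K')" using eq(2) cardK' by simp
qed

text \<open>Start from \<open>P\<close>, with one coset and one character, and adjoin the generators
  of \<open>H\<close> one at a time. Counting in this way replaces duality for the elementary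
  abelian quotient.\<close>

lemma card_pchar:
  fixes p :: nat
  assumes p: "Factorial_Ring.prime p" "CARD('k::{field,finite}) = p"
    and P: "subgroup P G" and H: "subgroup H G" and PH: "P \<subseteq> H"
    and comm: "\<And>x y. x \<in> H \<Longrightarrow> y \<in> H \<Longrightarrow> x \<otimes> y \<otimes> inv x \<otimes> inv y \<in> P"
    and pow: "\<And>x. x \<in> H \<Longrightarrow> x [^] p \<in> P"
    and Y: "finite Y" "Y \<subseteq> H" "generate G Y = H"
  shows "finite ((\<lambda>x. P #> x) ` H) \<and> finite (pchar P H :: ('a \<Rightarrow> 'k) set)
    \<and> card (pchar P H :: ('a \<Rightarrow> 'k) set) = card ((\<lambda>x. P #> x) ` H)"
proof -
  have "\<exists>K. subgroup K G \<and> P \<subseteq> K \<and> Z \<subseteq> K \<and> K \<subseteq> H \<and> finite ((\<lambda>x. P #> x) ` K)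
     \<and> finite (pchar P K :: ('a \<Rightarrow> 'k) set) \<and> card (pchar P K :: ('a \<Rightarrow> 'k) set) = card ((\<lambda>x. P #> x) ` K)" if "finite Z" "Z \<subseteq> H" for Z
    using that
  proof (induction Z rule: finite_induct)
    case empty
    have "(\<lambda>x. P #> x) ` P = {P}"
      using coset_join2[OF _ P] subgroup.subset[OF P] subgroup.one_closed[OF P] by (auto simp: image_iff)
    moreover have "(pchar P P :: ('a \<Rightarrow> 'k) set) = {\<lambda>_. 0}"
    proof -
      have "\<phi> = (\<lambda>_. 0)" if "\<phi> \<in> pchar P P" for \<phi> :: "'a \<Rightarrow> 'k"
      proof
        show "\<phi> x = 0" for x using that unfolding pchar_def by (cases "x \<in> P") auto
      qed
      moreover have "(\<lambda>_. 0) \<in> (pchar P P :: ('a \<Rightarrow> 'k) set)" by (simp add: pchar_def)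
      ultimately show ?thesis by blast
    qed
    ultimately show ?case using P PH by (intro exI[of _ P]) simp
  next
    case (insert a Z)
    then obtain K where K: "subgroup K G" "P \<subseteq> K" "Z \<subseteq> K" "K \<subseteq> H" "finite ((\<lambda>x. P #> x) ` K)"
      "finite (pchar P K :: ('a \<Rightarrow> 'k) set)" "card (pchar P K :: ('a \<Rightarrow> 'k) set) = card ((\<lambda>x. P #> x) ` K)" by auto
    show ?case
    proof (cases "a \<in> K")
      case True
      then show ?thesis using K by (intro exI[of _ K]) simp
    next
      case False
      have aH: "a \<in> H" using insert.prems by simp
      note adj = pchar_adjoin[OF p P K(1) H K(2,4) comm pow aH False K(5,6,7)]
      show ?thesis
        using adj K(2,3) by (intro exI[of _ "{k \<otimes> a [^] i | k i. k \<in> K \<and> i < p}"]) blast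
    qed
  qed
  from this[OF Y(1,2)] obtain K where K: "subgroup K G" "P \<subseteq> K" "Y \<subseteq> K" "K \<subseteq> H" "finite ((\<lambda>x. P #> x) ` K)"
      "finite (pchar P K :: ('a \<Rightarrow> 'k) set)" "card (pchar P K :: ('a \<Rightarrow> 'k) set) = card ((\<lambda>x. P #> x) ` K)" by blast
  have "H \<subseteq> K" using generate_subgroup_incl[OF K(3,1)] Y(3) by simp
  then have "K = H" using K(4) by blast
  then show ?thesis using K by blast
qed

end

section \<open>Mod-p homology of the chain\<close>

context residual_chain
begin

lemma modp_frattini_props:
  fixes p :: nat
  shows "subgroup (modp_frattini G (Ns n) p) G" "modp_frattini G (Ns n) p \<subseteq> Ns n"
    "\<And>x y. x \<in> Ns n \<Longrightarrow> y \<in> Ns n \<Longrightarrow> x \<otimes> y \<otimes> inv x \<otimes> inv y \<in> modp_frattini G (Ns n) p"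
    "\<And>x. x \<in> Ns n \<Longrightarrow> x [^] p \<in> modp_frattini G (Ns n) p"
proof -
  let ?B = "{x \<otimes> y \<otimes> inv x \<otimes> inv y | x y. x \<in> Ns n \<and> y \<in> Ns n} \<union> {x [^] p | x. x \<in> Ns n}"
  note mc = subgroup.m_closed[OF Ns_subgroup] and ic = subgroup.m_inv_closed[OF Ns_subgroup]
  have powN: "x [^] k \<in> Ns n" if "x \<in> Ns n" for x and k :: nat
    using that mc subgroup.one_closed[OF Ns_subgroup] by (induction k) auto
  have B: "?B \<subseteq> Ns n" using mc ic powN by auto
  have Bc: "?B \<subseteq> carrier G" using B Ns_carrier by blast
  show "subgroup (modp_frattini G (Ns n) p) G" unfolding modp_frattini_def by (rule generate_is_subgroup[OF Bc])
  show "modp_frattini G (Ns n) p \<subseteq> Ns n" unfolding modp_frattini_def by (rule generate_subgroup_incl[OF B Ns_subgroup])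
  show "x \<otimes> y \<otimes> inv x \<otimes> inv y \<in> modp_frattini G (Ns n) p" if "x \<in> Ns n" "y \<in> Ns n" for x y
    unfolding modp_frattini_def by (rule generate.incl) (use that in blast)
  show "x [^] p \<in> modp_frattini G (Ns n) p" if "x \<in> Ns n" for x
    unfolding modp_frattini_def by (rule generate.incl) (use that in blast)
qed

text \<open>A quasi-homomorphism corresponds to its restriction to \<open>Ns n\<close> and its
  values at representatives of the nontrivial cosets. The trivial coset is represented by 1, where
  the value is 0.\<close>

lemma quasi_hom_bij:
  assumes p: "CARD('k::{field,finite}) = p"
  shows "\<exists>f. bij_betw f (quasi_hom G (Ns n) :: ('a \<Rightarrow> 'k) set)
     ((pchar (modp_frattini G (Ns n) p) (Ns n) :: ('a \<Rightarrow> 'k) set) \<times> ((rcosets (Ns n) - {Ns n}) \<rightarrow>\<^sub>E (UNIV :: 'k set)))"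
proof -
  let ?V = "rcosets (Ns n)"
  let ?P = "modp_frattini G (Ns n) p"
  note mc = subgroup.m_closed[OF Ns_subgroup] and ic = subgroup.m_inv_closed[OF Ns_subgroup]
  have "\<forall>v\<in>?V. \<exists>r. r \<in> carrier G \<and> v = Ns n #> r \<and> (v = Ns n \<longrightarrow> r = \<one>)"
  proof
    fix v assume "v \<in> ?V"
    then obtain g where "g \<in> carrier G" "v = Ns n #> g" by (auto simp: RCOSETS_def)
    then show "\<exists>r. r \<in> carrier G \<and> v = Ns n #> r \<and> (v = Ns n \<longrightarrow> r = \<one>)"
      using coset_mult_one[OF Ns_carrier[of n]] by (cases "v = Ns n") auto
  qed
  then obtain \<rho> where \<rho>: "\<And>v. v \<in> ?V \<Longrightarrow> \<rho> v \<in> carrier G \<and> v = Ns n #> \<rho> v \<and> (v = Ns n \<longrightarrow> \<rho> v = \<one>)" by metis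
  have dec: "\<exists>\<gamma>\<in>Ns n. x = \<gamma> \<otimes> \<rho> (Ns n #> x)" if x: "x \<in> carrier G" for x
  proof -
    have "Ns n #> x \<in> ?V" using x by (auto simp: RCOSETS_def)
    then have "x \<in> Ns n #> \<rho> (Ns n #> x)" using \<rho> rcos_self[OF x Ns_subgroup, of n] by auto
    then show ?thesis by (auto simp: r_coset_def)
  qed
  have coV: "Ns n #> x \<in> ?V" if "x \<in> carrier G" for x using that by (auto simp: RCOSETS_def)
  define f where "f u = ((\<lambda>x. if x \<in> Ns n then u x else 0), restrict (\<lambda>v. u (\<rho> v)) (?V - {Ns n}))" for u :: "'a \<Rightarrow> 'k"
  have NV: "Ns n \<in> ?V" using coV[OF one_closed] coset_mult_one[OF Ns_carrier[of n]] by simp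
  have \<rho>N: "\<rho> (Ns n) = \<one>" using \<rho>[OF NV] by simp
  have char: "of_nat p = (0::'k)"
  proof -
    have "of_nat CARD('k) = (0::'k)" by (rule of_nat_CARD_eq_0)
    then show ?thesis using p by simp
  qed
  \<comment> \<open>A homomorphism to a field with p elements kills commutators and p-th powers, so
    triviality on the mod-p Frattini subgroup is automatic.\<close>
  have vanish: "\<phi> x = 0" if hom: "\<And>x y. x \<in> Ns n \<Longrightarrow> y \<in> Ns n \<Longrightarrow> \<phi> (x \<otimes> y) = \<phi> x + \<phi> y" and x: "x \<in> ?P" for \<phi> :: "'a \<Rightarrow> 'k" and x
  proof -
    let ?B = "{x \<otimes> y \<otimes> inv x \<otimes> inv y | x y. x \<in> Ns n \<and> y \<in> Ns n} \<union> {x [^] p | x. x \<in> Ns n}"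
    have one: "\<phi> \<one> = 0"
    proof -
      have "\<phi> \<one> = \<phi> \<one> + \<phi> \<one>" using hom[of \<one> \<one>] subgroup.one_closed[OF Ns_subgroup] by simp
      then show ?thesis by (simp only: add_cancel_right_right)
    qed
    have inv: "\<phi> (inv y) = - \<phi> y" if "y \<in> Ns n" for y
    proof -
      have "\<phi> (y \<otimes> inv y) = \<phi> y + \<phi> (inv y)" using hom that ic by blast
      moreover have "y \<in> carrier G" using that Ns_carrier by blast
      ultimately show ?thesis using one by (simp add: eq_neg_iff_add_eq_0 add.commute)
    qed
    have powm: "y [^] k \<in> Ns n \<and> \<phi> (y [^] k) = of_nat k * \<phi> y" if "y \<in> Ns n" for y and k :: nat
      using that mc subgroup.one_closed[OF Ns_subgroup] one hom by (induction k) (auto simp: algebra_simps)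
    have B: "b \<in> Ns n \<and> \<phi> b = 0" if "b \<in> ?B" for b
      using that
    proof
      assume "b \<in> {x \<otimes> y \<otimes> inv x \<otimes> inv y | x y. x \<in> Ns n \<and> y \<in> Ns n}"
      then obtain x y where b: "b = x \<otimes> y \<otimes> inv x \<otimes> inv y" "x \<in> Ns n" "y \<in> Ns n" by blast
      have "x \<otimes> y \<in> Ns n" "x \<otimes> y \<otimes> inv x \<in> Ns n" using b mc ic by blast+
      then show ?thesis using b mc ic by (simp add: hom inv)
    next
      assume "b \<in> {x [^] p | x. x \<in> Ns n}"
      then show ?thesis using powm char by auto
    qed
    have "x \<in> Ns n \<and> \<phi> x = 0"
      using x unfolding modp_frattini_def
    proof (induction rule: generate.induct)
      case one
      then show ?case using \<open>\<phi> \<one> = 0\<close> subgroup.one_closed[OF Ns_subgroup] by simp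
    next
      case (incl h)
      then show ?case by (rule B)
    next
      case (inv h)
      then show ?case using B[OF inv] ic \<open>\<And>y. y \<in> Ns n \<Longrightarrow> \<phi> (inv y) = - \<phi> y\<close> by simp
    next
      case (eng h1 h2)
      then show ?case using mc hom by simp
    qed
    then show ?thesis by simp
  qed
  have "bij_betw f (quasi_hom G (Ns n)) ((pchar ?P (Ns n) :: ('a \<Rightarrow> 'k) set) \<times> ((?V - {Ns n}) \<rightarrow>\<^sub>E UNIV))"
  proof (rule bij_betw_imageI)
    show "inj_on f (quasi_hom G (Ns n))"
    proof (rule inj_onI)
      fix u w :: "'a \<Rightarrow> 'k" assume uw: "u \<in> quasi_hom G (Ns n)" "w \<in> quasi_hom G (Ns n)" "f u = f w"
      have e1: "(\<lambda>x. if x \<in> Ns n then u x else 0) = (\<lambda>x. if x \<in> Ns n then w x else 0)"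
        and e2: "restrict (\<lambda>v. u (\<rho> v)) (?V - {Ns n}) = restrict (\<lambda>v. w (\<rho> v)) (?V - {Ns n})" using uw(3) by (simp_all add: f_def)
      have N: "u x = w x" if "x \<in> Ns n" for x using fun_cong[OF e1, of x] that by simp
      have R: "u (\<rho> v) = w (\<rho> v)" if "v \<in> ?V" for v
      proof (cases "v = Ns n")
        case True
        then show ?thesis using \<rho>N quasi_hom_one[OF Ns_subgroup uw(1)] quasi_hom_one[OF Ns_subgroup uw(2)] by simp
      next
        case False
        then show ?thesis using fun_cong[OF e2, of v] that by simp
      qed
      show "u = w"
      proof
        fix x
        show "u x = w x"
        proof (cases "x \<in> carrier G")
          case True
          obtain \<gamma> where \<gamma>: "\<gamma> \<in> Ns n" "x = \<gamma> \<otimes> \<rho> (Ns n #> x)" using dec[OF True] by blast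
          have r: "\<rho> (Ns n #> x) \<in> carrier G" using \<rho> coV[OF True] by blast
          have "u (\<gamma> \<otimes> \<rho> (Ns n #> x)) = u \<gamma> + u (\<rho> (Ns n #> x))" "w (\<gamma> \<otimes> \<rho> (Ns n #> x)) = w \<gamma> + w (\<rho> (Ns n #> x))"
            using uw(1,2) \<gamma>(1) r unfolding quasi_hom_def by blast+
          then show ?thesis using \<gamma> N R coV[OF True] by simp
        next
          case False
          then show ?thesis using uw(1,2) by (simp add: quasi_hom_def)
        qed
      qed
    qed
    show "f ` quasi_hom G (Ns n) = pchar ?P (Ns n) \<times> ((?V - {Ns n}) \<rightarrow>\<^sub>E UNIV)"
    proof
      show "f ` quasi_hom G (Ns n) \<subseteq> pchar ?P (Ns n) \<times> ((?V - {Ns n}) \<rightarrow>\<^sub>E UNIV)"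
      proof
        fix s assume "s \<in> f ` quasi_hom G (Ns n)"
        then obtain u where u: "u \<in> quasi_hom G (Ns n)" "s = f u" by blast
        let ?\<phi> = "\<lambda>x. if x \<in> Ns n then u x else 0"
        have hom: "?\<phi> (x \<otimes> y) = ?\<phi> x + ?\<phi> y" if "x \<in> Ns n" "y \<in> Ns n" for x y
        proof -
          have "y \<in> carrier G" using that Ns_carrier by blast
          then have "u (x \<otimes> y) = u x + u y" using u(1) that unfolding quasi_hom_def by blast
          then show ?thesis using that mc by simp
        qed
        have "?\<phi> \<in> pchar ?P (Ns n)" unfolding pchar_def using hom vanish[of ?\<phi>, OF hom] by auto
        then show "s \<in> pchar ?P (Ns n) \<times> ((?V - {Ns n}) \<rightarrow>\<^sub>E UNIV)" unfolding u(2) f_def by auto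
      qed
      show "pchar ?P (Ns n) \<times> ((?V - {Ns n}) \<rightarrow>\<^sub>E UNIV) \<subseteq> f ` quasi_hom G (Ns n)"
      proof
        fix s :: "('a \<Rightarrow> 'k) \<times> ('a set \<Rightarrow> 'k)" assume "s \<in> pchar ?P (Ns n) \<times> ((?V - {Ns n}) \<rightarrow>\<^sub>E UNIV)"
        then obtain \<phi> c where s: "s = (\<phi>, c)" and \<phi>: "\<phi> \<in> pchar ?P (Ns n)" and c: "c \<in> (?V - {Ns n}) \<rightarrow>\<^sub>E UNIV" by auto
        have hom: "\<phi> (x \<otimes> y) = \<phi> x + \<phi> y" if "x \<in> Ns n" "y \<in> Ns n" for x y using \<phi> that by (auto simp: pchar_def)
        define c' where "c' v = (if v = Ns n then 0 else c v)" for v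
        define u where "u x = (if x \<in> carrier G then \<phi> (x \<otimes> inv (\<rho> (Ns n #> x))) + c' (Ns n #> x) else 0)" for x
        have u\<gamma>: "u (\<gamma> \<otimes> \<rho> v) = \<phi> \<gamma> + c' v" if "\<gamma> \<in> Ns n" "v \<in> ?V" for \<gamma> v
        proof -
          have cc: "\<gamma> \<in> carrier G" "\<rho> v \<in> carrier G" using that Ns_carrier \<rho> by blast+
          have "Ns n #> (\<gamma> \<otimes> \<rho> v) = v" using coset_mult_left[OF that(1) cc(2)] \<rho>[OF that(2)] by simp
          then show ?thesis using cc by (simp add: u_def m_assoc)
        qed
        have "u (\<gamma> \<otimes> h) = u \<gamma> + u h" if g: "\<gamma> \<in> Ns n" and h: "h \<in> carrier G" for \<gamma> h
        proof -
          obtain \<delta> where \<delta>: "\<delta> \<in> Ns n" "h = \<delta> \<otimes> \<rho> (Ns n #> h)" using dec[OF h] by blast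
          let ?v = "Ns n #> h"
          have v: "?v \<in> ?V" using coV[OF h] .
          have cc: "\<gamma> \<in> carrier G" "\<delta> \<in> carrier G" "\<rho> ?v \<in> carrier G" using g \<delta> Ns_carrier \<rho>[OF v] by blast+
          have e1: "u h = \<phi> \<delta> + c' ?v" using u\<gamma>[OF \<delta>(1) v] \<delta>(2) by simp
          have "u (\<gamma> \<otimes> h) = u ((\<gamma> \<otimes> \<delta>) \<otimes> \<rho> ?v)" using \<delta>(2) cc by (metis m_assoc)
          also have "\<dots> = \<phi> \<gamma> + \<phi> \<delta> + c' ?v" using u\<gamma>[OF mc[OF g \<delta>(1)] v] hom[OF g \<delta>(1)] by simp
          finally have e2: "u (\<gamma> \<otimes> h) = \<phi> \<gamma> + \<phi> \<delta> + c' ?v" .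
          have "u \<gamma> = \<phi> \<gamma>" using u\<gamma>[OF g NV] \<rho>N cc(1) by (simp add: c'_def)
          then show ?thesis using e1 e2 by simp
        qed
        then have uq: "u \<in> quasi_hom G (Ns n)" unfolding quasi_hom_def by (auto simp: u_def)
        have f1: "(if x \<in> Ns n then u x else 0) = \<phi> x" for x
        proof (cases "x \<in> Ns n")
          case True
          have "x \<in> carrier G" using True Ns_carrier by blast
          then show ?thesis using u\<gamma>[OF True NV] \<rho>N True by (simp add: c'_def)
        next
          case False
          then show ?thesis using \<phi> by (simp add: pchar_def)
        qed
        have f2: "restrict (\<lambda>v. u (\<rho> v)) (?V - {Ns n}) = c"
        proof
          fix v
          show "restrict (\<lambda>v. u (\<rho> v)) (?V - {Ns n}) v = c v"
          proof (cases "v \<in> ?V - {Ns n}")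
            case True
            have r: "\<rho> v \<in> carrier G" using \<rho> True by blast
            have "\<phi> \<one> = 0" using \<phi> subgroup.one_closed[OF modp_frattini_props(1)] unfolding pchar_def by blast
            then have "u (\<rho> v) = c v" using u\<gamma>[OF subgroup.one_closed[OF Ns_subgroup], of v] True r by (simp add: c'_def)
            then show ?thesis using True by simp
          next
            case False
            then show ?thesis using c by (auto simp: PiE_def extensional_def)
          qed
        qed
        have "f u = s" unfolding f_def s using f1 f2 by auto
        then show "s \<in> f ` quasi_hom G (Ns n)" using uq by blast
      qed
    qed
  qed
  then show ?thesis by blast
qed

text \<open>The space of quasi-homomorphisms is counted as a vector space and through the bijection.
  Comparing the two shows that the order of the Frattini quotient is a power of p and determines its
  exponent \<open>d_p\<close>.\<close>

theorem d_p_eq_dim: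
  assumes pr: "Factorial_Ring.prime CARD('k::{field,finite})" and fg: "fin_gen G"
  shows "real (d_p G CARD('k) (Ns n)) = real (fv.dim (quasi_hom G (Ns n) :: ('a \<Rightarrow> 'k) set)) + 1 - real (card (rcosets (Ns n)))"
proof -
  let ?p = "CARD('k)"
  let ?P = "modp_frattini G (Ns n) ?p"
  let ?V = "rcosets (Ns n)"
  let ?U = "quasi_hom G (Ns n) :: ('a \<Rightarrow> 'k) set"
  have p1: "?p > 1" using pr prime_gt_1_nat by blast
  obtain Y where Y: "finite Y" "Y \<subseteq> Ns n" "generate G Y = Ns n" using Ns_fin_gen[OF fg] by blast
  have c: "finite ((\<lambda>x. ?P #> x) ` Ns n)" "finite (pchar ?P (Ns n) :: ('a \<Rightarrow> 'k) set)"
    "card (pchar ?P (Ns n) :: ('a \<Rightarrow> 'k) set) = card ((\<lambda>x. ?P #> x) ` Ns n)"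
    using card_pchar[OF pr refl modp_frattini_props(1) Ns_subgroup modp_frattini_props(2) modp_frattini_props(3) modp_frattini_props(4) Y] by blast+
  obtain f where f: "bij_betw f ?U ((pchar ?P (Ns n) :: ('a \<Rightarrow> 'k) set) \<times> ((?V - {Ns n}) \<rightarrow>\<^sub>E (UNIV :: 'k set)))"
    using quasi_hom_bij[OF refl, of n, where 'k='k] by blast
  have finVN: "finite (?V - {Ns n})" using finidx[of n] by simp
  have fin: "finite ((pchar ?P (Ns n) :: ('a \<Rightarrow> 'k) set) \<times> ((?V - {Ns n}) \<rightarrow>\<^sub>E (UNIV :: 'k set)))"
    by (rule finite_cartesian_product[OF c(2) finite_PiE[OF finVN]]) simp
  have finU: "finite ?U" using bij_betw_finite[OF f] fin by simp
  have "Ns n #> \<one> \<in> ?V" by (auto simp: RCOSETS_def)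
  then have NV: "Ns n \<in> ?V" using coset_mult_one[OF Ns_carrier[of n]] by simp
  have cV: "card (?V - {Ns n}) = card ?V - 1" using NV finidx[of n] by simp
  have "card ?U = card ((\<lambda>x. ?P #> x) ` Ns n) * ?p ^ (card ?V - 1)"
    using bij_betw_same_card[OF f] c(3) finVN cV by (simp add: card_cartesian_product card_PiE)
  moreover have "card ?U = ?p ^ fv.dim ?U" using card_subspace_finite_field[OF subspace_quasi_hom finU] .
  ultimately have eq: "?p ^ fv.dim ?U = card ((\<lambda>x. ?P #> x) ` Ns n) * ?p ^ (card ?V - 1)" by simp
  have pos: "card ((\<lambda>x. ?P #> x) ` Ns n) > 0"
    using c(1) subgroup.one_closed[OF Ns_subgroup] by (auto simp: card_gt_0_iff)
  have "?p ^ (card ?V - 1) \<le> ?p ^ fv.dim ?U" unfolding eq using pos by simp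
  then have le: "card ?V - 1 \<le> fv.dim ?U" by (rule power_le_imp_le_exp[OF p1])
  have "?p ^ fv.dim ?U = ?p ^ (fv.dim ?U - (card ?V - 1)) * ?p ^ (card ?V - 1)"
    by (simp only: power_add[symmetric] le_add_diff_inverse2[OF le])
  then have "card ((\<lambda>x. ?P #> x) ` Ns n) * ?p ^ (card ?V - 1) = ?p ^ (fv.dim ?U - (card ?V - 1)) * ?p ^ (card ?V - 1)"
    by (rule trans[OF eq[symmetric]])
  then have cc: "card ((\<lambda>x. ?P #> x) ` Ns n) = ?p ^ (fv.dim ?U - (card ?V - 1))"
    by (rule mult_right_cancel[THEN iffD1, rotated]) simp
  have "d_p G ?p (Ns n) = fv.dim ?U - (card ?V - 1)"
    unfolding d_p_def cc using p1 by (intro the_equality) (auto simp: power_inject_exp)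
  then show ?thesis using le index_pos[of n] by (simp add: of_nat_diff)
qed

end

subsection \<open>Comparison of the invariants\<close>

text \<open>The integral cycle vector, of which the cycle vector over any field is the reduction. It
  makes ranks over different fields comparable.\<close>

definition int_cycle_vec :: "'v list \<Rightarrow> 'v \<times> 'v \<Rightarrow> int" where
  "int_cycle_vec xs a = (\<Sum>i<length xs. (if a = (xs!i, xs!(Suc i mod length xs)) then 1 else 0)
     - (if a = (xs!(Suc i mod length xs), xs!i) then 1 else 0))"

lemma cycle_vec_of_int: "cycle_vec xs = (\<lambda>a. of_int (int_cycle_vec xs a) :: 'k::field)"
proof
  fix a
  have ind: "of_int ((if P then 1 else 0) - (if Q then 1 else 0)) = ((if P then 1 else 0) - (if Q then 1 else 0) :: 'k)" for P Q
    by simp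
  show "cycle_vec xs a = (of_int (int_cycle_vec xs a) :: 'k)"
    unfolding cycle_vec_def int_cycle_vec_def sum_fun_apply of_int_sum
    by (intro sum.cong refl) (simp only: oriented_edge_def ind)
qed

definition int_cycle_vecs :: "nat \<Rightarrow> 'v graph \<Rightarrow> ('v \<times> 'v \<Rightarrow> int) set" where
  "int_cycle_vecs q H = int_cycle_vec ` {xs. is_cycle H xs \<and> length xs \<le> q}"

lemma int_cycle_vecs_supported: "int_cycle_vecs q H \<subseteq> supported (verts H \<times> verts H)"
proof
  fix w assume "w \<in> int_cycle_vecs q H"
  then obtain xs where xs: "is_cycle H xs" "w = int_cycle_vec xs" by (auto simp: int_cycle_vecs_def)
  have "w a = 0" if a: "a \<notin> verts H \<times> verts H" for a
    unfolding xs(2) int_cycle_vec_def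
  proof (rule sum.neutral, rule ballI)
    fix i assume i: "i \<in> {..<length xs}"
    then have "Suc i mod length xs < length xs" by (intro mod_less_divisor) auto
    then have "xs ! i \<in> verts H" "xs ! (Suc i mod length xs) \<in> verts H"
      using xs(1) i nth_mem unfolding is_cycle_def by blast+
    then have "a \<noteq> (xs!i, xs!(Suc i mod length xs))" "a \<noteq> (xs!(Suc i mod length xs), xs!i)"
      using a by auto
    then show "(if a = (xs!i, xs!(Suc i mod length xs)) then 1 else 0)
     - (if a = (xs!(Suc i mod length xs), xs!i) then 1 else 0) = (0::int)" by simp
  qed
  then show "w \<in> supported (verts H \<times> verts H)" by (simp add: supported_def)
qed

lemma dim_cycle_space_eq:
  fixes H :: "'v graph"
  shows "dim_cycle_space TYPE('k::field) q H = fv.dim ((\<lambda>w a. of_int (w a) :: 'k) ` int_cycle_vecs q H)"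
proof -
  have "{(cycle_vec xs :: 'v \<times> 'v \<Rightarrow> 'k) | xs. is_cycle H xs \<and> length xs \<le> q} = (\<lambda>w a. of_int (w a)) ` int_cycle_vecs q H"
    unfolding int_cycle_vecs_def cycle_vec_of_int by blast
  then show ?thesis unfolding dim_cycle_space_def fscale_eq_fun_scale by simp
qed

lemma dim_cycle_space_le_rat:
  assumes "simple_graph H"
  shows "dim_cycle_space TYPE('k::field) q H \<le> dim_cycle_space TYPE(rat) q H"
  unfolding dim_cycle_space_eq using assms
  by (intro rank_field_le_rank_rat[OF _ int_cycle_vecs_supported]) (simp add: simple_graph_def)

lemma dim_cycle_space_rat_eq_real:
  assumes "simple_graph H"
  shows "dim_cycle_space TYPE(rat) q H = dim_cycle_space TYPE(real) q H"
  unfolding dim_cycle_space_eq using assms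
  by (intro rank_rat_eq_rank_real[OF _ int_cycle_vecs_supported]) (simp add: simple_graph_def)

lemma dim_cycle_space_mono:
  assumes H: "simple_graph H" and qq: "q \<le> q'"
  shows "dim_cycle_space TYPE('k::field) q H \<le> dim_cycle_space TYPE('k) q' H"
  unfolding dim_cycle_space_eq
proof (rule dim_mono_supported)
  show "finite (verts H \<times> verts H)" using H by (simp add: simple_graph_def)
  show "(\<lambda>w a. of_int (w a) :: 'k) ` int_cycle_vecs q' H \<subseteq> supported (verts H \<times> verts H)"
    using int_cycle_vecs_supported[of q' H] by (fastforce simp: supported_def)
  show "(\<lambda>w a. of_int (w a) :: 'k) ` int_cycle_vecs q H \<subseteq> (\<lambda>w a. of_int (w a)) ` int_cycle_vecs q' H"
    using qq unfolding int_cycle_vecs_def by (intro image_mono) auto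
qed

lemma s_q_le:
  assumes "\<And>n. dim_cycle_space TYPE('k2::field) q' (Hs n) \<le> dim_cycle_space TYPE('k1::field) q (Hs n)"
  shows "s_q TYPE('k1) q Hs \<le> s_q TYPE('k2) q' Hs"
  unfolding s_q_def
  by (intro ereal_minus_mono Liminf_mono always_eventually allI order_refl)
    (simp only: ereal_less_eq, intro divide_right_mono diff_left_mono of_nat_mono assms of_nat_0_le_iff)

lemma beta_rat_le:
  assumes "\<And>n. simple_graph (Hs n)"
  shows "beta TYPE(rat) Hs \<le> beta TYPE('k::field) Hs"
proof -
  have "s_q TYPE(rat) q Hs \<le> s_q TYPE('k) q Hs" for q
    by (rule s_q_le) (rule dim_cycle_space_le_rat[OF assms])
  then show ?thesis unfolding beta_def by (rule INF_mono')
qed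

lemma beta_rat_eq_real:
  assumes "\<And>n. simple_graph (Hs n)"
  shows "beta TYPE(rat) Hs = beta TYPE(real) Hs"
  unfolding beta_def s_q_def by (simp add: dim_cycle_space_rat_eq_real[OF assms])

lemma liminf_eq_of_diff_tendsto:
  fixes x y :: "nat \<Rightarrow> real"
  assumes "(\<lambda>n. x n - y n) \<longlonglongrightarrow> c"
  shows "liminf (\<lambda>n. ereal (x n)) = liminf (\<lambda>n. ereal (y n)) + ereal c"
proof -
  have "(\<lambda>n. ereal (x n - y n)) \<longlonglongrightarrow> ereal c" using assms by simp
  then have "liminf (\<lambda>n. ereal (x n - y n) + ereal (y n)) = ereal c + liminf (\<lambda>n. ereal (y n))"
    by (rule ereal_liminf_lim_add) simp
  then show ?thesis by (simp add: add.commute)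
qed

section \<open>Identification of the invariants\<close>

context cayley_chain
begin

text \<open>For every q beyond a bound, \<open>s_q\<close> has the same value, because eventually in
  n the cocycles are the quasi-homomorphisms. The quotients \<open>?x\<close> and \<open>?y\<close>
  differ by 1 - 1/index, and the limit 1 is the one subtracted in \<open>s_q\<close>.\<close>

lemma beta_eq_liminf:
  assumes inf: "infinite (carrier G)" and pres: "is_fin_pres G T R"
  shows "beta TYPE('k::field) (\<lambda>n. Cay n)
    = liminf (\<lambda>n. ereal ((real (fv.dim (quasi_hom G (Ns n) :: ('a \<Rightarrow> 'k) set)) + 1 - real (card (rcosets (Ns n))))
        / real (card (rcosets (Ns n)))))"
    (is "_ = liminf (\<lambda>n. ereal (?y n))")
proof -
  obtain q0 where q0: "\<And>F :: 'a \<Rightarrow> 'a \<Rightarrow> 'k.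
     (\<forall>g\<in>carrier G. \<forall>w. set w \<subseteq> S \<and> eval_word G w = \<one> \<and> length w \<le> q0 \<longrightarrow> path_sum G F g w = 0)
     \<Longrightarrow> (\<forall>g\<in>carrier G. \<forall>w. set w \<subseteq> S \<and> eval_word G w = \<one> \<longrightarrow> path_sum G F g w = 0)"
    using short_closed_words_suffice[OF pres S_sub S_fin S_sym S_gen, where 'k='k] by auto
  let ?x = "\<lambda>q n. (real (card (edges (Cay n))) - real (dim_cycle_space TYPE('k) q (Cay n))) / real (card (verts (Cay n)))"
  have sq: "s_q TYPE('k) q (\<lambda>n. Cay n) = liminf (\<lambda>n. ereal (?y n))" if q: "max q0 2 \<le> q" for q
  proof -
    have short: "\<forall>g\<in>carrier G. \<forall>w. set w \<subseteq> S \<and> eval_word G w = \<one> \<longrightarrow> path_sum G F g w = 0"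
      if F: "\<forall>g\<in>carrier G. \<forall>w. set w \<subseteq> S \<and> eval_word G w = \<one> \<and> length w \<le> q \<longrightarrow> path_sum G F g w = 0"
      for F :: "'a \<Rightarrow> 'a \<Rightarrow> 'k"
      by (rule q0) (use F q in auto)
    have "\<forall>\<^sub>F n in sequentially. ?x q n - ?y n = 1 - 1 / real (card (rcosets (Ns n)))"
      using eventually_separates[OF finite_wball[of q]]
    proof (rule eventually_mono)
      fix n assume sep: "Ns n \<inter> wball q \<subseteq> {\<one>}"
      have q2: "q \<ge> 2" using q by simp
      have "real (card (edges (Cay n))) - real (dim_cycle_space TYPE('k) q (Cay n)) = real (fv.dim (quasi_hom G (Ns n) :: ('a \<Rightarrow> 'k) set))"
        using dim_cocycles[OF simple_Cay, of q n, where 'k='k] dim_cocycles_Cay[OF sep q2 short] by linarith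
      then show "?x q n - ?y n = 1 - 1 / real (card (rcosets (Ns n)))"
        unfolding verts_Cay using index_pos[of n] by (simp add: field_simps)
    qed
    moreover have "(\<lambda>n. 1 - 1 / real (card (rcosets (Ns n)))) \<longlonglongrightarrow> 1 - 0"
      by (intro tendsto_diff tendsto_const inverse_index_tendsto[OF inf])
    ultimately have "(\<lambda>n. ?x q n - ?y n) \<longlonglongrightarrow> 1" by (simp add: tendsto_cong)
    then have "liminf (\<lambda>n. ereal (?x q n)) = liminf (\<lambda>n. ereal (?y n)) + ereal 1"
      by (rule liminf_eq_of_diff_tendsto)
    then show ?thesis unfolding s_q_def by (cases "liminf (\<lambda>n. ereal (?y n))") (simp_all add: one_ereal_def)
  qed
  show ?thesis unfolding beta_def
  proof (rule antisym)
    show "(INF q. s_q TYPE('k) q (\<lambda>n. Cay n)) \<le> liminf (\<lambda>n. ereal (?y n))"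
      using INF_lower[of "max q0 2" UNIV "\<lambda>q. s_q TYPE('k) q (\<lambda>n. Cay n)"] sq[of "max q0 2"] by simp
    \<comment> \<open>\<open>s_q\<close> decreases as longer cycles are allowed, so small q cannot
      undercut the stable value.\<close>
    have "s_q TYPE('k) (max q (max q0 2)) (\<lambda>n. Cay n) \<le> s_q TYPE('k) q (\<lambda>n. Cay n)" for q
      by (rule s_q_le) (rule dim_cycle_space_mono[OF simple_Cay], simp)
    then have "liminf (\<lambda>n. ereal (?y n)) \<le> s_q TYPE('k) q (\<lambda>n. Cay n)" for q
      unfolding sq[OF max.cobounded2, symmetric, of q] .
    then show "liminf (\<lambda>n. ereal (?y n)) \<le> (INF q. s_q TYPE('k) q (\<lambda>n. Cay n))" by (rule INF_greatest)
  qed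
qed

text \<open>The presentation fixed by the choice operator is also the one fed into
  \<open>beta_eq_liminf\<close>, whose left-hand side does not involve it. Over the reals the
  sequence converges, so its lower limit is the Betti number.\<close>

lemma beta_rat_eq_l2_betti1:
  assumes inf: "infinite (carrier G)" and fp: "finitely_presented G"
  shows "beta TYPE(rat) (\<lambda>n. Cay n) = ereal (l2_betti1 G)"
proof -
  define P where "P = (SOME P. is_fin_pres G (fst P) (snd P))"
  have "\<exists>P. is_fin_pres G (fst P) (snd P)" using fp unfolding finitely_presented_def by auto
  then have P: "is_fin_pres G (fst P) (snd P)" unfolding P_def by (rule someI_ex)
  have "l2_betti1 G = l2_betti1_pres G (fst P) (snd P)" by (simp add: l2_betti1_def P_def Let_def)
  then have "(\<lambda>n. ereal ((real (fv.dim (quasi_hom G (Ns n) :: ('a \<Rightarrow> real) set)) + 1 - real (card (rcosets (Ns n))))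
        / real (card (rcosets (Ns n))))) \<longlonglongrightarrow> ereal (l2_betti1 G)"
    using quasi_hom_limit[OF P] by simp
  then show ?thesis
    unfolding beta_rat_eq_real[OF simple_Cay] beta_eq_liminf[OF inf P] by (rule lim_imp_Liminf[rotated]) simp
qed

lemma modp_grad_eq_beta:
  assumes inf: "infinite (carrier G)" and fg: "fin_gen G" and fp: "finitely_presented G"
    and p: "Factorial_Ring.prime CARD('k::{field,finite})"
  shows "modp_grad G Ns CARD('k) = beta TYPE('k) (\<lambda>n. Cay n)"
proof -
  obtain T R where pres: "is_fin_pres G T R" using fp unfolding finitely_presented_def by blast
  show ?thesis unfolding modp_grad_def beta_eq_liminf[OF inf pres] group_index_def d_p_eq_dim[OF p fg] ..
qed

end

text \<open>The prime p is represented by a finite field type of prime cardinality, which is then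
  the prime field with p elements.\<close>

theorem theorem2:
  fixes G :: "('a, 'b) monoid_scheme" and Ns :: "nat \<Rightarrow> 'a set" and S :: "'a set"
    and Gs :: "nat \<Rightarrow> 'a set graph"
  assumes grp: "group G"
    and inf: "infinite (carrier G)"
    and fg: "fin_gen G"
    and normal: "\<And>n. Ns n \<lhd> G"
    and finidx: "\<And>n. finite (rcosets\<^bsub>G\<^esub> (Ns n))"
    and nested: "\<And>n. Ns (Suc n) \<subseteq> Ns n"
    and inter: "(\<Inter>n. Ns n) = {\<one>\<^bsub>G\<^esub>}"
    and S_fin: "finite S" and S_sub: "S \<subseteq> carrier G"
    and S_sym: "\<And>s. s \<in> S \<Longrightarrow> inv\<^bsub>G\<^esub> s \<in> S"
    and S_gen: "generate G S = carrier G"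
    and Gs_def: "\<And>n. Gs n = cayley_quot G (Ns n) S"
  shows "cost Gs - 1 \<le> ereal (rk_grad G Ns)
    \<and> (finitely_presented G \<longrightarrow> Factorial_Ring.prime CARD('f::{field,finite}) \<longrightarrow>
           beta TYPE(rat) Gs = ereal (l2_betti1 G)
         \<and> ereal (l2_betti1 G) \<le> modp_grad G Ns CARD('f)
         \<and> modp_grad G Ns CARD('f) = beta TYPE('f) Gs
         \<and> beta TYPE('f) Gs \<le> cost Gs - 1)"
proof -
  interpret group G by (rule grp)
  interpret cayley_chain G Ns S
    by (rule cayley_chain.intro[OF residual_chain.intro[OF grp residual_chain_axioms.intro[OF normal finidx nested inter]]
          cayley_chain_axioms.intro[OF S_fin S_sub S_sym S_gen]])
  have Gs: "Gs = (\<lambda>n. Cay n)" using Gs_def by (rule ext)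
  show ?thesis unfolding Gs
  proof (intro conjI impI)
    show "cost (\<lambda>n. Cay n) - 1 \<le> ereal (rk_grad G Ns)" by (rule cost_le_rk_grad[OF inf fg])
    assume fp: "finitely_presented G" and p: "Factorial_Ring.prime CARD('f)"
    show rat: "beta TYPE(rat) (\<lambda>n. Cay n) = ereal (l2_betti1 G)" by (rule beta_rat_eq_l2_betti1[OF inf fp])
    show eq: "modp_grad G Ns CARD('f) = beta TYPE('f) (\<lambda>n. Cay n)" by (rule modp_grad_eq_beta[OF inf fg fp p])
    show "ereal (l2_betti1 G) \<le> modp_grad G Ns CARD('f)"
      unfolding eq rat[symmetric] by (rule beta_rat_le[OF simple_Cay])
    show "beta TYPE('f) (\<lambda>n. Cay n) \<le> cost (\<lambda>n. Cay n) - 1" by (rule beta_le_cost[OF simple_Cay])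
  qed
qed

end
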